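(* Let $k\ge2$ be fixed. Then $\mathsf{RCA}_0+(\Sigma^0_2)\text{-}\mathrm{IND}$ proves the following statement: for every dynamical hierarchy $\mathcal B=(B_i)_{i\in\mathbb N}$ such that $S_{B_0}(b)\le b\cdot\min B_0$ for every $b\in B_0$ and $\min B_0\le k$, for every $n$ there is some $i$ such that $\mathbb G^{\mathcal B}_i(n)=0$. Moreover, $\mathsf{RCA}_0+(\Sigma^0_2)\text{-}\mathrm{IND}$ does not prove this statement universally quantified over $k$ (i.e. for all $k\ge 2$ simultaneously).
   Context: Let $\mathbb N=\{0,1,2,\dots\}$; $\infty$ is regarded as greater than, and divisible by, every positive integer. For $b\ge 2$ and $n>0$, the $b$-decomposition of $n$ is the unique $n=b^e a+r$ with $b^e\le n<b^{e+1}$, $0<a<b$, $r<b^e$. For nonempty $B\subseteq\mathbb N\setminus\{0,1\}$: $\mathrm{base}_B(n)=\max\{b\in B: b\le n\}$ if $n\ge\min B$, else $\min B$; $S_B(n)=\min\{b\in B:b>n\}$ if this exists, else $\infty$. A base hierarchy is a nonempty $B\subseteq\mathbb N\setminus\{0,1\}$ with $b\mid S_B(b)$ for all $b\in B$. Upgrade: for base hierarchies $B,C$ with $\min B\le\min C$, define ${\uparrow}n={\uparrow}_B^C n\in\mathbb N\cup\{\infty\}$ recursively. If $n<\min B$, ${\uparrow}n=n$. Otherwise $b=\mathrm{base}_B(n)$; for $c\in C$ define $\langle b\to c\rangle m={\uparrow}m$ if $m<b$, and $\langle b\to c\rangle m=c^{\langle b\to c\rangle e}\cdot{\uparrow}a+\langle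 b\to c\rangle r$ if $m\ge b$ has $b$-decomposition $m=b^ea+r$. Then ${\uparrow}n=\langle b\to c\rangle n$ where $c$ is the least element of $C$ with ${\uparrow}(n-1)<\langle b\to c\rangle n<S_C(c)$; ${\uparrow}n=\infty$ if none exists. $C$ is a good successor of $B$ if (1) $\min B\le\min C$; (2) ${\uparrow}_B^C n<\infty$ for all $n$; (3) for every $b\in B$ with $b>\min B$, writing $x={\uparrow}_B^C(b-1)$, no multiple of $\mathrm{base}_C(x)$ lies strictly between $x$ and $S_C(x)$. A dynamical hierarchy is a sequence $(B_i)_{i\in\mathbb N}$ of base hierarchies with each $B_{i+1}$ a good successor of $B_i$. Goodstein sequence: $\mathbb G^{\mathcal B}_0(n)=n$, $\mathbb G^{\mathcal B}_{i+1}(n)={\uparrow}_{B_i}^{B_{i+1}}\mathbb G^{\mathcal B}_i(n)-1$ if $\mathbb G^{\mathcal B}_i(n)>0$, else $0$. These notions are formalized in second-order arithmetic in the natural way. *)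

theory Defs
  imports Main
begin

section \<open>Second-order arithmetic\<close>

text \<open>
  Two-sorted classical first-order logic over the language of second-order arithmetic. Bound
  variables are de Bruijn indices, with separate index spaces for number variables and set
  variables: \<open>All\<close> and \<open>Ex\<close> bind number index 0, \<open>SAll\<close> and \<open>SEx\<close> bind set index 0. Equality is
  primitive for numbers only.
\<close>

datatype tm = NVar nat | Zero | One | Plus tm tm | Times tm tm

datatype fm =
    Eq tm tm | Less tm tm | Mem tm nat
  | Bot | Imp fm fm | And fm fm | Or fm fm
  | All fm | Ex fm | SAll fm | SEx fm

abbreviation Neg :: "fm \<Rightarrow> fm" where "Neg p \<equiv> Imp p Bot"
abbreviation Iff :: "fm \<Rightarrow> fm \<Rightarrow> fm" where "Iff p q \<equiv> And (Imp p q) (Imp q p)"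

primrec subst_tm :: "tm \<Rightarrow> (nat \<Rightarrow> tm) \<Rightarrow> tm" where
  "subst_tm (NVar n) \<sigma> = \<sigma> n"
| "subst_tm Zero \<sigma> = Zero"
| "subst_tm One \<sigma> = One"
| "subst_tm (Plus s t) \<sigma> = Plus (subst_tm s \<sigma>) (subst_tm t \<sigma>)"
| "subst_tm (Times s t) \<sigma> = Times (subst_tm s \<sigma>) (subst_tm t \<sigma>)"

definition shift_tm :: "tm \<Rightarrow> tm" where
  "shift_tm t = subst_tm t (\<lambda>n. NVar (Suc n))"

text \<open>Simultaneous capture-avoiding substitution of terms for the free number variables and of
  set variables for the free set variables.\<close>

primrec subst :: "fm \<Rightarrow> (nat \<Rightarrow> tm) \<Rightarrow> (nat \<Rightarrow> nat) \<Rightarrow> fm" where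
  "subst (Eq s t) \<sigma> \<rho> = Eq (subst_tm s \<sigma>) (subst_tm t \<sigma>)"
| "subst (Less s t) \<sigma> \<rho> = Less (subst_tm s \<sigma>) (subst_tm t \<sigma>)"
| "subst (Mem t X) \<sigma> \<rho> = Mem (subst_tm t \<sigma>) (\<rho> X)"
| "subst Bot \<sigma> \<rho> = Bot"
| "subst (Imp p q) \<sigma> \<rho> = Imp (subst p \<sigma> \<rho>) (subst q \<sigma> \<rho>)"
| "subst (And p q) \<sigma> \<rho> = And (subst p \<sigma> \<rho>) (subst q \<sigma> \<rho>)"
| "subst (Or p q) \<sigma> \<rho> = Or (subst p \<sigma> \<rho>) (subst q \<sigma> \<rho>)"
| "subst (All p) \<sigma> \<rho> = All (subst p (case_nat (NVar 0) (\<lambda>n. shift_tm (\<sigma> n))) \<rho>)"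
| "subst (Ex p) \<sigma> \<rho> = Ex (subst p (case_nat (NVar 0) (\<lambda>n. shift_tm (\<sigma> n))) \<rho>)"
| "subst (SAll p) \<sigma> \<rho> = SAll (subst p \<sigma> (case_nat 0 (\<lambda>n. Suc (\<rho> n))))"
| "subst (SEx p) \<sigma> \<rho> = SEx (subst p \<sigma> (case_nat 0 (\<lambda>n. Suc (\<rho> n))))"

definition shift :: "fm \<Rightarrow> fm" where
  "shift p = subst p (\<lambda>n. NVar (Suc n)) (\<lambda>n. n)"

definition sshift :: "fm \<Rightarrow> fm" where
  "sshift p = subst p NVar Suc"

definition inst :: "fm \<Rightarrow> tm \<Rightarrow> fm" where
  "inst p t = subst p (case_nat t NVar) (\<lambda>n. n)"

definition sinst :: "fm \<Rightarrow> nat \<Rightarrow> fm" where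
  "sinst p X = subst p NVar (case_nat X (\<lambda>n. n))"

text \<open>Classical natural deduction from a set \<open>T\<close> of axioms. Free variables of members of \<open>T\<close> are
  understood as universally quantified, so the eigenvariable conditions concern only the open
  assumptions.\<close>

inductive deriv :: "fm set \<Rightarrow> fm list \<Rightarrow> fm \<Rightarrow> bool" for T :: "fm set" where
  Axiom: "p \<in> T \<Longrightarrow> deriv T G p"
| Assm: "p \<in> set G \<Longrightarrow> deriv T G p"
| ImpI: "deriv T (p # G) q \<Longrightarrow> deriv T G (Imp p q)"
| ImpE: "deriv T G (Imp p q) \<Longrightarrow> deriv T G p \<Longrightarrow> deriv T G q"
| Classical: "deriv T (Neg p # G) Bot \<Longrightarrow> deriv T G p"
| AndI: "deriv T G p \<Longrightarrow> deriv T G q \<Longrightarrow> deriv T G (And p q)"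
| AndE1: "deriv T G (And p q) \<Longrightarrow> deriv T G p"
| AndE2: "deriv T G (And p q) \<Longrightarrow> deriv T G q"
| OrI1: "deriv T G p \<Longrightarrow> deriv T G (Or p q)"
| OrI2: "deriv T G q \<Longrightarrow> deriv T G (Or p q)"
| OrE: "deriv T G (Or p q) \<Longrightarrow> deriv T (p # G) r \<Longrightarrow> deriv T (q # G) r \<Longrightarrow> deriv T G r"
| AllI: "deriv T (map shift G) p \<Longrightarrow> deriv T G (All p)"
| AllE: "deriv T G (All p) \<Longrightarrow> deriv T G (inst p t)"
| ExI: "deriv T G (inst p t) \<Longrightarrow> deriv T G (Ex p)"
| ExE: "deriv T G (Ex p) \<Longrightarrow> deriv T (p # map shift G) (shift q) \<Longrightarrow> deriv T G q"
| SAllI: "deriv T (map sshift G) p \<Longrightarrow> deriv T G (SAll p)"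
| SAllE: "deriv T G (SAll p) \<Longrightarrow> deriv T G (sinst p X)"
| SExI: "deriv T G (sinst p X) \<Longrightarrow> deriv T G (SEx p)"
| SExE: "deriv T G (SEx p) \<Longrightarrow> deriv T (p # map sshift G) (sshift q) \<Longrightarrow> deriv T G q"
| EqRefl: "deriv T G (Eq t t)"
| EqSubst: "deriv T G (Eq s t) \<Longrightarrow> deriv T G (inst p s) \<Longrightarrow> deriv T G (inst p t)"

definition proves :: "fm set \<Rightarrow> fm \<Rightarrow> bool" (infix "\<turnstile>" 50) where
  "T \<turnstile> p \<longleftrightarrow> deriv T [] p"


section \<open>The theory \<open>RCA\<^sub>0\<close> and \<open>\<Sigma>\<^sup>0\<^sub>2\<close> induction\<close>

text \<open>Formulas with bounded number quantifiers only; set parameters are allowed. The bound of a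
  quantifier is shifted, as it must not contain the quantified variable.\<close>

inductive_set Delta00 :: "fm set" where
  "Eq s t \<in> Delta00"
| "Less s t \<in> Delta00"
| "Mem t X \<in> Delta00"
| "Bot \<in> Delta00"
| "p \<in> Delta00 \<Longrightarrow> q \<in> Delta00 \<Longrightarrow> Imp p q \<in> Delta00"
| "p \<in> Delta00 \<Longrightarrow> q \<in> Delta00 \<Longrightarrow> And p q \<in> Delta00"
| "p \<in> Delta00 \<Longrightarrow> q \<in> Delta00 \<Longrightarrow> Or p q \<in> Delta00"
| "p \<in> Delta00 \<Longrightarrow> All (Imp (Less (NVar 0) (shift_tm t)) p) \<in> Delta00"
| "p \<in> Delta00 \<Longrightarrow> Ex (And (Less (NVar 0) (shift_tm t)) p) \<in> Delta00"

definition Sigma01 :: "fm set" where "Sigma01 = {Ex p |p. p \<in> Delta00}"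
definition Pi01 :: "fm set" where "Pi01 = {All p |p. p \<in> Delta00}"
definition Sigma02 :: "fm set" where "Sigma02 = {Ex p |p. p \<in> Pi01}"

definition basic_axioms :: "fm set" where
  "basic_axioms = (let m = NVar 0; n = NVar 1 in
    {Neg (Eq (Plus n One) Zero),
     Imp (Eq (Plus m One) (Plus n One)) (Eq m n),
     Eq (Plus m Zero) m,
     Eq (Plus m (Plus n One)) (Plus (Plus m n) One),
     Eq (Times m Zero) Zero,
     Eq (Times m (Plus n One)) (Plus (Times m n) m),
     Neg (Less m Zero),
     Iff (Less m (Plus n One)) (Or (Less m n) (Eq m n))})"

definition induction_axiom :: "fm \<Rightarrow> fm" where
  "induction_axiom p =
    Imp (And (inst p Zero)
             (All (Imp p (subst p (case_nat (Plus (NVar 0) One) (\<lambda>n. NVar (Suc n))) (\<lambda>n. n)))))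
        (All p)"

definition delta_comprehension_axiom :: "fm \<Rightarrow> fm \<Rightarrow> fm" where
  "delta_comprehension_axiom p q =
    Imp (All (Iff p q)) (SEx (All (Iff (Mem (NVar 0) 0) (sshift p))))"

definition Sigma01_IND :: "fm set" where "Sigma01_IND = induction_axiom ` Sigma01"
definition Sigma02_IND :: "fm set" where "Sigma02_IND = induction_axiom ` Sigma02"

definition Delta01_CA :: "fm set" where
  "Delta01_CA = {delta_comprehension_axiom p q |p q. p \<in> Sigma01 \<and> q \<in> Pi01}"

definition RCA0 :: "fm set" where
  "RCA0 = basic_axioms \<union> Sigma01_IND \<union> Delta01_CA"


section \<open>Writing formulas with named bound variables\<close>

text \<open>
  To write formulas readably, expressions are represented as functions of the number of enclosing
  number binders and set binders. A bound variable introduced below \<open>m\<close> number binders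
  is the function that, at a place below \<open>m'\<close> such binders, returns its index \<open>m' - Suc m\<close>.
  Object-language symbols are set in bold. Sets such as the members of a sequence of sets are
  represented by the formula expressing membership in them (type \<open>cls\<close>).
\<close>

type_synonym nterm = "nat \<Rightarrow> tm"
type_synonym setv = "nat \<Rightarrow> nat"
type_synonym form = "nat \<Rightarrow> nat \<Rightarrow> fm"
type_synonym cls = "nterm \<Rightarrow> form"

definition fzero :: nterm ("\<^bold>0") where "\<^bold>0 = (\<lambda>m. Zero)"
definition fone :: nterm ("\<^bold>1") where "\<^bold>1 = (\<lambda>m. One)"
definition fplus :: "nterm \<Rightarrow> nterm \<Rightarrow> nterm" (infixl "\<^bold>+" 65) where
  "x \<^bold>+ y = (\<lambda>m. Plus (x m) (y m))"
definition ftimes :: "nterm \<Rightarrow> nterm \<Rightarrow> nterm" (infixl "\<^bold>*" 70) where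
  "x \<^bold>* y = (\<lambda>m. Times (x m) (y m))"

primrec numeral_of :: "nat \<Rightarrow> nterm" where
  "numeral_of 0 = \<^bold>0"
| "numeral_of (Suc n) = numeral_of n \<^bold>+ \<^bold>1"

definition feq :: "nterm \<Rightarrow> nterm \<Rightarrow> form" (infix "\<^bold>=" 50) where
  "(x \<^bold>= y) = (\<lambda>m s. Eq (x m) (y m))"
definition fless :: "nterm \<Rightarrow> nterm \<Rightarrow> form" (infix "\<^bold><" 50) where
  "(x \<^bold>< y) = (\<lambda>m s. Less (x m) (y m))"
definition fmem :: "nterm \<Rightarrow> setv \<Rightarrow> form" (infix "\<^bold>\<in>" 50) where
  "(x \<^bold>\<in> X) = (\<lambda>m s. Mem (x m) (X s))"
definition fnot :: "form \<Rightarrow> form" ("\<^bold>\<not> _" [40] 40) where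
  "(\<^bold>\<not> P) = (\<lambda>m s. Neg (P m s))"
definition fand :: "form \<Rightarrow> form \<Rightarrow> form" (infixr "\<^bold>\<and>" 35) where
  "(P \<^bold>\<and> Q) = (\<lambda>m s. And (P m s) (Q m s))"
definition fdisj :: "form \<Rightarrow> form \<Rightarrow> form" (infixr "\<^bold>\<or>" 30) where
  "(P \<^bold>\<or> Q) = (\<lambda>m s. Or (P m s) (Q m s))"
definition fimp :: "form \<Rightarrow> form \<Rightarrow> form" (infixr "\<^bold>\<longrightarrow>" 25) where
  "(P \<^bold>\<longrightarrow> Q) = (\<lambda>m s. Imp (P m s) (Q m s))"

definition fall :: "(nterm \<Rightarrow> form) \<Rightarrow> form" (binder "\<^bold>\<forall>" 10) where
  "fall P = (\<lambda>m s. All (P (\<lambda>m'. NVar (m' - Suc m)) (Suc m) s))"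
definition fex :: "(nterm \<Rightarrow> form) \<Rightarrow> form" (binder "\<^bold>\<exists>" 10) where
  "fex P = (\<lambda>m s. Ex (P (\<lambda>m'. NVar (m' - Suc m)) (Suc m) s))"
definition fall_set :: "(setv \<Rightarrow> form) \<Rightarrow> form" (binder "\<^bold>\<forall>\<^sub>2" 10) where
  "fall_set P = (\<lambda>m s. SAll (P (\<lambda>s'. s' - Suc s) m (Suc s)))"

definition sentence :: "form \<Rightarrow> fm" where
  "sentence P = P 0 0"

abbreviation fle :: "nterm \<Rightarrow> nterm \<Rightarrow> form" (infix "\<^bold>\<le>" 50) where
  "x \<^bold>\<le> y \<equiv> x \<^bold>< y \<^bold>\<or> x \<^bold>= y"


section \<open>Arithmetic in the object language\<close>

definition divides :: "nterm \<Rightarrow> nterm \<Rightarrow> form" where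
  "divides x y = (\<^bold>\<exists>q. y \<^bold>= x \<^bold>* q)"

text \<open>Finite sequences are coded with Goedel's \<open>\<beta>\<close> function:
  \<open>entry a d i v\<close> says that \<open>v\<close> is the remainder of \<open>a\<close> modulo \<open>1 + (i + 1) d\<close>.\<close>

definition entry :: "nterm \<Rightarrow> nterm \<Rightarrow> nterm \<Rightarrow> nterm \<Rightarrow> form" where
  "entry a d i v =
    (let mdl = \<^bold>1 \<^bold>+ (i \<^bold>+ \<^bold>1) \<^bold>* d in v \<^bold>< mdl \<^bold>\<and> (\<^bold>\<exists>q. a \<^bold>= q \<^bold>* mdl \<^bold>+ v))"

text \<open>\<open>is_pow b e v\<close>: \<open>b\<^sup>e = v\<close>.\<close>

definition is_pow :: "nterm \<Rightarrow> nterm \<Rightarrow> nterm \<Rightarrow> form" where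
  "is_pow b e v = (\<^bold>\<exists>a. \<^bold>\<exists>d.
    entry a d \<^bold>0 \<^bold>1 \<^bold>\<and>
    (\<^bold>\<forall>i. i \<^bold>< e \<^bold>\<longrightarrow> (\<^bold>\<exists>u. entry a d i u \<^bold>\<and> entry a d (i \<^bold>+ \<^bold>1) (u \<^bold>* b))) \<^bold>\<and>
    entry a d e v)"

text \<open>\<open>n = b\<^sup>e a + r\<close> is the \<open>b\<close>-decomposition of \<open>n\<close>.\<close>

definition is_decomp :: "nterm \<Rightarrow> nterm \<Rightarrow> nterm \<Rightarrow> nterm \<Rightarrow> nterm \<Rightarrow> form" where
  "is_decomp b n e a r = (\<^bold>\<exists>p. \<^bold>\<exists>p'.
    is_pow b e p \<^bold>\<and> is_pow b (e \<^bold>+ \<^bold>1) p' \<^bold>\<and>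
    n \<^bold>= p \<^bold>* a \<^bold>+ r \<^bold>\<and> p \<^bold>\<le> n \<^bold>\<and> n \<^bold>< p' \<^bold>\<and> \<^bold>0 \<^bold>< a \<^bold>\<and> a \<^bold>< b \<^bold>\<and> r \<^bold>< p)"


section \<open>Base hierarchies and the upgrade operator\<close>

text \<open>Functional notions are rendered by their graphs: \<open>is_f x y\<close> says that \<open>f x\<close> exists,
  is finite and equals \<open>y\<close>. An infinite value is thus the absence of a value.\<close>

definition is_min :: "cls \<Rightarrow> nterm \<Rightarrow> form" where
  "is_min B b = (B b \<^bold>\<and> (\<^bold>\<forall>x. B x \<^bold>\<longrightarrow> b \<^bold>\<le> x))"

definition is_base :: "cls \<Rightarrow> nterm \<Rightarrow> nterm \<Rightarrow> form" where
  "is_base B n b = (\<^bold>\<exists>p. is_min B p \<^bold>\<and>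
    ((p \<^bold>\<le> n \<^bold>\<and> B b \<^bold>\<and> b \<^bold>\<le> n \<^bold>\<and> (\<^bold>\<forall>x. B x \<^bold>\<and> x \<^bold>\<le> n \<^bold>\<longrightarrow> x \<^bold>\<le> b)) \<^bold>\<or>
     (n \<^bold>< p \<^bold>\<and> b \<^bold>= p)))"

definition is_S :: "cls \<Rightarrow> nterm \<Rightarrow> nterm \<Rightarrow> form" where
  "is_S B n s = (B s \<^bold>\<and> n \<^bold>< s \<^bold>\<and> (\<^bold>\<forall>x. B x \<^bold>\<and> n \<^bold>< x \<^bold>\<longrightarrow> s \<^bold>\<le> x))"

text \<open>\<open>x < S\<^sub>B(n)\<close>, which holds vacuously if \<open>S\<^sub>B(n) = \<infinity>\<close>.\<close>

definition less_S :: "nterm \<Rightarrow> cls \<Rightarrow> nterm \<Rightarrow> form" where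
  "less_S x B n = (\<^bold>\<forall>s. is_S B n s \<^bold>\<longrightarrow> x \<^bold>< s)"

definition base_hierarchy :: "cls \<Rightarrow> form" where
  "base_hierarchy B =
    ((\<^bold>\<exists>x. B x) \<^bold>\<and>
     (\<^bold>\<forall>x. B x \<^bold>\<longrightarrow> \<^bold>\<not> x \<^bold>= \<^bold>0 \<^bold>\<and> \<^bold>\<not> x \<^bold>= \<^bold>1) \<^bold>\<and>
     (\<^bold>\<forall>b. B b \<^bold>\<longrightarrow> (\<^bold>\<forall>s. is_S B b s \<^bold>\<longrightarrow> divides b s)))"

text \<open>\<open>is_change a d b c n v\<close> says that \<open>\<langle>b \<rightarrow> c\<rangle> n = v\<close>, where the values of the upgrade operator
  are read off from the sequence coded by \<open>a, d\<close>. The values \<open>\<langle>b \<rightarrow> c\<rangle> m\<close> for \<open>m \<le> n\<close> are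
  collected in the sequence coded by \<open>a', d'\<close>.\<close>

definition is_change :: "nterm \<Rightarrow> nterm \<Rightarrow> nterm \<Rightarrow> nterm \<Rightarrow> nterm \<Rightarrow> nterm \<Rightarrow> form" where
  "is_change a d b c n v = (\<^bold>\<exists>a'. \<^bold>\<exists>d'.
    (\<^bold>\<forall>m. m \<^bold>\<le> n \<^bold>\<longrightarrow>
      (m \<^bold>< b \<^bold>\<longrightarrow> (\<^bold>\<exists>u. entry a d m u \<^bold>\<and> entry a' d' m u)) \<^bold>\<and>
      (b \<^bold>\<le> m \<^bold>\<longrightarrow> (\<^bold>\<exists>e. \<^bold>\<exists>f. \<^bold>\<exists>r. is_decomp b m e f r \<^bold>\<and>
        (\<^bold>\<exists>x. \<^bold>\<exists>p. \<^bold>\<exists>y. \<^bold>\<exists>z. entry a' d' e x \<^bold>\<and> is_pow c x p \<^bold>\<and> entry a d f y \<^bold>\<and> entry a' d' r z \<^bold>\<and>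
          entry a' d' m (p \<^bold>* y \<^bold>+ z))))) \<^bold>\<and>
    entry a' d' n v)"

text \<open>The condition \<open>\<up>(n - 1) < \<langle>b \<rightarrow> c\<rangle> n < S\<^sub>C(c)\<close>, with \<open>v\<close> the value of \<open>\<langle>b \<rightarrow> c\<rangle> n\<close>.\<close>

definition admissible :: "cls \<Rightarrow> nterm \<Rightarrow> nterm \<Rightarrow> nterm \<Rightarrow> nterm \<Rightarrow> nterm \<Rightarrow> nterm \<Rightarrow> form" where
  "admissible C a d b n c v =
    (is_change a d b c n v \<^bold>\<and>
     (\<^bold>\<exists>n'. \<^bold>\<exists>u. n' \<^bold>+ \<^bold>1 \<^bold>= n \<^bold>\<and> entry a d n' u \<^bold>\<and> u \<^bold>< v) \<^bold>\<and>
     less_S v C c)"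

text \<open>The sequence coded by \<open>a, d\<close> satisfies the recursion clause of the upgrade operator at \<open>n\<close>,
  with a finite value.\<close>

definition upgrade_clause :: "cls \<Rightarrow> cls \<Rightarrow> nterm \<Rightarrow> nterm \<Rightarrow> nterm \<Rightarrow> form" where
  "upgrade_clause B C a d n = (\<^bold>\<exists>p. is_min B p \<^bold>\<and>
    (n \<^bold>< p \<^bold>\<longrightarrow> entry a d n n) \<^bold>\<and>
    (p \<^bold>\<le> n \<^bold>\<longrightarrow>
      (\<^bold>\<exists>b. \<^bold>\<exists>c. \<^bold>\<exists>v. is_base B n b \<^bold>\<and> C c \<^bold>\<and> admissible C a d b n c v \<^bold>\<and>
        (\<^bold>\<forall>c'. C c' \<^bold>\<and> c' \<^bold>< c \<^bold>\<longrightarrow> \<^bold>\<not> (\<^bold>\<exists>v'. admissible C a d b n c' v')) \<^bold>\<and>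
        entry a d n v)))"

text \<open>As \<open>\<up>n < \<infinity>\<close> implies \<open>\<up>m < \<infinity>\<close> for all \<open>m < n\<close>, a finite value \<open>\<up>n\<close> is always
  witnessed by a finite sequence of finite values.\<close>

definition is_upgrade :: "cls \<Rightarrow> cls \<Rightarrow> nterm \<Rightarrow> nterm \<Rightarrow> form" where
  "is_upgrade B C n v = (\<^bold>\<exists>a. \<^bold>\<exists>d.
    (\<^bold>\<forall>m. m \<^bold>\<le> n \<^bold>\<longrightarrow> upgrade_clause B C a d m) \<^bold>\<and> entry a d n v)"


section \<open>Dynamical hierarchies and Goodstein sequences\<close>

definition good_successor :: "cls \<Rightarrow> cls \<Rightarrow> form" where
  "good_successor B C =
    ((\<^bold>\<exists>p. \<^bold>\<exists>q. is_min B p \<^bold>\<and> is_min C q \<^bold>\<and> p \<^bold>\<le> q) \<^bold>\<and>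
     (\<^bold>\<forall>n. \<^bold>\<exists>v. is_upgrade B C n v) \<^bold>\<and>
     (\<^bold>\<forall>b. B b \<^bold>\<and> (\<^bold>\<exists>p. is_min B p \<^bold>\<and> p \<^bold>< b) \<^bold>\<longrightarrow>
       (\<^bold>\<forall>n. \<^bold>\<forall>x. \<^bold>\<forall>c. n \<^bold>+ \<^bold>1 \<^bold>= b \<^bold>\<and> is_upgrade B C n x \<^bold>\<and> is_base C x c \<^bold>\<longrightarrow>
         \<^bold>\<not> (\<^bold>\<exists>y. divides c y \<^bold>\<and> x \<^bold>< y \<^bold>\<and> less_S y C x))))"

text \<open>The set \<open>X\<close> codes the sequence whose \<open>i\<close>-th member is \<open>{x. (x, i) \<in> X}\<close>, with the pairing
  function \<open>(x, i) = (x + i)\<^sup>2 + x\<close>.\<close>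

definition member :: "setv \<Rightarrow> nterm \<Rightarrow> cls" where
  "member X i = (\<lambda>x. (x \<^bold>+ i) \<^bold>* (x \<^bold>+ i) \<^bold>+ x \<^bold>\<in> X)"

definition dynamical_hierarchy :: "setv \<Rightarrow> form" where
  "dynamical_hierarchy X = (\<^bold>\<forall>i.
    base_hierarchy (member X i) \<^bold>\<and> good_successor (member X i) (member X (i \<^bold>+ \<^bold>1)))"

text \<open>\<open>is_goodstein X n i v\<close>: the Goodstein sequence of \<open>X\<close> starting at \<open>n\<close> has \<open>i\<close>-th term \<open>v\<close>.\<close>

definition is_goodstein :: "setv \<Rightarrow> nterm \<Rightarrow> nterm \<Rightarrow> nterm \<Rightarrow> form" where
  "is_goodstein X n i v = (\<^bold>\<exists>a. \<^bold>\<exists>d.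
    entry a d \<^bold>0 n \<^bold>\<and>
    (\<^bold>\<forall>j. j \<^bold>< i \<^bold>\<longrightarrow> (\<^bold>\<exists>u. \<^bold>\<exists>w. entry a d j u \<^bold>\<and> entry a d (j \<^bold>+ \<^bold>1) w \<^bold>\<and>
      ((\<^bold>0 \<^bold>< u \<^bold>\<and> is_upgrade (member X j) (member X (j \<^bold>+ \<^bold>1)) u (w \<^bold>+ \<^bold>1)) \<^bold>\<or>
       (u \<^bold>= \<^bold>0 \<^bold>\<and> w \<^bold>= \<^bold>0)))) \<^bold>\<and>
    entry a d i v)"

text \<open>The bound on \<open>S\<close> entails that it is finite, so the first hierarchy has no largest member.\<close>

definition goodstein_termination :: "nterm \<Rightarrow> form" where
  "goodstein_termination k = (\<^bold>\<forall>\<^sub>2X.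
    dynamical_hierarchy X \<^bold>\<and>
    (\<^bold>\<exists>p. is_min (member X \<^bold>0) p \<^bold>\<and> p \<^bold>\<le> k \<^bold>\<and>
      (\<^bold>\<forall>b. member X \<^bold>0 b \<^bold>\<longrightarrow> (\<^bold>\<exists>s. is_S (member X \<^bold>0) b s \<^bold>\<and> s \<^bold>\<le> b \<^bold>* p))) \<^bold>\<longrightarrow>
    (\<^bold>\<forall>n. \<^bold>\<exists>i. is_goodstein X n i \<^bold>0))"

end

theory Submission
  imports Defs "HOL-Library.Countable"
begin

text \<open>
  All ratios of consecutive bases are bounded by \<open>k\<close> and by the least base. Hence exponents in base
  changes are 1, and an upgrade replaces a leading term \<open>b f\<close> by \<open>c f\<close> and acts on the remainder.

  Provability. By completeness, one may argue in a model. Let \<open>A i b\<close> say that from time \<open>i\<close> on every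
  Goodstein run from below (the current value of) \<open>b\<close> terminates. If all ratios between \<open>b\<close> and \<open>b'\<close>
  are at most \<open>c\<close>, then \<open>A i b\<close> implies \<open>A i b'\<close>. This follows by induction on \<open>c\<close> outside the model:
  an upgrade turns a ratio \<open>c + 1\<close> into ratios at most \<open>c\<close> followed by \<open>c + 1\<close> and uses up a digit.
  As \<open>k\<close> is standard, finitely many instances of \<open>\<Pi>\<^sup>0\<^sub>2\<close> induction suffice.

  Unprovability. In the natural numbers, replacing at time \<open>i\<close> a ratio \<open>c + 1\<close> by \<open>i\<close> ratios \<open>c\<close> and
  \<open>c + 1\<close> yields hierarchies with \<open>k = c + 2\<close> whose runs are longer than the \<open>c\<close>-th function \<open>Phi c\<close> of
  a fast growing hierarchy. In an ultraproduct over increasing \<open>k\<close>, nested intervals that shrink to a cut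
  below the length of the run decide all \<open>\<Sigma>\<^sup>0\<^sub>2\<close> formulas over the cut (as with indicators): if a
  function family does not map a smaller interval into itself, one passes to the gap left by it,
  which lowers the index of \<open>Phi\<close>. The cut satisfies the theory, but the run does not terminate in it.
\<close>

section \<open>Semantics and soundness\<close>

text \<open>The induction on \<open>c\<close> stays outside the model because its statement, for all
  pairs of bases an implication between \<Pi>2 properties, exceeds \<Pi>2. Only for fixed
  \<open>c\<close> does the walk from base to base have a \<Pi>2 hypothesis, so every unit of the
  ratio costs one use of the scheme and nonstandard ratios are out of reach. The converse exploits
  this: a ratio \<open>c + 2\<close> realises the operator \<open>Phi c\<close>, one stage of the
  interval construction lowers the index of \<open>Phi\<close> by 2, so \<open>n\<close> stages call
  for \<open>k = 2 n + 3\<close>, which becomes nonstandard in the ultraproduct. Arguments inside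
  models are semantic: \<open>D0\<close>, \<open>S1\<close>, \<open>P1\<close>, \<open>S2\<close>,
  \<open>P2\<close> classify predicates on the carrier by closure rules, so that induction and
  comprehension apply without writing down object formulas. Term model, cut and natural numbers are
  all made instances of \<open>linordered_semidom\<close>; facts about codes and upgrades are proved
  once and serve in each of them.\<close>

record 'a struc =
  zr :: 'a
  on :: 'a
  pl :: "'a \<Rightarrow> 'a \<Rightarrow> 'a"
  ti :: "'a \<Rightarrow> 'a \<Rightarrow> 'a"
  ls :: "'a \<Rightarrow> 'a \<Rightarrow> bool"
  sets :: "'a set set"

primrec evt :: "'a struc \<Rightarrow> tm \<Rightarrow> (nat \<Rightarrow> 'a) \<Rightarrow> 'a" where
  "evt M (NVar n) e = e n"
| "evt M Zero e = zr M"
| "evt M One e = on M"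
| "evt M (Plus s t) e = pl M (evt M s e) (evt M t e)"
| "evt M (Times s t) e = ti M (evt M s e) (evt M t e)"

primrec sat :: "'a struc \<Rightarrow> fm \<Rightarrow> (nat \<Rightarrow> 'a) \<Rightarrow> (nat \<Rightarrow> 'a set) \<Rightarrow> bool" where
  "sat M (Eq s t) e E = (evt M s e = evt M t e)"
| "sat M (Less s t) e E = ls M (evt M s e) (evt M t e)"
| "sat M (Mem t X) e E = (evt M t e \<in> E X)"
| "sat M Bot e E = False"
| "sat M (Imp p q) e E = (sat M p e E \<longrightarrow> sat M q e E)"
| "sat M (And p q) e E = (sat M p e E \<and> sat M q e E)"
| "sat M (Or p q) e E = (sat M p e E \<or> sat M q e E)"
| "sat M (All p) e E = (\<forall>a. sat M p (case_nat a e) E)"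
| "sat M (Ex p) e E = (\<exists>a. sat M p (case_nat a e) E)"
| "sat M (SAll p) e E = (\<forall>S\<in>sets M. sat M p e (case_nat S E))"
| "sat M (SEx p) e E = (\<exists>S\<in>sets M. sat M p e (case_nat S E))"

text \<open>Free variables of an axiom count as universally quantified, hence the quantification
  over assignments; set variables range over \<open>sets M\<close> only, as in Henkin
  semantics.\<close>

definition valid :: "'a struc \<Rightarrow> fm \<Rightarrow> bool" where
  "valid M p \<longleftrightarrow> (\<forall>e E. (\<forall>n. E n \<in> sets M) \<longrightarrow> sat M p e E)"

lemma evt_subst: "evt M (subst_tm t \<sigma>) e = evt M t (\<lambda>n. evt M (\<sigma> n) e)"
  by (induction t) auto

lemma evt_shift [simp]: "evt M (shift_tm t) (case_nat a e) = evt M t e"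
  by (simp add: shift_tm_def evt_subst)

lemma case_nat_up: "(\<lambda>n. evt M (case n of 0 \<Rightarrow> NVar 0 | Suc n \<Rightarrow> shift_tm (\<sigma> n)) (case_nat a e))
   = case_nat a (\<lambda>n. evt M (\<sigma> n) e)"
  by (rule ext) (auto split: nat.split)

lemma case_nat_sup: "(\<lambda>n. (case_nat S E) (case n of 0 \<Rightarrow> 0 | Suc n \<Rightarrow> Suc (\<rho> n)))
   = case_nat S (\<lambda>n. E (\<rho> n))"
  by (rule ext) (auto split: nat.split)

lemma sat_subst: "sat M (subst p \<sigma> \<rho>) e E = sat M p (\<lambda>n. evt M (\<sigma> n) e) (\<lambda>n. E (\<rho> n))"
  by (induction p arbitrary: \<sigma> \<rho> e E) (simp_all add: evt_subst case_nat_up case_nat_sup)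

lemma sat_shift [simp]: "sat M (shift p) (case_nat a e) E = sat M p e E"
  by (simp add: shift_def sat_subst)

lemma sat_sshift [simp]: "sat M (sshift p) e (case_nat S E) = sat M p e E"
  by (simp add: sshift_def sat_subst)

lemma case_nat_inst: "(\<lambda>n. evt M (case n of 0 \<Rightarrow> t | Suc n \<Rightarrow> NVar n) e) = case_nat (evt M t e) e"
  by (rule ext) (auto split: nat.split)

lemma sat_inst: "sat M (inst p t) e E = sat M p (case_nat (evt M t e) e) E"
  by (simp add: inst_def sat_subst case_nat_inst)

lemma case_nat_sinst: "(\<lambda>n. E (case n of 0 \<Rightarrow> X | Suc n \<Rightarrow> n)) = case_nat (E X) E"
  by (rule ext) (auto split: nat.split)

lemma sat_sinst: "sat M (sinst p X) e E = sat M p e (case_nat (E X) E)"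
  by (simp add: sinst_def sat_subst case_nat_sinst)

theorem soundness:
  assumes "deriv T G p" and T: "\<And>q. q \<in> T \<Longrightarrow> valid M q"
  shows "(\<And>n. E n \<in> sets M) \<Longrightarrow> (\<And>q. q \<in> set G \<Longrightarrow> sat M q e E) \<Longrightarrow> sat M p e E"
  using assms(1)
proof (induction arbitrary: e E rule: deriv.induct)
  case (Axiom p G)
  then show ?case using T by (auto simp: valid_def)
next
  case (ExE G p q)
  from ExE.IH(1)[OF ExE.prems] obtain a where "sat M p (case_nat a e) E" by auto
  then have "sat M (shift q) (case_nat a e) E"
    using ExE.prems by (intro ExE.IH(2)) auto
  then show ?case by simp
next
  case (SExE G p q)
  from SExE.IH(1)[OF SExE.prems] obtain S where S: "S \<in> sets M" "sat M p e (case_nat S E)" by auto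
  then have "sat M (sshift q) e (case_nat S E)"
    using SExE.prems by (intro SExE.IH(2)) (auto split: nat.split)
  then show ?case by simp
next
  case (AllI G p)
  have "sat M p (case_nat a e) E" for a using AllI.prems by (intro AllI.IH) auto
  then show ?case by simp
next
  case (SAllI G p)
  show ?case using SAllI.prems by (auto intro!: SAllI.IH split: nat.split)
next
  case (AllE G p t)
  then show ?case by (auto simp: sat_inst)
next
  case (ExI G p t)
  then show ?case by (auto simp: sat_inst)
next
  case (SAllE G p X)
  then show ?case by (auto simp: sat_sinst)
next
  case (SExI G p X)
  then show ?case by (auto simp: sat_sinst)
next
  case (EqSubst G s t p)
  show ?case using EqSubst.IH(1)[OF EqSubst.prems] EqSubst.IH(2)[OF EqSubst.prems]
    by (simp add: sat_inst)
next
  case (Classical p G)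
  show ?case
  proof (rule ccontr)
    assume "\<not> sat M p e E"
    then have "sat M Bot e E" using Classical.prems by (intro Classical.IH) auto
    then show False by simp
  qed
next
  case (ImpI p G q)
  show ?case using ImpI.prems by (auto intro!: ImpI.IH)
next
  case (OrE G p q r)
  have "sat M p e E \<Longrightarrow> sat M r e E" using OrE.prems by (intro OrE.IH(2)) auto
  moreover have "sat M q e E \<Longrightarrow> sat M r e E" using OrE.prems by (intro OrE.IH(3)) auto
  ultimately show ?case using OrE.IH(1)[OF OrE.prems] by auto
qed auto

section \<open>Substitution\<close>

abbreviation nlift :: "(nat \<Rightarrow> tm) \<Rightarrow> nat \<Rightarrow> tm" where
  "nlift \<sigma> \<equiv> case_nat (NVar 0) (\<lambda>n. shift_tm (\<sigma> n))"
abbreviation slift :: "(nat \<Rightarrow> nat) \<Rightarrow> nat \<Rightarrow> nat" where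
  "slift \<rho> \<equiv> case_nat 0 (\<lambda>n. Suc (\<rho> n))"

lemma subst_tm_comp: "subst_tm (subst_tm t \<sigma>) \<tau> = subst_tm t (\<lambda>n. subst_tm (\<sigma> n) \<tau>)"
  by (induction t) auto

lemma subst_tm_NVar [simp]: "subst_tm t NVar = t"
  by (induction t) auto

lemma subst_tm_shift: "subst_tm (shift_tm t) \<tau> = subst_tm t (\<lambda>n. \<tau> (Suc n))"
  by (simp add: shift_tm_def subst_tm_comp)

lemma shift_tm_subst: "shift_tm (subst_tm t \<sigma>) = subst_tm t (\<lambda>n. shift_tm (\<sigma> n))"
  by (simp add: shift_tm_def subst_tm_comp)

lemma up_comp: "(\<lambda>n. subst_tm (nlift \<sigma> n) (nlift \<tau>)) = nlift (\<lambda>n. subst_tm (\<sigma> n) \<tau>)"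
  by (rule ext) (auto split: nat.split simp: subst_tm_shift shift_tm_subst)

lemma sup_comp: "(\<lambda>n. slift \<rho>' (slift \<rho> n)) = slift (\<lambda>n. \<rho>' (\<rho> n))"
  by (rule ext) (auto split: nat.split)

lemma subst_comp:
  "subst (subst p \<sigma> \<rho>) \<tau> \<rho>' = subst p (\<lambda>n. subst_tm (\<sigma> n) \<tau>) (\<lambda>n. \<rho>' (\<rho> n))"
  by (induction p arbitrary: \<sigma> \<rho> \<tau> \<rho>') (simp_all add: subst_tm_comp up_comp sup_comp)

lemma up_NVar: "nlift NVar = NVar"
  by (rule ext) (auto split: nat.split simp: shift_tm_def)

lemma sup_id: "slift (\<lambda>n. n) = (\<lambda>n. n)"
  by (rule ext) (auto split: nat.split)

lemma subst_id [simp]: "subst p NVar (\<lambda>n. n) = p"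
  by (induction p) (simp_all add: up_NVar sup_id)

primrec tbound :: "tm \<Rightarrow> nat" where
  "tbound (NVar n) = Suc n"
| "tbound Zero = 0"
| "tbound One = 0"
| "tbound (Plus s t) = max (tbound s) (tbound t)"
| "tbound (Times s t) = max (tbound s) (tbound t)"

text \<open>Strict upper bounds, to be compared with indices by \<open><\<close>.\<close>

primrec nbound :: "fm \<Rightarrow> nat" where
  "nbound (Eq s t) = max (tbound s) (tbound t)"
| "nbound (Less s t) = max (tbound s) (tbound t)"
| "nbound (Mem t X) = tbound t"
| "nbound Bot = 0"
| "nbound (Imp p q) = max (nbound p) (nbound q)"
| "nbound (And p q) = max (nbound p) (nbound q)"
| "nbound (Or p q) = max (nbound p) (nbound q)"
| "nbound (All p) = nbound p - 1"
| "nbound (Ex p) = nbound p - 1"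
| "nbound (SAll p) = nbound p"
| "nbound (SEx p) = nbound p"

primrec sbound :: "fm \<Rightarrow> nat" where
  "sbound (Eq s t) = 0"
| "sbound (Less s t) = 0"
| "sbound (Mem t X) = Suc X"
| "sbound Bot = 0"
| "sbound (Imp p q) = max (sbound p) (sbound q)"
| "sbound (And p q) = max (sbound p) (sbound q)"
| "sbound (Or p q) = max (sbound p) (sbound q)"
| "sbound (All p) = sbound p"
| "sbound (Ex p) = sbound p"
| "sbound (SAll p) = sbound p - 1"
| "sbound (SEx p) = sbound p - 1"

lemma subst_tm_cong: "(\<And>i. i < tbound t \<Longrightarrow> \<sigma> i = \<tau> i) \<Longrightarrow> subst_tm t \<sigma> = subst_tm t \<tau>"
  by (induction t) auto

lemma subst_cong:
  "(\<And>i. i < nbound p \<Longrightarrow> \<sigma> i = \<tau> i) \<Longrightarrow> (\<And>i. i < sbound p \<Longrightarrow> \<rho> i = \<rho>' i) \<Longrightarrow>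
   subst p \<sigma> \<rho> = subst p \<tau> \<rho>'"
proof (induction p arbitrary: \<sigma> \<tau> \<rho> \<rho>')
  case (All p)
  show ?case using All.prems by (auto intro!: All.IH split: nat.split)
next
  case (Ex p)
  show ?case using Ex.prems by (auto intro!: Ex.IH split: nat.split)
next
  case (SAll p)
  show ?case using SAll.prems by (auto intro!: SAll.IH split: nat.split)
next
  case (SEx p)
  show ?case using SEx.prems by (auto intro!: SEx.IH split: nat.split)
next
  case (Imp p q)
  have "subst p \<sigma> \<rho> = subst p \<tau> \<rho>'" by (rule Imp.IH(1)) (auto intro: Imp.prems)
  moreover have "subst q \<sigma> \<rho> = subst q \<tau> \<rho>'" by (rule Imp.IH(2)) (auto intro: Imp.prems)
  ultimately show ?case by simp
next
  case (And p q)
  have "subst p \<sigma> \<rho> = subst p \<tau> \<rho>'" by (rule And.IH(1)) (auto intro: And.prems)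
  moreover have "subst q \<sigma> \<rho> = subst q \<tau> \<rho>'" by (rule And.IH(2)) (auto intro: And.prems)
  ultimately show ?case by simp
next
  case (Or p q)
  have "subst p \<sigma> \<rho> = subst p \<tau> \<rho>'" by (rule Or.IH(1)) (auto intro: Or.prems)
  moreover have "subst q \<sigma> \<rho> = subst q \<tau> \<rho>'" by (rule Or.IH(2)) (auto intro: Or.prems)
  ultimately show ?case by simp
qed (auto intro: subst_tm_cong)

lemma subst_inst: "subst (inst p t) \<sigma> \<rho> = inst (subst p (nlift \<sigma>) \<rho>) (subst_tm t \<sigma>)"
  by (auto simp: inst_def subst_comp subst_tm_shift fun_eq_iff split: nat.split intro!: subst_cong)

lemma subst_sinst: "subst (sinst p X) \<sigma> \<rho> = sinst (subst p \<sigma> (slift \<rho>)) (\<rho> X)"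
  by (auto simp: sinst_def subst_comp fun_eq_iff split: nat.split intro!: subst_cong)

lemma subst_shift: "subst (shift p) (nlift \<sigma>) \<rho> = shift (subst p \<sigma> \<rho>)"
  by (auto simp: shift_def subst_comp shift_tm_def intro!: subst_cong)

lemma subst_sshift: "subst (sshift p) \<sigma> (slift \<rho>) = sshift (subst p \<sigma> \<rho>)"
  by (auto simp: sshift_def subst_comp intro!: subst_cong)

lemma inst_up: "inst (subst p (nlift \<sigma>) \<rho>) t = subst p (case_nat t \<sigma>) \<rho>"
  by (auto simp: inst_def subst_comp subst_tm_shift split: nat.split intro!: subst_cong)

lemma sinst_sup: "sinst (subst p \<sigma> (slift \<rho>)) X = subst p \<sigma> (case_nat X \<rho>)"
  by (auto simp: sinst_def subst_comp split: nat.split intro!: subst_cong)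

section \<open>Derivations under weakening and substitution\<close>

lemma deriv_weaken: "deriv T G p \<Longrightarrow> set G \<subseteq> set G' \<Longrightarrow> deriv T G' p"
proof (induction arbitrary: G' rule: deriv.induct)
  case (ExE G p q)
  have "deriv T (p # map shift G') (shift q)" using ExE.prems by (intro ExE.IH) auto
  then show ?case using ExE.IH(1)[OF ExE.prems] by (rule deriv.ExE[rotated])
next
  case (SExE G p q)
  have "deriv T (p # map sshift G') (sshift q)" using SExE.prems by (intro SExE.IH) auto
  then show ?case using SExE.IH(1)[OF SExE.prems] by (rule deriv.SExE[rotated])
next
  case (OrE G p q r)
  have "deriv T (p # G') r" using OrE.prems by (intro OrE.IH(2)) auto
  moreover have "deriv T (q # G') r" using OrE.prems by (intro OrE.IH(3)) auto
  ultimately show ?case using OrE.IH(1)[OF OrE.prems] by (metis deriv.OrE)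
next
  case (AllI G p)
  show ?case using AllI.prems by (intro deriv.AllI AllI.IH) auto
next
  case (SAllI G p)
  show ?case using SAllI.prems by (intro deriv.SAllI SAllI.IH) auto
next
  case (ImpI p G q)
  show ?case using ImpI.prems by (intro deriv.ImpI ImpI.IH) auto
next
  case (Classical p G)
  show ?case using Classical.prems by (intro deriv.Classical[of _ p] Classical.IH) auto
next
  case (Axiom p G) then show ?case by (intro deriv.Axiom)
next
  case (Assm p G) then show ?case by (intro deriv.Assm) auto
next
  case (ImpE G p q) from ImpE.IH[OF ImpE.prems] show ?case by (rule deriv.ImpE)
next
  case (AndI G p q) from AndI.IH[OF AndI.prems] show ?case by (rule deriv.AndI)
next
  case (AndE1 G p q) from AndE1.IH[OF AndE1.prems] show ?case by (rule deriv.AndE1)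
next
  case (AndE2 G p q) from AndE2.IH[OF AndE2.prems] show ?case by (rule deriv.AndE2)
next
  case (OrI1 G p q) from OrI1.IH[OF OrI1.prems] show ?case by (rule deriv.OrI1)
next
  case (OrI2 G p q) from OrI2.IH[OF OrI2.prems] show ?case by (rule deriv.OrI2)
next
  case (AllE G p t) from AllE.IH[OF AllE.prems] show ?case by (rule deriv.AllE)
next
  case (ExI G p t) from ExI.IH[OF ExI.prems] show ?case by (rule deriv.ExI)
next
  case (SAllE G p t) from SAllE.IH[OF SAllE.prems] show ?case by (rule deriv.SAllE)
next
  case (SExI G p t) from SExI.IH[OF SExI.prems] show ?case by (rule deriv.SExI)
next
  case (EqRefl G t) show ?case by (rule deriv.EqRefl)
next
  case (EqSubst G s t p) from EqSubst.IH[OF EqSubst.prems] show ?case by (rule deriv.EqSubst)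
qed

text \<open>Below a quantifier the substitution is lifted, and shifting the assumptions commutes
  with lifting, so eigenvariables stay fresh. Closure of \<open>T\<close> under substitution settles
  the axiom rule.\<close>

lemma deriv_subst:
  assumes "deriv T G p" and cl: "\<And>p \<sigma> \<rho>. p \<in> T \<Longrightarrow> subst p \<sigma> \<rho> \<in> T"
  shows "deriv T (map (\<lambda>q. subst q \<sigma> \<rho>) G) (subst p \<sigma> \<rho>)"
  using assms(1)
proof (induction arbitrary: \<sigma> \<rho> rule: deriv.induct)
  case (AllI G p)
  show ?case unfolding subst.simps
    using AllI.IH[of "nlift \<sigma>" \<rho>] by (intro deriv.AllI) (simp add: comp_def subst_shift)
next
  case (SAllI G p)
  show ?case unfolding subst.simps
    using SAllI.IH[of \<sigma> "slift \<rho>"] by (intro deriv.SAllI) (simp add: comp_def subst_sshift)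
next
  case (ExE G p q)
  show ?case using ExE.IH(2)[of "nlift \<sigma>" \<rho>]
    by (intro deriv.ExE[OF ExE.IH(1)[of \<sigma> \<rho>, unfolded subst.simps]])
      (simp add: comp_def subst_shift)
next
  case (SExE G p q)
  show ?case using SExE.IH(2)[of \<sigma> "slift \<rho>"]
    by (intro deriv.SExE[OF SExE.IH(1)[of \<sigma> \<rho>, unfolded subst.simps]])
      (simp add: comp_def subst_sshift)
next
  case (AllE G p t)
  show ?case using deriv.AllE[OF AllE.IH[of \<sigma> \<rho>, unfolded subst.simps]] by (simp only: subst_inst)
next
  case (SAllE G p X)
  show ?case using deriv.SAllE[OF SAllE.IH[of \<sigma> \<rho>, unfolded subst.simps]] by (simp only: subst_sinst)
next
  case (ExI G p t)
  show ?case unfolding subst.simps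
    by (rule deriv.ExI[OF ExI.IH[of \<sigma> \<rho>, unfolded subst_inst]])
next
  case (SExI G p X)
  show ?case unfolding subst.simps
    by (rule deriv.SExI[OF SExI.IH[of \<sigma> \<rho>, unfolded subst_sinst]])
next
  case (EqSubst G s t p)
  show ?case unfolding subst_inst
    by (rule deriv.EqSubst[OF EqSubst.IH(1)[of \<sigma> \<rho>, unfolded subst.simps]
      EqSubst.IH(2)[of \<sigma> \<rho>, unfolded subst_inst]])
next
  case (Axiom p G)
  then show ?case by (intro deriv.Axiom cl)
next
  case (OrE G p q r)
  show ?case by (rule deriv.OrE[OF OrE.IH(1)[of \<sigma> \<rho>, unfolded subst.simps]
      OrE.IH(2)[of \<sigma> \<rho>, unfolded list.map] OrE.IH(3)[of \<sigma> \<rho>, unfolded list.map]])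
next
  case (ImpE G p q)
  show ?case by (rule deriv.ImpE[OF ImpE.IH(1)[of \<sigma> \<rho>, unfolded subst.simps] ImpE.IH(2)[of \<sigma> \<rho>]])
next
  case (Classical p G)
  show ?case by (rule deriv.Classical[OF Classical.IH[of \<sigma> \<rho>, unfolded list.map subst.simps]])
next
  case (AndE1 G p q)
  show ?case by (rule deriv.AndE1[OF AndE1.IH[of \<sigma> \<rho>, unfolded subst.simps]])
next
  case (AndE2 G p q)
  show ?case by (rule deriv.AndE2[OF AndE2.IH[of \<sigma> \<rho>, unfolded subst.simps]])
next
  case (Assm p G) then show ?case by (intro deriv.Assm) auto
next
  case (ImpI p G q)
  show ?case unfolding subst.simps by (rule deriv.ImpI[OF ImpI.IH[of \<sigma> \<rho>, unfolded list.map]])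
next
  case (AndI G p q)
  show ?case unfolding subst.simps by (rule deriv.AndI[OF AndI.IH])
next
  case (OrI1 G p q)
  show ?case unfolding subst.simps by (rule deriv.OrI1[OF OrI1.IH])
next
  case (OrI2 G q p)
  show ?case unfolding subst.simps by (rule deriv.OrI2[OF OrI2.IH])
next
  case (EqRefl G t)
  show ?case unfolding subst.simps by (rule deriv.EqRefl)
qed

text \<open>Free variables of axioms are implicitly universally quantified, so substitution
  instances of axioms are derivable.\<close>

lemma deriv_All_inst:
  "deriv T G ((All ^^ n) p) \<Longrightarrow> deriv T G (subst p (\<lambda>i. if i < n then \<tau> i else NVar (i - n)) (\<lambda>i. i))"
proof (induction n arbitrary: p \<tau>)
  case (Suc n)
  let ?t = "\<lambda>i. if i < n then \<tau> (Suc i) else NVar (i - n)"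
  have "deriv T G (All (subst p (nlift ?t) (\<lambda>i. i)))"
    using Suc.IH[of "All p" "\<lambda>i. \<tau> (Suc i)"] Suc.prems by (simp add: funpow_swap1)
  from deriv.AllE[OF this, of "\<tau> 0"] have "deriv T G (subst p (case_nat (\<tau> 0) ?t) (\<lambda>i. i))"
    by (simp add: inst_up)
  moreover have "case_nat (\<tau> 0) ?t = (\<lambda>i. if i < Suc n then \<tau> i else NVar (i - Suc n))"
    by (rule ext) (auto split: nat.split)
  ultimately show ?case by simp
qed simp

lemma deriv_SAll_inst:
  "deriv T G ((SAll ^^ n) p) \<Longrightarrow> deriv T G (subst p NVar (\<lambda>i. if i < n then \<tau> i else (i - n)))"
proof (induction n arbitrary: p \<tau>)
  case (Suc n)
  let ?t = "\<lambda>i. if i < n then \<tau> (Suc i) else (i - n)"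
  have "deriv T G (SAll (subst p NVar (slift ?t)))"
    using Suc.IH[of "SAll p" "\<lambda>i. \<tau> (Suc i)"] Suc.prems by (simp add: funpow_swap1)
  from deriv.SAllE[OF this, of "\<tau> 0"] have "deriv T G (subst p NVar (case_nat (\<tau> 0) ?t))"
    by (simp add: sinst_sup)
  moreover have "case_nat (\<tau> 0) ?t = (\<lambda>i. if i < Suc n then \<tau> i else (i - Suc n))"
    by (rule ext) (auto split: nat.split)
  ultimately show ?case by simp
qed simp

lemma deriv_Alls: "deriv T [] p \<Longrightarrow> deriv T [] ((All ^^ n) p)"
  by (induction n) (auto intro: deriv.AllI)

lemma deriv_SAlls: "deriv T [] p \<Longrightarrow> deriv T [] ((SAll ^^ n) p)"
  by (induction n) (auto intro: deriv.SAllI)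

text \<open>The axiom is generalised over \<open>nbound p\<close> number variables and
  \<open>sbound p\<close> set variables and then instantiated; only the values of a substitution
  below these bounds affect \<open>p\<close>.\<close>

lemma deriv_axiom_subst:
  assumes "p \<in> T" shows "deriv T G (subst p \<sigma> \<rho>)"
proof -
  have "deriv T [] p" using assms by (rule deriv.Axiom)
  from deriv_All_inst[OF deriv_Alls[OF this], of "nbound p" \<sigma>]
  have "deriv T [] (subst p (\<lambda>i. if i < nbound p then \<sigma> i else NVar (i - nbound p)) (\<lambda>i. i))" .
  also have "subst p (\<lambda>i. if i < nbound p then \<sigma> i else NVar (i - nbound p)) (\<lambda>i. i) = subst p \<sigma> (\<lambda>i. i)"
    by (rule subst_cong) auto
  finally have "deriv T [] (subst p \<sigma> (\<lambda>i. i))" .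
  from deriv_SAll_inst[OF deriv_SAlls[OF this], of "sbound p" \<rho>]
  have "deriv T [] (subst p \<sigma> (\<lambda>i. if i < sbound p then \<rho> i else i - sbound p))"
    by (simp add: subst_comp)
  also have "subst p \<sigma> (\<lambda>i. if i < sbound p then \<rho> i else i - sbound p) = subst p \<sigma> \<rho>"
    by (rule subst_cong) auto
  finally show ?thesis by (rule deriv_weaken) simp
qed

text \<open>\<open>deriv_subst\<close> asks for a set of axioms closed under substitution, which
  \<open>RCA0\<close> is not; by \<open>deriv_closure\<close> the passage to the closure proves
  nothing new.\<close>

definition closure :: "fm set \<Rightarrow> fm set" where
  "closure T = {subst p \<sigma> \<rho> |p \<sigma> \<rho>. p \<in> T}"

lemma closure_subst: "p \<in> closure T \<Longrightarrow> subst p \<sigma> \<rho> \<in> closure T"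
  by (clarsimp simp: closure_def subst_comp) blast

lemma deriv_closure: "deriv (closure T) G p \<Longrightarrow> deriv T G p"
proof (induction rule: deriv.induct)
  case (Axiom p G)
  then show ?case by (auto simp: closure_def intro: deriv_axiom_subst)
next
  case (ImpI p G q) from ImpI.IH show ?case by (rule deriv.ImpI)
next
  case (ImpE G p q) from ImpE.IH show ?case by (rule deriv.ImpE)
next
  case (Classical p G) from Classical.IH show ?case by (rule deriv.Classical)
next
  case (AndI G p q) from AndI.IH show ?case by (rule deriv.AndI)
next
  case (AndE1 G p q) from AndE1.IH show ?case by (rule deriv.AndE1)
next
  case (AndE2 G p q) from AndE2.IH show ?case by (rule deriv.AndE2)
next
  case (OrI1 G p q) from OrI1.IH show ?case by (rule deriv.OrI1)
next
  case (OrI2 G q p) from OrI2.IH show ?case by (rule deriv.OrI2)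
next
  case (OrE G p q r) from OrE.IH show ?case by (rule deriv.OrE)
next
  case (AllI G p) from AllI.IH show ?case by (rule deriv.AllI)
next
  case (AllE G p t) from AllE.IH show ?case by (rule deriv.AllE)
next
  case (ExI G p t) from ExI.IH show ?case by (rule deriv.ExI)
next
  case (ExE G p q) from ExE.IH show ?case by (rule deriv.ExE)
next
  case (SAllI G p) from SAllI.IH show ?case by (rule deriv.SAllI)
next
  case (SAllE G p X) from SAllE.IH show ?case by (rule deriv.SAllE)
next
  case (SExI G p X) from SExI.IH show ?case by (rule deriv.SExI)
next
  case (SExE G p q) from SExE.IH show ?case by (rule deriv.SExE)
next
  case (EqSubst G s t p) from EqSubst.IH show ?case by (rule deriv.EqSubst)
next
  case (Assm p G) then show ?case by (rule deriv.Assm)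
next
  case (EqRefl G t) show ?case by (rule deriv.EqRefl)
qed

section \<open>Completeness\<close>

instance tm :: countable by countable_datatype
instance fm :: countable by countable_datatype

definition henkin :: "fm set \<Rightarrow> fm set \<Rightarrow> bool" where
  "henkin T H \<longleftrightarrow> (\<forall>G p. set G \<subseteq> H \<longrightarrow> deriv T G p \<longrightarrow> p \<in> H) \<and> Bot \<notin> H \<and>
     (\<forall>p. p \<in> H \<or> Neg p \<in> H) \<and> (\<forall>p. Ex p \<in> H \<longrightarrow> (\<exists>t. inst p t \<in> H)) \<and>
     (\<forall>p. SEx p \<in> H \<longrightarrow> (\<exists>X. sinst p X \<in> H))"

lemma deriv_cut: "deriv T G p \<Longrightarrow> deriv T (p # G) q \<Longrightarrow> deriv T G q"
  by (rule deriv.ImpE[OF deriv.ImpI])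

lemma consistent_witness:
  assumes cl: "\<And>p \<sigma> \<rho>. p \<in> T \<Longrightarrow> subst p \<sigma> \<rho> \<in> T"
    and c: "\<not> deriv T G Bot" and x: "\<And>q. q \<in> set G \<Longrightarrow> nbound q \<le> x" and E: "Ex p \<in> set G"
  shows "\<not> deriv T (inst p (NVar x) # G) Bot"
proof
  assume d0: "deriv T (inst p (NVar x) # G) Bot"
  let ?s = "\<lambda>n. if n = x then NVar 0 else NVar (Suc n)"
  from deriv_subst[OF d0 cl, where \<sigma> = ?s and \<rho> = "\<lambda>n. n"]
  have d: "deriv T (subst (inst p (NVar x)) ?s (\<lambda>n. n) # map (\<lambda>q. subst q ?s (\<lambda>n. n)) G) Bot"
    by simp
  have nb: "nbound p \<le> Suc x" using x[OF E] by simp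
  have "subst (inst p (NVar x)) ?s (\<lambda>n. n) = subst p (case_nat (NVar 0) ?s) (\<lambda>n. n)"
    by (simp only: subst_inst inst_up) simp
  also have "\<dots> = subst p NVar (\<lambda>n. n)"
    by (rule subst_cong) (use nb in \<open>auto split: nat.split\<close>)
  finally have 1: "subst (inst p (NVar x)) ?s (\<lambda>n. n) = p" by simp
  have 2: "map (\<lambda>q. subst q ?s (\<lambda>n. n)) G = map shift G"
    unfolding shift_def by (intro map_cong refl subst_cong) (auto dest: x)
  from d have "deriv T (p # map shift G) (shift Bot)" unfolding 1 2 by (simp add: shift_def)
  then have "deriv T G Bot" using deriv.ExE[OF deriv.Assm[OF E]] by blast
  with c show False by simp
qed

lemma consistent_switness:
  assumes cl: "\<And>p \<sigma> \<rho>. p \<in> T \<Longrightarrow> subst p \<sigma> \<rho> \<in> T"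
    and c: "\<not> deriv T G Bot" and x: "\<And>q. q \<in> set G \<Longrightarrow> sbound q \<le> x" and E: "SEx p \<in> set G"
  shows "\<not> deriv T (sinst p x # G) Bot"
proof
  assume d0: "deriv T (sinst p x # G) Bot"
  let ?s = "\<lambda>n. if n = x then 0 else Suc n"
  from deriv_subst[OF d0 cl, where \<sigma> = NVar and \<rho> = ?s]
  have d: "deriv T (subst (sinst p x) NVar ?s # map (\<lambda>q. subst q NVar ?s) G) Bot"
    by simp
  have nb: "sbound p \<le> Suc x" using x[OF E] by simp
  have "subst (sinst p x) NVar ?s = subst p NVar (case_nat 0 ?s)"
    by (simp only: subst_sinst sinst_sup) simp
  also have "\<dots> = subst p NVar (\<lambda>n. n)"
    by (rule subst_cong) (use nb in \<open>auto split: nat.split\<close>)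
  finally have 1: "subst (sinst p x) NVar ?s = p" by simp
  have 2: "map (\<lambda>q. subst q NVar ?s) G = map sshift G"
    unfolding sshift_def by (intro map_cong refl subst_cong) (auto dest: x)
  from d have "deriv T (p # map sshift G) (sshift Bot)" unfolding 1 2 by (simp add: sshift_def)
  then have "deriv T G Bot" using deriv.SExE[OF deriv.Assm[OF E]] by blast
  with c show False by simp
qed

text \<open>The sum of the bounds is a crude bound for the variables in use and therefore a fresh
  index. A formula inconsistent with \<open>G\<close> contributes its negation, which makes the
  limit complete.\<close>

definition extend :: "fm set \<Rightarrow> fm list \<Rightarrow> fm \<Rightarrow> fm list" where
  "extend T G f = (if \<not> deriv T (f # G) Bot then
     (case f of Ex p \<Rightarrow> inst p (NVar (sum_list (map nbound (f # G)))) # f # G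
      | SEx p \<Rightarrow> sinst p (sum_list (map sbound (f # G))) # f # G | _ \<Rightarrow> f # G)
     else Neg f # G)"

primrec chain :: "fm set \<Rightarrow> fm list \<Rightarrow> nat \<Rightarrow> fm list" where
  "chain T G 0 = G"
| "chain T G (Suc n) = extend T (chain T G n) (from_nat n)"

lemma extend_consistent:
  assumes cl: "\<And>p \<sigma> \<rho>. p \<in> T \<Longrightarrow> subst p \<sigma> \<rho> \<in> T" and c: "\<not> deriv T G Bot"
  shows "\<not> deriv T (extend T G f) Bot"
proof (cases "deriv T (f # G) Bot")
  case True
  have "deriv T G f" if "deriv T (Neg f # G) Bot" using that by (rule deriv.Classical)
  then show ?thesis using True c by (auto simp: extend_def dest: deriv_cut)
next
  case False
  have n: "nbound q \<le> sum_list (map nbound (f # G))" if "q \<in> set (f # G)" for q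
    using that by (intro member_le_sum_list) auto
  have s: "sbound q \<le> sum_list (map sbound (f # G))" if "q \<in> set (f # G)" for q
    using that by (intro member_le_sum_list) auto
  have "\<not> deriv T (inst p (NVar (sum_list (map nbound (f # G)))) # f # G) Bot" if "f = Ex p" for p
    by (rule consistent_witness[OF cl False n]) (use that in auto)
  moreover have "\<not> deriv T (sinst p (sum_list (map sbound (f # G))) # f # G) Bot" if "f = SEx p" for p
    by (rule consistent_switness[OF cl False s]) (use that in auto)
  ultimately show ?thesis using False unfolding extend_def by (cases f) simp_all
qed

lemma set_extend: "set G \<subseteq> set (extend T G f)"
  by (cases f) (auto simp: extend_def)

text \<open>Formulas are enumerated by \<open>from_nat\<close>. The stages increase and a derivation
  has finitely many assumptions, so the union is as consistent as its stages.\<close>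

theorem henkin_exists:
  assumes cl: "\<And>p \<sigma> \<rho>. p \<in> T \<Longrightarrow> subst p \<sigma> \<rho> \<in> T" and c: "\<not> deriv T G Bot"
  shows "\<exists>H. henkin T H \<and> set G \<subseteq> H"
proof -
  define H where "H = (\<Union>n. set (chain T G n))"
  have con: "\<not> deriv T (chain T G n) Bot" for n
    by (induction n) (simp_all add: c extend_consistent cl)
  have mono: "set (chain T G n) \<subseteq> set (chain T G m)" if "n \<le> m" for n m
    using that by (induction rule: dec_induct) (auto dest: set_mp[OF set_extend])
  have fin: "\<exists>n. set K \<subseteq> set (chain T G n)" if "set K \<subseteq> H" for K
    using that
  proof (induction K)
    case (Cons a K)
    then obtain n m where "set K \<subseteq> set (chain T G n)" "a \<in> set (chain T G m)" by (auto simp: H_def)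
    then have "set (a # K) \<subseteq> set (chain T G (max n m))"
      using mono[of n "max n m"] mono[of m "max n m"] by auto
    then show ?case by blast
  qed simp
  have conH: "\<not> deriv T K Bot" if "set K \<subseteq> H" for K
    using fin[OF that] con deriv_weaken by blast
  have stage: "extend T (chain T G (to_nat f)) f = chain T G (Suc (to_nat f))" for f
    by simp
  have dec: "f \<in> H \<or> Neg f \<in> H" for f
  proof -
    have "f \<in> set (extend T (chain T G (to_nat f)) f) \<or> Neg f \<in> set (extend T (chain T G (to_nat f)) f)"
      by (cases f) (auto simp: extend_def)
    then show ?thesis unfolding stage H_def by blast
  qed
  have ded: "p \<in> H" if "set K \<subseteq> H" "deriv T K p" for K p
  proof (rule ccontr)
    assume "p \<notin> H"
    then have "set (Neg p # K) \<subseteq> H" using dec that by auto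
    from conH[OF this] have "\<not> deriv T (Neg p # K) Bot" .
    moreover have "deriv T (Neg p # K) Bot"
      by (rule deriv.ImpE[OF deriv.Assm[of "Neg p"] deriv_weaken[OF that(2)]]) auto
    ultimately show False by simp
  qed
  \<comment> \<open>A formula that ever enters \<open>H\<close> is consistent with the stage that
    treats it, so its witness was added at that stage.\<close>
  have ok: "\<not> deriv T (f # chain T G (to_nat f)) Bot" if "f \<in> H" for f
  proof -
    from that obtain n where "f \<in> set (chain T G n)" by (auto simp: H_def)
    then have "set (f # chain T G (to_nat f)) \<subseteq> set (chain T G (max n (to_nat f)))"
      using mono[of n "max n (to_nat f)"] mono[of "to_nat f" "max n (to_nat f)"] by auto
    then show ?thesis using con deriv_weaken by blast
  qed
  have ex: "\<exists>t. inst p t \<in> H" if "Ex p \<in> H" for p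
  proof -
    have "\<exists>t. inst p t \<in> set (extend T (chain T G (to_nat (Ex p))) (Ex p))"
      using ok[OF that] by (auto simp: extend_def)
    then show ?thesis unfolding stage H_def by blast
  qed
  have sex: "\<exists>t. sinst p t \<in> H" if "SEx p \<in> H" for p
  proof -
    have "\<exists>t. sinst p t \<in> set (extend T (chain T G (to_nat (SEx p))) (SEx p))"
      using ok[OF that] by (auto simp: extend_def)
    then show ?thesis unfolding stage H_def by blast
  qed
  have "Bot \<notin> H" using conH[of "[Bot]"] deriv.Assm[of Bot "[Bot]" T] by auto
  moreover have "set G \<subseteq> H" unfolding H_def by (rule subset_trans[OF _ UN_upper[of 0]]) auto
  ultimately show ?thesis using ded dec ex sex unfolding henkin_def by blast
qed

section \<open>Henkin theories obey the truth conditions\<close>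

context
  fixes T H assumes hen: "henkin T H"
begin

lemma henkin_ded: "set G \<subseteq> H \<Longrightarrow> deriv T G p \<Longrightarrow> p \<in> H"
  using hen unfolding henkin_def by blast

lemma henkin_Bot: "Bot \<notin> H"
  using hen unfolding henkin_def by blast

lemma henkin_axiom: "p \<in> T \<Longrightarrow> p \<in> H"
  using henkin_ded[of "[]"] by (auto intro: deriv.Axiom)

lemma henkin_Imp: "Imp p q \<in> H \<longleftrightarrow> (p \<in> H \<longrightarrow> q \<in> H)"
proof
  assume i: "Imp p q \<in> H"
  show "p \<in> H \<longrightarrow> q \<in> H"
  proof
    assume "p \<in> H"
    then show "q \<in> H" using i
      by (intro henkin_ded[of "[Imp p q, p]"] deriv.ImpE[OF deriv.Assm[of "Imp p q"] deriv.Assm]) auto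
  qed
next
  assume a: "p \<in> H \<longrightarrow> q \<in> H"
  show "Imp p q \<in> H"
  proof (cases "p \<in> H")
    case True
    then show ?thesis using a by (intro henkin_ded[of "[q]"] deriv.ImpI deriv.Assm) auto
  next
    case False
    then have "Neg p \<in> H" using hen unfolding henkin_def by blast
    moreover have "deriv T [Neg p] (Imp p q)"
      by (intro deriv.ImpI deriv.Classical[of _ q]
          deriv.ImpE[OF deriv.Assm[of "Neg p"] deriv.Assm[of p]]) auto
    ultimately show ?thesis by (intro henkin_ded[of "[Neg p]"]) auto
  qed
qed

lemma henkin_And: "And p q \<in> H \<longleftrightarrow> p \<in> H \<and> q \<in> H"
proof
  assume "And p q \<in> H"
  then show "p \<in> H \<and> q \<in> H"
    by (intro conjI henkin_ded[of "[And p q]"] deriv.AndE1[OF deriv.Assm] deriv.AndE2[OF deriv.Assm]) auto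
next
  assume "p \<in> H \<and> q \<in> H"
  then show "And p q \<in> H"
    by (intro henkin_ded[OF _ deriv.AndI[OF deriv.Assm[of p "[p, q]"] deriv.Assm[of q "[p, q]"]]]) auto
qed

lemma henkin_Or: "Or p q \<in> H \<longleftrightarrow> p \<in> H \<or> q \<in> H"
proof
  assume o: "Or p q \<in> H"
  show "p \<in> H \<or> q \<in> H"
  proof (rule ccontr)
    assume "\<not> (p \<in> H \<or> q \<in> H)"
    then have n: "Neg p \<in> H" "Neg q \<in> H" using hen unfolding henkin_def by blast+
    let ?G = "[Or p q, Neg p, Neg q]"
    have "deriv T (p # ?G) Bot"
      by (rule deriv.ImpE[OF deriv.Assm[of "Neg p"] deriv.Assm[of p]]) auto
    moreover have "deriv T (q # ?G) Bot"
      by (rule deriv.ImpE[OF deriv.Assm[of "Neg q"] deriv.Assm[of q]]) auto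
    ultimately have "deriv T ?G Bot" using deriv.OrE[OF deriv.Assm[of "Or p q" ?G]] by simp
    then have "Bot \<in> H" using o n by (intro henkin_ded[of ?G]) auto
    then show False using henkin_Bot by simp
  qed
next
  assume "p \<in> H \<or> q \<in> H"
  then show "Or p q \<in> H"
  proof
    assume "p \<in> H"
    then show ?thesis by (intro henkin_ded[OF _ deriv.OrI1[OF deriv.Assm[of p "[p]"]]]) auto
  next
    assume "q \<in> H"
    then show ?thesis by (intro henkin_ded[OF _ deriv.OrI2[OF deriv.Assm[of q "[q]"]]]) auto
  qed
qed

lemma henkin_Ex: "Ex p \<in> H \<longleftrightarrow> (\<exists>t. inst p t \<in> H)"
proof
  assume "\<exists>t. inst p t \<in> H"
  then obtain t where "inst p t \<in> H" ..
  then show "Ex p \<in> H" by (intro henkin_ded[of "[inst p t]"] deriv.ExI[of _ _ _ t] deriv.Assm) auto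
next
  assume "Ex p \<in> H" then show "\<exists>t. inst p t \<in> H" using hen unfolding henkin_def by blast
qed

lemma henkin_SEx: "SEx p \<in> H \<longleftrightarrow> (\<exists>t. sinst p t \<in> H)"
proof
  assume "\<exists>t. sinst p t \<in> H"
  then obtain t where "sinst p t \<in> H" ..
  then show "SEx p \<in> H" by (intro henkin_ded[OF _ deriv.SExI[OF deriv.Assm[of "sinst p t" "[sinst p t]"]]]) auto
next
  assume "SEx p \<in> H" then show "\<exists>t. sinst p t \<in> H" using hen unfolding henkin_def by blast
qed

lemma henkin_Neg: "Neg p \<in> H \<longleftrightarrow> p \<notin> H"
  using henkin_Imp henkin_Bot by blast

lemma inst_shift_self:
  "inst (subst p (nlift (\<lambda>n. NVar (Suc n))) (\<lambda>n. n)) (NVar 0) = p"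
proof -
  have "case_nat (NVar 0) (\<lambda>n. NVar (Suc n)) n = NVar n" for n by (cases n) auto
  then have "case_nat (NVar 0) (\<lambda>n. NVar (Suc n)) = NVar" ..
  then show ?thesis by (simp only: inst_up subst_id)
qed

lemma sinst_shift_self: "sinst (subst p NVar (slift Suc)) 0 = p"
proof -
  have "case_nat 0 Suc n = n" for n by (cases n) auto
  then have "case_nat 0 Suc = (\<lambda>n. n)" ..
  then show ?thesis by (simp only: sinst_sup subst_id)
qed

text \<open>\<open>Neg (Ex (Neg p))\<close> proves \<open>All p\<close>. Hence, if
  \<open>All p\<close> is absent, \<open>Ex (Neg p)\<close> is present and supplies a
  counterexample.\<close>

lemma henkin_All: "All p \<in> H \<longleftrightarrow> (\<forall>t. inst p t \<in> H)"
proof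
  assume "All p \<in> H"
  then show "\<forall>t. inst p t \<in> H" by (intro allI henkin_ded[OF _ deriv.AllE[OF deriv.Assm[of "All p" "[All p]"]]]) auto
next
  assume a: "\<forall>t. inst p t \<in> H"
  have "deriv T [Neg (Ex (Neg p))] (All p)"
  proof (rule deriv.AllI, rule deriv.Classical)
    let ?G = "Neg p # map shift [Neg (Ex (Neg p))]"
    have "deriv T ?G (shift (Ex (Neg p)))" unfolding shift_def subst.simps(9)
      by (rule deriv.ExI[of _ _ _ "NVar 0"]) (simp only: inst_shift_self, auto intro: deriv.Assm)
    moreover have "deriv T ?G (Neg (shift (Ex (Neg p))))" by (rule deriv.Assm) (simp add: shift_def)
    ultimately show "deriv T ?G Bot" by (rule deriv.ImpE[rotated])
  qed
  then have "Neg (Ex (Neg p)) \<in> H \<Longrightarrow> All p \<in> H" by (intro henkin_ded[of "[Neg (Ex (Neg p))]"]) auto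
  moreover have "inst (Neg p) t = Neg (inst p t)" for t by (simp add: inst_def)
  ultimately show "All p \<in> H" using a henkin_Neg henkin_Ex by metis
qed

lemma henkin_SAll: "SAll p \<in> H \<longleftrightarrow> (\<forall>t. sinst p t \<in> H)"
proof
  assume "SAll p \<in> H"
  then show "\<forall>t. sinst p t \<in> H" by (intro allI henkin_ded[OF _ deriv.SAllE[OF deriv.Assm[of "SAll p" "[SAll p]"]]]) auto
next
  assume a: "\<forall>t. sinst p t \<in> H"
  have "deriv T [Neg (SEx (Neg p))] (SAll p)"
  proof (rule deriv.SAllI, rule deriv.Classical)
    let ?G = "Neg p # map sshift [Neg (SEx (Neg p))]"
    have "deriv T ?G (sshift (SEx (Neg p)))" unfolding sshift_def subst.simps(11)
      by (rule deriv.SExI[of _ _ _ 0]) (simp only: sinst_shift_self, auto intro: deriv.Assm)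
    moreover have "deriv T ?G (Neg (sshift (SEx (Neg p))))" by (rule deriv.Assm) (simp add: sshift_def)
    ultimately show "deriv T ?G Bot" by (rule deriv.ImpE[rotated])
  qed
  then have "Neg (SEx (Neg p)) \<in> H \<Longrightarrow> SAll p \<in> H" by (intro henkin_ded[of "[Neg (SEx (Neg p))]"]) auto
  moreover have "sinst (Neg p) t = Neg (sinst p t)" for t by (simp add: sinst_def)
  ultimately show "SAll p \<in> H" using a henkin_Neg henkin_SEx by metis
qed

text \<open>The congruence properties below are instances for formulas \<open>p\<close> with
  variable 0 at the place of the replacement.\<close>

lemma henkin_EqSubst: "Eq s t \<in> H \<Longrightarrow> inst p s \<in> H \<Longrightarrow> inst p t \<in> H"
  by (intro henkin_ded[of "[Eq s t, inst p s]"]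
      deriv.EqSubst[OF deriv.Assm[of "Eq s t"] deriv.Assm[of "inst p s"]]) auto

lemma henkin_EqRefl: "Eq t t \<in> H"
  by (intro henkin_ded[of "[]"] deriv.EqRefl) auto

lemma inst_tm [simp]: "subst_tm (shift_tm s) (case_nat t NVar) = s"
  by (simp add: subst_tm_shift)

lemma henkin_EqSym: "Eq s t \<in> H \<Longrightarrow> Eq t s \<in> H"
  using henkin_EqSubst[of s t "Eq (NVar 0) (shift_tm s)"] henkin_EqRefl by (simp add: inst_def)

lemma henkin_EqTrans: "Eq s t \<in> H \<Longrightarrow> Eq t u \<in> H \<Longrightarrow> Eq s u \<in> H"
  using henkin_EqSubst[of t u "Eq (shift_tm s) (NVar 0)"] by (simp add: inst_def)

lemma henkin_equivp: "equivp (\<lambda>s t. Eq s t \<in> H)"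
  by (intro equivpI reflpI sympI transpI)
    (rule henkin_EqRefl, erule henkin_EqSym, erule (1) henkin_EqTrans)

lemma henkin_Plus:
  assumes "Eq s s' \<in> H" "Eq t t' \<in> H" shows "Eq (Plus s t) (Plus s' t') \<in> H"
proof -
  have "Eq (Plus s t) (Plus s' t) \<in> H"
    using henkin_EqSubst[OF assms(1), of "Eq (shift_tm (Plus s t)) (Plus (NVar 0) (shift_tm t))"] henkin_EqRefl
    by (simp add: inst_def)
  then show ?thesis
    using henkin_EqSubst[OF assms(2), of "Eq (shift_tm (Plus s t)) (Plus (shift_tm s') (NVar 0))"]
    by (simp add: inst_def)
qed

lemma henkin_Times:
  assumes "Eq s s' \<in> H" "Eq t t' \<in> H" shows "Eq (Times s t) (Times s' t') \<in> H"
proof -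
  have "Eq (Times s t) (Times s' t) \<in> H"
    using henkin_EqSubst[OF assms(1), of "Eq (shift_tm (Times s t)) (Times (NVar 0) (shift_tm t))"] henkin_EqRefl
    by (simp add: inst_def)
  then show ?thesis
    using henkin_EqSubst[OF assms(2), of "Eq (shift_tm (Times s t)) (Times (shift_tm s') (NVar 0))"]
    by (simp add: inst_def)
qed

lemma henkin_Less:
  assumes "Eq s s' \<in> H" "Eq t t' \<in> H" "Less s t \<in> H" shows "Less s' t' \<in> H"
proof -
  have "Less s' t \<in> H"
    using henkin_EqSubst[OF assms(1), of "Less (NVar 0) (shift_tm t)"] assms(3) by (simp add: inst_def)
  then show ?thesis
    using henkin_EqSubst[OF assms(2), of "Less (shift_tm s') (NVar 0)"] by (simp add: inst_def)
qed

lemma henkin_Mem: "Eq s s' \<in> H \<Longrightarrow> Mem s X \<in> H \<Longrightarrow> Mem s' X \<in> H"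
  using henkin_EqSubst[of s s' "Mem (NVar 0) X"] by (simp add: inst_def)

text \<open>The carrier is kept abstract, as the image of a surjection \<open>c\<close> that
  identifies provably equal terms, because the quotient type is introduced only after a particular
  \<open>H\<close> has been fixed.\<close>

theorem henkin_truth:
  fixes M :: "'a struc" and c :: "tm \<Rightarrow> 'a" and S :: "nat \<Rightarrow> 'a set"
  assumes surj: "surj c" and eq: "\<And>s t. c s = c t \<longleftrightarrow> Eq s t \<in> H"
    and less: "\<And>s t. ls M (c s) (c t) \<longleftrightarrow> Less s t \<in> H"
    and ops: "zr M = c Zero" "on M = c One"
      "\<And>s t. pl M (c s) (c t) = c (Plus s t)" "\<And>s t. ti M (c s) (c t) = c (Times s t)"
    and sets: "sets M = range S" and mem: "\<And>t X. c t \<in> S X \<longleftrightarrow> Mem t X \<in> H"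
  shows "sat M p (\<lambda>n. c (\<sigma> n)) (\<lambda>n. S (\<rho> n)) \<longleftrightarrow> subst p \<sigma> \<rho> \<in> H"
proof -
  have ev: "evt M t (\<lambda>n. c (\<sigma> n)) = c (subst_tm t \<sigma>)" for t \<sigma>
    by (induction t) (simp_all add: ops)
  have cn: "case_nat (c t) (\<lambda>n. c (\<sigma> n)) = (\<lambda>n. c (case_nat t \<sigma> n))" for t \<sigma>
    by (rule ext) (auto split: nat.split)
  have sn: "case_nat (S t) (\<lambda>n. S (\<rho> n)) = (\<lambda>n. S (case_nat t \<rho> n))" for t \<rho>
    by (rule ext) (auto split: nat.split)
  have all: "(\<forall>a. P a) \<longleftrightarrow> (\<forall>t. P (c t))" for P
    using surj by (metis surjD)
  have ex: "(\<exists>a. P a) \<longleftrightarrow> (\<exists>t. P (c t))" for P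
    using surj by (metis surjD)
  show ?thesis
  proof (induction p arbitrary: \<sigma> \<rho>)
    case (All p)
    show ?case by (simp add: all[of "\<lambda>a. sat M p (case_nat a _) _"] cn All.IH henkin_All inst_up)
  next
    case (Ex p)
    show ?case by (simp add: ex[of "\<lambda>a. sat M p (case_nat a _) _"] cn Ex.IH henkin_Ex inst_up)
  next
    case (SAll p)
    show ?case by (simp add: sets sn SAll.IH henkin_SAll sinst_sup)
  next
    case (SEx p)
    show ?case by (simp add: sets sn SEx.IH henkin_SEx sinst_sup)
  qed (simp_all add: ev eq less mem henkin_Bot henkin_Imp henkin_And henkin_Or)
qed

end

section \<open>Basic arithmetic in models of \<open>RCA\<^sub>0\<close>\<close>

text \<open>Truncated subtraction: the class \<open>linordered_semidom\<close> has such an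
  operation, the object language has none.\<close>

definition diff_of :: "'a struc \<Rightarrow> 'a \<Rightarrow> 'a \<Rightarrow> 'a" where
  "diff_of M x y = (if \<exists>z. pl M y z = x then THE z. pl M y z = x else zr M)"

text \<open>Stated for arbitrary structures and not for a type class, since these lemmas are to
  establish the class axioms of the term model.\<close>

locale arith =
  fixes M :: "'a struc"
  assumes basic: "p \<in> basic_axioms \<Longrightarrow> valid M p"
    and ind1: "p \<in> Sigma01_IND \<Longrightarrow> valid M p"
    and ne: "sets M \<noteq> {}"
begin

abbreviation add (infixl "\<oplus>" 65) where "x \<oplus> y \<equiv> pl M x y"
abbreviation mul (infixl "\<otimes>" 70) where "x \<otimes> y \<equiv> ti M x y"
abbreviation lt (infix "\<prec>" 50) where "x \<prec> y \<equiv> ls M x y"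
abbreviation nil ("\<zero>") where "\<zero> \<equiv> zr M"
abbreviation unit ("\<one>") where "\<one> \<equiv> on M"

definition E0 :: "nat \<Rightarrow> 'a set" where "E0 n = (SOME S. S \<in> sets M)"

lemma E0: "E0 n \<in> sets M"
  unfolding E0_def using ne by (simp add: some_in_eq)

lemma ax:
  shows "n \<oplus> \<one> \<noteq> \<zero>" "m \<oplus> \<one> = n \<oplus> \<one> \<Longrightarrow> m = n" "m \<oplus> \<zero> = m"
    "m \<oplus> (n \<oplus> \<one>) = (m \<oplus> n) \<oplus> \<one>" "m \<otimes> \<zero> = \<zero>" "m \<otimes> (n \<oplus> \<one>) = m \<otimes> n \<oplus> m"
    "\<not> m \<prec> \<zero>" "m \<prec> n \<oplus> \<one> \<longleftrightarrow> m \<prec> n \<or> m = n"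
proof -
  have "sat M p (case_nat m (\<lambda>_. n)) E0" if "p \<in> basic_axioms" for p
    using basic[OF that] E0 unfolding valid_def by blast
  note * = this[unfolded basic_axioms_def Let_def]
  show "n \<oplus> \<one> \<noteq> \<zero>" using *[of "Neg (Eq (Plus (NVar 1) One) Zero)"] by simp
  show "m \<oplus> \<one> = n \<oplus> \<one> \<Longrightarrow> m = n"
    using *[of "Imp (Eq (Plus (NVar 0) One) (Plus (NVar 1) One)) (Eq (NVar 0) (NVar 1))"] by simp
  show "m \<oplus> \<zero> = m" using *[of "Eq (Plus (NVar 0) Zero) (NVar 0)"] by simp
  show "m \<oplus> (n \<oplus> \<one>) = (m \<oplus> n) \<oplus> \<one>"
    using *[of "Eq (Plus (NVar 0) (Plus (NVar 1) One)) (Plus (Plus (NVar 0) (NVar 1)) One)"] by simp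
  show "m \<otimes> \<zero> = \<zero>" using *[of "Eq (Times (NVar 0) Zero) Zero"] by simp
  show "m \<otimes> (n \<oplus> \<one>) = m \<otimes> n \<oplus> m"
    using *[of "Eq (Times (NVar 0) (Plus (NVar 1) One)) (Plus (Times (NVar 0) (NVar 1)) (NVar 0))"] by simp
  show "\<not> m \<prec> \<zero>" using *[of "Neg (Less (NVar 0) Zero)"] by simp
  show "m \<prec> n \<oplus> \<one> \<longleftrightarrow> m \<prec> n \<or> m = n"
    using *[of "Iff (Less (NVar 0) (Plus (NVar 1) One)) (Or (Less (NVar 0) (NVar 1)) (Eq (NVar 0) (NVar 1)))"]
    by simp blast
qed

lemma case_nat_succ:
  "(\<lambda>n. evt M (case n of 0 \<Rightarrow> Plus (NVar 0) One | Suc n \<Rightarrow> NVar (Suc n)) (case_nat x e)) = case_nat (x \<oplus> \<one>) e"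
  by (rule ext) (auto split: nat.split)

lemma sat_induction_axiom:
  "sat M (induction_axiom p) e E \<longleftrightarrow>
    (sat M p (case_nat \<zero> e) E \<longrightarrow> (\<forall>x. sat M p (case_nat x e) E \<longrightarrow> sat M p (case_nat (x \<oplus> \<one>) e) E) \<longrightarrow>
     (\<forall>x. sat M p (case_nat x e) E))"
  unfolding induction_axiom_def by (simp add: sat_inst sat_subst case_nat_succ) blast

lemma ind_sig:
  assumes "p \<in> Delta00" and E: "\<And>n. E n \<in> sets M"
    and "\<exists>y. sat M p (case_nat y (case_nat \<zero> e)) E"
    and "\<And>x. \<exists>y. sat M p (case_nat y (case_nat x e)) E \<Longrightarrow>
       \<exists>y. sat M p (case_nat y (case_nat (x \<oplus> \<one>) e)) E"
  shows "\<exists>y. sat M p (case_nat y (case_nat x e)) E"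
proof -
  have "induction_axiom (Ex p) \<in> Sigma01_IND"
    using assms(1) by (auto simp: Sigma01_IND_def Sigma01_def)
  then have "sat M (induction_axiom (Ex p)) e E" using ind1 E unfolding valid_def by blast
  then show ?thesis using assms(3,4) unfolding sat_induction_axiom by simp
qed

text \<open>Induction is available for formulas of the form \<open>Ex p\<close>. An equation is put
  under a dummy quantifier, and \<open>nv\<close> says that both sides are independent of its
  variable.\<close>

lemma ind_eq:
  fixes s t :: tm and e :: "nat \<Rightarrow> 'a"
  defines "P \<equiv> \<lambda>x. evt M s (case_nat \<zero> (case_nat x e)) = evt M t (case_nat \<zero> (case_nat x e))"
  assumes nv: "\<And>y y' x. evt M s (case_nat y (case_nat x e)) = evt M s (case_nat y' (case_nat x e))"
    "\<And>y y' x. evt M t (case_nat y (case_nat x e)) = evt M t (case_nat y' (case_nat x e))"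
    and "P \<zero>" "\<And>x. P x \<Longrightarrow> P (x \<oplus> \<one>)"
  shows "P x"
proof -
  have "(\<exists>y. sat M (Eq s t) (case_nat y (case_nat x e)) E0) \<longleftrightarrow> P x" for x
    unfolding P_def sat.simps using nv by metis
  with ind_sig[of "Eq s t" E0 e x] show ?thesis using assms(4,5) E0 by (auto intro: Delta00.intros)
qed

text \<open>Layout of the variables in the following inductions: 0 belongs to the existential
  quantifier, 1 is the induction variable, 2 and 3 hold the parameters \<open>a\<close> and
  \<open>b\<close>.\<close>

abbreviation ev2 :: "'a \<Rightarrow> 'a \<Rightarrow> nat \<Rightarrow> 'a" where "ev2 a b \<equiv> case_nat a (case_nat b (\<lambda>_. \<zero>))"

abbreviation (input) vx where "vx \<equiv> NVar 1"
abbreviation (input) va where "va \<equiv> NVar 2"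
abbreviation (input) vb where "vb \<equiv> NVar 3"

section \<open>Laws of an ordered semiring by induction\<close>

lemma zero_add: "\<zero> \<oplus> x = x"
  using ind_eq[where s="Plus Zero vx" and t=vx and e="ev2 \<zero> \<zero>" and x=x] by (simp add: ax)

lemma succ_add: "(a \<oplus> \<one>) \<oplus> x = (a \<oplus> x) \<oplus> \<one>"
  using ind_eq[where s="Plus (Plus va One) vx" and t="Plus (Plus va vx) One" and e="ev2 a \<zero>" and x=x]
  by (simp add: ax numeral_2_eq_2)

lemma add_comm: "a \<oplus> x = x \<oplus> a"
proof -
  have "a \<oplus> (x \<oplus> \<one>) = (x \<oplus> \<one>) \<oplus> a" if "a \<oplus> x = x \<oplus> a" for x
    using that by (simp only: ax(4) succ_add)
  then show ?thesis
    using ind_eq[where s="Plus va vx" and t="Plus vx va" and e="ev2 a \<zero>" and x=x]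
    by (simp add: ax(3) numeral_2_eq_2 zero_add)
qed

lemma add_assoc: "(a \<oplus> b) \<oplus> x = a \<oplus> (b \<oplus> x)"
  using ind_eq[where s="Plus (Plus va vb) vx" and t="Plus va (Plus vb vx)" and e="ev2 a b" and x=x]
  by (simp add: ax numeral_2_eq_2 numeral_3_eq_3)

lemma zero_mul: "\<zero> \<otimes> x = \<zero>"
  using ind_eq[where s="Times Zero vx" and t=Zero and e="ev2 \<zero> \<zero>" and x=x] by (simp add: ax)

lemma add_lcomm: "a \<oplus> (b \<oplus> c) = b \<oplus> (a \<oplus> c)"
  by (metis add_assoc add_comm)

lemma succ_mul: "(a \<oplus> \<one>) \<otimes> x = a \<otimes> x \<oplus> x"
  using ind_eq[where s="Times (Plus va One) vx" and t="Plus (Times va vx) vx" and e="ev2 a \<zero>" and x=x]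
  by (simp add: ax(3,5,6) numeral_2_eq_2) (simp add: add_assoc add_comm add_lcomm)

lemma mul_comm: "a \<otimes> x = x \<otimes> a"
  using ind_eq[where s="Times va vx" and t="Times vx va" and e="ev2 a \<zero>" and x=x]
  by (simp add: ax(3,5,6) numeral_2_eq_2 zero_mul succ_mul)

lemma distrib: "(a \<oplus> b) \<otimes> x = a \<otimes> x \<oplus> b \<otimes> x"
  using ind_eq[where s="Times (Plus va vb) vx" and t="Plus (Times va vx) (Times vb vx)" and e="ev2 a b" and x=x]
  by (simp add: ax(3,5,6) numeral_2_eq_2 numeral_3_eq_3) (simp add: add_assoc add_comm add_lcomm)

lemma mul_assoc: "(a \<otimes> b) \<otimes> x = a \<otimes> (b \<otimes> x)"
  using ind_eq[where s="Times (Times va vb) vx" and t="Times va (Times vb vx)" and e="ev2 a b" and x=x]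
  by (simp add: ax(3,5,6) numeral_2_eq_2 numeral_3_eq_3 mul_comm[of a] distrib)

lemma one_mul: "\<one> \<otimes> x = x"
  by (metis ax(3,5,6) zero_add mul_comm)

lemma add_cancel: "a \<oplus> x = b \<oplus> x \<Longrightarrow> a = b"
proof -
  have "\<exists>y. sat M (Imp (Eq (Plus va vx) (Plus vb vx)) (Eq va vb)) (case_nat y (case_nat x (ev2 a b))) E0"
    by (rule ind_sig) (auto intro: Delta00.intros E0 simp: numeral_2_eq_2 numeral_3_eq_3 ax)
  then show "a \<oplus> x = b \<oplus> x \<Longrightarrow> a = b" by (simp add: numeral_2_eq_2 numeral_3_eq_3)
qed

lemma add_lcancel: "x \<oplus> a = x \<oplus> b \<longleftrightarrow> a = b"
  using add_cancel add_comm by metis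

text \<open>The existential variable is now a genuine witness, the difference \<open>y\<close>,
  updated at each step of the induction.\<close>

lemma lt_imp: "a \<prec> x \<Longrightarrow> \<exists>y. a \<oplus> (y \<oplus> \<one>) = x"
proof -
  have "\<exists>y. sat M (Imp (Less va vx) (Eq (Plus va (Plus (NVar 0) One)) vx)) (case_nat y (case_nat x (ev2 a \<zero>))) E0"
  proof (rule ind_sig)
    fix x assume "\<exists>y. sat M (Imp (Less va vx) (Eq (Plus va (Plus (NVar 0) One)) vx)) (case_nat y (case_nat x (ev2 a \<zero>))) E0"
    then obtain y where y: "a \<prec> x \<Longrightarrow> a \<oplus> (y \<oplus> \<one>) = x" by (auto simp: numeral_2_eq_2)
    have "\<exists>y. a \<prec> x \<oplus> \<one> \<longrightarrow> a \<oplus> (y \<oplus> \<one>) = x \<oplus> \<one>"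
    proof (cases "a = x")
      case True
      then show ?thesis by (intro exI[of _ \<zero>]) (simp add: zero_add)
    next
      case False
      then show ?thesis using y by (intro exI[of _ "y \<oplus> \<one>"]) (auto simp: ax(4,8))
    qed
    then show "\<exists>y. sat M (Imp (Less va vx) (Eq (Plus va (Plus (NVar 0) One)) vx)) (case_nat y (case_nat (x \<oplus> \<one>) (ev2 a \<zero>))) E0"
      by (simp add: numeral_2_eq_2)
  qed (auto intro: Delta00.intros E0 simp: numeral_2_eq_2 ax)
  then show "a \<prec> x \<Longrightarrow> \<exists>y. a \<oplus> (y \<oplus> \<one>) = x" by (auto simp add: numeral_2_eq_2)
qed

lemma lt_add: "a \<prec> a \<oplus> (x \<oplus> \<one>)"
proof -
  have "\<exists>y. sat M (Less va (Plus va (Plus vx One))) (case_nat y (case_nat x (ev2 a \<zero>))) E0"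
    by (rule ind_sig) (auto intro: Delta00.intros E0 simp: numeral_2_eq_2 ax)
  then show ?thesis by (auto simp add: numeral_2_eq_2)
qed

lemma lt_iff: "a \<prec> b \<longleftrightarrow> (\<exists>y. a \<oplus> (y \<oplus> \<one>) = b)"
  using lt_imp lt_add by blast

lemma zero_or_succ: "x = \<zero> \<or> (\<exists>y. x = y \<oplus> \<one>)"
proof -
  have "\<exists>y. sat M (Or (Eq vx Zero) (Eq vx (Plus (NVar 0) One))) (case_nat y (case_nat x (ev2 \<zero> \<zero>))) E0"
    by (rule ind_sig) (auto intro: Delta00.intros E0 simp: ax)
  then show ?thesis by auto
qed

lemma le_iff: "a \<prec> b \<or> a = b \<longleftrightarrow> (\<exists>y. a \<oplus> y = b)"
  unfolding lt_iff by (metis ax(3) zero_or_succ)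

lemma lt_irrefl: "\<not> a \<prec> a"
proof
  assume "a \<prec> a"
  then obtain y where "a \<oplus> (y \<oplus> \<one>) = a \<oplus> \<zero>" by (auto simp: lt_iff ax(3))
  then show False by (simp only: add_lcancel ax(1))
qed

lemma le_linear: "(\<exists>y. a \<oplus> y = x) \<or> (\<exists>y. x \<oplus> y = a)"
proof -
  have "\<exists>y. sat M (Or (Eq (Plus va (NVar 0)) vx) (Eq (Plus vx (NVar 0)) va)) (case_nat y (case_nat x (ev2 a \<zero>))) E0"
  proof (rule ind_sig)
    fix x assume "\<exists>y. sat M (Or (Eq (Plus va (NVar 0)) vx) (Eq (Plus vx (NVar 0)) va)) (case_nat y (case_nat x (ev2 a \<zero>))) E0"
    then have "\<exists>y. a \<oplus> y = x \<or> x \<oplus> y = a" by (simp add: numeral_2_eq_2)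
    then have "\<exists>y. a \<oplus> y = x \<oplus> \<one> \<or> (x \<oplus> \<one>) \<oplus> y = a"
      by (metis ax(3,4) succ_add zero_or_succ)
    then show "\<exists>y. sat M (Or (Eq (Plus va (NVar 0)) vx) (Eq (Plus vx (NVar 0)) va)) (case_nat y (case_nat (x \<oplus> \<one>) (ev2 a \<zero>))) E0"
      by (simp add: numeral_2_eq_2)
  qed (auto intro: Delta00.intros E0 simp: numeral_2_eq_2 ax zero_add)
  then show ?thesis by (auto simp add: numeral_2_eq_2)
qed

lemma diff_add: "diff_of M (a \<oplus> b) a = b"
  unfolding diff_of_def by (auto simp: add_lcancel)

lemma add_eq_zero: "a \<oplus> b = \<zero> \<Longrightarrow> a = \<zero>"
  by (metis ax(1,3,4) zero_or_succ)

lemma diff_diff: "diff_of M (diff_of M a b) c = diff_of M a (b \<oplus> c)"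
proof (cases "\<exists>z. b \<oplus> z = a")
  case True
  then obtain z where z: "a = b \<oplus> z" by auto
  have "(\<exists>w. b \<oplus> c \<oplus> w = a) \<longleftrightarrow> (\<exists>w. c \<oplus> w = z)" "\<And>w. b \<oplus> c \<oplus> w = a \<longleftrightarrow> c \<oplus> w = z"
    unfolding z by (auto simp: add_assoc add_lcancel)
  then show ?thesis unfolding z diff_add unfolding diff_of_def z by simp
next
  case False
  then have "diff_of M a b = \<zero>" unfolding diff_of_def by simp
  moreover have "\<not> (\<exists>w. b \<oplus> c \<oplus> w = a)" using False by (metis add_assoc)
  then have "diff_of M a (b \<oplus> c) = \<zero>" unfolding diff_of_def by simp
  moreover have "diff_of M \<zero> c = \<zero>"
  proof (cases "\<exists>z. c \<oplus> z = \<zero>")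
    case True
    then obtain z where z: "c \<oplus> z = \<zero>" by blast
    then have "c = \<zero>" "z = \<zero>" using add_eq_zero add_comm by metis+
    then show ?thesis using diff_add[of c z] z by simp
  next
    case False
    then show ?thesis unfolding diff_of_def by simp
  qed
  ultimately show ?thesis by simp
qed

lemma mul_zero: "a \<otimes> b = \<zero> \<Longrightarrow> a = \<zero> \<or> b = \<zero>"
  by (metis add_comm add_eq_zero ax(6) zero_or_succ)

lemma lt_trans: "a \<prec> b \<Longrightarrow> b \<prec> c \<Longrightarrow> a \<prec> c"
  unfolding lt_iff by (metis add_assoc ax(4))

lemma mul_lt: "a \<prec> b \<Longrightarrow> \<zero> \<prec> c \<Longrightarrow> c \<otimes> a \<prec> c \<otimes> b"
proof -
  assume "a \<prec> b" "\<zero> \<prec> c"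
  then obtain y k where "b = a \<oplus> (y \<oplus> \<one>)" "c = k \<oplus> \<one>" by (auto simp: lt_iff zero_add)
  then have "c \<otimes> b = c \<otimes> a \<oplus> ((c \<otimes> y \<oplus> k) \<oplus> \<one>)"
    by (metis ax(4,6) distrib mul_comm)
  then show ?thesis unfolding lt_iff by metis
qed

lemma mul_diff: "c \<otimes> diff_of M a b = diff_of M (c \<otimes> a) (c \<otimes> b)"
proof (cases "\<exists>z. b \<oplus> z = a")
  case True
  then obtain z where z: "a = b \<oplus> z" by auto
  have "c \<otimes> a = c \<otimes> b \<oplus> c \<otimes> z" unfolding z by (metis distrib mul_comm)
  then show ?thesis unfolding z by (simp add: diff_add)
next
  case False
  then have d: "diff_of M a b = \<zero>" unfolding diff_of_def by simp
  have "a \<prec> b" using False le_linear[of a b] le_iff[of a b] le_iff[of b a] by metis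
  show ?thesis
  proof (cases "c = \<zero>")
    case True
    then show ?thesis by (simp add: zero_mul) (metis ax(3) diff_add)
  next
    case False
    then have "c \<otimes> a \<prec> c \<otimes> b" using mul_lt \<open>a \<prec> b\<close> by (metis le_iff zero_add)
    then have "\<not> (\<exists>z. c \<otimes> b \<oplus> z = c \<otimes> a)"
      by (metis le_iff lt_trans lt_irrefl)
    then show ?thesis unfolding d by (simp add: ax diff_of_def)
  qed
qed

lemma add_lt: "a \<prec> b \<Longrightarrow> c \<oplus> a \<prec> c \<oplus> b"
  unfolding lt_iff by (metis add_assoc)

lemma lt_linear: "a \<prec> b \<or> a = b \<or> b \<prec> a"
  using le_linear[of a b] le_iff by metis

lemma zero_lt_one: "\<zero> \<prec> \<one>"
  by (metis lt_add zero_add)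

end

section \<open>Meaning of the formulas\<close>

definition tstr :: "'a::{zero,one,plus,times,ord} set set \<Rightarrow> 'a struc" where
  "tstr SS = \<lparr>zr = 0, on = 1, pl = (+), ti = (*), ls = (<), sets = SS\<rparr>"

lemma tstr_sel [simp]:
  "zr (tstr SS) = 0" "on (tstr SS) = 1" "pl (tstr SS) = (+)" "ti (tstr SS) = (*)"
  "ls (tstr SS) = (<)" "sets (tstr SS) = SS"
  by (simp_all add: tstr_def)

primrec ev :: "tm \<Rightarrow> (nat \<Rightarrow> 'a) \<Rightarrow> 'a::{zero,one,plus,times}" where
  "ev (NVar n) e = e n"
| "ev Zero e = 0"
| "ev One e = 1"
| "ev (Plus s t) e = ev s e + ev t e"
| "ev (Times s t) e = ev s e * ev t e"

lemma evt_tstr [simp]: "evt (tstr SS) t e = ev t e"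
  by (induction t) auto

text \<open>The meanings of the formulas for sequences, powers, hierarchies and upgrades in a structure whose
  set variables range over \<open>SS\<close>: \<open>sentry\<close> for \<open>entry\<close>, \<open>spow\<close> for \<open>is_pow\<close>, and so on.\<close>

definition sentry :: "'a::linordered_semidom \<Rightarrow> 'a \<Rightarrow> 'a \<Rightarrow> 'a \<Rightarrow> bool" where
  "sentry a d i v \<longleftrightarrow> v < 1 + (i + 1) * d \<and> (\<exists>q. a = q * (1 + (i + 1) * d) + v)"

definition spow :: "'a::linordered_semidom \<Rightarrow> 'a \<Rightarrow> 'a \<Rightarrow> bool" where
  "spow b e v \<longleftrightarrow> (\<exists>a d. sentry a d 0 1 \<and>
     (\<forall>i. i < e \<longrightarrow> (\<exists>u. sentry a d i u \<and> sentry a d (i + 1) (u * b))) \<and> sentry a d e v)"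

definition sdecomp :: "'a::linordered_semidom \<Rightarrow> 'a \<Rightarrow> 'a \<Rightarrow> 'a \<Rightarrow> 'a \<Rightarrow> bool" where
  "sdecomp b n e a r \<longleftrightarrow> (\<exists>p p'. spow b e p \<and> spow b (e + 1) p' \<and>
     n = p * a + r \<and> p \<le> n \<and> n < p' \<and> 0 < a \<and> a < b \<and> r < p)"

definition smin :: "'a::linordered_semidom set \<Rightarrow> 'a \<Rightarrow> bool" where
  "smin B b \<longleftrightarrow> b \<in> B \<and> (\<forall>x. x \<in> B \<longrightarrow> b \<le> x)"

definition sbase :: "'a::linordered_semidom set \<Rightarrow> 'a \<Rightarrow> 'a \<Rightarrow> bool" where
  "sbase B n b \<longleftrightarrow> (\<exists>p. smin B p \<and>
     ((p \<le> n \<and> b \<in> B \<and> b \<le> n \<and> (\<forall>x. x \<in> B \<and> x \<le> n \<longrightarrow> x \<le> b)) \<or> (n < p \<and> b = p)))"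

definition sS :: "'a::linordered_semidom set \<Rightarrow> 'a \<Rightarrow> 'a \<Rightarrow> bool" where
  "sS B n s \<longleftrightarrow> s \<in> B \<and> n < s \<and> (\<forall>x. x \<in> B \<and> n < x \<longrightarrow> s \<le> x)"

definition slessS :: "'a::linordered_semidom \<Rightarrow> 'a set \<Rightarrow> 'a \<Rightarrow> bool" where
  "slessS x B n \<longleftrightarrow> (\<forall>s. sS B n s \<longrightarrow> x < s)"

definition shier :: "'a::linordered_semidom set \<Rightarrow> bool" where
  "shier B \<longleftrightarrow> (\<exists>x. x \<in> B) \<and> (\<forall>x. x \<in> B \<longrightarrow> x \<noteq> 0 \<and> x \<noteq> 1) \<and>
     (\<forall>b. b \<in> B \<longrightarrow> (\<forall>s. sS B b s \<longrightarrow> (\<exists>q. s = b * q)))"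

definition schange :: "'a::linordered_semidom \<Rightarrow> 'a \<Rightarrow> 'a \<Rightarrow> 'a \<Rightarrow> 'a \<Rightarrow> 'a \<Rightarrow> bool" where
  "schange a d b c n v \<longleftrightarrow> (\<exists>a' d'. (\<forall>m. m \<le> n \<longrightarrow>
      (m < b \<longrightarrow> (\<exists>u. sentry a d m u \<and> sentry a' d' m u)) \<and>
      (b \<le> m \<longrightarrow> (\<exists>e f r. sdecomp b m e f r \<and>
        (\<exists>x p y z. sentry a' d' e x \<and> spow c x p \<and> sentry a d f y \<and> sentry a' d' r z \<and>
          sentry a' d' m (p * y + z))))) \<and> sentry a' d' n v)"

definition sadm :: "'a::linordered_semidom set \<Rightarrow> 'a \<Rightarrow> 'a \<Rightarrow> 'a \<Rightarrow> 'a \<Rightarrow> 'a \<Rightarrow> 'a \<Rightarrow> bool" where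
  "sadm C a d b n c v \<longleftrightarrow> schange a d b c n v \<and>
     (\<exists>n' u. n' + 1 = n \<and> sentry a d n' u \<and> u < v) \<and> slessS v C c"

definition sclause :: "'a::linordered_semidom set \<Rightarrow> 'a set \<Rightarrow> 'a \<Rightarrow> 'a \<Rightarrow> 'a \<Rightarrow> bool" where
  "sclause B C a d n \<longleftrightarrow> (\<exists>p. smin B p \<and> (n < p \<longrightarrow> sentry a d n n) \<and>
     (p \<le> n \<longrightarrow> (\<exists>b c v. sbase B n b \<and> c \<in> C \<and> sadm C a d b n c v \<and>
        (\<forall>c'. c' \<in> C \<and> c' < c \<longrightarrow> \<not> (\<exists>v'. sadm C a d b n c' v')) \<and> sentry a d n v)))"

definition supg :: "'a::linordered_semidom set \<Rightarrow> 'a set \<Rightarrow> 'a \<Rightarrow> 'a \<Rightarrow> bool" where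
  "supg B C n v \<longleftrightarrow> (\<exists>a d. (\<forall>m. m \<le> n \<longrightarrow> sclause B C a d m) \<and> sentry a d n v)"

definition sgood :: "'a::linordered_semidom set \<Rightarrow> 'a set \<Rightarrow> bool" where
  "sgood B C \<longleftrightarrow> (\<exists>p q. smin B p \<and> smin C q \<and> p \<le> q) \<and> (\<forall>n. \<exists>v. supg B C n v) \<and>
     (\<forall>b. b \<in> B \<and> (\<exists>p. smin B p \<and> p < b) \<longrightarrow>
       (\<forall>n x c. n + 1 = b \<and> supg B C n x \<and> sbase C x c \<longrightarrow>
         \<not> (\<exists>y. (\<exists>q. y = c * q) \<and> x < y \<and> slessS y C x)))"

definition mb :: "'a::linordered_semidom set \<Rightarrow> 'a \<Rightarrow> 'a set" where
  "mb Y i = {x. (x + i) * (x + i) + x \<in> Y}"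

definition sdyn :: "'a::linordered_semidom set \<Rightarrow> bool" where
  "sdyn Y \<longleftrightarrow> (\<forall>i. shier (mb Y i) \<and> sgood (mb Y i) (mb Y (i + 1)))"

definition sgs :: "'a::linordered_semidom set \<Rightarrow> 'a \<Rightarrow> 'a \<Rightarrow> 'a \<Rightarrow> bool" where
  "sgs Y n i v \<longleftrightarrow> (\<exists>a d. sentry a d 0 n \<and>
     (\<forall>j. j < i \<longrightarrow> (\<exists>u w. sentry a d j u \<and> sentry a d (j + 1) w \<and>
       ((0 < u \<and> supg (mb Y j) (mb Y (j + 1)) u (w + 1)) \<or> (u = 0 \<and> w = 0)))) \<and> sentry a d i v)"

definition sterm :: "'a::linordered_semidom set set \<Rightarrow> 'a \<Rightarrow> bool" where
  "sterm SS k \<longleftrightarrow> (\<forall>Y\<in>SS. sdyn Y \<and>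
     (\<exists>p. smin (mb Y 0) p \<and> p \<le> k \<and> (\<forall>b. b \<in> mb Y 0 \<longrightarrow> (\<exists>s. sS (mb Y 0) b s \<and> s \<le> b * p))) \<longrightarrow>
     (\<forall>n. \<exists>i. sgs Y n i 0))"

locale hoas =
  fixes SS :: "'a::linordered_semidom set set" and e0 :: "nat \<Rightarrow> 'a" and E0 :: "nat \<Rightarrow> 'a set"
begin

text \<open>Below \<open>m\<close> number binders, the value of the variable of level \<open>i < m\<close> is \<open>w i\<close>.\<close>

definition env :: "nat \<Rightarrow> (nat \<Rightarrow> 'a) \<Rightarrow> nat \<Rightarrow> 'a" where
  "env m w n = (if n < m then w (m - Suc n) else e0 (n - m))"

definition senv :: "nat \<Rightarrow> (nat \<Rightarrow> 'a set) \<Rightarrow> nat \<Rightarrow> 'a set" where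
  "senv s W n = (if n < s then W (s - Suc n) else E0 (n - s))"

definition val :: "nat \<Rightarrow> (nat \<Rightarrow> 'a) \<Rightarrow> nterm \<Rightarrow> 'a" where
  "val m w x = ev (x m) (env m w)"

definition sval :: "nat \<Rightarrow> (nat \<Rightarrow> 'a set) \<Rightarrow> setv \<Rightarrow> 'a set" where
  "sval s W X = senv s W (X s)"

definition holds :: "form \<Rightarrow> nat \<Rightarrow> nat \<Rightarrow> (nat \<Rightarrow> 'a) \<Rightarrow> (nat \<Rightarrow> 'a set) \<Rightarrow> bool" where
  "holds P m s w W = sat (tstr SS) (P m s) (env m w) (senv s W)"

text \<open>An \<open>nterm\<close> may depend on the depth in any way. Stability at
  \<open>m\<close> says that from depth \<open>m\<close> on it reads only the levels below
  \<open>m\<close>; this allows its value to be carried under further binders.\<close>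

definition stab :: "nat \<Rightarrow> nterm \<Rightarrow> bool" where
  "stab m x \<longleftrightarrow> (\<forall>m'\<ge>m. \<forall>w w'. (\<forall>i<m. w' i = w i) \<longrightarrow> val m' w' x = val m w x)"

lemma env_upd: "case_nat a (env m w) = env (Suc m) (w(m := a))"
  by (rule ext) (auto simp: env_def split: nat.split)

lemma senv_upd: "case_nat a (senv m w) = senv (Suc m) (w(m := a))"
  by (rule ext) (auto simp: senv_def split: nat.split)

lemma val_simps [simp]:
  "val m w fzero = 0" "val m w fone = 1" "val m w (fplus x y) = val m w x + val m w y"
  "val m w (ftimes x y) = val m w x * val m w y"
  by (simp_all add: val_def fzero_def fone_def fplus_def ftimes_def)

lemma val_new [simp]: "val (Suc m) (w(m := a)) (\<lambda>k. NVar (k - Suc m)) = a"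
  by (simp add: val_def env_def)

lemma stabD: "stab m x \<Longrightarrow> m \<le> m' \<Longrightarrow> (\<And>i. i < m \<Longrightarrow> w' i = w i) \<Longrightarrow> val m' w' x = val m w x"
  by (auto simp: stab_def)

lemma val_old [simp]: "stab m x \<Longrightarrow> val (Suc m) (w(m := a)) x = val m w x"
  by (rule stabD) auto

lemma stab_consts [simp]: "stab m fzero" "stab m fone"
  by (simp_all add: stab_def)

lemma stab_ops [simp]:
  assumes s: "stab m x" "stab m y"
  shows "stab m (fplus x y)" "stab m (ftimes x y)"
  by (auto simp: stab_def intro!: arg_cong2[where f = "(+)"] arg_cong2[where f = "(*)"]
      stabD[OF s(1)] stabD[OF s(2)])

lemma stab_new [simp]: "stab (Suc m) (\<lambda>k. NVar (k - Suc m))"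
  by (auto simp: stab_def val_def env_def)

lemma stab_Suc [simp]: "stab m x \<Longrightarrow> stab (Suc m) x"
proof -
  assume x: "stab m x"
  show "stab (Suc m) x" unfolding stab_def
  proof (intro allI impI)
  fix m' and w w' :: "nat \<Rightarrow> 'a" assume "Suc m \<le> m'" "\<forall>i<Suc m. w' i = w i"
  then have "val m' w' x = val m w x" "val (Suc m) w x = val m w x" using x by (auto intro: stabD)
  then show "val m' w' x = val (Suc m) w x" by simp
  qed
qed

lemma holds_simps [simp]:
  "holds (feq x y) m s w W \<longleftrightarrow> val m w x = val m w y"
  "holds (fless x y) m s w W \<longleftrightarrow> val m w x < val m w y"
  "holds (fmem x X) m s w W \<longleftrightarrow> val m w x \<in> sval s W X"
  "holds (fnot P) m s w W \<longleftrightarrow> \<not> holds P m s w W"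
  "holds (fand P Q) m s w W \<longleftrightarrow> holds P m s w W \<and> holds Q m s w W"
  "holds (fdisj P Q) m s w W \<longleftrightarrow> holds P m s w W \<or> holds Q m s w W"
  "holds (fimp P Q) m s w W \<longleftrightarrow> (holds P m s w W \<longrightarrow> holds Q m s w W)"
  "holds (fall F) m s w W \<longleftrightarrow> (\<forall>a. holds (F (\<lambda>k. NVar (k - Suc m))) (Suc m) s (w(m := a)) W)"
  "holds (fex F) m s w W \<longleftrightarrow> (\<exists>a. holds (F (\<lambda>k. NVar (k - Suc m))) (Suc m) s (w(m := a)) W)"
  "holds (fall_set G) m s w W \<longleftrightarrow> (\<forall>S\<in>SS. holds (G (\<lambda>k. k - Suc s)) m (Suc s) w (W(s := S)))"
  by (simp_all add: holds_def feq_def fless_def fmem_def fnot_def fand_def fdisj_def fimp_def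
      fall_def fex_def fall_set_def env_upd senv_upd val_def sval_def)

lemma sval_new [simp]: "sval (Suc s) (W(s := S)) (\<lambda>k. k - Suc s) = S"
  by (simp add: sval_def senv_def)

lemma holds_member [simp]: "holds (member X i x) m s w W \<longleftrightarrow> val m w x \<in> mb (sval s W X) (val m w i)"
  by (simp add: member_def mb_def)

lemma holds_divides [simp]:
  "stab m x \<Longrightarrow> stab m y \<Longrightarrow> holds (divides x y) m s w W \<longleftrightarrow> (\<exists>q. val m w y = val m w x * q)"
  by (simp add: divides_def)

lemma holds_entry [simp]:
  "stab m a \<Longrightarrow> stab m d \<Longrightarrow> stab m i \<Longrightarrow> stab m v \<Longrightarrow>
   holds (entry a d i v) m s w W \<longleftrightarrow> sentry (val m w a) (val m w d) (val m w i) (val m w v)"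
  by (simp add: entry_def sentry_def Let_def)

lemma holds_is_pow [simp]:
  "stab m b \<Longrightarrow> stab m e \<Longrightarrow> stab m v \<Longrightarrow>
   holds (is_pow b e v) m s w W \<longleftrightarrow> spow (val m w b) (val m w e) (val m w v)"
  by (simp add: is_pow_def spow_def)

lemma holds_is_decomp [simp]:
  "stab m b \<Longrightarrow> stab m n \<Longrightarrow> stab m e \<Longrightarrow> stab m a \<Longrightarrow> stab m r \<Longrightarrow>
   holds (is_decomp b n e a r) m s w W \<longleftrightarrow>
     sdecomp (val m w b) (val m w n) (val m w e) (val m w a) (val m w r)"
  by (simp add: is_decomp_def sdecomp_def le_less)

lemma holds_is_min [simp]:
  "stab m i \<Longrightarrow> stab m b \<Longrightarrow>
   holds (is_min (member X i) b) m s w W \<longleftrightarrow> smin (mb (sval s W X) (val m w i)) (val m w b)"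
  by (simp add: is_min_def smin_def le_less)

lemma holds_is_base [simp]:
  "stab m i \<Longrightarrow> stab m n \<Longrightarrow> stab m b \<Longrightarrow>
   holds (is_base (member X i) n b) m s w W \<longleftrightarrow>
     sbase (mb (sval s W X) (val m w i)) (val m w n) (val m w b)"
  by (simp add: is_base_def sbase_def le_less)

lemma holds_is_S [simp]:
  "stab m i \<Longrightarrow> stab m n \<Longrightarrow> stab m b \<Longrightarrow>
   holds (is_S (member X i) n b) m s w W \<longleftrightarrow>
     sS (mb (sval s W X) (val m w i)) (val m w n) (val m w b)"
  by (simp add: is_S_def sS_def le_less)

lemma holds_less_S [simp]:
  "stab m i \<Longrightarrow> stab m x \<Longrightarrow> stab m n \<Longrightarrow>
   holds (less_S x (member X i) n) m s w W \<longleftrightarrow>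
     slessS (val m w x) (mb (sval s W X) (val m w i)) (val m w n)"
  by (simp add: less_S_def slessS_def)

lemma holds_hierarchy [simp]:
  "stab m i \<Longrightarrow> holds (base_hierarchy (member X i)) m s w W \<longleftrightarrow> shier (mb (sval s W X) (val m w i))"
  by (simp add: base_hierarchy_def shier_def)

lemma holds_change [simp]:
  "stab m a \<Longrightarrow> stab m d \<Longrightarrow> stab m b \<Longrightarrow> stab m c \<Longrightarrow> stab m n \<Longrightarrow> stab m v \<Longrightarrow>
   holds (is_change a d b c n v) m s w W \<longleftrightarrow>
     schange (val m w a) (val m w d) (val m w b) (val m w c) (val m w n) (val m w v)"
  by (simp add: is_change_def schange_def le_less)

lemma holds_admissible [simp]:
  "stab m i \<Longrightarrow> stab m a \<Longrightarrow> stab m d \<Longrightarrow> stab m b \<Longrightarrow> stab m c \<Longrightarrow> stab m n \<Longrightarrow> stab m v \<Longrightarrow>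
   holds (admissible (member X i) a d b n c v) m s w W \<longleftrightarrow>
     sadm (mb (sval s W X) (val m w i)) (val m w a) (val m w d) (val m w b) (val m w n) (val m w c) (val m w v)"
  by (simp add: admissible_def sadm_def)

lemma holds_clause [simp]:
  "stab m i \<Longrightarrow> stab m j \<Longrightarrow> stab m a \<Longrightarrow> stab m d \<Longrightarrow> stab m n \<Longrightarrow>
   holds (upgrade_clause (member X i) (member X j) a d n) m s w W \<longleftrightarrow>
     sclause (mb (sval s W X) (val m w i)) (mb (sval s W X) (val m w j)) (val m w a) (val m w d) (val m w n)"
  by (simp add: upgrade_clause_def sclause_def le_less)

lemma holds_upgrade [simp]:
  "stab m i \<Longrightarrow> stab m j \<Longrightarrow> stab m n \<Longrightarrow> stab m v \<Longrightarrow>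
   holds (is_upgrade (member X i) (member X j) n v) m s w W \<longleftrightarrow>
     supg (mb (sval s W X) (val m w i)) (mb (sval s W X) (val m w j)) (val m w n) (val m w v)"
  by (simp add: is_upgrade_def supg_def le_less)

lemma holds_good [simp]:
  "stab m i \<Longrightarrow> stab m j \<Longrightarrow>
   holds (good_successor (member X i) (member X j)) m s w W \<longleftrightarrow>
     sgood (mb (sval s W X) (val m w i)) (mb (sval s W X) (val m w j))"
  by (simp add: good_successor_def sgood_def le_less)

lemma holds_dynamical [simp]:
  "holds (dynamical_hierarchy X) m s w W \<longleftrightarrow> sdyn (sval s W X)"
  by (simp add: dynamical_hierarchy_def sdyn_def)

lemma holds_goodstein [simp]:
  "stab m n \<Longrightarrow> stab m i \<Longrightarrow> stab m v \<Longrightarrow>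
   holds (is_goodstein X n i v) m s w W \<longleftrightarrow> sgs (sval s W X) (val m w n) (val m w i) (val m w v)"
  by (simp add: is_goodstein_def sgs_def)

lemma holds_termination [simp]:
  "stab m k \<Longrightarrow> holds (goodstein_termination k) m s w W \<longleftrightarrow> sterm SS (val m w k)"
  by (simp add: goodstein_termination_def sterm_def le_less)

lemma numeral_of_simps [simp]: "val m w (numeral_of n) = of_nat n" "stab m (numeral_of n)"
  by (induction n) (simp_all add: add.commute)

lemma sat_sentence: "sat (tstr SS) (sentence P) e0 E0 \<longleftrightarrow> holds P 0 0 w W"
proof -
  have "env 0 w = e0" "senv 0 W = E0" by (auto simp: env_def senv_def fun_eq_iff)
  then show ?thesis by (simp add: sentence_def holds_def)
qed

theorem sat_termination:
  "sat (tstr SS) (sentence (goodstein_termination (numeral_of k))) e0 E0 \<longleftrightarrow> sterm SS (of_nat k)"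
  unfolding sat_sentence[where w = "\<lambda>_. 0" and W = "\<lambda>_. {}"] by simp

theorem sat_all_termination:
  "sat (tstr SS) (sentence (fall (\<lambda>k. fimp (fdisj (fless (numeral_of 2) k) (feq (numeral_of 2) k))
     (goodstein_termination k)))) e0 E0 \<longleftrightarrow> (\<forall>k\<ge>2. sterm SS k)"
  unfolding sat_sentence[where w = "\<lambda>_. 0" and W = "\<lambda>_. {}"]
  by (simp del: numeral_of.simps) (auto simp: le_less)

end

section \<open>Definability and induction\<close>

lemma Delta00_subst: "p \<in> Delta00 \<Longrightarrow> subst p \<sigma> \<rho> \<in> Delta00"
proof (induction p arbitrary: \<sigma> \<rho> rule: Delta00.induct)
  case (8 p t)
  have "subst_tm (shift_tm t) (nlift \<sigma>) = shift_tm (subst_tm t \<sigma>)"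
    by (simp add: subst_tm_shift shift_tm_subst)
  then show ?case using 8 by (auto intro!: Delta00.intros)
next
  case (9 p t)
  have "subst_tm (shift_tm t) (nlift \<sigma>) = shift_tm (subst_tm t \<sigma>)"
    by (simp add: subst_tm_shift shift_tm_subst)
  then show ?case using 9 by (auto intro!: Delta00.intros)
qed (auto intro: Delta00.intros)

definition mix :: "(nat \<Rightarrow> 'b) \<Rightarrow> (nat \<Rightarrow> 'b) \<Rightarrow> nat \<Rightarrow> 'b" where
  "mix e c n = (if even n then e (n div 2) else c (n div 2))"

lemma mix_simps [simp]: "mix e c (2 * n) = e n" "mix e c (Suc (2 * n)) = c n"
  by (simp_all add: mix_def)

lemma ev_subst: "ev (subst_tm t \<sigma>) e = ev t (\<lambda>n. ev (\<sigma> n) e)"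
  by (induction t) auto

locale rca =
  fixes SS :: "'a::linordered_semidom set set"
  assumes model: "p \<in> RCA0 \<union> Sigma02_IND \<Longrightarrow> valid (tstr SS) p" and SS_ne: "SS \<noteq> {}"
begin

sublocale A: arith "tstr SS"
proof
  show "valid (tstr SS) p" if "p \<in> basic_axioms" for p using that model by (auto simp: RCA0_def)
  show "valid (tstr SS) p" if "p \<in> Sigma01_IND" for p using that model by (auto simp: RCA0_def)
  show "sets (tstr SS) \<noteq> {}" using SS_ne by simp
qed

lemma modelD: "p \<in> RCA0 \<union> Sigma02_IND \<Longrightarrow> (\<And>n. E n \<in> SS) \<Longrightarrow> sat (tstr SS) p e E"
  using model[of p] unfolding valid_def by simp

lemma less_add1 [simp]: "(x::'a) < y + 1 \<longleftrightarrow> x \<le> y"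
  using A.ax(8)[of x y] by (auto simp: le_less)

lemma add1_le [simp]: "(x::'a) + 1 \<le> y \<longleftrightarrow> x < y"
  by (metis less_add1 not_le)

lemma zero_le [simp]: "0 \<le> (x::'a)"
  using A.ax(7)[of x] by (simp add: not_less)

lemma not_less_0 [simp]: "\<not> x < (0::'a)"
  by (simp add: not_less)

lemma pos_iff: "0 < (x::'a) \<longleftrightarrow> x \<noteq> 0"
  using zero_le[of x] by (auto simp: le_less)

lemma succ_ex: "(x::'a) \<noteq> 0 \<Longrightarrow> \<exists>y. x = y + 1"
  using A.zero_or_succ[of x] by simp

text \<open>Definability with parameters. Parameters are interleaved with the variables by \<open>mix\<close>, so
  that new ones can be added without renumbering.\<close>

definition Tm :: "((nat \<Rightarrow> 'a) \<Rightarrow> 'a) \<Rightarrow> bool" where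
  "Tm t \<longleftrightarrow> (\<exists>s c. \<forall>e. t e = ev s (mix e c))"

definition D0 :: "((nat \<Rightarrow> 'a) \<Rightarrow> bool) \<Rightarrow> bool" where
  "D0 P \<longleftrightarrow> (\<exists>p\<in>Delta00. \<exists>c E. (\<forall>n. E n \<in> SS) \<and> (\<forall>e. P e \<longleftrightarrow> sat (tstr SS) p (mix e c) E))"

text \<open>Two definitions come with separate parameters \<open>c\<close> and \<open>c'\<close>,
  which are merged into \<open>mix c c'\<close>; \<open>r1\<close> and \<open>r2\<close> redirect
  the odd variables to the respective half.\<close>

definition r1 :: "nat \<Rightarrow> nat" where "r1 n = (if even n then n else Suc (2 * (2 * (n div 2))))"
definition r2 :: "nat \<Rightarrow> nat" where "r2 n = (if even n then n else Suc (2 * Suc (2 * (n div 2))))"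

lemma mix_r1: "mix e (mix c c') (r1 n) = mix e c n"
  by (auto simp add: r1_def mix_def elim!: oddE)

lemma mix_r2: "mix e (mix c c') (r2 n) = mix e c' n"
  by (auto simp add: r2_def mix_def elim!: oddE)

lemma sat_ren: "sat (tstr SS) (subst p (\<lambda>n. NVar (f n)) g) e E = sat (tstr SS) p (\<lambda>n. e (f n)) (\<lambda>n. E (g n))"
  by (simp add: sat_subst)

lemma sat_r1: "sat (tstr SS) (subst p (\<lambda>n. NVar (r1 n)) (\<lambda>n. 2 * n)) (mix e (mix c c')) (mix E E') = sat (tstr SS) p (mix e c) E"
  by (simp add: sat_ren mix_r1)

lemma sat_r2: "sat (tstr SS) (subst p (\<lambda>n. NVar (r2 n)) (\<lambda>n. Suc (2 * n))) (mix e (mix c c')) (mix E E') = sat (tstr SS) p (mix e c') E'"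
  by (simp add: sat_ren mix_r2)

lemma ev_r1: "ev (subst_tm s (\<lambda>n. NVar (r1 n))) (mix e (mix c c')) = ev s (mix e c)"
  by (simp add: ev_subst mix_r1)

lemma ev_r2: "ev (subst_tm s (\<lambda>n. NVar (r2 n))) (mix e (mix c c')) = ev s (mix e c')"
  by (simp add: ev_subst mix_r2)

lemma mix_SS: "(\<And>n. E n \<in> SS) \<Longrightarrow> (\<And>n. E' n \<in> SS) \<Longrightarrow> mix E E' n \<in> SS"
  by (simp add: mix_def)

lemma D0_pair:
  assumes "D0 P" "D0 Q"
  obtains p q c E where "p \<in> Delta00" "q \<in> Delta00" "\<And>n. E n \<in> SS"
    "\<And>e. P e \<longleftrightarrow> sat (tstr SS) p (mix e c) E" "\<And>e. Q e \<longleftrightarrow> sat (tstr SS) q (mix e c) E"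
proof -
  from assms obtain p q c c' E E' where *: "p \<in> Delta00" "q \<in> Delta00" "\<And>n. E n \<in> SS" "\<And>n. E' n \<in> SS"
    "\<And>e. P e \<longleftrightarrow> sat (tstr SS) p (mix e c) E" "\<And>e. Q e \<longleftrightarrow> sat (tstr SS) q (mix e c') E'"
    unfolding D0_def by metis
  show thesis
    by (rule that[OF Delta00_subst[OF *(1), of "\<lambda>n. NVar (r1 n)" "\<lambda>n. 2 * n"]
        Delta00_subst[OF *(2), of "\<lambda>n. NVar (r2 n)" "\<lambda>n. Suc (2 * n)"], of "mix E E'" "mix c c'"])
      (use * in \<open>simp_all add: sat_r1 sat_r2 mix_SS\<close>)
qed

lemma D0_Tm:
  assumes "D0 P" "Tm t"
  obtains p s c E where "p \<in> Delta00" "\<And>n. E n \<in> SS"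
    "\<And>e. P e \<longleftrightarrow> sat (tstr SS) p (mix e c) E" "\<And>e. t e = ev s (mix e c)"
proof -
  from assms obtain p s c c' E where *: "p \<in> Delta00" "\<And>n. E n \<in> SS"
    "\<And>e. P e \<longleftrightarrow> sat (tstr SS) p (mix e c) E" "\<And>e. t e = ev s (mix e c')"
    unfolding D0_def Tm_def by metis
  show thesis
    by (rule that[OF Delta00_subst[OF *(1), of "\<lambda>n. NVar (r1 n)" "\<lambda>n. 2 * n"],
        of "mix E E" "mix c c'" "subst_tm s (\<lambda>n. NVar (r2 n))"])
      (use * in \<open>simp_all add: sat_r1 ev_r2 mix_SS\<close>)
qed

lemma Tm_pair:
  assumes "Tm t" "Tm u"
  obtains s s' c where "\<And>e. t e = ev s (mix e c)" "\<And>e. u e = ev s' (mix e c)"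
proof -
  from assms obtain s s' c c' where "\<And>e. t e = ev s (mix e c)" "\<And>e. u e = ev s' (mix e c')"
    unfolding Tm_def by metis
  then show thesis
    by (intro that[of "subst_tm s (\<lambda>n. NVar (r1 n))" "mix c c'" "subst_tm s' (\<lambda>n. NVar (r2 n))"])
      (simp_all add: ev_r1 ev_r2)
qed

lemma Tm_var: "Tm (\<lambda>e. e n)"
  unfolding Tm_def by (rule exI[of _ "NVar (2 * n)"]) simp

lemma Tm_const: "Tm (\<lambda>e. a)"
  unfolding Tm_def by (rule exI[of _ "NVar 1"], rule exI[of _ "\<lambda>_. a"]) (simp add: mix_def)

lemma Tm_add: "Tm t \<Longrightarrow> Tm u \<Longrightarrow> Tm (\<lambda>e. t e + u e)"
  by (erule (1) Tm_pair, unfold Tm_def) (metis ev.simps(4))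

lemma Tm_mult: "Tm t \<Longrightarrow> Tm u \<Longrightarrow> Tm (\<lambda>e. t e * u e)"
  by (erule (1) Tm_pair, unfold Tm_def) (metis ev.simps(5))

lemma D0I: "p \<in> Delta00 \<Longrightarrow> (\<And>n. E n \<in> SS) \<Longrightarrow> (\<And>e. P e \<longleftrightarrow> sat (tstr SS) p (mix e c) E) \<Longrightarrow> D0 P"
  unfolding D0_def by blast

lemma D0_eq: "Tm t \<Longrightarrow> Tm u \<Longrightarrow> D0 (\<lambda>e. t e = u e)"
proof (erule (1) Tm_pair)
  fix s s' c assume "\<And>e. t e = ev s (mix e c)" "\<And>e. u e = ev s' (mix e c)"
  then show "D0 (\<lambda>e. t e = u e)"
    by (intro D0I[of "Eq s s'" A.E0]) (use A.E0 in \<open>simp_all add: Delta00.intros\<close>)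
qed

lemma D0_less: "Tm t \<Longrightarrow> Tm u \<Longrightarrow> D0 (\<lambda>e. t e < u e)"
proof (erule (1) Tm_pair)
  fix s s' c assume "\<And>e. t e = ev s (mix e c)" "\<And>e. u e = ev s' (mix e c)"
  then show "D0 (\<lambda>e. t e < u e)"
    by (intro D0I[of "Less s s'" A.E0]) (use A.E0 in \<open>simp_all add: Delta00.intros\<close>)
qed

lemma D0_mem: "S \<in> SS \<Longrightarrow> Tm t \<Longrightarrow> D0 (\<lambda>e. t e \<in> S)"
  unfolding Tm_def by (auto intro!: D0I[of "Mem _ 0" "\<lambda>_. S"] Delta00.intros)

lemma D0_const: "D0 (\<lambda>e. b)"
proof (cases b)
  case True
  then show ?thesis using A.E0 by (intro D0I[of "Eq Zero Zero" A.E0]) (auto intro: Delta00.intros)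
next
  case False
  then show ?thesis using A.E0 by (intro D0I[of Bot A.E0]) (auto intro: Delta00.intros)
qed

lemma D0_imp: "D0 P \<Longrightarrow> D0 Q \<Longrightarrow> D0 (\<lambda>e. P e \<longrightarrow> Q e)"
  by (erule (1) D0_pair, rule D0I[of "Imp _ _"]) (auto intro: Delta00.intros)

lemma D0_and: "D0 P \<Longrightarrow> D0 Q \<Longrightarrow> D0 (\<lambda>e. P e \<and> Q e)"
  by (erule (1) D0_pair, rule D0I[of "And _ _"]) (auto intro: Delta00.intros)

lemma D0_or: "D0 P \<Longrightarrow> D0 Q \<Longrightarrow> D0 (\<lambda>e. P e \<or> Q e)"
  by (erule (1) D0_pair, rule D0I[of "Or _ _"]) (auto intro: Delta00.intros)

lemma D0_not: "D0 P \<Longrightarrow> D0 (\<lambda>e. \<not> P e)"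
  using D0_imp[OF _ D0_const[of False]] by simp

lemma D0_iff: "D0 P \<Longrightarrow> D0 Q \<Longrightarrow> D0 (\<lambda>e. P e \<longleftrightarrow> Q e)"
  unfolding iff_conv_conj_imp by (intro D0_and D0_imp)

lemma D0_le: "Tm t \<Longrightarrow> Tm u \<Longrightarrow> D0 (\<lambda>e. t e \<le> u e)"
  unfolding le_less by (intro D0_or D0_less D0_eq)

text \<open>Takes a binder out of the interleaving: the bound variable keeps index 0, the old
  variable \<open>n\<close>, at \<open>2 n + 2\<close> in the body, is found at
  \<open>2 n + 1\<close>, and parameters move up by one.\<close>

definition dn0 :: "nat \<Rightarrow> nat" where "dn0 n = (if n = 0 then 0 else if even n then n - 1 else Suc n)"

lemma mix_dn0: "case_nat y (mix e c) (dn0 n) = mix (case_nat y e) c n"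
proof (cases "even n")
  case True
  then obtain k where k: "n = 2 * k" by auto
  then show ?thesis by (cases k) (simp_all add: dn0_def mix_def)
next
  case False
  then show ?thesis by (auto simp add: dn0_def mix_def)
qed

lemma sat_dn0: "sat (tstr SS) (subst p (\<lambda>n. NVar (dn0 n)) (\<lambda>n. n)) (case_nat y (mix e c)) E
   = sat (tstr SS) p (mix (case_nat y e) c) E"
  by (simp add: sat_ren mix_dn0)

lemma D0_all:
  assumes "Tm t" "D0 (\<lambda>e. P (e 0) (\<lambda>n. e (Suc n)))" shows "D0 (\<lambda>e. \<forall>y<t e. P y e)"
proof -
  from D0_Tm[OF assms(2,1)] obtain p s c E where *: "p \<in> Delta00" "\<And>n. E n \<in> SS"
    "\<And>e. P (e 0) (\<lambda>n. e (Suc n)) \<longleftrightarrow> sat (tstr SS) p (mix e c) E" "\<And>e. t e = ev s (mix e c)" by metis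
  have "P y e \<longleftrightarrow> sat (tstr SS) p (mix (case_nat y e) c) E" for y e using *(3)[of "case_nat y e"] by simp
  then show ?thesis using *
    by (intro D0I[of "All (Imp (Less (NVar 0) (shift_tm s)) (subst p (\<lambda>n. NVar (dn0 n)) (\<lambda>n. n)))" E _ c]
        Delta00.intros Delta00_subst) (simp_all add: sat_dn0 evt_shift[of "tstr SS", simplified])
qed

lemma D0_ex:
  assumes "Tm t" "D0 (\<lambda>e. P (e 0) (\<lambda>n. e (Suc n)))" shows "D0 (\<lambda>e. \<exists>y<t e. P y e)"
proof -
  have "D0 (\<lambda>e. \<not> (\<forall>y<t e. \<not> P y e))" by (intro D0_not D0_all assms)
  then show ?thesis by simp
qed

lemma D0_allle:
  assumes "Tm t" "D0 (\<lambda>e. P (e 0) (\<lambda>n. e (Suc n)))" shows "D0 (\<lambda>e. \<forall>y\<le>t e. P y e)"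
  using D0_all[where P = P, OF Tm_add[OF assms(1) Tm_const[of 1]]] assms(2) by simp

lemma D0_exle:
  assumes "Tm t" "D0 (\<lambda>e. P (e 0) (\<lambda>n. e (Suc n)))" shows "D0 (\<lambda>e. \<exists>y\<le>t e. P y e)"
  using D0_ex[where P = P, OF Tm_add[OF assms(1) Tm_const[of 1]]] assms(2) by simp

text \<open>A variable is replaced by another variable (\<open>Inl\<close>) or by a parameter (\<open>Inr\<close>).\<close>

definition ren :: "(nat \<Rightarrow> nat + 'a) \<Rightarrow> (nat \<Rightarrow> 'a) \<Rightarrow> nat \<Rightarrow> 'a" where
  "ren f e n = (case f n of Inl k \<Rightarrow> e k | Inr a \<Rightarrow> a)"

lemma D0_ren:
  assumes "D0 P" shows "D0 (\<lambda>e. P (ren f e))"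
proof -
  from assms obtain p c E where *: "p \<in> Delta00" "\<And>n. E n \<in> SS"
    "\<And>e. P e \<longleftrightarrow> sat (tstr SS) p (mix e c) E" unfolding D0_def by metis
  define c' where "c' n = (case f n of Inl k \<Rightarrow> 0 | Inr a \<Rightarrow> a)" for n
  define g where "g n = (if even n then (case f (n div 2) of Inl k \<Rightarrow> 2 * k | Inr a \<Rightarrow> r2 (Suc (2 * (n div 2)))) else r1 n)" for n
  have "mix e (mix c c') (g n) = mix (ren f e) c n" for e n
    unfolding g_def by (auto simp: ren_def c'_def mix_r1 mix_r2 split: sum.split) (simp_all add: mix_def ren_def)
  then show ?thesis using *
    by (intro D0I[of "subst p (\<lambda>n. NVar (g n)) (\<lambda>n. n)" E _ "mix c c'"] Delta00_subst)
      (simp_all add: sat_ren)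
qed

text \<open>One unbounded existential quantifier in front of a class \<open>K\<close>. Alternating
  it with complements yields the levels up to \<Sigma>2 and \<Pi>2 as classes of predicates.\<close>

definition Exs :: "(((nat \<Rightarrow> 'a) \<Rightarrow> bool) \<Rightarrow> bool) \<Rightarrow> ((nat \<Rightarrow> 'a) \<Rightarrow> bool) \<Rightarrow> bool" where
  "Exs K P \<longleftrightarrow> (\<exists>Q. K (\<lambda>e. Q (e 0) (\<lambda>n. e (Suc n))) \<and> (\<forall>e. P e \<longleftrightarrow> (\<exists>y. Q y e)))"

abbreviation S1 where "S1 \<equiv> Exs D0"
definition P1 where "P1 P \<longleftrightarrow> S1 (\<lambda>e. \<not> P e)"
abbreviation S2 where "S2 \<equiv> Exs P1"
definition P2 where "P2 P \<longleftrightarrow> S2 (\<lambda>e. \<not> P e)"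

lemma ExsI: "K (\<lambda>e. Q (e 0) (\<lambda>n. e (Suc n))) \<Longrightarrow> (\<And>e. P e \<longleftrightarrow> (\<exists>y. Q y e)) \<Longrightarrow> Exs K P"
  unfolding Exs_def by blast

text \<open>The properties of \<open>K\<close> from which the closure of \<open>Exs K\<close> is
  derived. They hold for \<Delta>0 and for \<Pi>1, so the rules for \<open>Exs\<close> are proved
  once for \<Sigma>1 and \<Sigma>2.\<close>

definition dclosed :: "(((nat \<Rightarrow> 'a) \<Rightarrow> bool) \<Rightarrow> bool) \<Rightarrow> bool" where
  "dclosed K \<longleftrightarrow> (\<forall>P f. K P \<longrightarrow> K (\<lambda>e. P (ren f e))) \<and> (\<forall>P Q. K P \<longrightarrow> K Q \<longrightarrow> K (\<lambda>e. P e \<and> Q e) \<and> K (\<lambda>e. P e \<or> Q e)) \<and>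
     (\<forall>t P. Tm t \<longrightarrow> K (\<lambda>e. P (e 0) (\<lambda>n. e (Suc n))) \<longrightarrow> K (\<lambda>e. \<exists>y\<le>t e. P y e))"

lemma closedD:
  assumes "dclosed K"
  shows "K P \<Longrightarrow> K (\<lambda>e. P (ren f e))" "K P \<Longrightarrow> K Q \<Longrightarrow> K (\<lambda>e. P e \<and> Q e)" "K P \<Longrightarrow> K Q \<Longrightarrow> K (\<lambda>e. P e \<or> Q e)"
    "Tm t \<Longrightarrow> K (\<lambda>e. R (e 0) (\<lambda>n. e (Suc n))) \<Longrightarrow> K (\<lambda>e. \<exists>y\<le>t e. R y e)"
  using assms unfolding dclosed_def by blast+

lemma closed_D0: "dclosed D0"
  unfolding dclosed_def by (auto intro: D0_ren D0_and D0_or D0_exle)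

lemma shift_ren: "(\<lambda>n. e (Suc n)) = ren (\<lambda>n. Inl (Suc n)) e"
  by (simp add: ren_def fun_eq_iff)

lemma Exs_base: "dclosed K \<Longrightarrow> K P \<Longrightarrow> Exs K P"
  by (rule ExsI[where Q = "\<lambda>y e. P e"]) (simp_all add: shift_ren closedD(1))

lemma Exs_ren:
  assumes "dclosed K" "Exs K P" shows "Exs K (\<lambda>e. P (ren f e))"
proof -
  from assms(2) obtain Q where Q: "K (\<lambda>e. Q (e 0) (\<lambda>n. e (Suc n)))" "\<And>e. P e \<longleftrightarrow> (\<exists>y. Q y e)"
    unfolding Exs_def by blast
  let ?g = "case_nat (Inl 0) (\<lambda>n. case f n of Inl k \<Rightarrow> Inl (Suc k) | Inr a \<Rightarrow> Inr a)"
  have "ren ?g e 0 = e 0" "(\<lambda>n. ren ?g e (Suc n)) = ren f (\<lambda>n. e (Suc n))" for e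
    by (auto simp: ren_def fun_eq_iff split: sum.split)
  then have "K (\<lambda>e. Q (e 0) (ren f (\<lambda>n. e (Suc n))))"
    using closedD(1)[OF assms(1) Q(1), of ?g] by simp
  then show ?thesis by (intro ExsI[where Q = "\<lambda>y e. Q y (ren f e)"]) (simp_all add: Q(2))
qed

text \<open>Two quantifiers are contracted to one by a common bound \<open>w\<close> for both
  witnesses, which avoids a pairing function.\<close>

lemma Exs_ex:
  assumes K: "dclosed K" "Exs K (\<lambda>e. P (e 0) (\<lambda>n. e (Suc n)))" shows "Exs K (\<lambda>e. \<exists>y. P y e)"
proof -
  from K(2) obtain Q where Q: "K (\<lambda>e. Q (e 0) (\<lambda>n. e (Suc n)))"
    "\<And>e. P (e 0) (\<lambda>n. e (Suc n)) \<longleftrightarrow> (\<exists>z. Q z e)" unfolding Exs_def by blast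
  have P: "P y e \<longleftrightarrow> (\<exists>z. Q z (case_nat y e))" for y e using Q(2)[of "case_nat y e"] by simp
  let ?g = "case_nat (Inl 0) (case_nat (Inl 1) (\<lambda>n. Inl (n + 3)))"
  have "(\<lambda>n. ren ?g e (Suc n)) = case_nat (e (Suc 0)) (\<lambda>n. e (Suc (Suc (Suc n))))" "ren ?g e 0 = e 0" for e
    by (auto simp: ren_def fun_eq_iff numeral_3_eq_3 split: nat.split)
  then have 1: "K (\<lambda>e. Q (e 0) (case_nat (e (Suc 0)) (\<lambda>n. e (Suc (Suc (Suc n))))))"
    using closedD(1)[OF K(1) Q(1), of ?g] by simp
  have "K (\<lambda>e. \<exists>y\<le>e 0. \<exists>z\<le>e 0. Q z (case_nat y (\<lambda>n. e (Suc n))))"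
    by (rule closedD(4)[OF K(1) Tm_var], rule closedD(4)[OF K(1) Tm_var], rule 1)
  then show ?thesis
  proof (rule ExsI[where Q = "\<lambda>w e. \<exists>y\<le>w. \<exists>z\<le>w. Q z (case_nat y e)"])
    fix e show "(\<exists>y. P y e) \<longleftrightarrow> (\<exists>w. \<exists>y\<le>w. \<exists>z\<le>w. Q z (case_nat y e))"
      unfolding P by (metis max.cobounded1 max.cobounded2)
  qed
qed

lemma Exs_and:
  assumes K: "dclosed K" "Exs K P" "Exs K Q" shows "Exs K (\<lambda>e. P e \<and> Q e)"
proof -
  from K(2,3) obtain P' Q' where *: "K (\<lambda>e. P' (e 0) (\<lambda>n. e (Suc n)))" "\<And>e. P e \<longleftrightarrow> (\<exists>y. P' y e)"
    "K (\<lambda>e. Q' (e 0) (\<lambda>n. e (Suc n)))" "\<And>e. Q e \<longleftrightarrow> (\<exists>y. Q' y e)" unfolding Exs_def by blast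
  let ?g = "case_nat (Inl 0) (\<lambda>n. Inl (Suc (Suc n)))"
  let ?h = "\<lambda>n. Inl (Suc n)"
  have "(\<lambda>n. ren ?g e (Suc n)) = (\<lambda>n. e (Suc (Suc n)))" "ren ?g e 0 = e 0" for e
    by (auto simp: ren_def fun_eq_iff)
  with closedD(1)[OF K(1) *(1), of ?g] have 1: "K (\<lambda>e. P' (e 0) (\<lambda>n. e (Suc (Suc n))))" by simp
  have 2: "K (\<lambda>e. Q' (e (Suc 0)) (\<lambda>n. e (Suc (Suc n))))"
    using closedD(1)[OF K(1) *(3), of ?h] by (simp add: ren_def)
  show ?thesis unfolding *(2,4) ex_simps[symmetric]
    by (rule Exs_ex[OF K(1)], rule Exs_ex[OF K(1)], rule Exs_base[OF K(1)], rule closedD(2)[OF K(1)])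
      (use 1 2 in simp_all)
qed

lemma Exs_or: "dclosed K \<Longrightarrow> Exs K P \<Longrightarrow> Exs K Q \<Longrightarrow> Exs K (\<lambda>e. P e \<or> Q e)"
proof -
  assume K: "dclosed K" "Exs K P" "Exs K Q"
  from K(2,3) obtain P' Q' where *: "K (\<lambda>e. P' (e 0) (\<lambda>n. e (Suc n)))" "\<And>e. P e \<longleftrightarrow> (\<exists>y. P' y e)"
    "K (\<lambda>e. Q' (e 0) (\<lambda>n. e (Suc n)))" "\<And>e. Q e \<longleftrightarrow> (\<exists>y. Q' y e)" unfolding Exs_def by blast
  show "Exs K (\<lambda>e. P e \<or> Q e)"
    by (rule ExsI[where Q = "\<lambda>y e. P' y e \<or> Q' y e"]) (use * in \<open>auto intro: closedD(3)[OF K(1)]\<close>)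
qed

lemmas S1_D0 = Exs_base[OF closed_D0]
lemmas S1_ex = Exs_ex[OF closed_D0]
lemmas S1_and = Exs_and[OF closed_D0]
lemmas S1_or = Exs_or[OF closed_D0]

lemma P1_D0: "D0 P \<Longrightarrow> P1 P"
  unfolding P1_def by (intro S1_D0 D0_not)

lemma P1_all: "P1 (\<lambda>e. P (e 0) (\<lambda>n. e (Suc n))) \<Longrightarrow> P1 (\<lambda>e. \<forall>y. P y e)"
  unfolding P1_def using S1_ex[of "\<lambda>y e. \<not> P y e"] by simp

lemma S2_D0: "D0 P \<Longrightarrow> S2 P"
  by (rule ExsI[where Q = "\<lambda>y e. P e"]) (simp_all add: shift_ren P1_D0 D0_ren)

text \<open>The variable of an instance of an axiom scheme is variable 0 of the formula; all other
  variables of \<open>P\<close> are irrelevant.\<close>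

lemma ind_S2:
  assumes "S2 (\<lambda>e. Q (e 0))" "Q 0" "\<And>x. Q x \<Longrightarrow> Q (x + 1)"
  shows "Q x"
proof -
  from assms(1) obtain R where R: "P1 (\<lambda>e. R (e 0) (\<lambda>n. e (Suc n)))" "\<And>e. Q (e 0) \<longleftrightarrow> (\<exists>y. R y e)"
    unfolding Exs_def by blast
  from R(1) obtain U where U: "D0 (\<lambda>e. U (e 0) (\<lambda>n. e (Suc n)))"
    "\<And>e. \<not> R (e 0) (\<lambda>n. e (Suc n)) \<longleftrightarrow> (\<exists>y. U y e)" unfolding P1_def Exs_def by blast
  from D0_not[OF U(1)] obtain p c E where p: "p \<in> Delta00" "\<And>n. E n \<in> SS"
    "\<And>e. \<not> U (e 0) (\<lambda>n. e (Suc n)) \<longleftrightarrow> sat (tstr SS) p (mix e c) E" unfolding D0_def by blast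
  let ?g = "\<lambda>n. if even n then (if n = 0 then 0 else if n = 2 then Suc 0 else Suc (Suc 0)) else Suc (Suc (Suc (n div 2)))"
  let ?p = "subst p (\<lambda>n. NVar (?g n)) (\<lambda>n. n)"
  have g: "(\<lambda>n. case_nat z (case_nat y (case_nat x c)) (?g n)) = mix (case_nat z (case_nat y (\<lambda>_. x))) c" for z y x
  proof
    fix n show "case_nat z (case_nat y (case_nat x c)) (?g n) = mix (case_nat z (case_nat y (\<lambda>_. x))) c n"
    proof (cases "even n")
      case True
      then obtain k where k: "n = 2 * k" by auto
      consider "k = 0" | "k = 1" | j where "k = Suc (Suc j)" by (metis One_nat_def not0_implies_Suc)
      then show ?thesis by cases (simp_all add: mix_def k)
    qed (auto simp: mix_def)
  qed
  have Qx: "Q x \<longleftrightarrow> sat (tstr SS) (Ex (All ?p)) (case_nat x c) E" for x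
  proof -
    have 1: "R y (\<lambda>_. x) \<longleftrightarrow> (\<forall>z. \<not> U z (case_nat y (\<lambda>_. x)))" for y
    proof -
      have "\<not> R y (\<lambda>_. x) \<longleftrightarrow> (\<exists>z. U z (case_nat y (\<lambda>_. x)))"
        using U(2)[of "case_nat y (\<lambda>_. x)"] by simp
      then show ?thesis by blast
    qed
    have 2: "\<not> U z (case_nat y (\<lambda>_. x)) \<longleftrightarrow> sat (tstr SS) p (mix (case_nat z (case_nat y (\<lambda>_. x))) c) E" for z y
      using p(3)[of "case_nat z (case_nat y (\<lambda>_. x))"] by simp
    have "Q x \<longleftrightarrow> (\<exists>y. R y (\<lambda>_. x))" using R(2)[of "\<lambda>_. x"] by simp
    then show ?thesis unfolding sat.simps sat_ren g 1 2 .
  qed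
  have "Ex (All ?p) \<in> Sigma02" unfolding Sigma02_def Pi01_def using Delta00_subst[OF p(1)] by blast
  then have "induction_axiom (Ex (All ?p)) \<in> Sigma02_IND" by (auto simp: Sigma02_IND_def)
  then have "sat (tstr SS) (induction_axiom (Ex (All ?p))) c E"
    using p(2) by (intro modelD UnI2)
  then show ?thesis using assms(2,3) unfolding A.sat_induction_axiom Qx[symmetric] tstr_sel by blast
qed

lemma ind_S1: "S1 (\<lambda>e. Q (e 0)) \<Longrightarrow> Q 0 \<Longrightarrow> (\<And>x. Q x \<Longrightarrow> Q (x + 1)) \<Longrightarrow> Q x"
  by (rule ind_S2) (auto simp: Exs_def intro: P1_D0)

lemma Tm_ren: "Tm t \<Longrightarrow> Tm (\<lambda>e. t (\<lambda>n. e (Suc n)))"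
proof -
  assume "Tm t"
  then obtain s c where s: "\<And>e. t e = ev s (mix e c)" unfolding Tm_def by blast
  have "mix e c (if even n then n + 2 else n) = mix (\<lambda>n. e (Suc n)) c n" for e n
    by (simp add: mix_def)
  then show ?thesis unfolding Tm_def
    by (intro exI[of _ "subst_tm s (\<lambda>n. NVar (if even n then n + 2 else n))"] exI[of _ c])
      (simp add: s ev_subst)
qed

text \<open>This is \<Sigma>1 collection: a common bound for the witnesses is built up by \<Sigma>1
  induction on the length \<open>u\<close> of the initial segment.\<close>

lemma S1_all:
  assumes t: "Tm t" and "S1 (\<lambda>e. P (e 0) (\<lambda>n. e (Suc n)))" shows "S1 (\<lambda>e. \<forall>y<t e. P y e)"
proof -
  from assms(2) obtain Q where Q: "D0 (\<lambda>e. Q (e 0) (\<lambda>n. e (Suc n)))"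
    "\<And>e. P (e 0) (\<lambda>n. e (Suc n)) \<longleftrightarrow> (\<exists>z. Q z e)" unfolding Exs_def by blast
  have P: "P y e \<longleftrightarrow> (\<exists>z. Q z (case_nat y e))" for y e using Q(2)[of "case_nat y e"] by simp
  let ?g = "case_nat (Inl 0) (case_nat (Inl 1) (\<lambda>n. Inl (n + 3)))"
  have "(\<lambda>n. ren ?g e (Suc n)) = case_nat (e (Suc 0)) (\<lambda>n. e (Suc (Suc (Suc n))))" "ren ?g e 0 = e 0" for e
    by (auto simp: ren_def fun_eq_iff numeral_3_eq_3 split: nat.split)
  then have 1: "D0 (\<lambda>e. Q (e 0) (case_nat (e (Suc 0)) (\<lambda>n. e (Suc (Suc (Suc n))))))"
    using D0_ren[OF Q(1), of ?g] by simp
  \<comment> \<open>The induction takes place for a fixed \<open>e\<close>, so the remaining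
    variables become parameters.\<close>
  have 2: "D0 (\<lambda>e. Q (e 0) (case_nat (e (Suc 0)) d))" for d
  proof -
    let ?g = "case_nat (Inl 0) (case_nat (Inl 1) (\<lambda>n. Inr (d n)))"
    have "(\<lambda>n. ren ?g e (Suc n)) = case_nat (e (Suc 0)) d" "ren ?g e 0 = e 0" for e
      by (auto simp: ren_def fun_eq_iff split: nat.split)
    then show ?thesis using D0_ren[OF Q(1), of ?g] by simp
  qed
  show ?thesis
  proof (rule ExsI[where Q = "\<lambda>w e. \<forall>y<t e. \<exists>z\<le>w. Q z (case_nat y e)"])
    show "D0 (\<lambda>e. \<forall>y<t (\<lambda>n. e (Suc n)). \<exists>z\<le>e 0. Q z (case_nat y (\<lambda>n. e (Suc n))))"
      by (rule D0_all[OF Tm_ren[OF t]], rule D0_exle[OF Tm_var], rule 1)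
    fix e
    show "(\<forall>y<t e. P y e) \<longleftrightarrow> (\<exists>w. \<forall>y<t e. \<exists>z\<le>w. Q z (case_nat y e))"
    proof
      assume a: "\<forall>y<t e. P y e"
      have "\<exists>w. \<forall>y<u. y < t e \<longrightarrow> (\<exists>z\<le>w. Q z (case_nat y e))" for u
      proof (rule ind_S1[of "\<lambda>u. \<exists>w. \<forall>y<u. y < t e \<longrightarrow> (\<exists>z\<le>w. Q z (case_nat y e))"])
        show "S1 (\<lambda>e'. \<exists>w. \<forall>y<e' 0. y < t e \<longrightarrow> (\<exists>z\<le>w. Q z (case_nat y e)))"
          by (intro S1_ex S1_D0 D0_all D0_imp D0_less D0_exle Tm_var Tm_const 2)
        fix u assume "\<exists>w. \<forall>y<u. y < t e \<longrightarrow> (\<exists>z\<le>w. Q z (case_nat y e))"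
        then obtain w where w: "\<forall>y<u. y < t e \<longrightarrow> (\<exists>z\<le>w. Q z (case_nat y e))" ..
        obtain z where z: "u < t e \<Longrightarrow> Q z (case_nat u e)" using a P by blast
        have "\<forall>y<u + 1. y < t e \<longrightarrow> (\<exists>z'\<le>max w z. Q z' (case_nat y e))"
        proof (intro allI impI)
          fix y assume "y < u + 1" "y < t e"
          then consider "y < u" | "y = u" by (auto simp: le_less)
          then show "\<exists>z'\<le>max w z. Q z' (case_nat y e)"
            by cases (use w z \<open>y < t e\<close> in \<open>auto intro: le_max_iff_disj[THEN iffD2]\<close>)
        qed
        then show "\<exists>w. \<forall>y<u + 1. y < t e \<longrightarrow> (\<exists>z\<le>w. Q z (case_nat y e))" ..
      qed (simp add: not_less)
      from this[of "t e"] show "\<exists>w. \<forall>y<t e. \<exists>z\<le>w. Q z (case_nat y e)" by auto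
    qed (use P in blast)
  qed
qed

lemma S1_allle: "Tm t \<Longrightarrow> S1 (\<lambda>e. P (e 0) (\<lambda>n. e (Suc n))) \<Longrightarrow> S1 (\<lambda>e. \<forall>y\<le>t e. P y e)"
  using S1_all[where P = P, OF Tm_add[OF _ Tm_const[of 1]]] by simp

lemma closed_P1: "dclosed P1"
proof -
  have "P1 (\<lambda>e. P (ren f e))" if "P1 P" for P f
    using Exs_ren[OF closed_D0 that[unfolded P1_def]] by (simp add: P1_def)
  moreover have "P1 (\<lambda>e. P e \<and> Q e)" "P1 (\<lambda>e. P e \<or> Q e)" if "P1 P" "P1 Q" for P Q
    using S1_or S1_and that by (simp_all only: P1_def de_Morgan_conj de_Morgan_disj)
  moreover have "P1 (\<lambda>e. \<exists>y\<le>t e. P y e)" if "Tm t" "P1 (\<lambda>e. P (e 0) (\<lambda>n. e (Suc n)))" for t P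
    using S1_allle[of t "\<lambda>y e. \<not> P y e"] that by (simp add: P1_def)
  ultimately show ?thesis unfolding dclosed_def by blast
qed

lemmas S1_ren = Exs_ren[OF closed_D0]
lemmas S2_P1 = Exs_base[OF closed_P1]
lemmas S2_ex = Exs_ex[OF closed_P1]
lemmas S2_and = Exs_and[OF closed_P1]
lemmas S2_or = Exs_or[OF closed_P1]

lemma P2_S1: "S1 P \<Longrightarrow> P2 P"
  unfolding P2_def by (rule S2_P1) (simp add: P1_def)

lemma P2_all: "P2 (\<lambda>e. P (e 0) (\<lambda>n. e (Suc n))) \<Longrightarrow> P2 (\<lambda>e. \<forall>y. P y e)"
  unfolding P2_def using S2_ex[of "\<lambda>y e. \<not> P y e"] by simp

lemma P2_imp: "D0 P \<Longrightarrow> P2 Q \<Longrightarrow> P2 (\<lambda>e. P e \<longrightarrow> Q e)"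
  unfolding P2_def using S2_and[OF S2_D0, of P "\<lambda>e. \<not> Q e"] by simp

text \<open>Given a counterexample \<open>a\<close>, the \<Sigma>2 statement that some
  \<open>y\<close> with \<open>x + y = a\<close> is a counterexample is carried from
  \<open>x = 0\<close> to \<open>x = a\<close>, where it contradicts \<open>Q 0\<close>. The
  disjunct \<open>a < x\<close> makes it hold for all \<open>x\<close>.\<close>

lemma ind_P2:
  assumes "P2 (\<lambda>e. Q (e 0))" "Q 0" "\<And>x. Q x \<Longrightarrow> Q (x + 1)"
  shows "Q a"
proof (rule ccontr)
  assume a: "\<not> Q a"
  have "S2 (\<lambda>e. a < e 0 \<or> (\<exists>y. e 0 + y = a \<and> \<not> Q y))"
    by (intro S2_or S2_ex S2_and S2_D0 D0_eq D0_less Tm_add Tm_var Tm_const assms(1)[unfolded P2_def])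
  then have "a < x \<or> (\<exists>y. x + y = a \<and> \<not> Q y)" for x
  proof (rule ind_S2[of "\<lambda>x. a < x \<or> (\<exists>y. x + y = a \<and> \<not> Q y)"])
    show "a < 0 \<or> (\<exists>y. 0 + y = a \<and> \<not> Q y)" using a by simp
    fix x assume "a < x \<or> (\<exists>y. x + y = a \<and> \<not> Q y)"
    then show "a < x + 1 \<or> (\<exists>y. x + 1 + y = a \<and> \<not> Q y)"
    proof
      assume "\<exists>y. x + y = a \<and> \<not> Q y"
      then obtain y where y: "x + y = a" "\<not> Q y" by blast
      then have "y \<noteq> 0" using assms(2) by auto
      then obtain y' where "y = y' + 1" using succ_ex by blast
      then show ?thesis using y assms(3)[of y'] by (intro disjI2 exI[of _ y']) (auto simp: ac_simps)
    qed (simp add: less_imp_le)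
  qed
  from this[of a] assms(2) show False by simp
qed

text \<open>If there is no least element, the statement that no \<open>z < u\<close> satisfies
  \<open>Q\<close> is inductive in \<open>u\<close>; it is \<Sigma>1 by collection.\<close>

lemma least_P1:
  assumes P: "P1 (\<lambda>e. Q (e 0))" and x: "Q x"
  obtains y where "Q y" "\<And>z. z < y \<Longrightarrow> \<not> Q z"
proof -
  have "\<exists>y. Q y \<and> (\<forall>z<y. \<not> Q z)"
  proof (rule ccontr)
    assume n: "\<not> ?thesis"
    have "\<forall>z<u. \<not> Q z" for u
    proof (rule ind_S1[of "\<lambda>u. \<forall>z<u. \<not> Q z"])
      show "S1 (\<lambda>e. \<forall>z<e 0. \<not> Q z)" by (rule S1_all[OF Tm_var]) (use P in \<open>simp add: P1_def\<close>)
      show "\<forall>z<u + 1. \<not> Q z" if "\<forall>z<u. \<not> Q z" for u using that n by (auto simp: le_less)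
    qed (simp add: not_less)
    from this[of "x + 1"] x show False by auto
  qed
  then show thesis using that by blast
qed

text \<open>Found as the least \<open>u\<close> above which nothing up to \<open>n\<close> satisfies
  \<open>Q\<close>.\<close>

lemma greatest_D0:
  assumes D: "D0 (\<lambda>e. Q (e 0))" and x: "Q x" "x \<le> n"
  obtains y where "Q y" "y \<le> n" "\<And>z. y < z \<Longrightarrow> z \<le> n \<Longrightarrow> \<not> Q z"
proof -
  have "D0 (\<lambda>e. \<forall>z\<le>n. e 0 < z \<longrightarrow> \<not> Q z)"
    by (intro D0_allle D0_imp D0_not D0_less Tm_var Tm_const D)
  moreover have "\<forall>z\<le>n. n < z \<longrightarrow> \<not> Q z" by auto
  ultimately obtain u where u: "\<forall>z\<le>n. u < z \<longrightarrow> \<not> Q z"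
    "\<And>v. v < u \<Longrightarrow> \<not> (\<forall>z\<le>n. v < z \<longrightarrow> \<not> Q z)"
    by (rule least_P1[OF P1_D0, of "\<lambda>u. \<forall>z\<le>n. u < z \<longrightarrow> \<not> Q z" n]) (rule that)
  have "Q u \<and> u \<le> n"
  proof (cases "u = 0")
    case True
    then have "x = u" using u(1) x pos_iff by auto
    then show ?thesis using x by simp
  next
    case False
    then obtain v where v: "u = v + 1" using succ_ex by blast
    then obtain z where "z \<le> n" "v < z" "Q z" using u(2)[of v] by auto
    then have "z = u" using u(1) v by (metis add1_le le_less)
    then show ?thesis using \<open>z \<le> n\<close> \<open>Q z\<close> by simp
  qed
  then show thesis using u(1) by (auto intro: that)
qed

lemma sat_delta_comprehension: "sat (tstr SS) (delta_comprehension_axiom p q) e E \<longleftrightarrow>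
  ((\<forall>x. sat (tstr SS) p (case_nat x e) E \<longleftrightarrow> sat (tstr SS) q (case_nat x e) E) \<longrightarrow>
   (\<exists>S\<in>SS. \<forall>x. x \<in> S \<longleftrightarrow> sat (tstr SS) p (case_nat x e) E))"
  unfolding delta_comprehension_axiom_def by (simp add: iff_conv_conj_imp)

lemma comprehension:
  assumes "S1 (\<lambda>e. Q (e 0))" "S1 (\<lambda>e. \<not> Q (e 0))"
  shows "{x. Q x} \<in> SS"
proof -
  from assms obtain R1 R2 where R: "D0 (\<lambda>e. R1 (e 0) (\<lambda>n. e (Suc n)))" "\<And>e. Q (e 0) \<longleftrightarrow> (\<exists>y. R1 y e)"
    "D0 (\<lambda>e. R2 (e 0) (\<lambda>n. e (Suc n)))" "\<And>e. \<not> Q (e 0) \<longleftrightarrow> (\<exists>y. R2 y e)"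
    unfolding Exs_def by blast
  from D0_pair[OF R(1) D0_not[OF R(3)]] obtain p q c E where p: "p \<in> Delta00" "q \<in> Delta00" "\<And>n. E n \<in> SS"
    "\<And>e. R1 (e 0) (\<lambda>n. e (Suc n)) \<longleftrightarrow> sat (tstr SS) p (mix e c) E"
    "\<And>e. \<not> R2 (e 0) (\<lambda>n. e (Suc n)) \<longleftrightarrow> sat (tstr SS) q (mix e c) E" by metis
  \<comment> \<open>Variable 0 is the witness, every other even variable is read as
    \<open>x\<close>, and the odd ones become parameters of the axiom instance.\<close>
  let ?g = "\<lambda>n. if n = 0 then 0 else if even n then 1 else 2 + n div 2"
  let ?s = "\<lambda>p. subst p (\<lambda>n. NVar (?g n)) (\<lambda>n. n)"
  have g: "(\<lambda>n. case_nat y (case_nat x c) (?g n)) = mix (case_nat y (\<lambda>_. x)) c" for y x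
  proof
    fix n show "case_nat y (case_nat x c) (?g n) = mix (case_nat y (\<lambda>_. x)) c n"
    proof (cases "even n")
      case True
      then obtain k where "n = 2 * k" by auto
      then show ?thesis by (cases k) (auto simp: mix_def)
    qed (auto simp: mix_def numeral_2_eq_2)
  qed
  have 1: "sat (tstr SS) (Ex (?s p)) (case_nat x c) E \<longleftrightarrow> Q x" for x
    using R(2)[of "\<lambda>_. x"] p(4)[of "case_nat y (\<lambda>_. x)" for y] by (simp add: sat_ren g)
  have 2: "sat (tstr SS) (All (?s q)) (case_nat x c) E \<longleftrightarrow> Q x" for x
    using R(4)[of "\<lambda>_. x"] p(5)[of "case_nat y (\<lambda>_. x)" for y] by (simp add: sat_ren g) blast
  have "delta_comprehension_axiom (Ex (?s p)) (All (?s q)) \<in> RCA0"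
    unfolding RCA0_def Delta01_CA_def Sigma01_def Pi01_def using Delta00_subst p(1,2) by blast
  then have "sat (tstr SS) (delta_comprehension_axiom (Ex (?s p)) (All (?s q))) c E"
    using p(3) by (intro modelD UnI1)
  then have "\<exists>S\<in>SS. \<forall>x. x \<in> S \<longleftrightarrow> Q x"
    unfolding sat_delta_comprehension 1 2 by simp
  then obtain S where "S \<in> SS" "S = {x. Q x}" by blast
  then show ?thesis by simp
qed

end

section \<open>Coding of sequences\<close>

context rca
begin

lemmas D0_intros = D0_eq D0_less D0_le D0_const D0_imp D0_and D0_or D0_not D0_iff
  D0_all D0_ex D0_allle D0_exle Tm_var Tm_const Tm_add Tm_mult

lemma S1_imp: "D0 P \<Longrightarrow> S1 Q \<Longrightarrow> S1 (\<lambda>e. P e \<longrightarrow> Q e)"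
  unfolding imp_conv_disj by (rule S1_or[OF S1_D0[OF D0_not]])

lemma S1_sub2: "S1 (\<lambda>e. G (e 0) (e (Suc 0))) \<Longrightarrow> S1 (\<lambda>e. G (e k) (e l))"
  using S1_ren[of "\<lambda>e. G (e 0) (e (Suc 0))" "case_nat (Inl k) (\<lambda>_. Inl l)"] by (simp add: ren_def)

lemma le_mult_pos: "0 < (y::'a) \<Longrightarrow> x \<le> y * x"
  using mult_right_mono[of 1 y x] by (metis add1_le add_0 mult_1 zero_le)

section \<open>Division with remainder and the \<beta> function\<close>

lemma division: "0 < (m::'a) \<Longrightarrow> \<exists>q r. a = q * m + r \<and> r < m"
proof (rule ind_S1[of "\<lambda>a. \<exists>q r. a = q * m + r \<and> r < m"])
  assume m: "0 < m"
  show "S1 (\<lambda>e. \<exists>q r. e 0 = q * m + r \<and> r < m)"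
    by (intro S1_ex S1_D0 D0_intros)
  show "\<exists>q r. 0 = q * m + r \<and> r < m" using m by (intro exI[of _ 0]) simp
  fix a assume "\<exists>q r. a = q * m + r \<and> r < m"
  then obtain q r where qr: "a = q * m + r" "r < m" by blast
  show "\<exists>q r. a + 1 = q * m + r \<and> r < m"
  proof (cases "r + 1 = m")
    case True
    have "a + 1 = q * m + (r + 1)" using qr(1) by (simp add: add.assoc)
    also have "\<dots> = (q + 1) * m + 0" unfolding True by (simp add: distrib_right)
    finally show ?thesis using m by blast
  next
    case False
    then have "r + 1 < m" using qr(2) by (metis add1_le le_less)
    then show ?thesis using qr by (intro exI[of _ q] exI[of _ "r + 1"]) (simp add: algebra_simps)
  qed
qed

lemma division_less:
  assumes "q * m + r = q' * m + r'" "r < m" "q < q'" shows "r' < (0::'a)"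
proof -
  have "q * m + r < (q + 1) * m" using assms(2) by (simp add: algebra_simps)
  also have "(q + 1) * m \<le> q' * m" using assms(3) by (intro mult_right_mono) simp_all
  also have "q' * m \<le> q' * m + r'" by simp
  finally show ?thesis using assms(1) by simp
qed

lemma division_unique:
  assumes "q * m + r = q' * m + (r'::'a)" "r < m" "r' < m" shows "q = q' \<and> r = r'"
proof -
  have "q = q'" using division_less[OF assms(1,2)] division_less[OF assms(1)[symmetric] assms(3)]
    by (metis linorder_cases not_less_0)
  then show ?thesis using assms(1) by simp
qed

definition ent :: "'a \<Rightarrow> 'a \<Rightarrow> 'a \<Rightarrow> 'a" where
  "ent a d i = (THE v. sentry a d i v)"

lemma sentry_iff: "sentry a d i v \<longleftrightarrow> v = ent a d i"
proof -
  let ?m = "1 + (i + 1) * d"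
  have "0 < ?m" by (simp add: pos_iff add_nonneg_eq_0_iff)
  from division[OF this, of a] obtain q r where "a = q * ?m + r" "r < ?m" by blast
  then have r: "sentry a d i r" unfolding sentry_def by blast
  have u: "v = r" if "sentry a d i v" for v
    using that r unfolding sentry_def by (metis division_unique)
  then have "ent a d i = r" unfolding ent_def using r by blast
  then show ?thesis using u r by blast
qed

lemma sentry_bounded:
  "sentry (a::'a) d i v \<longleftrightarrow> v < 1 + (i + 1) * d \<and> (\<exists>q\<le>a. a = q * (1 + (i + 1) * d) + v)"
proof -
  have "q \<le> q * (1 + (i + 1) * d) + v" for q v :: 'a by (simp add: algebra_simps)
  then show ?thesis unfolding sentry_def by metis
qed

lemma ent_le: "ent a d i \<le> a"
proof -
  have "sentry a d i (ent a d i)" by (simp add: sentry_iff)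
  then show ?thesis unfolding sentry_def by (metis add_increasing order_refl zero_le)
qed

lemma D0_sentry: "Tm a \<Longrightarrow> Tm d \<Longrightarrow> Tm i \<Longrightarrow> Tm v \<Longrightarrow> D0 (\<lambda>e. sentry (a e) (d e) (i e) (v e))"
  unfolding sentry_bounded
proof (intro D0_and D0_exle D0_less D0_eq Tm_add Tm_mult Tm_var Tm_const)
qed (assumption | rule Tm_ren)+

text \<open>With \<open>M\<close> and \<open>J\<close> the moduli of \<open>m\<close> and
  \<open>j\<close>, one has \<open>(j + 1) M - (m + 1) J = j - m = s\<close>. As \<open>s\<close>
  divides \<open>d\<close> and \<open>(j + 1) d = J - 1\<close>, a multiple of \<open>M\<close> is
  -1 modulo \<open>J\<close>.\<close>

lemma invertible:
  fixes d :: 'a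
  assumes "j = m + s" "0 < d" "d = s * q"
  shows "\<exists>x y. (1 + (m + 1) * d) * x = (1 + (j + 1) * d) * y + 1"
proof -
  let ?M = "1 + (m + 1) * d" and ?J = "1 + (j + 1) * d"
  let ?z = "q * (j + 1) * (j + 1)" and ?Y = "q * (j + 1) * (m + 1) + 1"
  let ?u = "?M * ?z"
  have "(j + 1) * ?M = (m + 1) * ?J + s" using assms(1) by (simp add: algebra_simps)
  then have "(j + 1) * q * ((j + 1) * ?M) = (j + 1) * q * ((m + 1) * ?J + s)" by simp
  then have 1: "?u + 1 = ?J * ?Y" using assms(3) by (simp add: algebra_simps)
  define U J Y where "U = ?u" "J = ?J" "Y = ?Y"
  have 2: "U + 1 = J * Y" using 1 unfolding U_J_Y_def .
  have "U \<noteq> 0" using assms(2,3) by (auto simp: add_nonneg_eq_0_iff U_J_Y_def)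
  then obtain u' where u: "U = u' + 1" using succ_ex by blast
  \<comment> \<open>Squaring the residue -1 of \<open>U\<close> gives the residue 1 without negative
    numbers.\<close>
  have "U * U + J * Y = U * (U + 1) + 1" unfolding 2[symmetric] by (simp add: algebra_simps)
  also have "\<dots> = (u' + 1) * (J * Y) + 1" using 2 u by metis
  also have "\<dots> = (J * (u' * Y) + 1) + J * Y" by (simp add: algebra_simps)
  finally have "U * U = J * (u' * Y) + 1" by simp
  then have "?M * (?z * U) = ?J * (u' * Y) + 1" unfolding U_J_Y_def by (simp only: mult.assoc)
  then show ?thesis by blast
qed

text \<open>\<open>G\<close> has to be total up to \<open>n\<close> but may be many-valued.
  Collection bounds suitable values by \<open>w\<close>, and the code is then extended entry by
  entry by Chinese remaindering.\<close>

theorem beta: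
  assumes G: "S1 (\<lambda>e. G (e 0) (e (Suc 0)))" and tot: "\<And>i. i \<le> n \<Longrightarrow> \<exists>v. G i v"
  shows "\<exists>a d. \<forall>i\<le>n. G i (ent a d i)"
proof -
  have "\<exists>w. \<forall>i<u. i \<le> n \<longrightarrow> (\<exists>v. v \<le> w \<and> G i v)" for u
  proof (rule ind_S1[of "\<lambda>u. \<exists>w. \<forall>i<u. i \<le> n \<longrightarrow> (\<exists>v. v \<le> w \<and> G i v)"])
    show "S1 (\<lambda>e. \<exists>w. \<forall>i<e 0. i \<le> n \<longrightarrow> (\<exists>v. v \<le> w \<and> G i v))"
      by (intro S1_ex S1_all S1_imp S1_and S1_sub2[OF G] S1_D0 D0_le D0_less Tm_var Tm_const)
    fix u assume "\<exists>w. \<forall>i<u. i \<le> n \<longrightarrow> (\<exists>v. v \<le> w \<and> G i v)"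
    then obtain w where w: "\<And>i. i < u \<Longrightarrow> i \<le> n \<Longrightarrow> \<exists>v. v \<le> w \<and> G i v" by blast
    obtain z where z: "u \<le> n \<Longrightarrow> G u z" using tot by blast
    have "\<exists>v. v \<le> max w z \<and> G i v" if "i < u + 1" "i \<le> n" for i
    proof (cases "i = u")
      case True
      then show ?thesis using z that by (metis max.cobounded2)
    next
      case False
      then have "i < u" using that by (simp add: le_less)
      then show ?thesis using w that by (metis max.coboundedI1)
    qed
    then show "\<exists>w. \<forall>i<u + 1. i \<le> n \<longrightarrow> (\<exists>v. v \<le> w \<and> G i v)" by blast
  qed simp
  from this[of "n + 1"] obtain w where w: "\<And>i. i \<le> n \<Longrightarrow> \<exists>v. v \<le> w \<and> G i v" by auto
  \<comment> \<open>In place of a factorial. Divisibility by \<open>w + 1\<close> makes the moduli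
    exceed all values; divisibility by the differences \<open>j - m\<close> makes them pairwise
    coprime.\<close>
  have "\<exists>d. 0 < d \<and> (\<forall>j\<le>u. 0 < j \<longrightarrow> (\<exists>q\<le>d. d = j * q))" for u :: 'a
  proof (rule ind_S1[of "\<lambda>u. \<exists>d. 0 < d \<and> (\<forall>j\<le>u. 0 < j \<longrightarrow> (\<exists>q\<le>d. d = j * q))"])
    show "S1 (\<lambda>e. \<exists>d. 0 < d \<and> (\<forall>j\<le>e 0. 0 < j \<longrightarrow> (\<exists>q\<le>d. d = j * q)))"
      by (intro S1_ex S1_D0 D0_intros)
    fix u :: 'a assume "\<exists>d. 0 < d \<and> (\<forall>j\<le>u. 0 < j \<longrightarrow> (\<exists>q\<le>d. d = j * q))"
    then obtain d where d: "0 < d" "\<And>j. j \<le> u \<Longrightarrow> 0 < j \<Longrightarrow> \<exists>q\<le>d. d = j * q" by blast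
    have "\<exists>q\<le>(u + 1) * d. (u + 1) * d = j * q" if T: "j \<le> u + 1" "0 < j" for j
    proof -
      have "\<exists>q. (u + 1) * d = j * q"
      proof (cases "j = u + 1")
        case False
        then have "j \<le> u" using T(1) by (metis le_less less_add1)
        then obtain q where "d = j * q" using d(2) T(2) by blast
        then show ?thesis by (metis mult.left_commute)
      qed auto
      then show ?thesis using le_mult_pos[OF T(2)] by metis
    qed
    moreover have "0 < (u + 1) * d" using d(1) by (simp add: pos_iff add_nonneg_eq_0_iff)
    ultimately show "\<exists>d. 0 < d \<and> (\<forall>j\<le>u + 1. 0 < j \<longrightarrow> (\<exists>q\<le>d. d = j * q))" by blast
  qed (auto intro!: exI[of _ 1])
  from this[of "n + w + 1"] obtain d where d: "0 < d" "\<And>j. j \<le> n + w + 1 \<Longrightarrow> 0 < j \<Longrightarrow> \<exists>q\<le>d. d = j * q" by blast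
  have wd: "w < d"
  proof -
    obtain q where q: "d = (w + 1) * q" using d(2)[of "w + 1"] by (auto simp: add_increasing pos_iff add_nonneg_eq_0_iff)
    then have "0 < q" using d(1) by (auto simp: pos_iff)
    then have "w + 1 \<le> d" using le_mult_pos[of q "w + 1"] q by (simp add: mult.commute)
    then show ?thesis by simp
  qed
  let ?m = "\<lambda>i. 1 + (i + 1) * d"
  have vm: "v < ?m i" if T: "v \<le> w" for v i
  proof -
    have "v < d" using T wd by simp
    also have "d \<le> ?m i" by (simp add: algebra_simps add_increasing)
    finally show ?thesis .
  qed
  \<comment> \<open>\<open>P\<close> is a common multiple of the moduli treated so far and
    invertible modulo all later ones, while \<open>a\<close> already has the right
    remainders.\<close>
  define K where "K a P m \<longleftrightarrow> (\<forall>i<m. \<exists>q\<le>P. P = ?m i * q) \<and>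
    (\<forall>j\<le>n. m \<le> j \<longrightarrow> (\<exists>x y. P * x = ?m j * y + 1)) \<and>
    (\<forall>i<m. \<exists>v. G i v \<and> sentry a d i v)" for a P m
  have "n + 1 < m \<or> (\<exists>a P. K a P m)" for m
  proof (rule ind_S1[of "\<lambda>m. n + 1 < m \<or> (\<exists>a P. K a P m)"])
    show "S1 (\<lambda>e. n + 1 < e 0 \<or> (\<exists>a P. K a P (e 0)))"
      unfolding K_def
      by (intro S1_or S1_ex S1_and S1_all S1_allle S1_imp S1_sub2[OF G]; intro S1_D0 D0_sentry D0_intros)
    show "n + 1 < 0 \<or> (\<exists>a P. K a P 0)"
    proof -
      have "\<exists>x y. (1::'a) * x = ?m j * y + 1" for j by (rule exI[of _ 1], rule exI[of _ 0]) simp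
      then have "K 0 1 0" unfolding K_def by simp
      then show ?thesis by blast
    qed
    fix m assume "n + 1 < m \<or> (\<exists>a P. K a P m)"
    then consider "n + 1 < m" | "\<exists>a P. K a P m" by blast
    then show "n + 1 < m + 1 \<or> (\<exists>a P. K a P (m + 1))"
    proof cases
      case 1
      then have "n + 1 \<le> m" by (rule less_imp_le)
      then show ?thesis by simp
    next
      case 2
      then obtain a P where K: "K a P m" by blast
      show ?thesis
      proof (cases "m \<le> n")
        case False
        then show ?thesis by (simp add: not_le)
      next
        case mn: True
        obtain v where v: "v \<le> w" "G m v" using w mn by blast
        obtain x y where xy: "P * x = ?m m * y + 1" using K mn unfolding K_def by blast
        \<comment> \<open>\<open>P * x\<close> is 1 modulo the new modulus, and
          \<open>a + a * ((m + 1) * d)\<close> is a multiple of that modulus. Adding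
          \<open>P * ?t\<close> thus replaces the remainder of \<open>a\<close> by \<open>v\<close>
          without a subtraction.\<close>
        let ?t = "x * (v + a * ((m + 1) * d))"
        let ?a = "a + P * ?t"
        have "?a = a + (P * x) * (v + a * ((m + 1) * d))" by (simp add: algebra_simps)
        also have "\<dots> = (a + y * (v + a * ((m + 1) * d))) * ?m m + v" unfolding xy by (simp add: algebra_simps)
        finally have am: "sentry ?a d m v" unfolding sentry_def using vm[OF v(1)] by blast
        have ai: "sentry ?a d i u" if T: "i < m" "sentry a d i u" for i u
        proof -
          obtain q where "P = ?m i * q" using K T(1) unfolding K_def by blast
          moreover obtain q' where "a = q' * ?m i + u" using T(2) unfolding sentry_def by blast
          ultimately have "?a = (q' + q * ?t) * ?m i + u" by (simp add: algebra_simps)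
          then show ?thesis using T(2) unfolding sentry_def by blast
        qed
        have P1: "\<exists>q\<le>P * ?m m. P * ?m m = ?m i * q" if T: "i < m + 1" for i
        proof -
          have "\<exists>q. P * ?m m = ?m i * q"
          proof (cases "i = m")
            case False
            then have "i < m" using T by (simp add: le_less)
            then obtain q where "P = ?m i * q" using K unfolding K_def by blast
            then show ?thesis by (metis mult.assoc)
          qed (auto simp: mult.commute)
          moreover have "q \<le> ?m i * q" for q by (rule le_mult_pos) (simp add: pos_iff add_nonneg_eq_0_iff)
          ultimately show ?thesis by metis
        qed
        have P2: "\<exists>x y. P * ?m m * x = ?m j * y + 1" if T: "j \<le> n" "m + 1 \<le> j" for j
        proof -
          have "m < j" using T(2) by simp
          then obtain s where s: "j = m + s" "0 < s" by (metis A.lt_imp tstr_sel(2,3,5) add_pos_nonneg zero_le zero_less_one add.commute)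
          have "s \<le> n + w + 1" using T(1) s(1) by (metis add_increasing2 add_increasing order_trans add.assoc zero_le order_refl add_left_mono)
          then obtain q where "d = s * q" using d(2) s(2) by blast
          then obtain x2 y2 where 2: "?m m * x2 = ?m j * y2 + 1" using invertible[OF s(1) d(1)] by blast
          obtain x1 y1 where 1: "P * x1 = ?m j * y1 + 1" using K T \<open>m < j\<close> unfolding K_def by (meson less_imp_le)
          have "P * ?m m * (x1 * x2) = (P * x1) * (?m m * x2)" by (simp only: ac_simps)
          also have "\<dots> = ?m j * (?m j * y1 * y2 + y1 + y2) + 1" unfolding 1 2 by (simp add: algebra_simps)
          finally show ?thesis by blast
        qed
        have P3: "\<exists>v. G i v \<and> sentry ?a d i v" if T: "i < m + 1" for i
        proof (cases "i = m")
          case True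
          then show ?thesis using am v by blast
        next
          case False
          then have "i < m" using T by (simp add: le_less)
          then show ?thesis using K ai unfolding K_def by blast
        qed
        have "K ?a (P * ?m m) (m + 1)" unfolding K_def using P1 P2 P3 by blast
        then show ?thesis by blast
      qed
    qed
  qed
  from this[of "n + 1"] obtain a P where "K a P (n + 1)" by auto
  then have "\<forall>i\<le>n. \<exists>v. G i v \<and> sentry a d i v" unfolding K_def by simp
  then show ?thesis unfolding sentry_iff by blast
qed

lemma ent_eq_iff: "ent a d i = v \<longleftrightarrow> sentry a d i v"
  by (auto simp: sentry_iff)

lemma D0_ent: "Tm a \<Longrightarrow> Tm d \<Longrightarrow> Tm i \<Longrightarrow> Tm v \<Longrightarrow> D0 (\<lambda>e. ent (a e) (d e) (i e) = v e)"
  unfolding ent_eq_iff by (rule D0_sentry)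

lemma two_le: "2 \<le> (b::'a) \<Longrightarrow> 1 < b"
  by (metis add1_le one_add_one)

lemma le1_cases: "e = 0 \<or> e = 1 \<or> 2 \<le> (e::'a)"
  by (metis add1_le not_less pos_iff one_add_one le_less not_less_0 add_0)

lemma less_1_iff: "i < 1 \<longleftrightarrow> i = (0::'a)"
  using less_add1[of i 0] by (auto simp: le_less)

section \<open>Powers and decompositions with exponent 1\<close>

lemma spow_1: "spow (b::'a) 1 v \<longleftrightarrow> v = b"
proof
  assume "spow b 1 v"
  then obtain a d where *: "sentry a d 0 1" "\<forall>i<1. \<exists>u. sentry a d i u \<and> sentry a d (i + 1) (u * b)" "sentry a d 1 v"
    unfolding spow_def by blast
  from *(2) obtain u where "sentry a d 0 u" "sentry a d 1 (u * b)" by force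
  then show "v = b" using * by (simp add: sentry_iff)
next
  assume v: "v = b"
  let ?G = "\<lambda>(i::'a) v. (i = 0 \<longrightarrow> v = 1) \<and> (i = 1 \<longrightarrow> v = b)"
  have "\<exists>a d. \<forall>i\<le>1. ?G i (ent a d i)"
  proof (rule beta)
    show "S1 (\<lambda>e. ?G (e 0) (e (Suc 0)))" by (intro S1_D0 D0_intros)
    show "\<exists>v. ?G i v" for i by (rule exI[of _ "if i = 0 then 1 else b"]) simp
  qed
  then obtain a d where "\<And>i. i \<le> 1 \<Longrightarrow> ?G i (ent a d i)" by blast
  from this[of 0] this[of 1] have "ent a d 0 = 1" "ent a d 1 = b" by simp_all
  then have "\<exists>u. sentry a d i u \<and> sentry a d (i + 1) (u * b)" if "i < 1" for i
    using that by (simp add: less_1_iff sentry_iff)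
  then show "spow b 1 v" unfolding spow_def v
    by (intro exI[of _ a] exI[of _ d]) (simp add: sentry_iff \<open>ent a d 0 = 1\<close> \<open>ent a d 1 = b\<close>)
qed

lemma less_2_iff: "i < 2 \<longleftrightarrow> i = 0 \<or> i = (1::'a)"
  using less_add1[of i 1] le1_cases[of i] by auto

lemma spow_2: "spow (b::'a) 2 v \<longleftrightarrow> v = b * b"
proof
  assume "spow b 2 v"
  then obtain a d where *: "sentry a d 0 1" "\<forall>i<2. \<exists>u. sentry a d i u \<and> sentry a d (i + 1) (u * b)" "sentry a d 2 v"
    unfolding spow_def by blast
  obtain u u' where "sentry a d 0 u" "sentry a d 1 (u * b)" "sentry a d 1 u'" "sentry a d 2 (u' * b)"
    using *(2)[rule_format, of 0] *(2)[rule_format, of 1] by (auto simp: less_2_iff)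
  then show "v = b * b" using * by (simp add: sentry_iff)
next
  assume v: "v = b * b"
  let ?G = "\<lambda>(i::'a) v. (i = 0 \<longrightarrow> v = 1) \<and> (i = 1 \<longrightarrow> v = b) \<and> (i = 2 \<longrightarrow> v = b * b)"
  have "\<exists>a d. \<forall>i\<le>2. ?G i (ent a d i)"
  proof (rule beta)
    show "S1 (\<lambda>e. ?G (e 0) (e (Suc 0)))" by (intro S1_D0 D0_intros)
    show "\<exists>v. ?G i v" for i by (rule exI[of _ "if i = 0 then 1 else if i = 1 then b else b * b"]) simp
  qed
  then obtain a d where "\<And>i. i \<le> 2 \<Longrightarrow> ?G i (ent a d i)" by blast
  from this[of 0] this[of 1] this[of 2] have "ent a d 0 = 1" "ent a d 1 = b" "ent a d 2 = b * b"
    by simp_all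
  then have "\<exists>u. sentry a d i u \<and> sentry a d (i + 1) (u * b)" if "i < 2" for i
    using that by (auto simp: less_2_iff sentry_iff)
  then show "spow b 2 v" unfolding spow_def v
    by (intro exI[of _ a] exI[of _ d]) (simp add: sentry_iff \<open>ent a d 0 = 1\<close> \<open>ent a d 2 = b * b\<close>)
qed

text \<open>Excludes exponents of at least 2 for numbers below \<open>b * b\<close>; the induction
  runs over the exponents \<open>i + 2\<close>.\<close>

lemma spow_ge:
  assumes "spow (b::'a) e v" "2 \<le> e" "1 \<le> b" shows "b * b \<le> v"
proof -
  from assms(1) obtain a d where *: "ent a d 0 = 1" "\<And>i. i < e \<Longrightarrow> ent a d (i + 1) = ent a d i * b" "ent a d e = v"
    unfolding spow_def by (auto simp: sentry_iff)
  have "\<exists>v. ent a d (i + 2) = v \<and> (i + 2 \<le> e \<longrightarrow> b * b \<le> v)" for i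
  proof (rule ind_S1[of "\<lambda>i. \<exists>v. ent a d (i + 2) = v \<and> (i + 2 \<le> e \<longrightarrow> b * b \<le> v)"])
    show "S1 (\<lambda>e'. \<exists>v. ent a d (e' 0 + 2) = v \<and> (e' 0 + 2 \<le> e \<longrightarrow> b * b \<le> v))"
      by (intro S1_ex S1_D0 D0_ent D0_intros)
    have "1 < e" using two_le assms(2) by blast
    then have "0 < e" using zero_less_one by (rule less_trans[rotated])
    then have "ent a d (0 + 1) = 1 * b" "ent a d (1 + 1) = ent a d 1 * b"
      using *(1) *(2)[of 0] *(2)[of 1] \<open>1 < e\<close> by simp_all
    then show "\<exists>v. ent a d (0 + 2) = v \<and> (0 + 2 \<le> e \<longrightarrow> b * b \<le> v)" by simp
    fix i assume "\<exists>v. ent a d (i + 2) = v \<and> (i + 2 \<le> e \<longrightarrow> b * b \<le> v)"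
    then have i: "i + 2 \<le> e \<Longrightarrow> b * b \<le> ent a d (i + 2)" by blast
    have "b * b \<le> ent a d (i + 1 + 2)" if "i + 1 + 2 \<le> e"
    proof -
      have "i + 2 < e" using that by (simp add: ac_simps flip: add1_le)
      then have "ent a d (i + 2 + 1) = ent a d (i + 2) * b" "b * b \<le> ent a d (i + 2)" using * i by auto
      moreover have "ent a d (i + 2) \<le> ent a d (i + 2) * b" using mult_left_mono[OF assms(3), of "ent a d (i + 2)"] by simp
      ultimately show ?thesis by (simp add: ac_simps)
    qed
    then show "\<exists>v. ent a d (i + 1 + 2) = v \<and> (i + 1 + 2 \<le> e \<longrightarrow> b * b \<le> v)" by blast
  qed
  moreover obtain i where "e = i + 2" using assms(2) A.le_iff[of 2 e] by (auto simp: le_less add.commute)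
  ultimately show ?thesis using *(3) by auto
qed

lemma sdecomp_iff:
  assumes "2 \<le> (b::'a)" "b \<le> n" "n < b * b"
  shows "sdecomp b n e f r \<longleftrightarrow> e = 1 \<and> n = b * f + r \<and> 0 < f \<and> f < b \<and> r < b"
proof
  assume "sdecomp b n e f r"
  then obtain p p' where *: "spow b e p" "spow b (e + 1) p'" "n = p * f + r" "p \<le> n" "n < p'" "0 < f" "f < b" "r < p"
    unfolding sdecomp_def by blast
  have "e = 1"
  proof (rule ccontr)
    assume "e \<noteq> 1"
    then consider "e = 0" | "2 \<le> e" using le1_cases by blast
    then show False
    proof cases
      case 1
      then have "p' = b" using *(2) by (simp add: spow_1)
      then show False using * assms by simp
    next
      case 2
      then have "b * b \<le> p" using spow_ge[OF *(1)] two_le[OF assms(1)] by simp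
      then show False using * assms by (meson leD le_less_trans order_trans)
    qed
  qed
  then show "e = 1 \<and> n = b * f + r \<and> 0 < f \<and> f < b \<and> r < b" using * by (simp add: spow_1)
next
  assume "e = 1 \<and> n = b * f + r \<and> 0 < f \<and> f < b \<and> r < b"
  then show "sdecomp b n e f r"
    unfolding sdecomp_def using assms by (intro exI[of _ b] exI[of _ "b * b"]) (auto simp: spow_1 spow_2)
qed

lemma decomp_ex:
  assumes "b \<le> n" "n < b * b"
  obtains f r where "n = b * f + r" "0 < f" "f < b" "r < (b::'a)"
proof -
  have "0 < b" using assms by (auto simp: pos_iff)
  then obtain f r where fr: "n = f * b + r" "r < b" using division by blast
  have "f \<noteq> 0" using fr assms(1) by auto
  moreover have "f < b"
  proof (rule ccontr)
    assume "\<not> f < b"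
    then have "b * b \<le> f * b" by (intro mult_right_mono) (auto simp: not_less)
    then have "b * b \<le> n" using fr(1) by (simp add: add_increasing2)
    then show False using assms(2) by simp
  qed
  ultimately show thesis using fr that[of f r] by (simp add: mult.commute pos_iff)
qed

text \<open>Below \<open>b\<^sup>2\<close> the exponent in a base change is always 1.\<close>

lemma schange_iff:
  assumes b: "2 \<le> (b::'a)" "b \<le> n" "n < b * b" and one: "ent a d 1 = 1"
  shows "schange a d b c n v \<longleftrightarrow> (\<exists>f r. n = b * f + r \<and> r < b \<and> v = c * ent a d f + ent a d r)"
proof
  assume "schange a d b c n v"
  then obtain a' d' where **: "\<And>m. m \<le> n \<Longrightarrow> (m < b \<longrightarrow> (\<exists>u. u = ent a d m \<and> u = ent a' d' m)) \<and>
      (b \<le> m \<longrightarrow> (\<exists>e f r. sdecomp b m e f r \<and>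
        (\<exists>x p y z. x = ent a' d' e \<and> spow c x p \<and> y = ent a d f \<and> z = ent a' d' r \<and>
          p * y + z = ent a' d' m)))" "v = ent a' d' n"
    unfolding schange_def sentry_iff by blast
  have *: "ent a' d' m = ent a d m" if "m \<le> n" "m < b" for m using **(1)[OF that(1)] that(2) by simp
  from **(1)[OF order_refl] b(2)
  have "\<exists>e f r. sdecomp b n e f r \<and> (\<exists>p. spow c (ent a' d' e) p \<and> p * ent a d f + ent a' d' r = ent a' d' n)"
    by simp
  then obtain f r p where 2: "n = b * f + r" "0 < f" "f < b" "r < b"
    "spow c (ent a' d' 1) p" "ent a' d' n = p * ent a d f + ent a' d' r"
    unfolding sdecomp_iff[OF b] by auto
  have 1: "1 < b" using two_le b(1) by blast
  then have "ent a' d' 1 = 1" using *[of 1] one b(2) by auto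
  then have "p = c" using 2(5) by (simp add: spow_1)
  moreover have "ent a' d' r = ent a d r" using *[of r] 2(4) b(2) by auto
  ultimately show "\<exists>f r. n = b * f + r \<and> r < b \<and> v = c * ent a d f + ent a d r" using 2 **(2) by (intro exI[of _ f] exI[of _ r]) simp
next
  assume "\<exists>f r. n = b * f + r \<and> r < b \<and> v = c * ent a d f + ent a d r"
  then obtain f0 r0 where v: "n = b * f0 + r0" "r0 < b" "v = c * ent a d f0 + ent a d r0" by blast
  \<comment> \<open>The graph of the base change. The values \<open>y\<close> and \<open>z\<close>
    are bounded by the code \<open>a\<close>, so all quantifiers are bounded and \<open>beta\<close>
    applies to a \<Delta>0 predicate.\<close>
  let ?G = "\<lambda>m v. (m < b \<longrightarrow> ent a d m = v) \<and> (b \<le> m \<longrightarrow> (\<exists>f\<le>m. \<exists>r<b. m = b * f + r \<and>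
     (\<exists>y\<le>a. ent a d f = y \<and> (\<exists>z\<le>a. ent a d r = z \<and> v = c * y + z))))"
  have bm: "m < b * b" if "m \<le> n" for m using that b(3) by simp
  have b0: "0 < b" using b(1) by (auto simp: pos_iff)
  have G: "?G m v \<longleftrightarrow> v = c * ent a d f + ent a d r" if "m = b * f + r" "r < b" "b \<le> m" for m f r v
  proof -
    have "f \<le> m" using le_mult_pos[OF b0, of f] that(1) by (simp add: add_increasing2)
    moreover have "f' = f \<and> r' = r" if "m = b * f' + r'" "r' < b" for f' r'
      using division_unique[of f' b r' f r] that \<open>m = b * f + r\<close> \<open>r < b\<close> by (simp add: mult.commute)
    ultimately show ?thesis using that ent_le by (metis not_le)
  qed
  have "\<exists>a' d'. \<forall>m\<le>n. ?G m (ent a' d' m)"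
  proof (rule beta)
    show "S1 (\<lambda>e. ?G (e 0) (e (Suc 0)))"
      by (intro S1_D0 D0_ent D0_intros)
    show "\<exists>v. ?G m v" if T: "m \<le> n" for m
    proof (cases "m < b")
      case False
      then obtain f r where "m = b * f + r" "r < b" using decomp_ex[of b m] bm[OF T] by (metis not_le)
      then show ?thesis using G[of m f r] False by (metis not_le)
    qed auto
  qed
  then obtain a' d' where G': "\<And>m. m \<le> n \<Longrightarrow> ?G m (ent a' d' m)" by blast
  have lo: "ent a' d' m = ent a d m" if "m \<le> n" "m < b" for m using G'[OF that(1)] that(2) by simp
  have hi: "ent a' d' m = c * ent a d f + ent a d r" if "m \<le> n" "m = b * f + r" "r < b" "b \<le> m" for m f r
    using G'[OF that(1)] G[OF that(2-)] by blast
  have b1: "1 < b" using two_le b(1) by blast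
  have "\<exists>e f r. sdecomp b m e f r \<and> (\<exists>p. spow c (ent a' d' e) p \<and> p * ent a d f + ent a' d' r = ent a' d' m)"
    if m: "m \<le> n" "b \<le> m" for m
  proof -
    obtain f r where fr: "m = b * f + r" "0 < f" "f < b" "r < b" using decomp_ex[OF m(2) bm[OF m(1)]] by blast
    have "sdecomp b m 1 f r" using sdecomp_iff[OF b(1) m(2) bm[OF m(1)]] fr by blast
    moreover have "ent a' d' 1 = 1" using lo[of 1] b1 b(2) one by auto
    moreover have "ent a' d' r = ent a d r" using lo[of r] fr(4) b(2) by auto
    ultimately show ?thesis using hi[OF m(1) fr(1,4) m(2)] spow_1[of c c] by metis
  qed
  moreover have "v = ent a' d' n" using hi[OF order_refl v(1,2) b(2)] v(3) by simp
  ultimately show "schange a d b c n v"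
    unfolding schange_def sentry_iff by - (rule exI[of _ a'], rule exI[of _ d'], simp add: lo)
qed

end

section \<open>The upgrade operator\<close>

definition bs :: "'a::linordered_semidom set \<Rightarrow> 'a \<Rightarrow> 'a \<Rightarrow> bool" where
  "bs B n b \<longleftrightarrow> b \<in> B \<and> b \<le> n \<and> (\<forall>x\<le>n. x \<in> B \<longrightarrow> x \<le> b)"

definition adm :: "'a::linordered_semidom set \<Rightarrow> 'a \<Rightarrow> 'a \<Rightarrow> 'a \<Rightarrow> 'a \<Rightarrow> bool" where
  "adm C u y z c \<longleftrightarrow> u < c * y + z \<and> slessS (c * y + z) C c"

definition least_adm :: "'a::linordered_semidom set \<Rightarrow> 'a \<Rightarrow> 'a \<Rightarrow> 'a \<Rightarrow> 'a \<Rightarrow> bool" where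
  "least_adm C u y z c \<longleftrightarrow> c \<in> C \<and> adm C u y z c \<and> (\<forall>c'<c. c' \<in> C \<longrightarrow> \<not> adm C u y z c')"

text \<open>The recursion clause of the upgrade operator, when all exponents are 1.\<close>

definition stepg :: "'a::linordered_semidom set \<Rightarrow> 'a set \<Rightarrow> ('a \<Rightarrow> 'a) \<Rightarrow> 'a \<Rightarrow> bool" where
  "stepg B C g m \<longleftrightarrow> ((\<forall>x\<le>m. x \<notin> B) \<longrightarrow> g m = m) \<and>
     (\<forall>b\<le>m. \<forall>f\<le>m. \<forall>r\<le>m. \<forall>m'\<le>m. bs B m b \<and> m = b * f + r \<and> r < b \<and> m' + 1 = m \<longrightarrow>
       (\<exists>c. least_adm C (g m') (g f) (g r) c \<and> g m = c * g f + g r))"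

lemma stepgD:
  assumes s: "stepg B C g m" and a: "bs B m b" "m = b * f + r" "r < b" "m' + 1 = m" "f \<le> m" "r \<le> m" "m' \<le> m"
  shows "\<exists>c. least_adm C (g m') (g f) (g r) c \<and> g m = c * g f + g r"
proof -
  have "b \<le> m" using a(1) by (simp add: bs_def)
  from conjunct2[OF s[unfolded stepg_def], rule_format, OF this a(5,6,7)] a(1,2,3,4) show ?thesis by blast
qed

context rca
begin

definition supn :: "'a set \<Rightarrow> 'a set \<Rightarrow> 'a \<Rightarrow> 'a \<Rightarrow> bool" where
  "supn B C n v \<longleftrightarrow> (\<exists>a d. (\<forall>m\<le>n. stepg B C (ent a d) m) \<and> ent a d n = v)"

text \<open>\<open>K\<close> stands for the least base of the first hierarchy. With ratios at most
  \<open>K\<close> and bases at least \<open>K\<close>, the next base after \<open>b\<close> is at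
  most \<open>b * b\<close>, and leading coefficients are smaller than every base, so upgrades leave
  them unchanged.\<close>

definition RB :: "'a \<Rightarrow> 'a set \<Rightarrow> bool" where
  "RB K B \<longleftrightarrow> B \<in> SS \<and> shier B \<and> (\<forall>b\<in>B. \<exists>s. sS B b s \<and> s \<le> b * K) \<and> (\<forall>b\<in>B. K \<le> b)"

lemma D0_mb: "Y \<in> SS \<Longrightarrow> Tm i \<Longrightarrow> Tm t \<Longrightarrow> D0 (\<lambda>e. t e \<in> mb Y (i e))"
  unfolding mb_def mem_Collect_eq by (intro D0_mem Tm_add Tm_mult)

lemma sS_iff: "sS (B::'a set) n s \<longleftrightarrow> s \<in> B \<and> n < s \<and> (\<forall>x<s. n < x \<longrightarrow> x \<notin> B)"
  unfolding sS_def by (auto simp: not_less; metis not_le)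

lemma slessS_iff: "slessS x (B::'a set) n \<longleftrightarrow> (\<forall>s\<le>x. \<not> sS B n s)"
  unfolding slessS_def by (auto simp: not_le; metis not_le)

lemma smin_iff: "smin (B::'a set) p \<longleftrightarrow> p \<in> B \<and> (\<forall>x<p. x \<notin> B)"
  unfolding smin_def by (auto simp: not_le; metis not_le)

lemma D0_bs:
  "Y \<in> SS \<Longrightarrow> Tm i \<Longrightarrow> Tm n \<Longrightarrow> Tm b \<Longrightarrow> D0 (\<lambda>e. bs (mb Y (i e)) (n e) (b e))"
  unfolding bs_def by (intro D0_and D0_allle D0_imp D0_mb D0_le Tm_var Tm_ren)

lemma D0_sS:
  "Y \<in> SS \<Longrightarrow> Tm i \<Longrightarrow> Tm n \<Longrightarrow> Tm b \<Longrightarrow> D0 (\<lambda>e. sS (mb Y (i e)) (n e) (b e))"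
  unfolding sS_iff by (intro D0_and D0_all D0_imp D0_not D0_mb D0_less Tm_var Tm_ren)

lemma D0_slessS:
  "Y \<in> SS \<Longrightarrow> Tm i \<Longrightarrow> Tm n \<Longrightarrow> Tm x \<Longrightarrow> D0 (\<lambda>e. slessS (x e) (mb Y (i e)) (n e))"
  unfolding slessS_iff by (intro D0_allle D0_not D0_sS Tm_var Tm_ren)

lemma D0_adm:
  "Y \<in> SS \<Longrightarrow> Tm i \<Longrightarrow> Tm u \<Longrightarrow> Tm y \<Longrightarrow> Tm z \<Longrightarrow> Tm c \<Longrightarrow>
    D0 (\<lambda>e. adm (mb Y (i e)) (u e) (y e) (z e) (c e))"
  unfolding adm_def by (intro D0_and D0_slessS D0_less Tm_add Tm_mult)

lemma D0_least_adm:
  "Y \<in> SS \<Longrightarrow> Tm i \<Longrightarrow> Tm u \<Longrightarrow> Tm y \<Longrightarrow> Tm z \<Longrightarrow> Tm c \<Longrightarrow>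
    D0 (\<lambda>e. least_adm (mb Y (i e)) (u e) (y e) (z e) (c e))"
  unfolding least_adm_def by (intro D0_and D0_mb D0_all D0_imp D0_not D0_adm Tm_var Tm_ren)

lemma stepg_values: "stepg B C g m \<longleftrightarrow> ((\<forall>x\<le>m. x \<notin> B) \<longrightarrow> g m = m) \<and>
     (\<forall>b\<le>m. \<forall>f\<le>m. \<forall>r\<le>m. \<forall>m'\<le>m. bs B m b \<and> m = b * f + r \<and> r < b \<and> m' + 1 = m \<longrightarrow>
       (\<exists>c u y z. g m' = u \<and> g f = y \<and> g r = z \<and> least_adm C u y z c \<and> g m = c * y + z))"
  unfolding stepg_def by simp

text \<open>The arguments are named by existential quantifiers, so that \<Sigma>1 definability has
  to be checked for plain variables only.\<close>

lemma S1_sub5: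
  assumes Q: "S1 (\<lambda>e. Q (e 0) (e (Suc 0)) (e (Suc (Suc 0))) (e (Suc (Suc (Suc 0)))) (e (Suc (Suc (Suc (Suc 0))))))"
    and t: "Tm a" "Tm b" "Tm c" "Tm d" "Tm f"
  shows "S1 (\<lambda>e. Q (a e) (b e) (c e) (d e) (f e))"
proof -
  have 1: "S1 (\<lambda>e. Q (e 4) (e 3) (e 2) (e (Suc 0)) (e 0))"
    using S1_ren[OF Q, of "case_nat (Inl 4) (case_nat (Inl 3) (case_nat (Inl 2) (case_nat (Inl 1) (\<lambda>_. Inl 0))))"]
    by (simp add: ren_def)
  have "S1 (\<lambda>e. \<exists>x0 x1 x2 x3 x4. x0 = a e \<and> x1 = b e \<and> x2 = c e \<and> x3 = d e \<and> x4 = f e \<and> Q x0 x1 x2 x3 x4)"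
  proof (intro S1_ex S1_and)
    show "S1 (\<lambda>e. Q (e (Suc (Suc (Suc (Suc 0))))) (e (Suc (Suc (Suc 0)))) (e (Suc (Suc 0))) (e (Suc 0)) (e 0))"
      using 1 by (simp add: numeral_2_eq_2 numeral_3_eq_3 eval_nat_numeral)
  qed (rule S1_D0, rule D0_eq, rule Tm_var, (rule Tm_ren)+, rule t)+
  then show ?thesis by simp
qed

lemma S1_stepg_var:
  "Y \<in> SS \<Longrightarrow> S1 (\<lambda>e. stepg (mb Y (e 0)) (mb Y (e (Suc 0))) (ent (e (Suc (Suc 0))) (e (Suc (Suc (Suc 0)))))
     (e (Suc (Suc (Suc (Suc 0))))))"
  unfolding stepg_values
  by (intro S1_and S1_allle S1_imp S1_ex; intro S1_D0 D0_imp D0_allle D0_and D0_not D0_mb D0_bs D0_ent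
      D0_least_adm D0_eq D0_less Tm_add Tm_mult Tm_const Tm_var)

lemma S1_stepg:
  "Y \<in> SS \<Longrightarrow> Tm i \<Longrightarrow> Tm j \<Longrightarrow> Tm a \<Longrightarrow> Tm d \<Longrightarrow> Tm m \<Longrightarrow>
    S1 (\<lambda>e. stepg (mb Y (i e)) (mb Y (j e)) (ent (a e) (d e)) (m e))"
  by (rule S1_sub5[where Q = "\<lambda>i j a d m. stepg (mb Y i) (mb Y j) (ent a d) m", OF S1_stepg_var])

lemma S1_supn:
  assumes Y: "Y \<in> SS" and t: "Tm i" "Tm j" "Tm n" "Tm v"
  shows "S1 (\<lambda>e. supn (mb Y (i e)) (mb Y (j e)) (n e) (v e))"
proof (rule S1_sub5[where Q = "\<lambda>i j n v _. supn (mb Y i) (mb Y j) n v", OF _ t Tm_const])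
  show "S1 (\<lambda>e. supn (mb Y (e 0)) (mb Y (e (Suc 0))) (e (Suc (Suc 0))) (e (Suc (Suc (Suc 0)))))"
    unfolding supn_def by (intro S1_ex S1_and S1_allle S1_stepg[OF Y] S1_D0 D0_ent Tm_var)
qed

lemma mb_SS: "Y \<in> SS \<Longrightarrow> mb Y i \<in> SS"
  using comprehension[of "\<lambda>x. x \<in> mb Y i"]
  by (simp add: S1_D0 D0_not D0_mb Tm_var Tm_const)

lemma RB_D:
  assumes "RB K B"
  shows "B \<in> SS" "\<exists>x. x \<in> B" "b \<in> B \<Longrightarrow> 2 \<le> b" "b \<in> B \<Longrightarrow> K \<le> b"
    "b \<in> B \<Longrightarrow> \<exists>s. sS B b s \<and> s \<le> b * K" "b \<in> B \<Longrightarrow> sS B b s \<Longrightarrow> \<exists>q. s = b * q"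
proof -
  show "b \<in> B \<Longrightarrow> 2 \<le> b" using assms le1_cases[of b] unfolding RB_def shier_def by auto
qed (use assms in \<open>auto simp: RB_def shier_def\<close>)

lemma sS_unique: "sS (B::'a set) n s \<Longrightarrow> sS B n s' \<Longrightarrow> s = s'"
  unfolding sS_def by (auto intro: antisym)

lemma smin_ex: "B \<in> SS \<Longrightarrow> x \<in> B \<Longrightarrow> \<exists>p. smin B p"
  using least_P1[OF P1_D0[OF D0_mem[OF _ Tm_var]], of B x] unfolding smin_iff by metis

lemma smin_unique: "smin (B::'a set) p \<Longrightarrow> smin B p' \<Longrightarrow> p = p'"
  unfolding smin_def by (auto intro: antisym)

lemma bs_ex: "B \<in> SS \<Longrightarrow> x \<in> B \<Longrightarrow> x \<le> n \<Longrightarrow> \<exists>b. bs B n b"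
  using greatest_D0[OF D0_mem[OF _ Tm_var], of B x n] unfolding bs_def by (metis not_le)

lemma bs_unique: "bs (B::'a set) n b \<Longrightarrow> bs B n b' \<Longrightarrow> b = b'"
  unfolding bs_def by (auto intro: antisym)

lemma sbase_iff: "smin (B::'a set) p \<Longrightarrow> p \<le> n \<Longrightarrow> sbase B n b \<longleftrightarrow> bs B n b"
  unfolding sbase_def bs_def using smin_unique by (metis not_le)

lemma bs_less_S: "bs (B::'a set) n b \<Longrightarrow> sS B b s \<Longrightarrow> n < s"
  unfolding bs_def sS_def by (metis not_le)

text \<open>\<open>n\<close> lies below the next base, which is at most \<open>b * K\<close> and
  hence at most \<open>b * b\<close>. This is why the exponent of a decomposition is always
  1.\<close>

lemma RB_square: "RB K B \<Longrightarrow> bs B n b \<Longrightarrow> n < b * b"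
proof -
  assume R: "RB K B" and b: "bs B n b"
  then have "b \<in> B" by (simp add: bs_def)
  then obtain s where s: "sS B b s" "s \<le> b * K" using RB_D(5)[OF R] by blast
  have "b * K \<le> b * b" using RB_D(4)[OF R \<open>b \<in> B\<close>] by (intro mult_left_mono) auto
  then show ?thesis using bs_less_S[OF b s(1)] s(2) by auto
qed

text \<open>A base change also changes the exponent 1; the assumption \<open>ent a d 1 = 1\<close>
  makes this trivial and turns the formal clause into \<open>stepg\<close>.\<close>

lemma sclause_iff:
  assumes R: "RB K B" and one: "1 \<le> m \<Longrightarrow> ent a d 1 = 1"
  shows "sclause B C a d m \<longleftrightarrow> stepg B C (ent a d) m"
proof -
  obtain p where p: "smin B p" using smin_ex RB_D(1,2)[OF R] by blast
  have sc: "sclause B C a d m \<longleftrightarrow> (m < p \<longrightarrow> sentry a d m m) \<and>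
     (p \<le> m \<longrightarrow> (\<exists>b c v. sbase B m b \<and> c \<in> C \<and> sadm C a d b m c v \<and>
        (\<forall>c'. c' \<in> C \<and> c' < c \<longrightarrow> \<not> (\<exists>v'. sadm C a d b m c' v')) \<and> sentry a d m v))"
    unfolding sclause_def using p smin_unique[OF p] by blast
  show ?thesis
  proof (cases "m < p")
    case True
    then have "\<forall>x\<le>m. x \<notin> B" "\<And>b. \<not> bs B m b" using p unfolding smin_def bs_def by auto
    then show ?thesis unfolding sc stepg_def using True by (auto simp: sentry_iff)
  next
    case False
    then have pm: "p \<le> m" by simp
    have "p \<in> B" using p by (simp add: smin_def)
    then obtain b where b: "bs B m b" using bs_ex RB_D(1)[OF R] pm by blast
    have b2: "2 \<le> b" "b \<le> m" using b RB_D(3)[OF R] by (auto simp: bs_def)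
    then have m1: "1 \<le> m" using two_le by (meson less_imp_le order_trans)
    obtain f r where fr: "m = b * f + r" "0 < f" "f < b" "r < b" using decomp_ex[OF b2(2) RB_square[OF R b]] .
    obtain m' where m': "m = m' + 1" using succ_ex[of m] m1 by (cases "m = 0") auto
    have uq: "f' = f \<and> r' = r" if "m = b * f' + r'" "r' < b" for f' r'
      using division_unique[of f' b r' f r] that fr by (simp add: mult.commute)
    have "schange a d b c m v \<longleftrightarrow> v = c * ent a d f + ent a d r" for c v
      unfolding schange_iff[OF b2 RB_square[OF R b] one[OF m1]] using uq fr by blast
    then have sa: "sadm C a d b m c v \<longleftrightarrow> v = c * ent a d f + ent a d r \<and> adm C (ent a d m') (ent a d f) (ent a d r) c" for c v
      unfolding sadm_def adm_def m' sentry_iff by auto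
    have "sbase B m b' \<longleftrightarrow> b' = b" for b' using sbase_iff[OF p pm] b bs_unique by blast
    then have 1: "sclause B C a d m \<longleftrightarrow> (\<exists>c. least_adm C (ent a d m') (ent a d f) (ent a d r) c \<and>
        ent a d m = c * ent a d f + ent a d r)"
      unfolding sc least_adm_def sentry_iff \<open>\<And>b'. sbase B m b' \<longleftrightarrow> b' = b\<close> using pm by (auto simp: sa)
    have le: "b \<le> m" "f \<le> m" "r \<le> m" using b2 fr by auto
    have "m' \<le> m" unfolding m' by simp
    note le = le this
    have 2: "bs B m b' \<and> m = b' * f' + r' \<and> r' < b' \<and> m'' + 1 = m \<longleftrightarrow> b' = b \<and> f' = f \<and> r' = r \<and> m'' = m'" for b' f' r' m''
    proof
      assume L: "bs B m b' \<and> m = b' * f' + r' \<and> r' < b' \<and> m'' + 1 = m"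
      then have b': "b' = b" using b bs_unique by blast
      moreover have "f' = f \<and> r' = r" using L uq[of f' r'] unfolding b' by blast
      moreover have "m'' = m'" using L m' by simp
      ultimately show "b' = b \<and> f' = f \<and> r' = r \<and> m'' = m'" by blast
    next
      assume "b' = b \<and> f' = f \<and> r' = r \<and> m'' = m'"
      then show "bs B m b' \<and> m = b' * f' + r' \<and> r' < b' \<and> m'' + 1 = m" using b fr m' by metis
    qed
    have 3: "\<not> (\<forall>x\<le>m. x \<notin> B)" using \<open>p \<in> B\<close> pm by blast
    let ?E = "\<lambda>f r m'. \<exists>c. least_adm C (ent a d m') (ent a d f) (ent a d r) c \<and> ent a d m = c * ent a d f + ent a d r"
    have "stepg B C (ent a d) m \<longleftrightarrow> (\<forall>b'\<le>m. \<forall>f'\<le>m. \<forall>r'\<le>m. \<forall>m''\<le>m. b' = b \<and> f' = f \<and> r' = r \<and> m'' = m' \<longrightarrow> ?E f' r' m'')"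
      unfolding stepg_def 2 using 3 by blast
    also have "\<dots> \<longleftrightarrow> ?E f r m'" using le by blast
    finally show ?thesis using 1 by simp
  qed
qed

lemma supg_iff:
  assumes R: "RB K B" shows "supg B C n v \<longleftrightarrow> supn B C n v"
proof -
  have B1: "x \<notin> B" if "x \<le> 1" for x using RB_D(3)[OF R, of x] two_le[of x] that by (auto simp: not_le)
  have "(\<forall>m\<le>n. sclause B C a d m) \<longleftrightarrow> (\<forall>m\<le>n. stepg B C (ent a d) m)" for a d
  proof (cases "1 \<le> n")
    case False
    then show ?thesis using sclause_iff[OF R] by (meson order_trans)
  next
    case True
    have "ent a d 1 = 1" if "sclause B C a d 1"
    proof -
      obtain p where p: "smin B p" using smin_ex RB_D(1,2)[OF R] by blast
      then have "\<not> p \<le> 1" using B1[of p] by (auto simp: smin_def)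
      then have "1 < p" by simp
      then show ?thesis using that p smin_unique[OF p] unfolding sclause_def sentry_iff by metis
    qed
    moreover have "ent a d 1 = 1" if "stepg B C (ent a d) 1" using that B1 unfolding stepg_def by blast
    ultimately show ?thesis using True sclause_iff[OF R] by blast
  qed
  then show ?thesis unfolding supg_def supn_def sentry_iff by auto
qed

text \<open>The clause at \<open>m\<close> refers to the values at \<open>m'\<close>,
  \<open>f\<close> and \<open>r\<close>, all smaller than \<open>m\<close>, and the least admissible
  base is unique.\<close>

lemma stepg_cong:
  assumes R: "RB K B" and eq: "\<And>x. x < m \<Longrightarrow> g x = h x" and s: "stepg B C g m" "stepg B C h m"
  shows "g m = h m"
proof (cases "\<exists>x\<le>m. x \<in> B")
  case False
  then show ?thesis using s unfolding stepg_def by simp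
next
  case True
  then obtain b where b: "bs B m b" using bs_ex RB_D(1)[OF R] by blast
  have b2: "2 \<le> b" "b \<le> m" using b RB_D(3)[OF R] by (auto simp: bs_def)
  then have "0 < m" by (metis less_le_trans pos_iff two_le not_less_0 le1_cases)
  then obtain m' where m': "m = m' + 1" using succ_ex[of m] by (auto simp: pos_iff)
  obtain f r where fr: "m = b * f + r" "0 < f" "f < b" "r < b" using decomp_ex[OF b2(2) RB_square[OF R b]] .
  have le: "b \<le> m" "f \<le> m" "r \<le> m" using b2 fr by auto
  have "m' \<le> m" unfolding m' by simp
  note le = le this
  have "m' < m" unfolding m' by simp
  moreover have "f < m" "r < m" using b2(2) fr(3,4) by auto
  ultimately have e: "g m' = h m'" "g f = h f" "g r = h r" by (auto intro: eq)
  obtain c where c: "least_adm C (g m') (g f) (g r) c" "g m = c * g f + g r"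
    using stepgD[OF s(1) b fr(1,4) m'[symmetric] le(2,3,4)] by blast
  obtain c' where c': "least_adm C (h m') (h f) (h r) c'" "h m = c' * h f + h r"
    using stepgD[OF s(2) b fr(1,4) m'[symmetric] le(2,3,4)] by blast
  have "c = c'" using c(1) c'(1) unfolding e least_adm_def by (metis linorder_cases)
  then show ?thesis using c(2) c'(2) e by simp
qed

lemma stepg_ext:
  assumes "\<And>x. x \<le> n \<Longrightarrow> g x = h x" and g: "stepg B C g n" shows "stepg B C h n"
proof -
  have "g n = h n" by (rule assms) simp
  moreover have "\<exists>c. least_adm C (h m') (h f) (h r) c \<and> g n = c * h f + h r"
    if "b \<le> n" "f \<le> n" "r \<le> n" "m' \<le> n" "bs B n b \<and> n = b * f + r \<and> r < b \<and> m' + 1 = n" for b f r m'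
  proof -
    have "\<exists>c. least_adm C (g m') (g f) (g r) c \<and> g n = c * g f + g r"
      using that by (intro stepgD[OF g]) auto
    then show ?thesis using assms(1)[OF that(2)] assms(1)[OF that(3)] assms(1)[OF that(4)] by simp
  qed
  ultimately show ?thesis using g unfolding stepg_def by metis
qed

lemma stepg_unique:
  assumes R: "RB K B" and D: "S1 (\<lambda>e. g (e 0) = h (e 0))"
    and s: "\<And>m. m \<le> n \<Longrightarrow> stepg B C g m" "\<And>m. m \<le> n \<Longrightarrow> stepg B C h m"
  shows "g n = h n"
proof -
  have "\<forall>x<m. x \<le> n \<longrightarrow> g x = h x" for m
  proof (rule ind_S1[of "\<lambda>m. \<forall>x<m. x \<le> n \<longrightarrow> g x = h x"])
    show "S1 (\<lambda>e. \<forall>x<e 0. x \<le> n \<longrightarrow> g x = h x)"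
      by (intro S1_all S1_imp D D0_le Tm_var Tm_const)
    show "\<forall>x<m + 1. x \<le> n \<longrightarrow> g x = h x" if "\<forall>x<m. x \<le> n \<longrightarrow> g x = h x" for m
    proof (intro allI impI)
      fix x assume x: "x < m + 1" "x \<le> n"
      show "g x = h x"
        by (rule stepg_cong[OF R _ s(1)[OF x(2)] s(2)[OF x(2)]]) (use that x in auto)
    qed
  qed simp
  from this[of "n + 1"] show ?thesis by simp
qed

lemma supn_ent:
  assumes R: "RB K B" and "supn B C n v" and s: "\<And>m. m \<le> n \<Longrightarrow> stepg B C (ent a d) m"
  shows "v = ent a d n"
proof -
  from assms(2) obtain a' d' where *: "\<And>m. m \<le> n \<Longrightarrow> stepg B C (ent a' d') m" "ent a' d' n = v"
    unfolding supn_def by blast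
  have "S1 (\<lambda>e. \<exists>y. ent a' d' (e 0) = y \<and> ent a d (e 0) = y)"
    by (intro S1_ex S1_D0 D0_and D0_ent Tm_var Tm_const)
  then have "S1 (\<lambda>e. ent a' d' (e 0) = ent a d (e 0))" by (simp add: eq_commute)
  from stepg_unique[OF R this *(1) s] show ?thesis using *(2) by simp
qed

definition up :: "'a set \<Rightarrow> 'a \<Rightarrow> 'a \<Rightarrow> 'a" where
  "up Y i n = (THE v. supn (mb Y i) (mb Y (i + 1)) n v)"

end

section \<open>One upgrade step as a function on the model\<close>

locale rstep = rca SS for SS :: "'a::linordered_semidom set set" +
  fixes K :: 'a and Y :: "'a set" and i :: 'a
  assumes Y: "Y \<in> SS" and RBi: "RB K (mb Y i)" and hier: "shier (mb Y (i + 1))"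
    and good: "sgood (mb Y i) (mb Y (i + 1))"
begin

abbreviation B where "B \<equiv> mb Y i"
abbreviation C where "C \<equiv> mb Y (i + 1)"

abbreviation u where "u \<equiv> up Y i"

lemma supn_u: "supn B C n v \<longleftrightarrow> v = u n"
proof -
  obtain v0 where "supn B C n v0" using good unfolding sgood_def supg_iff[OF RBi] by blast
  then obtain a d where *: "\<And>m. m \<le> n \<Longrightarrow> stepg B C (ent a d) m" unfolding supn_def by blast
  have "supn B C n (ent a d n)" unfolding supn_def using * by blast
  moreover have "v = ent a d n" if "supn B C n v" for v using supn_ent[OF RBi that *] .
  ultimately show ?thesis unfolding up_def by (metis the_equality)
qed

lemma stepg_u: "stepg B C u n"
proof -
  have "supn B C n (u n)" by (simp add: supn_u)
  then obtain a d where *: "\<And>m. m \<le> n \<Longrightarrow> stepg B C (ent a d) m" unfolding supn_def by blast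
  have "ent a d m = u m" if "m \<le> n" for m
  proof -
    have "supn B C m (ent a d m)" unfolding supn_def
      by (rule exI[of _ a], rule exI[of _ d]) (use * that in auto)
    then show ?thesis by (simp add: supn_u)
  qed
  then show ?thesis using stepg_ext[OF _ *[OF order_refl]] by blast
qed

lemma S1_u: "Tm n \<Longrightarrow> Tm v \<Longrightarrow> S1 (\<lambda>e. u (n e) = v e)"
  using S1_supn[OF Y Tm_const Tm_const, of n v i "i + 1"] by (simp add: supn_u eq_commute)

end

text \<open>The ratio of \<open>e\<close> is the quotient \<open>s / e\<close> of its successor
  \<open>s\<close> by \<open>e\<close>; it is bounded without division, and by bounded quantifiers,
  so that the notion is \<Delta>0.\<close>

definition rat :: "'a::linordered_semidom set \<Rightarrow> 'a \<Rightarrow> 'a \<Rightarrow> 'a \<Rightarrow> bool" where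
  "rat C b b' f \<longleftrightarrow> (\<forall>e<b'. e \<in> C \<and> b \<le> e \<longrightarrow> (\<forall>s\<le>b'. sS C e s \<longrightarrow> s \<le> f * e))"

lemma ratD: "rat C b b' f \<Longrightarrow> e \<in> C \<Longrightarrow> b \<le> e \<Longrightarrow> e < b' \<Longrightarrow> b' \<in> C \<Longrightarrow> sS C e s \<Longrightarrow> s \<le> f * e"
  unfolding rat_def sS_def by blast

lemma ratI: "(\<And>e s. e \<in> C \<Longrightarrow> b \<le> e \<Longrightarrow> e < b' \<Longrightarrow> sS C e s \<Longrightarrow> s \<le> f * e) \<Longrightarrow> rat C b b' f"
  unfolding rat_def by blast

lemma rat_trans: "rat C b c f \<Longrightarrow> rat C c d f \<Longrightarrow> c \<in> C \<Longrightarrow> d \<in> C \<Longrightarrow> rat C b d f"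
proof (rule ratI)
  fix e s assume *: "rat C b c f" "rat C c d f" "c \<in> C" "d \<in> C" "e \<in> C" "b \<le> e" "e < d" "sS C e s"
  show "s \<le> f * e"
  proof (cases "e < c")
    case True
    then show ?thesis using ratD[OF *(1,5,6) True *(3,8)] by simp
  next
    case False
    then show ?thesis using ratD[OF *(2,5) _ *(7,4,8)] by simp
  qed
qed

context rca
begin

lemma rat_mono: "rat C b b' f \<Longrightarrow> b' \<in> C \<Longrightarrow> f \<le> (g::'a) \<Longrightarrow> rat C b b' g"
  by (rule ratI) (meson ratD mult_right_mono order_trans zero_le)

lemma D0_rat: "Y \<in> SS \<Longrightarrow> Tm i \<Longrightarrow> Tm b \<Longrightarrow> Tm c \<Longrightarrow> Tm f \<Longrightarrow> D0 (\<lambda>e. rat (mb Y (i e)) (b e) (c e) (f e))"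
  unfolding rat_def
  by (intro D0_all D0_allle D0_imp D0_and D0_mb D0_sS D0_le Tm_mult Tm_var Tm_ren)

lemma sS_ex: "B \<in> SS \<Longrightarrow> x \<in> B \<Longrightarrow> n < x \<Longrightarrow> \<exists>s. sS B n s"
proof -
  assume B: "B \<in> SS" "x \<in> B" "n < x"
  have "D0 (\<lambda>e. e 0 \<in> B \<and> n < e 0)" by (intro D0_and D0_mem[OF B(1)] D0_less Tm_var Tm_const)
  from least_P1[OF P1_D0[OF this], of x] B(2,3) obtain y where "y \<in> B \<and> n < y" "\<And>z. z < y \<Longrightarrow> \<not> (z \<in> B \<and> n < z)"
    by blast
  then show ?thesis unfolding sS_iff by blast
qed

lemma mult_gap: "(b::'a) * f < b * q \<Longrightarrow> b * f + b \<le> b * q"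
proof -
  assume a: "b * f < b * q"
  have "f < q"
  proof (rule ccontr)
    assume "\<not> f < q"
    then have "b * q \<le> b * f" by (intro mult_left_mono) auto
    then show False using a by simp
  qed
  then have "b * (f + 1) \<le> b * q" by (intro mult_left_mono) auto
  then show ?thesis by (simp add: distrib_left)
qed

text \<open>\<open>b * f\<close> and the next base are both multiples of \<open>b\<close>, so a
  strict inequality between them leaves room for another \<open>b\<close>.\<close>

lemma slessS_gap: "shier (B::'a set) \<Longrightarrow> b \<in> B \<Longrightarrow> slessS (b * f) B b \<Longrightarrow> sS B b s \<Longrightarrow> b * f + b \<le> s"
proof -
  assume *: "shier B" "b \<in> B" "slessS (b * f) B b" "sS B b s"
  then obtain q where "s = b * q" unfolding shier_def by blast
  moreover have "b * f < s" using *(3,4) unfolding slessS_def by blast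
  ultimately show ?thesis using mult_gap by simp
qed

end

context rstep
begin

lemma C_SS: "C \<in> SS" and B_SS: "B \<in> SS"
  using mb_SS[OF Y] by auto

lemma B2: "b \<in> B \<Longrightarrow> 2 \<le> b"
  using RB_D(3)[OF RBi] .

lemma B_pos: "b \<in> B \<Longrightarrow> 0 < b"
  using B2[of b] two_le[of b] by (meson less_trans zero_less_one)

lemma C_pos: "c \<in> C \<Longrightarrow> 0 < c"
  using hier unfolding shier_def pos_iff by blast

lemma hierB: "shier B"
  using RBi unfolding RB_def by blast

lemma u_low: "(\<And>x. x \<le> m \<Longrightarrow> x \<notin> B) \<Longrightarrow> u m = m"
  using stepg_u[of m] unfolding stepg_def by blast

lemma u_0: "u 0 = 0"
proof (rule u_low)
  fix x :: 'a assume "x \<le> 0"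
  then show "x \<notin> B" using order_trans[OF B2[of x], of 0] by auto
qed

text \<open>\<open>b * f\<close> stays below the next base, hence below \<open>b * K\<close>. By
  \<open>u_digit\<close> such a coefficient is not changed by the upgrade.\<close>

lemma digit_less: "bs B m b \<Longrightarrow> m = b * f + r \<Longrightarrow> f < K"
proof -
  assume b: "bs B m b" and m: "m = b * f + r"
  have "b \<in> B" using b by (simp add: bs_def)
  then obtain s where s: "sS B b s" "s \<le> b * K" using RB_D(5)[OF RBi] by blast
  have "b * f \<le> m" unfolding m by simp
  also have "m < s" using bs_less_S[OF b s(1)] .
  also have "s \<le> b * K" by fact
  finally have "b * f < b * K" .
  show "f < K"
  proof (rule ccontr)
    assume "\<not> f < K"
    then have "b * K \<le> b * f" by (intro mult_left_mono) auto
    then show False using \<open>b * f < b * K\<close> by simp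
  qed
qed

lemma u_digit: "f < K \<Longrightarrow> u f = f"
proof (rule u_low)
  fix x assume "f < K" "x \<le> f"
  then show "x \<notin> B" using RB_D(4)[OF RBi, of x] by force
qed

lemma uD:
  assumes b: "bs B m b" and m: "m = b * f + r" "r < b" "m' + 1 = m"
  shows "\<exists>c. least_adm C (u m') f (u r) c \<and> u m = c * f + u r"
proof -
  have "b \<in> B" "b \<le> m" using b by (auto simp: bs_def)
  then have "f \<le> b * f" using le_mult_pos[OF B_pos] by blast
  then have "f \<le> m" unfolding m(1) by (simp add: add_increasing2)
  moreover have "r \<le> m" using m(2) \<open>b \<le> m\<close> by simp
  moreover have "m' \<le> m" unfolding m(3)[symmetric] by simp
  ultimately have "\<exists>c. least_adm C (u m') (u f) (u r) c \<and> u m = c * u f + u r"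
    by (rule stepgD[OF stepg_u b m])
  then show ?thesis unfolding u_digit[OF digit_less[OF b m(1)]] .
qed

lemma bs_exB: "x \<in> B \<Longrightarrow> x \<le> m \<Longrightarrow> \<exists>b f r. bs B m b \<and> m = b * f + r \<and> 0 < f \<and> r < b"
proof -
  assume "x \<in> B" "x \<le> m"
  then obtain b where b: "bs B m b" using bs_ex[OF B_SS] by blast
  then have "b \<le> m" by (simp add: bs_def)
  from decomp_ex[OF this RB_square[OF RBi b]] obtain f r where "m = b * f + r" "0 < f" "r < b" by metis
  then show ?thesis using b by blast
qed

lemma u_step: "u m < u (m + 1)"
proof (cases "\<exists>x\<le>m + 1. x \<in> B")
  case True
  then obtain x where "x \<in> B" "x \<le> m + 1" by blast
  from bs_exB[OF this] obtain b f r where "bs B (m + 1) b" "m + 1 = b * f + r" "r < b" by blast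
  from uD[OF this refl] obtain c where "least_adm C (u m) f (u r) c" "u (m + 1) = c * f + u r" by blast
  then show ?thesis unfolding least_adm_def adm_def by simp
next
  case False
  then have 1: "u (m + 1) = m + 1" by (intro u_low) blast
  have "x \<notin> B" if "x \<le> m" for x
  proof -
    have "x \<le> m + 1" using that by (rule order_trans) simp
    then show ?thesis using False by blast
  qed
  then have "u m = m" by (intro u_low) blast
  then show ?thesis using 1 by simp
qed

lemma u_less: "x < y \<Longrightarrow> u x < u y"
proof -
  have "x < y \<longrightarrow> (\<exists>v. u y = v \<and> u x < v)" for y
  proof (rule ind_S1[of "\<lambda>y. x < y \<longrightarrow> (\<exists>v. u y = v \<and> u x < v)"])
    show "S1 (\<lambda>e. x < e 0 \<longrightarrow> (\<exists>v. u (e 0) = v \<and> u x < v))"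
      by (intro S1_imp S1_ex S1_and S1_u S1_D0 D0_less Tm_var Tm_const)
    show "x < y + 1 \<longrightarrow> (\<exists>v. u (y + 1) = v \<and> u x < v)" if "x < y \<longrightarrow> (\<exists>v. u y = v \<and> u x < v)" for y
    proof
      assume "x < y + 1"
      then consider "x < y" | "x = y" by (auto simp: le_less)
      then show "\<exists>v. u (y + 1) = v \<and> u x < v"
      proof cases
        case 1
        then have "u x < u y" using that by blast
        then show ?thesis using u_step[of y] by (metis less_trans)
      qed (use u_step in blast)
    qed
  qed simp
  then show "x < y \<Longrightarrow> u x < u y" by blast
qed

lemma u_less_iff: "u x < u y \<longleftrightarrow> x < y"
  using u_less by (metis linorder_cases less_asym less_irrefl)

lemma u_le_iff: "u x \<le> u y \<longleftrightarrow> x \<le> y"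
  using u_less_iff[of y x] by (metis not_le)

lemma le_u: "x \<le> u x"
proof -
  have "\<exists>v. u x = v \<and> x \<le> v" for x
  proof (rule ind_S1[of "\<lambda>x. \<exists>v. u x = v \<and> x \<le> v"])
    show "S1 (\<lambda>e. \<exists>v. u (e 0) = v \<and> e 0 \<le> v)" by (intro S1_ex S1_and S1_u S1_D0 D0_le Tm_var)
    show "\<exists>v. u (x + 1) = v \<and> x + 1 \<le> v" if "\<exists>v. u x = v \<and> x \<le> v" for x
      using that u_step[of x] by (metis add1_le le_less_trans)
  qed simp
  then show ?thesis by blast
qed

lemma u_pos: "0 < x \<Longrightarrow> 0 < u x"
  using le_u[of x] by simp

lemma bs_multiple:
  assumes b: "b \<in> B" and f: "0 < f" and s: "slessS (b * f) B b" and r: "r < b"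
  shows "bs B (b * f + r) b"
proof -
  have "b \<le> b * f" using le_mult_pos[OF f, of b] by (simp add: mult.commute)
  moreover have "x \<le> b" if x: "x \<le> b * f + r" "x \<in> B" for x
  proof (rule ccontr)
    assume "\<not> x \<le> b"
    then have bx: "b < x" by simp
    then obtain t where t: "sS B b t" using sS_ex[OF B_SS x(2)] by blast
    then have "t \<le> x" using x(2) bx unfolding sS_def by blast
    moreover have "b * f + b \<le> t" using slessS_gap[OF hierB b s t] .
    ultimately have "b * f + b \<le> x" by (metis order_trans)
    then have "b * f + b \<le> b * f + r" using x(1) by (rule order_trans)
    then show False using r by simp
  qed
  ultimately show ?thesis using b unfolding bs_def by (simp add: add_increasing2)
qed

text \<open>\<open>\<up>(b f + r) = c f + \<up>r\<close> for all \<open>r < b\<close>; the bases between \<open>\<up>b\<close> and \<open>c\<close> are skipped because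
  their ratios are at most \<open>f\<close>.\<close>

definition MP :: "'a \<Rightarrow> 'a \<Rightarrow> 'a \<Rightarrow> bool" where
  "MP b f c \<longleftrightarrow> c \<in> C \<and> slessS (c * f) C c \<and> u (b * f) = c * f \<and> u b \<le> c \<and> rat C (u b) c f"

lemma u_base_C: "b \<in> B \<Longrightarrow> least_adm C (u m') 1 0 (u b) \<and> u b \<in> C" if "m' + 1 = b"
proof -
  assume b: "b \<in> B"
  have "bs B b b" using b unfolding bs_def by simp
  from uD[OF this, of 1 0 m'] that B_pos[OF b] obtain c where "least_adm C (u m') 1 (u 0) c" "u b = c * 1 + u 0" by auto
  then show "least_adm C (u m') 1 0 (u b) \<and> u b \<in> C" unfolding u_0 by (auto simp: least_adm_def)
qed

lemma uC: "b \<in> B \<Longrightarrow> u b \<in> C"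
  using u_base_C succ_ex[of b] B_pos[of b] by (metis pos_iff)

lemma slessS_le: "slessS y C c \<Longrightarrow> x \<le> y \<Longrightarrow> slessS x C c"
  unfolding slessS_def by (meson le_less_trans)

text \<open>At \<open>r + 1\<close> the base \<open>c\<close> is still admissible, because
  \<open>\<up>(r + 1) < \<up>b \<le> c\<close> fits into the gap after \<open>c * f\<close>. A
  smaller base \<open>c'\<close> yields values below its successor, hence below \<open>c\<close> and
  below \<open>\<up>(b f + r)\<close>.\<close>

lemma MP_add:
  assumes b: "b \<in> B" and f: "0 < f" and s: "slessS (b * f) B b" and M: "MP b f c" and r: "r < b"
  shows "u (b * f + r) = c * f + u r"
proof -
  have c: "c \<in> C" "slessS (c * f) C c" "u (b * f) = c * f" "u b \<le> c" using M unfolding MP_def by auto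
  have "r < b \<longrightarrow> (\<exists>y z. u (b * f + r) = y \<and> u r = z \<and> y = c * f + z)" for r
  proof (rule ind_S1[of "\<lambda>r. r < b \<longrightarrow> (\<exists>y z. u (b * f + r) = y \<and> u r = z \<and> y = c * f + z)"])
    show "S1 (\<lambda>e. e 0 < b \<longrightarrow> (\<exists>y z. u (b * f + e 0) = y \<and> u (e 0) = z \<and> y = c * f + z))"
      by (intro S1_imp S1_ex S1_and S1_u S1_D0 D0_less D0_eq Tm_var Tm_const Tm_add)
    show "0 < b \<longrightarrow> (\<exists>y z. u (b * f + 0) = y \<and> u 0 = z \<and> y = c * f + z)" using c(3) u_0 by simp
    fix r assume IH: "r < b \<longrightarrow> (\<exists>y z. u (b * f + r) = y \<and> u r = z \<and> y = c * f + z)"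
    show "r + 1 < b \<longrightarrow> (\<exists>y z. u (b * f + (r + 1)) = y \<and> u (r + 1) = z \<and> y = c * f + z)"
    proof
      assume r1: "r + 1 < b"
      have "r < r + 1" by simp
      then have rb: "r < b" using r1 by (rule less_trans)
      then have ur: "u (b * f + r) = c * f + u r" using IH by blast
      have bs: "bs B (b * f + (r + 1)) b" using bs_multiple[OF b f s r1] .
      from uD[OF this refl r1, of "b * f + r"] obtain c' where
        c': "least_adm C (u (b * f + r)) f (u (r + 1)) c'" "u (b * f + (r + 1)) = c' * f + u (r + 1)"
        by (auto simp: add.assoc)
      have "u (r + 1) < u b" using u_less r1 by blast
      then have "u (r + 1) < c" using c(4) by simp
      then have "slessS (c * f + u (r + 1)) C c"
        unfolding slessS_def using slessS_gap[OF hier c(1,2)] by (metis add_strict_left_mono less_le_trans)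
      then have adm: "adm C (u (b * f + r)) f (u (r + 1)) c"
        unfolding adm_def ur using u_step[of r] by simp
      have "\<not> c < c'" using c'(1) adm c(1) unfolding least_adm_def by blast
      moreover have "\<not> c' < c"
      proof
        assume less: "c' < c"
        obtain t where t: "sS C c' t" using sS_ex[OF C_SS c(1) less] by blast
        have "c' * f + u (r + 1) < t" using c'(1) t unfolding least_adm_def adm_def slessS_def by blast
        also have "t \<le> c" using t c(1) less unfolding sS_def by blast
        also have "c \<le> c * f" using le_mult_pos[OF f, of c] by (simp add: mult.commute)
        also have "c * f \<le> u (b * f + r)" unfolding ur by simp
        finally have "c' * f + u (r + 1) < u (b * f + r)" .
        moreover have "u (b * f + r) < c' * f + u (r + 1)" using c'(1) unfolding least_adm_def adm_def by blast
        ultimately show False by (rule less_asym)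
      qed
      ultimately have "c' = c" by simp
      then show "\<exists>y z. u (b * f + (r + 1)) = y \<and> u (r + 1) = z \<and> y = c * f + z" using c'(2) by blast
    qed
  qed
  then show ?thesis using r by blast
qed

text \<open>Induction on \<open>f\<close>. If \<open>c1\<close> belongs to \<open>f - 1\<close>,
  then \<open>\<up>(b f - 1) = c1 (f - 1) + \<up>(b - 1) < c1 f\<close>. An element \<open>e\<close>
  of \<open>C\<close> between \<open>\<up>b\<close> and \<open>c\<close> with ratio above
  \<open>f\<close> can have been rejected only because \<open>e f \<le> \<up>(b f - 1)\<close>; so
  \<open>e < c1\<close>, where the induction hypothesis bounds its ratio by
  \<open>f - 1\<close>.\<close>

lemma MP_ex:
  assumes b: "b \<in> B" and f: "0 < f" and s: "slessS (b * f) B b"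
  shows "\<exists>c. MP b f c"
proof -
  define Q where "Q f \<longleftrightarrow> (0 < f \<longrightarrow> slessS (b * f) B b \<longrightarrow> (\<exists>c. c \<in> C \<and> slessS (c * f) C c \<and> u (b * f) = c * f \<and> u b \<le> c \<and> rat C (u b) c f))" for f
  have "Q f" for f
  proof (rule ind_S1[of Q])
    show "S1 (\<lambda>e. Q (e 0))" unfolding Q_def
      by (intro S1_imp S1_ex S1_and S1_u; (intro S1_D0)?; intro D0_less D0_slessS[OF Y] D0_rat[OF Y] D0_mb[OF Y] D0_le Tm_mult Tm_var Tm_const)
    show "Q 0" unfolding Q_def by simp
    fix f1 assume IH: "Q f1"
    define f where "f = f1 + 1"
    have f: "0 < f" unfolding f_def by (simp add: pos_iff add_nonneg_eq_0_iff)
    show "Q (f1 + 1)" unfolding f_def[symmetric] unfolding Q_def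
    proof (intro impI)
      assume s: "slessS (b * f) B b"
      have "b * f \<noteq> 0" using f B_pos[OF b] by (simp add: pos_iff)
      then obtain m' where m': "b * f = m' + 1" using succ_ex by blast
      have bs: "bs B (b * f + 0) b" using bs_multiple[OF b f s B_pos[OF b]] .
      from uD[OF this refl B_pos[OF b], of m'] m' u_0 obtain c where
        c: "least_adm C (u m') f 0 c" "u (b * f) = c * f" by auto
      have cC: "c \<in> C" and cS: "slessS (c * f) C c" and cu: "u m' < c * f"
        using c(1) unfolding least_adm_def adm_def by auto
      have main: "u b \<le> c \<and> rat C (u b) c f"
      proof (cases "f1 = 0")
        \<comment> \<open>For \<open>f = 1\<close> the base is \<open>\<up>b\<close> itself, and no
          base is skipped.\<close>
        case True
        then have "u b = c" using c(2) f_def by simp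
        then show ?thesis unfolding rat_def by auto
      next
        case False
        then have f1: "0 < f1" by (simp add: pos_iff)
        have s1: "slessS (b * f1) B b"
        proof -
          have "b * f1 \<le> b * f" unfolding f_def by (simp add: distrib_left)
          then show ?thesis using s unfolding slessS_def by (meson le_less_trans)
        qed
        then obtain c1 where c1: "c1 \<in> C" "slessS (c1 * f1) C c1" "u (b * f1) = c1 * f1" "u b \<le> c1" "rat C (u b) c1 f1"
          using IH f1 unfolding Q_def by blast
        then have M1: "MP b f1 c1" unfolding MP_def by blast
        obtain b1 where b1: "b = b1 + 1" using succ_ex[of b] B_pos[OF b] by (auto simp: pos_iff)
        have "m' + 1 = (b * f1 + b1) + 1" unfolding m'[symmetric] f_def using b1 by (simp add: distrib_left add.assoc)
        then have "m' = b * f1 + b1" by simp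
        moreover have b1b: "b1 < b" unfolding b1 by simp
        ultimately have um': "u m' = c1 * f1 + u b1" using MP_add[OF b f1 s1 M1] by simp
        have ubm: "u b \<le> u m'"
        proof -
          have "u b \<le> c1" by fact
          also have "c1 \<le> c1 * f1" using le_mult_pos[OF f1, of c1] by (simp add: mult.commute)
          also have "\<dots> \<le> u m'" unfolding um' by simp
          finally show ?thesis .
        qed
        have 1: "u b \<le> c"
        proof (rule ccontr)
          assume "\<not> u b \<le> c"
          then have less: "c < u b" by simp
          then obtain t where t: "sS C c t" using sS_ex[OF C_SS uC[OF b]] by blast
          then have "t \<le> u b" using uC[OF b] less unfolding sS_def by blast
          moreover have "c * f < t" using cS t unfolding slessS_def by blast
          ultimately show False using cu ubm by simp
        qed
        have "rat C (u b) c f"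
        proof (rule ratI)
          fix e t assume e: "e \<in> C" "u b \<le> e" "e < c" "sS C e t"
          show "t \<le> f * e"
          proof (rule ccontr)
            assume n: "\<not> t \<le> f * e"
            have "slessS (e * f + 0) C e"
              unfolding slessS_def using n sS_unique[OF e(4)] by (auto simp: mult.commute not_le)
            moreover have "\<not> adm C (u m') f 0 e" using c(1) e(1,3) unfolding least_adm_def by blast
            ultimately have "e * f \<le> u m'" unfolding adm_def by auto
            also have "u m' < c1 * f1 + u b" unfolding um' using u_less[OF b1b] by simp
            also have "\<dots> \<le> c1 * f1 + c1" using c1(4) by simp
            also have "\<dots> = c1 * f" unfolding f_def by (simp add: distrib_left)
            finally have "e < c1" by (metis mult_right_mono not_le zero_le)
            then have "t \<le> f1 * e" using ratD[OF c1(5) e(1,2) _ c1(1) e(4)] by blast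
            also have "f1 * e \<le> f * e" unfolding f_def by (simp add: distrib_right)
            finally show False using n by simp
          qed
        qed
        with 1 show ?thesis by blast
      qed
      show "\<exists>c. c \<in> C \<and> slessS (c * f) C c \<and> u (b * f) = c * f \<and> u b \<le> c \<and> rat C (u b) c f"
        using cC cS c(2) main by blast
    qed
  qed
  then show ?thesis using f s unfolding Q_def MP_def by blast
qed

text \<open>Below the least base \<open>p\<close> the upgrade is the identity, so the least element
  \<open>q \<ge> p\<close> of \<open>C\<close> is admissible at \<open>p\<close> and bounds
  \<open>\<up>p\<close> from above.\<close>

lemma minC: "p \<in> B \<Longrightarrow> (\<And>x. x \<in> B \<Longrightarrow> p \<le> x) \<Longrightarrow> e \<in> C \<Longrightarrow> u p \<le> e \<and> p \<le> e"
proof -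
  assume p: "p \<in> B" "\<And>x. x \<in> B \<Longrightarrow> p \<le> x" and e: "e \<in> C"
  have mp: "smin B p" using p unfolding smin_def by blast
  obtain p' q where pq: "smin B p'" "smin C q" "p' \<le> q" using good unfolding sgood_def by blast
  then have pq': "p \<le> q" using smin_unique[OF mp] by blast
  obtain m' where m': "p = m' + 1" using succ_ex[of p] B_pos[OF p(1)] by (auto simp: pos_iff)
  have q: "q \<in> C" "q \<le> e" using pq(2) e unfolding smin_def by auto
  have "u m' = m'"
  proof (rule u_low)
    fix x assume "x \<le> m'"
    then have "x < p" unfolding m' by simp
    then show "x \<notin> B" using p(2) by force
  qed
  then have "adm C (u m') 1 0 q" unfolding adm_def slessS_def sS_def using pq' m' by auto
  then have "\<not> q < u p" using u_base_C[OF m'[symmetric] p(1)] q(1) unfolding least_adm_def by blast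
  then have "u p \<le> q" by simp
  then show ?thesis using order_trans[OF _ q(2)] pq' by blast
qed

lemma slessI: "sS (B'::'a set) n s \<Longrightarrow> x < s \<Longrightarrow> slessS x B' n"
  unfolding slessS_def using sS_unique by blast

text \<open>Condition (3) of a good successor bounds the ratio at the last base used for \<open>S\<^sub>B(b) - 1\<close>.\<close>

lemma next_base:
  assumes b: "b \<in> B" and s: "sS B b (b * (q1 + 1))" and M: "MP b q1 c" and q1: "0 < q1"
  shows "sS C c (u (b * (q1 + 1))) \<and> u (b * (q1 + 1)) \<le> c * (q1 + 1)"
proof -
  let ?s = "b * (q1 + 1)"
  have sB: "?s \<in> B" and bs: "b < ?s" using s unfolding sS_def by auto
  have c: "c \<in> C" "slessS (c * q1) C c" "u (b * q1) = c * q1" "u b \<le> c" using M unfolding MP_def by auto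
  obtain b1 where b1: "b = b1 + 1" using succ_ex[of b] B_pos[OF b] by (auto simp: pos_iff)
  have b1b: "b1 < b" unfolding b1 by simp
  let ?m = "b * q1 + b1"
  have m: "?m + 1 = ?s" using b1 by (simp add: distrib_left add.assoc)
  have ls: "slessS (b * q1) B b"
    by (rule slessI[OF s]) (simp add: distrib_left B_pos[OF b])
  have um: "u ?m = c * q1 + u b1" using MP_add[OF b q1 ls M b1b] .
  have ub1: "u b1 < c" using u_less[OF b1b] c(4) by simp
  have cm: "c \<le> u ?m"
  proof -
    have "c \<le> c * q1" using le_mult_pos[OF q1, of c] by (simp add: mult.commute)
    then show ?thesis unfolding um by (simp add: add_increasing2)
  qed
  have top: "x \<le> c" if x: "x \<le> u ?m" "x \<in> C" for x
  proof (rule ccontr)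
    assume "\<not> x \<le> c"
    then have cx: "c < x" by simp
    then obtain t where t: "sS C c t" using sS_ex[OF C_SS x(2)] by blast
    then have "t \<le> x" using x(2) cx unfolding sS_def by blast
    moreover have "c * q1 + c \<le> t" using slessS_gap[OF hier c(1,2) t] .
    ultimately show False using x(1) ub1 unfolding um by (metis add_strict_left_mono less_le_trans not_le order_trans)
  qed
  then have bsC: "bs C (u ?m) c" unfolding bs_def using c(1) cm by blast
  obtain qq where qq: "smin C qq" using smin_ex[OF C_SS c(1)] by blast
  then have "qq \<le> u ?m" using c(1) cm unfolding smin_def by (meson order_trans)
  then have sb: "sbase C (u ?m) c" using sbase_iff[OF qq] bsC by blast
  obtain p where p: "smin B p" using smin_ex[OF B_SS b] by blast
  then have "p < ?s" using b bs unfolding smin_def by (meson le_less_trans)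
  moreover have "supg B C ?m (u ?m)" unfolding supg_iff[OF RBi] supn_u ..
  ultimately have no: "\<not> (\<exists>y. (\<exists>q. y = c * q) \<and> u ?m < y \<and> slessS y C (u ?m))"
    using good[unfolded sgood_def] sB p m sb by blast
  \<comment> \<open>The multiple \<open>c * (q1 + 1)\<close> lies above
    \<open>\<up>(S b - 1)\<close>. By the third condition on good successors it cannot lie below the
    next element of \<open>C\<close>, which is therefore at most this multiple.\<close>
  have "u ?m < c * (q1 + 1)" unfolding um using ub1 by (simp add: distrib_left)
  then have "\<not> slessS (c * (q1 + 1)) C (u ?m)" using no by blast
  then obtain t where t: "sS C (u ?m) t" "t \<le> c * (q1 + 1)" unfolding slessS_def by (auto simp: not_less)
  have tC: "t \<in> C" "u ?m < t" using t(1) unfolding sS_def by auto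
  have ct: "sS C c t" unfolding sS_def
  proof (intro conjI allI impI)
    show "t \<in> C" by fact
    show "c < t" using cm tC(2) by simp
    fix x assume x: "x \<in> C \<and> c < x"
    then have "u ?m < x" using top by (meson not_le)
    then show "t \<le> x" using t(1) x unfolding sS_def by blast
  qed
  have l: "least_adm C (u ?m) 1 0 (u ?s)" "u ?s \<in> C" using u_base_C[OF m sB] by auto
  have "adm C (u ?m) 1 0 t" unfolding adm_def slessS_def sS_def using tC(2) by auto
  then have "\<not> t < u ?s" using l(1) tC(1) unfolding least_adm_def by blast
  moreover have "u ?m < u ?s" using l(1) unfolding least_adm_def adm_def by simp
  then have "t \<le> u ?s" using t(1) l(2) unfolding sS_def by blast
  ultimately have "u ?s = t" by simp
  then show ?thesis using ct t(2) by simp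
qed

lemma ratio_ex:
  assumes b: "b \<in> B"
  obtains q1 c where "sS B b (b * (q1 + 1))" "0 < q1" "q1 + 1 \<le> K" "MP b q1 c"
proof -
  obtain s where s: "sS B b s" "s \<le> b * K" using RB_D(5)[OF RBi b] by blast
  obtain q where q: "s = b * q" using RB_D(6)[OF RBi b s(1)] by blast
  have "b < b * q" using s(1) q unfolding sS_def by blast
  then have "q \<noteq> 0" "q \<noteq> 1" by auto
  then obtain q1 where q1: "q = q1 + 1" using succ_ex by blast
  then have "0 < q1" using \<open>q \<noteq> 1\<close> by (auto simp: pos_iff)
  have "q \<le> K"
  proof (rule ccontr)
    assume "\<not> q \<le> K"
    then have "b * K < b * q" using B_pos[OF b] by (intro mult_strict_left_mono) auto
    then show False using s(2) q by simp
  qed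
  have "slessS (b * q1) B b"
    by (rule slessI[OF s(1)]) (simp add: q q1 distrib_left B_pos[OF b])
  then obtain c where "MP b q1 c" using MP_ex[OF b \<open>0 < q1\<close>] by blast
  then show thesis using that[of q1 c] s(1) q q1 \<open>0 < q1\<close> \<open>q \<le> K\<close> by simp
qed

text \<open>The upgraded bases of \<open>B\<close> cut \<open>C\<close> into blocks. In the block of
  \<open>b\<close>, elements before \<open>c\<close> have ratio at most \<open>q1\<close> by
  \<open>MP\<close>, and \<open>c\<close> is followed by the upgrade of the next base with ratio at
  most \<open>q1 + 1\<close> by \<open>next_base\<close>.\<close>

lemma block:
  assumes e: "e \<in> C"
  obtains b q1 s where "b \<in> B" "u b \<le> e" "e < u (b * (q1 + 1))" "sS B b (b * (q1 + 1))" "q1 + 1 \<le> K"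
    "sS C e s" "s \<le> (q1 + 1) * e"
proof -
  let ?G = "{x. x \<in> B \<and> u x \<le> e}"
  \<comment> \<open>The upgrade is total with a \<Sigma>1 graph, so both \<open>u x \<le> e\<close>
    and its negation are \<Sigma>1. Comprehension gives the set \<open>?G\<close>, which has a
    greatest element up to \<open>e\<close>.\<close>
  have 1: "S1 (\<lambda>e'. e' 0 \<in> B \<and> (\<exists>y. u (e' 0) = y \<and> y \<le> e))"
    by (intro S1_and S1_ex S1_u; (intro S1_D0)?; intro D0_mb[OF Y] D0_le Tm_var Tm_const)
  have 2: "S1 (\<lambda>e'. \<not> e' 0 \<in> B \<or> (\<exists>y. u (e' 0) = y \<and> e < y))"
    by (intro S1_or S1_and S1_ex S1_u; (intro S1_D0)?; intro D0_not D0_mb[OF Y] D0_less Tm_var Tm_const)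
  have G: "?G \<in> SS"
    using comprehension[of "\<lambda>x. x \<in> B \<and> u x \<le> e"] 1 2 by (simp add: not_le)
  obtain x0 where "x0 \<in> B" using RB_D(2)[OF RBi] by blast
  then obtain p where p: "smin B p" using smin_ex[OF B_SS] by blast
  then have pB: "p \<in> B" "\<And>x. x \<in> B \<Longrightarrow> p \<le> x" unfolding smin_def by auto
  then have "p \<in> ?G" "p \<le> e" using minC[OF pB e] by auto
  from greatest_D0[OF D0_mem[OF G Tm_var] this] obtain b where
    b: "b \<in> ?G" "b \<le> e" "\<And>z. b < z \<Longrightarrow> z \<le> e \<Longrightarrow> z \<notin> ?G" by blast
  then have bB: "b \<in> B" "u b \<le> e" by auto
  from ratio_ex[OF bB(1)] obtain q1 c where q: "sS B b (b * (q1 + 1))" "0 < q1" "q1 + 1 \<le> K" "MP b q1 c" .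
  have nb: "sS C c (u (b * (q1 + 1)))" "u (b * (q1 + 1)) \<le> c * (q1 + 1)" using next_base[OF bB(1) q(1,4,2)] by auto
  have cC: "c \<in> C" "rat C (u b) c q1" using q(4) unfolding MP_def by auto
  have eless: "e < u (b * (q1 + 1))"
  proof (rule ccontr)
    assume "\<not> ?thesis"
    then have "u (b * (q1 + 1)) \<le> e" by simp
    moreover have "b * (q1 + 1) \<in> B" "b < b * (q1 + 1)" using q(1) unfolding sS_def by auto
    moreover have "b * (q1 + 1) \<le> e" using le_u \<open>u (b * (q1 + 1)) \<le> e\<close> by (rule order_trans)
    ultimately show False using b(3)[of "b * (q1 + 1)"] by blast
  qed
  have "\<not> c < e" using nb(1) e eless unfolding sS_def by (meson not_le)
  then consider "e < c" | "e = c" by (auto simp: not_less le_less)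
  then show thesis
  proof cases
    case 1
    then obtain t where t: "sS C e t" using sS_ex[OF C_SS cC(1)] by blast
    have "t \<le> q1 * e" using ratD[OF cC(2) e bB(2) 1 cC(1) t] .
    also have "\<dots> \<le> (q1 + 1) * e" by (simp add: distrib_right)
    finally show ?thesis using that[OF bB eless q(1,3) t] by blast
  next
    case 2
    then show ?thesis using that[OF bB eless q(1,3)] nb by (simp add: mult.commute)
  qed
qed

text \<open>The ratio of an element of \<open>C\<close> is bounded by the ratio of the base whose
  block contains it; thus the bound \<open>K\<close> is inherited by every later hierarchy.\<close>

lemma RB_C: "RB K C"
  unfolding RB_def
proof (intro conjI ballI)
  show "C \<in> SS" "shier C" using C_SS hier by auto
  fix e assume e: "e \<in> C"
  from block[OF e] obtain b q1 s where *: "b \<in> B" "u b \<le> e" "q1 + 1 \<le> K" "sS C e s" "s \<le> (q1 + 1) * e" by metis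
  have "(q1 + 1) * e \<le> K * e" using *(3) by (intro mult_right_mono) auto
  then show "\<exists>s. sS C e s \<and> s \<le> e * K" using *(4,5) by (metis mult.commute order_trans)
  have "K \<le> b" using RB_D(4)[OF RBi *(1)] .
  also have "b \<le> u b" by (rule le_u)
  finally show "K \<le> e" using *(2) by simp
qed

text \<open>The block containing \<open>e\<close> starts at a base \<open>a\<close> with
  \<open>b \<le> a < b'\<close>, because the upgrade is strictly increasing; its ratio bounds that
  of \<open>e\<close>.\<close>

lemma rat_u:
  assumes b: "b \<in> B" "b' \<in> B" and r: "rat B b b' f" shows "rat C (u b) (u b') f"
proof (rule ratI)
  fix e t assume e: "e \<in> C" "u b \<le> e" "e < u b'" "sS C e t"
  from block[OF e(1)] obtain a q1 s where a: "a \<in> B" "u a \<le> e" "e < u (a * (q1 + 1))" "sS B a (a * (q1 + 1))"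
    "sS C e s" "s \<le> (q1 + 1) * e" by metis
  have "u b < u (a * (q1 + 1))" using e(2) a(3) by simp
  then have "b < a * (q1 + 1)" unfolding u_less_iff .
  then have ba: "b \<le> a" using a(4) b(1) unfolding sS_def by (meson not_le)
  have "u a < u b'" using a(2) e(3) by simp
  then have ab: "a < b'" unfolding u_less_iff .
  have le: "a * (q1 + 1) \<le> f * a" using ratD[OF r a(1) ba ab b(2) a(4)] .
  have "q1 + 1 \<le> f"
  proof (rule ccontr)
    assume "\<not> q1 + 1 \<le> f"
    then have "f < q1 + 1" by (simp only: not_le)
    then have "a * f < a * (q1 + 1)" using B_pos[OF a(1)] by (rule mult_strict_left_mono)
    then show False using le by (simp add: mult.commute)
  qed
  then have "(q1 + 1) * e \<le> f * e" by (intro mult_right_mono) auto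
  then show "t \<le> f * e" using a(6) sS_unique[OF e(4) a(5)] by simp
qed

end

section \<open>Termination\<close>

context rca
begin

lemma le_0_iff [simp]: "x \<le> 0 \<longleftrightarrow> x = (0::'a)"
  by (auto intro: antisym)

lemma S1_S2: "S1 P \<Longrightarrow> S2 P"
  unfolding Exs_def by (blast intro: P1_D0)

lemma P2_P1: "P1 P \<Longrightarrow> P2 P"
  unfolding P2_def by (rule S1_S2) (simp add: P1_def)

lemma S1_sub3:
  assumes "S1 (\<lambda>e. Q (e 0) (e (Suc 0)) (e (Suc (Suc 0))))" and t: "Tm a" "Tm b" "Tm c"
  shows "S1 (\<lambda>e. Q (a e) (b e) (c e))"
  by (rule S1_sub5[where Q = "\<lambda>x y z _ _. Q x y z", OF assms(1) t Tm_const Tm_const])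

section \<open>Iteration of a time-dependent function\<close>

definition itr :: "('a \<Rightarrow> 'a \<Rightarrow> 'a) \<Rightarrow> 'a \<Rightarrow> 'a \<Rightarrow> 'a \<Rightarrow> 'a \<Rightarrow> bool" where
  "itr h j x t y \<longleftrightarrow> (\<exists>a d. ent a d 0 = x \<and>
     (\<forall>s<t. \<exists>v w. ent a d s = v \<and> ent a d (s + 1) = w \<and> h (j + s) v = w) \<and> ent a d t = y)"

lemma itrE:
  assumes "itr h j x t y"
  obtains a d where "ent a d 0 = x" "\<And>s. s < t \<Longrightarrow> ent a d (s + 1) = h (j + s) (ent a d s)" "ent a d t = y"
proof -
  from assms obtain a d where "ent a d 0 = x" "ent a d t = y"
    "\<forall>s<t. \<exists>v w. ent a d s = v \<and> ent a d (s + 1) = w \<and> h (j + s) v = w"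
    unfolding itr_def by blast
  then show thesis using that[of a d] by simp
qed

lemma itrI: "ent a d 0 = x \<Longrightarrow> (\<And>s. s < t \<Longrightarrow> ent a d (s + 1) = h (j + s) (ent a d s)) \<Longrightarrow> ent a d t = y \<Longrightarrow> itr h j x t y"
  unfolding itr_def by (rule exI[of _ a], rule exI[of _ d]) simp

definition it :: "('a \<Rightarrow> 'a \<Rightarrow> 'a) \<Rightarrow> 'a \<Rightarrow> 'a \<Rightarrow> 'a \<Rightarrow> 'a" where
  "it h j x t = (THE y. itr h j x t y)"

end

text \<open>Instantiated twice: with \<open>up Y\<close> for the trajectory of a number under
  repeated upgrades, and with \<open>sg\<close> for Goodstein runs.\<close>

locale iter = rca SS for SS :: "'a::linordered_semidom set set" +
  fixes h :: "'a \<Rightarrow> 'a \<Rightarrow> 'a"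
  assumes S1_h: "Tm i \<Longrightarrow> Tm x \<Longrightarrow> Tm y \<Longrightarrow> S1 (\<lambda>e. h (i e) (x e) = y e)"
begin

lemma S1_itr: "Tm j \<Longrightarrow> Tm x \<Longrightarrow> Tm t \<Longrightarrow> Tm y \<Longrightarrow> S1 (\<lambda>e. itr h (j e) (x e) (t e) (y e))"
proof (rule S1_sub5[where Q = "\<lambda>j x t y _. itr h j x t y", OF _ _ _ _ _ Tm_const])
  show "S1 (\<lambda>e. itr h (e 0) (e (Suc 0)) (e (Suc (Suc 0))) (e (Suc (Suc (Suc 0)))))"
    unfolding itr_def by (intro S1_ex S1_and S1_all S1_h; (intro S1_D0)?; intro D0_ent Tm_var Tm_add Tm_const)
qed

lemma itr_code:
  assumes a: "ent a d 0 = x" "\<And>s. s < t \<Longrightarrow> ent a d (s + 1) = h (j + s) (ent a d s)" and "itr h j x t y"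
  shows "s \<le> t \<Longrightarrow> itr h j x s v \<Longrightarrow> v = ent a d s"
proof -
  fix s v assume s: "s \<le> t" "itr h j x s v"
  from itrE[OF s(2)] obtain a' d' where b: "ent a' d' 0 = x"
    "\<And>r. r < s \<Longrightarrow> ent a' d' (r + 1) = h (j + r) (ent a' d' r)" "ent a' d' s = v" by blast
  have "r \<le> s \<longrightarrow> (\<exists>z. ent a' d' r = z \<and> ent a d r = z)" for r
  proof (rule ind_S1[of "\<lambda>r. r \<le> s \<longrightarrow> (\<exists>z. ent a' d' r = z \<and> ent a d r = z)"])
    show "S1 (\<lambda>e. e 0 \<le> s \<longrightarrow> (\<exists>z. ent a' d' (e 0) = z \<and> ent a d (e 0) = z))"
      by (intro S1_imp S1_ex S1_D0 D0_and D0_ent D0_le Tm_var Tm_const)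
    show "0 \<le> s \<longrightarrow> (\<exists>z. ent a' d' 0 = z \<and> ent a d 0 = z)" using a(1) b(1) by simp
    show "r + 1 \<le> s \<longrightarrow> (\<exists>z. ent a' d' (r + 1) = z \<and> ent a d (r + 1) = z)"
      if "r \<le> s \<longrightarrow> (\<exists>z. ent a' d' r = z \<and> ent a d r = z)" for r
    proof
      assume "r + 1 \<le> s"
      then have r: "r < s" by simp
      then have "ent a' d' r = ent a d r" using that by auto
      then show "\<exists>z. ent a' d' (r + 1) = z \<and> ent a d (r + 1) = z"
        using b(2)[OF r] a(2)[of r] r s(1) by simp
    qed
  qed
  then show "v = ent a d s" using b(3) by auto
qed

lemma itr_ex: "\<exists>y. itr h j x t y"
proof (rule ind_S1[of "\<lambda>t. \<exists>y. itr h j x t y"])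
  show "S1 (\<lambda>e. \<exists>y. itr h j x (e 0) y)" by (intro S1_ex S1_itr Tm_const Tm_var)
  have "\<exists>a d. \<forall>i\<le>0. ent a d i = x"
    by (rule beta[of "\<lambda>i v. v = x"]) (auto intro!: S1_D0 D0_eq Tm_var Tm_const)
  then obtain a d where "ent a d 0 = x" by auto
  then have "itr h j x 0 x" by (intro itrI[of a d]) auto
  then show "\<exists>y. itr h j x 0 y" ..
  fix t assume "\<exists>y. itr h j x t y"
  then obtain y where "itr h j x t y" ..
  from itrE[OF this] obtain a d where a: "ent a d 0 = x" "\<And>s. s < t \<Longrightarrow> ent a d (s + 1) = h (j + s) (ent a d s)"
    by blast
  let ?w = "h (j + t) (ent a d t)"
  let ?G = "\<lambda>s v. (s \<le> t \<longrightarrow> ent a d s = v) \<and> (t < s \<longrightarrow> v = ?w)"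
  have "\<exists>a' d'. \<forall>s\<le>t + 1. ?G s (ent a' d' s)"
  proof (rule beta)
    show "S1 (\<lambda>e. ?G (e 0) (e (Suc 0)))"
      by (intro S1_D0 D0_and D0_imp D0_le D0_less D0_eq D0_ent Tm_var Tm_const)
    show "\<exists>v. ?G s v" for s by (cases "s \<le> t") auto
  qed
  then obtain a' d' where a': "\<And>s. s \<le> t + 1 \<Longrightarrow> ?G s (ent a' d' s)" by blast
  have 1: "ent a' d' s = ent a d s" if "s \<le> t" for s
    using a'[of s] that by (simp add: add_increasing2)
  have 2: "ent a' d' (t + 1) = ?w" using a'[of "t + 1"] by simp
  have "ent a' d' (s + 1) = h (j + s) (ent a' d' s)" if "s < t + 1" for s
  proof (cases "s = t")
    case True
    then show ?thesis using 1[of t] 2 by simp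
  next
    case False
    then have "s < t" using that by (simp add: le_less)
    then show ?thesis using 1[of s] 1[of "s + 1"] a(2)[of s] by simp
  qed
  then have "itr h j x (t + 1) ?w" using 1[of 0] 2 a(1) by (intro itrI[of a' d']) simp_all
  then show "\<exists>y. itr h j x (t + 1) y" ..
qed

lemma itr_unique: "itr h j x t y \<Longrightarrow> itr h j x t y' \<Longrightarrow> y = y'"
proof -
  assume 1: "itr h j x t y" and 2: "itr h j x t y'"
  from itrE[OF 1] obtain a d where a: "ent a d 0 = x" "\<And>s. s < t \<Longrightarrow> ent a d (s + 1) = h (j + s) (ent a d s)"
    by blast
  from itr_code[OF a 1 order_refl 1] itr_code[OF a 1 order_refl 2] show ?thesis by simp
qed

lemma itr_it: "itr h j x t y \<longleftrightarrow> it h j x t = y"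
proof -
  obtain y0 where y0: "itr h j x t y0" using itr_ex by blast
  then have "it h j x t = y0" unfolding it_def using itr_unique by blast
  then show ?thesis using y0 itr_unique by blast
qed

lemma S1_it: "Tm j \<Longrightarrow> Tm x \<Longrightarrow> Tm t \<Longrightarrow> Tm y \<Longrightarrow> S1 (\<lambda>e. it h (j e) (x e) (t e) = y e)"
  using S1_itr by (simp add: itr_it)

lemma it_code:
  obtains a d where "\<And>s. s \<le> t \<Longrightarrow> ent a d s = it h j x s" "\<And>s. s < t \<Longrightarrow> ent a d (s + 1) = h (j + s) (ent a d s)"
    "ent a d 0 = x"
proof -
  have i: "itr h j x t (it h j x t)" by (simp add: itr_it)
  from itrE[OF i] obtain a d where a: "ent a d 0 = x" "\<And>s. s < t \<Longrightarrow> ent a d (s + 1) = h (j + s) (ent a d s)"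
    by blast
  have "ent a d s = it h j x s" if "s \<le> t" for s
    using itr_code[OF a i that] itr_it[of j x s "it h j x s"] by metis
  then show thesis using that a by blast
qed

lemma it_0 [simp]: "it h j x 0 = x"
  by (rule it_code[of 0 j x]) auto

lemma it_Suc: "it h j x (t + 1) = h (j + t) (it h j x t)"
proof (rule it_code[of "t + 1" j x])
  fix a d assume "\<And>s. s \<le> t + 1 \<Longrightarrow> ent a d s = it h j x s" "\<And>s. s < t + 1 \<Longrightarrow> ent a d (s + 1) = h (j + s) (ent a d s)"
  from this(1)[of "t + 1"] this(1)[of t] this(2)[of t] show ?thesis by (simp add: add_increasing2)
qed

lemma it_add: "it h j x (t + s) = it h (j + t) (it h j x t) s"
proof -
  have "\<exists>y. it h j x (t + s) = y \<and> it h (j + t) (it h j x t) s = y" for s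
  proof (rule ind_S1[of "\<lambda>s. \<exists>y. it h j x (t + s) = y \<and> it h (j + t) (it h j x t) s = y"])
    show "S1 (\<lambda>e. \<exists>y. it h j x (t + e 0) = y \<and> it h (j + t) (it h j x t) (e 0) = y)"
      by (intro S1_ex S1_and S1_it Tm_var Tm_const Tm_add)
    show "\<exists>y. it h j x (t + (s + 1)) = y \<and> it h (j + t) (it h j x t) (s + 1) = y"
      if "\<exists>y. it h j x (t + s) = y \<and> it h (j + t) (it h j x t) s = y" for s
    proof -
      have "it h j x (t + s + 1) = h (j + (t + s)) (it h j x (t + s))" by (rule it_Suc)
      moreover have "it h (j + t) (it h j x t) (s + 1) = h (j + t + s) (it h (j + t) (it h j x t) s)" by (rule it_Suc)
      ultimately show ?thesis using that by (simp add: add.assoc)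
    qed
  qed simp
  then show ?thesis by metis
qed

end

section \<open>Termination along a dynamical hierarchy\<close>

locale dyn = rca SS for SS :: "'a::linordered_semidom set set" +
  fixes K :: 'a and Y :: "'a set"
  assumes Y: "Y \<in> SS" and D: "sdyn Y" and RB0: "RB K (mb Y 0)"
begin

abbreviation Bi where "Bi i \<equiv> mb Y i"

lemma rstepI: "RB K (Bi i) \<Longrightarrow> rstep SS K Y i"
  using Y D rca_axioms unfolding rstep_def rstep_axioms_def sdyn_def by blast

text \<open>\<open>R\<close> leaves out the clauses that \<open>sdyn\<close> and comprehension
  provide at every time; what remains is \<Pi>1 and inductive by \<open>RB_C\<close>.\<close>

lemma RB_all: "RB K (Bi i)"
proof -
  define R where "R i \<longleftrightarrow> (\<forall>b. b \<in> Bi i \<longrightarrow> (\<exists>s\<le>b * K. sS (Bi i) b s) \<and> K \<le> b)" for i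
  have RR: "RB K (Bi i) \<longleftrightarrow> R i" for i
    using D mb_SS[OF Y] unfolding RB_def R_def sdyn_def by auto
  have "P2 (\<lambda>e. R (e 0))" unfolding R_def
    by (intro P2_P1 P1_all P1_D0 D0_imp D0_mb[OF Y] D0_and D0_exle D0_sS[OF Y] D0_le Tm_mult Tm_var Tm_const)
  then have "R i"
  proof (rule ind_P2)
    show "R 0" using RB0 RR by blast
    show "R (i + 1)" if "R i" for i using rstep.RB_C[OF rstepI] that RR by blast
  qed
  then show ?thesis using RR by blast
qed

lemma rs: "rstep SS K Y i"
  by (rule rstepI[OF RB_all])

lemma S1_up: "Tm i \<Longrightarrow> Tm n \<Longrightarrow> Tm v \<Longrightarrow> S1 (\<lambda>e. up Y (i e) (n e) = v e)"
proof (rule S1_sub3[where Q = "\<lambda>i n v. up Y i n = v"])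
  have "S1 (\<lambda>e. supn (mb Y (e 0)) (mb Y (e 0 + 1)) (e (Suc 0)) (e (Suc (Suc 0))))"
    by (intro S1_supn Y Tm_add Tm_var Tm_const)
  then show "S1 (\<lambda>e. up Y (e 0) (e (Suc 0)) = e (Suc (Suc 0)))"
    by (simp add: rstep.supn_u[OF rs] eq_commute)
qed

definition sg :: "'a \<Rightarrow> 'a \<Rightarrow> 'a" where
  "sg i x = (if x = 0 then 0 else THE w. up Y i x = w + 1)"

lemma sg_0 [simp]: "sg i 0 = 0"
  by (simp add: sg_def)

lemma sg_pos: "x \<noteq> 0 \<Longrightarrow> up Y i x = sg i x + 1"
proof -
  assume "x \<noteq> 0"
  then have "up Y i x \<noteq> 0" using rstep.u_pos[OF rs] by (simp add: pos_iff)
  then obtain w where "up Y i x = w + 1" using succ_ex by blast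
  then show ?thesis using \<open>x \<noteq> 0\<close> by (simp add: sg_def)
qed

lemma S1_sg: "Tm i \<Longrightarrow> Tm n \<Longrightarrow> Tm v \<Longrightarrow> S1 (\<lambda>e. sg (i e) (n e) = v e)"
proof (rule S1_sub3[where Q = "\<lambda>i n v. sg i n = v"])
  have 1: "sg i x = w \<longleftrightarrow> (x = 0 \<and> w = 0) \<or> (x \<noteq> 0 \<and> up Y i x = w + 1)" for i x w
    using sg_pos[of x i] by (cases "x = 0") auto
  show "S1 (\<lambda>e. sg (e 0) (e (Suc 0)) = e (Suc (Suc 0)))"
    unfolding 1 by (intro S1_or S1_and S1_up Tm_add Tm_var Tm_const; intro S1_D0 D0_and D0_not D0_eq Tm_var Tm_const)
qed

sublocale T: iter SS "up Y" by unfold_locales (rule S1_up)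
sublocale G: iter SS sg by unfold_locales (rule S1_sg)

abbreviation tr where "tr \<equiv> it (up Y)"
abbreviation rn where "rn \<equiv> it sg"

definition Term :: "'a \<Rightarrow> 'a \<Rightarrow> bool" where
  "Term j x \<longleftrightarrow> (\<exists>t. rn j x t = 0)"

text \<open>The quantifier over \<open>t\<close> makes the property persistent under upgrades
  (\<open>A_shift\<close>), so it can be invoked at whatever time a run reaches the upgraded
  base.\<close>

definition A :: "'a \<Rightarrow> 'a \<Rightarrow> bool" where
  "A i b \<longleftrightarrow> (\<forall>t. Term (i + t) (tr i b t))"

lemma sg_mono: "x \<le> y \<Longrightarrow> sg i x \<le> sg i y"
proof (cases "x = 0")
  case False
  assume le: "x \<le> y"
  then have "y \<noteq> 0" using False antisym[OF le] by auto
  then have "sg i x + 1 \<le> sg i y + 1"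
    using le sg_pos[OF False, of i] sg_pos[of y i] rstep.u_le_iff[OF rs, of i x y] by simp
  then show ?thesis by simp
qed simp

text \<open>The Goodstein step is monotone at each time, so two runs keep their order.\<close>

lemma Term_mono: "Term j y \<Longrightarrow> x \<le> y \<Longrightarrow> Term j x"
proof -
  assume T: "Term j y" and le: "x \<le> y"
  have "\<exists>v w. rn j x t = v \<and> rn j y t = w \<and> v \<le> w" for t
  proof (rule ind_S1[of "\<lambda>t. \<exists>v w. rn j x t = v \<and> rn j y t = w \<and> v \<le> w"])
    show "S1 (\<lambda>e. \<exists>v w. rn j x (e 0) = v \<and> rn j y (e 0) = w \<and> v \<le> w)"
      by (intro S1_ex S1_and G.S1_it Tm_var Tm_const; intro S1_D0 D0_le Tm_var)
    show "\<exists>v w. rn j x (t + 1) = v \<and> rn j y (t + 1) = w \<and> v \<le> w"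
      if "\<exists>v w. rn j x t = v \<and> rn j y t = w \<and> v \<le> w" for t
      using that sg_mono unfolding G.it_Suc by blast
  qed (use le in simp)
  moreover obtain t where "rn j y t = 0" using T unfolding Term_def by blast
  ultimately have "rn j x t \<le> 0" by metis
  then show ?thesis unfolding Term_def by (metis antisym zero_le)
qed

lemma Term_shift: "Term (j + t) (rn j x t) \<Longrightarrow> Term j x"
  unfolding Term_def G.it_add[symmetric] by blast

lemma rn_1: "rn j x 1 = sg j x"
  using G.it_Suc[of j x 0] by simp

lemma Term_step: "Term (j + 1) (sg j x) \<Longrightarrow> Term j x"
  using Term_shift[of j 1 x] by (simp add: rn_1)

lemma Term_0: "Term j 0"
  unfolding Term_def by (rule exI[of _ 0]) simp

lemma tr_1: "tr j x 1 = up Y j x"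
  using T.it_Suc[of j x 0] by simp

lemma A_shift: "A i b \<Longrightarrow> A (i + t) (tr i b t)"
  unfolding A_def T.it_add[symmetric] add.assoc by blast

lemma A_up: "A i b \<Longrightarrow> A (i + 1) (up Y i b)"
  using A_shift[of i b 1] by (simp add: tr_1)

lemma A_Term: "A i b \<Longrightarrow> Term i b"
  unfolding A_def by (metis T.it_0 add_0_right)

lemma tr_B: "b \<in> Bi i \<Longrightarrow> tr i b t \<in> Bi (i + t)"
proof (rule ind_S1[of "\<lambda>t. tr i b t \<in> Bi (i + t)"])
  have "S1 (\<lambda>e. \<exists>y. tr i b (e 0) = y \<and> y \<in> Bi (i + e 0))"
    by (intro S1_ex S1_and T.S1_it Tm_var Tm_const; intro S1_D0 D0_mb[OF Y] Tm_add Tm_var Tm_const)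
  then show "S1 (\<lambda>e. tr i b (e 0) \<in> Bi (i + e 0))" by simp
  show "tr i b (t + 1) \<in> Bi (i + (t + 1))" if "tr i b t \<in> Bi (i + t)" for t
    using rstep.uC[OF rs that] by (simp add: T.it_Suc add.assoc)
qed simp

text \<open>While the part \<open>l\<close> below \<open>e\<close> is being consumed, the leading part \<open>e f\<close> is only upgraded.\<close>

lemma run_lead:
  assumes e: "e \<in> Bi j" and f: "0 < f" and s: "slessS (e * f) (Bi j) e" and l: "l < e"
    and T: "Term j l"
  obtains t c where "rn j (e * f + l) t = c * f" "c \<in> Bi (j + t)" "slessS (c * f) (Bi (j + t)) c"
    "tr j e t \<le> c" "rat (Bi (j + t)) (tr j e t) c f"
proof -
  have S: "S1 (\<lambda>e. rn j l (e 0) = 0)" by (intro G.S1_it Tm_var Tm_const)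
  have "S1 (\<lambda>e. \<exists>y. rn j l (e 0) = y \<and> y \<noteq> 0)"
    by (intro S1_ex S1_and G.S1_it Tm_var Tm_const; intro S1_D0 D0_not D0_eq Tm_var Tm_const)
  then have P: "P1 (\<lambda>e. rn j l (e 0) = 0)" unfolding P1_def by simp
  obtain t1 where "rn j l t1 = 0" using T unfolding Term_def by blast
  \<comment> \<open>Before its first zero the low part is positive, so subtracting 1 affects the low
    part alone.\<close>
  from least_P1[OF P this] obtain t where t: "rn j l t = 0" "\<And>z. z < t \<Longrightarrow> rn j l z \<noteq> 0" by blast
  define Q where "Q r \<longleftrightarrow> (r \<le> t \<longrightarrow> (\<exists>c y z w. rn j (e * f + l) r = y \<and> rn j l r = z \<and> tr j e r = w \<and>
     y = c * f + z \<and> z < c \<and> c \<in> Bi (j + r) \<and> slessS (c * f) (Bi (j + r)) c \<and> w \<le> c \<and> rat (Bi (j + r)) w c f))" for r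
  have "Q r" for r
  proof (rule ind_S1[of Q])
    show "S1 (\<lambda>e. Q (e 0))" unfolding Q_def
      by (intro S1_imp S1_ex S1_and G.S1_it T.S1_it Tm_var Tm_const; (intro S1_D0)?;
          intro D0_and D0_le D0_less D0_eq D0_mb[OF Y] D0_slessS[OF Y] D0_rat[OF Y] Tm_add Tm_mult Tm_var Tm_const)
    show "Q 0" unfolding Q_def
    proof
      have "rat (Bi j) e e f" unfolding rat_def by auto
      then show "\<exists>c y z w. rn j (e * f + l) 0 = y \<and> rn j l 0 = z \<and> tr j e 0 = w \<and>
        y = c * f + z \<and> z < c \<and> c \<in> Bi (j + 0) \<and> slessS (c * f) (Bi (j + 0)) c \<and> w \<le> c \<and> rat (Bi (j + 0)) w c f"
        using e l s by - (rule exI[of _ e], simp)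
    qed
    fix r assume IH: "Q r"
    show "Q (r + 1)" unfolding Q_def
    proof
      assume r: "r + 1 \<le> t"
      then have rt: "r < t" by simp
      then obtain c where c: "rn j (e * f + l) r = c * f + rn j l r" "rn j l r < c" "c \<in> Bi (j + r)"
        "slessS (c * f) (Bi (j + r)) c" "tr j e r \<le> c" "rat (Bi (j + r)) (tr j e r) c f"
        using IH unfolding Q_def by auto
      interpret S: rstep SS K Y "j + r" by (rule rs)
      obtain c' where M: "S.MP c f c'" using S.MP_ex[OF c(3) f c(4)] by blast
      then have c': "c' \<in> Bi (j + (r + 1))" "slessS (c' * f) (Bi (j + (r + 1))) c'" "up Y (j + r) c \<le> c'"
        "rat (Bi (j + (r + 1))) (up Y (j + r) c) c' f"
        unfolding S.MP_def by (simp_all add: add.assoc)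
      let ?z = "rn j l r"
      have z0: "?z \<noteq> 0" using t(2)[OF rt] .
      have add: "up Y (j + r) (c * f + ?z) = c' * f + up Y (j + r) ?z"
        using S.MP_add[OF c(3) f c(4) M c(2)] .
      have sz: "up Y (j + r) ?z = sg (j + r) ?z + 1" using sg_pos[OF z0] .
      have "c * f + ?z \<noteq> 0" using z0 by (simp add: add_nonneg_eq_0_iff)
      then have "sg (j + r) (c * f + ?z) + 1 = c' * f + sg (j + r) ?z + 1"
        using sg_pos[of "c * f + ?z" "j + r"] add sz by (simp add: add.assoc)
      then have e1: "sg (j + r) (c * f + ?z) = c' * f + sg (j + r) ?z" by simp
      have "up Y (j + r) ?z < c'" using S.u_less[OF c(2)] c'(3) by simp
      then have e2: "sg (j + r) ?z < c'" unfolding sz by (metis less_add1 less_le_trans order_refl less_trans)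
      have mono: "up Y (j + r) (tr j e r) \<le> up Y (j + r) c" using c(5) S.u_le_iff by blast
      have tB: "tr j e r \<in> Bi (j + r)" using tr_B[OF e] .
      have "rat (Bi (j + (r + 1))) (up Y (j + r) (tr j e r)) (up Y (j + r) c) f"
        using S.rat_u[OF tB c(3) c(6)] by (simp add: add.assoc)
      then have e3: "rat (Bi (j + (r + 1))) (up Y (j + r) (tr j e r)) c' f"
        using rat_trans[OF _ c'(4) _ c'(1)] S.uC[OF c(3)] by (simp add: add.assoc)
      have e4: "up Y (j + r) (tr j e r) \<le> c'" using mono c'(3) by simp
      show "\<exists>c y z w. rn j (e * f + l) (r + 1) = y \<and> rn j l (r + 1) = z \<and> tr j e (r + 1) = w \<and>
        y = c * f + z \<and> z < c \<and> c \<in> Bi (j + (r + 1)) \<and> slessS (c * f) (Bi (j + (r + 1))) c \<and> w \<le> c \<and>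
        rat (Bi (j + (r + 1))) w c f"
        unfolding G.it_Suc T.it_Suc c(1) using e1 e2 e3 e4 c'(1,2) by blast
    qed
  qed
  from this[of t] obtain c where "rn j (e * f + l) t = c * f + 0" "c \<in> Bi (j + t)" "slessS (c * f) (Bi (j + t)) c"
    "tr j e t \<le> c" "rat (Bi (j + t)) (tr j e t) c f" unfolding Q_def using t(1) by auto
  then show thesis using that by simp
qed

definition L :: "nat \<Rightarrow> bool" where
  "L c \<longleftrightarrow> (\<forall>i b b'. b \<in> Bi i \<longrightarrow> b' \<in> Bi i \<longrightarrow> b \<le> b' \<longrightarrow> rat (Bi i) b b' (of_nat c) \<longrightarrow> A i b \<longrightarrow> A i b')"

lemma L_D: "L c \<Longrightarrow> b \<in> Bi i \<Longrightarrow> b' \<in> Bi i \<Longrightarrow> b \<le> b' \<Longrightarrow> rat (Bi i) b b' (of_nat c) \<Longrightarrow> A i b \<Longrightarrow> A i b'"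
  unfolding L_def by blast

text \<open>After \<open>l\<close> is consumed there remains \<open>d * f\<close>, where
  \<open>d\<close> may exceed the upgraded \<open>e\<close>. The bases passed over have ratios at
  most \<open>f \<le> c\<close>, so \<open>L c\<close> carries \<open>A\<close> from the upgraded
  \<open>e\<close> to \<open>d\<close>.\<close>

lemma Term_lead:
  assumes L: "L c" and fc: "f \<le> of_nat c" and f: "0 < f"
    and D: "\<And>i e. e \<in> Bi i \<Longrightarrow> A i e \<Longrightarrow> slessS (e * f) (Bi i) e \<Longrightarrow> Term i (e * f)"
    and e: "e \<in> Bi j" "slessS (e * f) (Bi j) e" "A j e" and l: "l < e"
  shows "Term j (e * f + l)"
proof -
  have "Term j l" using Term_mono[OF A_Term[OF e(3)]] l by simp
  from run_lead[OF e(1) f e(2) l this] obtain t d where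
    *: "rn j (e * f + l) t = d * f" "d \<in> Bi (j + t)" "slessS (d * f) (Bi (j + t)) d"
      "tr j e t \<le> d" "rat (Bi (j + t)) (tr j e t) d f" .
  have "A (j + t) d"
    by (rule L_D[OF L tr_B[OF e(1)] *(2,4) rat_mono[OF *(5,2) fc] A_shift[OF e(3)]])
  then have "Term (j + t) (d * f)" using D *(2,3) by blast
  then show ?thesis using Term_shift[of j t] *(1) by simp
qed

text \<open>One step turns \<open>e (a + 1)\<close> into \<open>c1 a + (c1 - 1)\<close>.
  \<open>Term_lead\<close> consumes the low part and leaves the digit \<open>a\<close>; the
  induction hypothesis covers it at any later time and base.\<close>

lemma digits:
  assumes L: "L c"
  shows "a \<le> c \<Longrightarrow> e \<in> Bi i \<Longrightarrow> A i e \<Longrightarrow> slessS (e * of_nat a) (Bi i) e \<Longrightarrow> Term i (e * of_nat a)"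
proof (induction a arbitrary: e i)
  case 0
  then show ?case by (simp add: Term_0)
next
  case (Suc a)
  let ?f = "of_nat (Suc a) :: 'a"
  have fa: "?f = of_nat a + 1" by (simp add: add.commute)
  have f0: "0 < ?f" unfolding fa by (simp add: pos_iff add_nonneg_eq_0_iff)
  interpret S: rstep SS K Y i by (rule rs)
  obtain c1 where M: "S.MP e ?f c1" using S.MP_ex[OF Suc.prems(2) f0 Suc.prems(4)] by blast
  then have c1: "c1 \<in> Bi (i + 1)" "slessS (c1 * ?f) (Bi (i + 1)) c1" "up Y i (e * ?f) = c1 * ?f" "up Y i e \<le> c1"
    "rat (Bi (i + 1)) (up Y i e) c1 ?f" unfolding S.MP_def by auto
  have "?f \<le> of_nat c" using Suc.prems(1) by (simp only: of_nat_le_iff)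
  then have A1: "A (i + 1) c1"
    by (rule L_D[OF L S.uC[OF Suc.prems(2)] c1(1,4) rat_mono[OF c1(5,1)] A_up[OF Suc.prems(3)]])
  obtain c2 where c2: "c1 = c2 + 1" using succ_ex[of c1] S.C_pos[OF c1(1)] by (auto simp: pos_iff)
  have "e * ?f \<noteq> 0" using f0 S.B_pos[OF Suc.prems(2)] by (simp add: pos_iff del: of_nat_Suc)
  then have "sg i (e * ?f) + 1 = c1 * ?f" using sg_pos c1(3) by metis
  also have "\<dots> = (c1 * of_nat a + c2) + 1" unfolding fa by (simp add: distrib_left add.assoc flip: c2)
  finally have sge: "sg i (e * ?f) = c1 * of_nat a + c2" by simp
  have c21: "c2 < c1" unfolding c2 by simp
  have "Term (i + 1) (c1 * of_nat a + c2)"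
  proof (cases "a = 0")
    case True
    then show ?thesis using Term_mono[OF A_Term[OF A1], of c2] c21 by simp
  next
    case False
    have s: "slessS (c1 * of_nat a) (Bi (i + 1)) c1"
      by (rule S.slessS_le[OF c1(2)]) (simp add: distrib_left)
    have "of_nat a \<le> (of_nat c :: 'a)" using Suc.prems(1) by simp
    moreover have "0 < (of_nat a :: 'a)" using False by simp
    ultimately show ?thesis using Suc.IH Suc.prems(1) by (intro Term_lead[OF L _ _ _ c1(1) s A1 c21]) auto
  qed
  then show ?case using Term_step sge by metis
qed

text \<open>Elements below a standard one are standard, which makes digits of the model accessible
  to the external induction in \<open>digits\<close>.\<close>

lemma le_of_nat: "x \<le> of_nat c \<Longrightarrow> \<exists>a\<le>c. x = (of_nat a :: 'a)"
proof (induction c)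
  case (Suc c)
  show ?case
  proof (cases "x \<le> of_nat c")
    case True
    then show ?thesis using Suc.IH by (meson le_SucI)
  next
    case False
    then have "of_nat c + 1 \<le> x" by simp
    then have "x = of_nat (Suc c)" using Suc.prems by (simp add: add.commute antisym)
    then show ?thesis by blast
  qed
qed auto

text \<open>A block whose last ratio is at most \<open>c + 1\<close> and whose other ratios are at most \<open>c\<close>; this
  shape is preserved by upgrades.\<close>

definition link :: "nat \<Rightarrow> 'a \<Rightarrow> 'a \<Rightarrow> 'a \<Rightarrow> bool" where
  "link c i b b' \<longleftrightarrow> (\<exists>e q. e \<in> Bi i \<and> b \<le> e \<and> rat (Bi i) b e (of_nat c) \<and> sS (Bi i) e b' \<and> b' = e * (q + 1) \<and>
     q \<le> of_nat c)"

text \<open>Between \<open>\<up>e\<close> and the new last base \<open>c1\<close> the ratios are at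
  most \<open>q \<le> c\<close> by \<open>MP\<close>; by \<open>next_base\<close> the last ratio
  does not grow.\<close>

lemma link_up:
  assumes b: "b \<in> Bi i" and l: "link c i b b'" shows "link c (i + 1) (up Y i b) (up Y i b')"
proof -
  from l obtain e q where e: "e \<in> Bi i" "b \<le> e" "rat (Bi i) b e (of_nat c)" "sS (Bi i) e b'" "b' = e * (q + 1)" "q \<le> of_nat c"
    unfolding link_def by blast
  interpret S: rstep SS K Y i by (rule rs)
  have q0: "0 < q"
  proof -
    have "e < e * (q + 1)" using e(4,5) unfolding sS_def by blast
    then have "q \<noteq> 0" by auto
    then show ?thesis by (simp add: pos_iff)
  qed
  have "slessS (e * q) (Bi i) e" by (rule S.slessI[OF e(4)]) (simp add: e(5) distrib_left S.B_pos[OF e(1)])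
  then obtain c1 where M: "S.MP e q c1" using S.MP_ex[OF e(1) q0] by blast
  then have c1: "c1 \<in> Bi (i + 1)" "up Y i e \<le> c1" "rat (Bi (i + 1)) (up Y i e) c1 q" unfolding S.MP_def by auto
  have nb: "sS (Bi (i + 1)) c1 (up Y i b')" "up Y i b' \<le> c1 * (q + 1)"
    using S.next_base[OF e(1) _ M q0] e(4) unfolding e(5) by auto
  obtain q' where q': "up Y i b' = c1 * q'" using S.hier nb(1) c1(1) unfolding shier_def by blast
  have "c1 < c1 * q'" using nb(1) unfolding sS_def q' by blast
  then have "q' \<noteq> 0" by auto
  then obtain q1 where q1: "q' = q1 + 1" using succ_ex by blast
  have "q1 \<le> q"
  proof (rule ccontr)
    assume "\<not> q1 \<le> q"
    then have "c1 * (q + 1) < c1 * q'" unfolding q1 using S.C_pos[OF c1(1)] by (intro mult_strict_left_mono) auto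
    then show False using nb(2) q' by simp
  qed
  then have qc: "q1 \<le> of_nat c" using e(6) by simp
  have "rat (Bi (i + 1)) (up Y i b) (up Y i e) (of_nat c)" using S.rat_u[OF b e(1,3)] .
  moreover have "rat (Bi (i + 1)) (up Y i e) c1 (of_nat c)" using rat_mono[OF c1(3,1) e(6)] .
  ultimately have "rat (Bi (i + 1)) (up Y i b) c1 (of_nat c)" using rat_trans S.uC[OF e(1)] c1(1) by blast
  moreover have "up Y i b \<le> c1" using S.u_le_iff e(2) c1(2) by (meson order_trans)
  ultimately show ?thesis unfolding link_def using c1(1) nb(1) q' q1 qc by blast
qed

lemma link_tr:
  assumes b: "b \<in> Bi i" and l: "link c i b b'" shows "link c (i + t) (tr i b t) (tr i b' t)"
proof (rule ind_S1[of "\<lambda>t. link c (i + t) (tr i b t) (tr i b' t)"])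
  have "S1 (\<lambda>e. \<exists>x y. tr i b (e 0) = x \<and> tr i b' (e 0) = y \<and> link c (i + e 0) x y)" unfolding link_def
    by (intro S1_ex S1_and T.S1_it Tm_var Tm_const; (intro S1_D0)?;
        intro D0_le D0_eq D0_mb[OF Y] D0_sS[OF Y] D0_rat[OF Y] Tm_add Tm_mult Tm_var Tm_const)
  then show "S1 (\<lambda>e. link c (i + e 0) (tr i b (e 0)) (tr i b' (e 0)))" by simp
  show "link c (i + 0) (tr i b 0) (tr i b' 0)" using l by simp
  show "link c (i + (t + 1)) (tr i b (t + 1)) (tr i b' (t + 1))" if "link c (i + t) (tr i b t) (tr i b' t)" for t
    using link_up[OF tr_B[OF b] that] by (simp add: T.it_Suc add.assoc)
qed

text \<open>One step takes \<open>b'\<close> through \<open>e (q + 1)\<close> to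
  \<open>e q + (e - 1)\<close>: the large ratio is exchanged for a digit \<open>q \<le> c\<close>
  over a base \<open>e\<close> reached through ratios at most \<open>c\<close>, where
  \<open>L c\<close> applies.\<close>

lemma link_Term:
  assumes L: "L c" and b: "b \<in> Bi i" and l: "link c i b b'" and A: "A i b" shows "Term i b'"
proof -
  from link_up[OF b l] obtain e q where e: "e \<in> Bi (i + 1)" "up Y i b \<le> e" "rat (Bi (i + 1)) (up Y i b) e (of_nat c)"
    "sS (Bi (i + 1)) e (up Y i b')" "up Y i b' = e * (q + 1)" "q \<le> of_nat c" unfolding link_def by blast
  interpret S: rstep SS K Y i by (rule rs)
  have Ae: "A (i + 1) e" by (rule L_D[OF L S.uC[OF b] e(1,2,3) A_up[OF A]])
  obtain e' where e': "e = e' + 1" using succ_ex[of e] S.C_pos[OF e(1)] by (auto simp: pos_iff)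
  have e'e: "e' < e" unfolding e' by simp
  have "b' \<noteq> 0"
  proof
    assume "b' = 0"
    then have "e * (q + 1) = 0" using e(5) S.u_0 by simp
    then show False using S.C_pos[OF e(1)] by (simp add: pos_iff add_nonneg_eq_0_iff)
  qed
  then have "sg i b' + 1 = (e * q + e') + 1" using sg_pos[of b' i] e(5) by (simp add: distrib_left add.assoc flip: e')
  then have sgb: "sg i b' = e * q + e'" by simp
  obtain a where a: "a \<le> c" "q = of_nat a" using le_of_nat[OF e(6)] by blast
  have "Term (i + 1) (e * q + e')"
  proof (cases "a = 0")
    case True
    then show ?thesis using Term_mono[OF A_Term[OF Ae], of e'] e'e a by simp
  next
    case False
    have s: "slessS (e * q) (Bi (i + 1)) e"
      by (rule S.slessI[OF e(4)]) (simp add: e(5) distrib_left S.C_pos[OF e(1)])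
    have "0 < q" using False a(2) by simp
    then show ?thesis
      using digits[OF L a(1)] unfolding a(2)[symmetric] by (intro Term_lead[OF L e(6) _ _ e(1) s Ae e'e]) auto
  qed
  then show ?thesis using Term_step sgb by metis
qed

lemma link_A:
  assumes L: "L c" and b: "b \<in> Bi i" and l: "link c i b b'" and A: "A i b" shows "A i b'"
  unfolding A_def by (intro allI link_Term[OF L tr_B[OF b] link_tr[OF b l] A_shift[OF A]])

text \<open>The trajectory enters through its \<Sigma>1 graph in negated position. The matrix is
  then a disjunction of a \<Pi>1 and a \<Sigma>1 predicate under universal quantifiers.\<close>

lemma P2_A: "P2 (\<lambda>e. A i (e 0))"
proof -
  have "P2 (\<lambda>e. \<forall>t y. \<not> tr i (e 0) t = y \<or> Term (i + t) y)"
  proof (intro P2_all)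
    have "S1 (\<lambda>e. tr i (e (Suc (Suc 0))) (e (Suc 0)) = e 0)" by (intro T.S1_it Tm_var Tm_const)
    then have "P2 (\<lambda>e. \<not> tr i (e (Suc (Suc 0))) (e (Suc 0)) = e 0)" by (intro P2_P1) (simp add: P1_def)
    moreover have "P2 (\<lambda>e. Term (i + e (Suc 0)) (e 0))"
      unfolding Term_def by (intro P2_S1 S1_ex G.S1_it Tm_add Tm_var Tm_const)
    ultimately show "P2 (\<lambda>e. \<not> tr i (e (Suc (Suc 0))) (e (Suc 0)) = e 0 \<or> Term (i + e (Suc 0)) (e 0))"
      unfolding P2_def using S2_and[of "\<lambda>e. \<not> \<not> tr i (e (Suc (Suc 0))) (e (Suc 0)) = e 0" "\<lambda>e. \<not> Term (i + e (Suc 0)) (e 0)"]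
      by simp
  qed
  then show ?thesis unfolding A_def by simp
qed

text \<open>For fixed \<open>c\<close>, \<open>link_A\<close> passes from one base to the next. The
  internal induction on \<open>y\<close> has a \<Pi>2 statement, and here \<Sigma>2 induction is
  used in full strength.\<close>

lemma L_all: "L c"
proof (induction c)
  case 0
  show ?case unfolding L_def
  proof (intro allI impI)
    fix i b b' assume *: "b \<in> Bi i" "b' \<in> Bi i" "b \<le> b'" "rat (Bi i) b b' (of_nat 0)" "A i b"
    \<comment> \<open>Successors are positive, so a ratio bound of 0 excludes any base properly
      below \<open>b'\<close>.\<close>
    have "b = b'"
    proof (rule ccontr)
      assume "b \<noteq> b'"
      then have less: "b < b'" using *(3) by simp
      then obtain s where s: "sS (Bi i) b s" using sS_ex[OF mb_SS[OF Y] *(2)] by blast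
      have "s \<le> of_nat 0 * b" using ratD[OF *(4,1) order_refl less *(2) s] .
      then show False using s unfolding sS_def by simp
    qed
    then show "A i b'" using *(5) by simp
  qed
next
  case (Suc c)
  show ?case unfolding L_def
  proof (intro allI impI)
    fix i b b' assume *: "b \<in> Bi i" "b' \<in> Bi i" "b \<le> b'" "rat (Bi i) b b' (of_nat (Suc c))" "A i b"
    interpret S: rstep SS K Y i by (rule rs)
    have "\<forall>x. x \<le> y \<and> x \<in> Bi i \<and> b \<le> x \<and> x \<le> b' \<longrightarrow> A i x" for y
    proof (rule ind_P2[of "\<lambda>y. \<forall>x. x \<le> y \<and> x \<in> Bi i \<and> b \<le> x \<and> x \<le> b' \<longrightarrow> A i x"])
      show "P2 (\<lambda>e. \<forall>x. x \<le> e 0 \<and> x \<in> Bi i \<and> b \<le> x \<and> x \<le> b' \<longrightarrow> A i x)"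
        by (intro P2_all P2_imp P2_A D0_and D0_le D0_mb[OF Y] Tm_var Tm_const)
      show "\<forall>x. x \<le> 0 \<and> x \<in> Bi i \<and> b \<le> x \<and> x \<le> b' \<longrightarrow> A i x"
        using S.B_pos[OF *(1)] by (auto simp: pos_iff)
      fix y assume IH: "\<forall>x. x \<le> y \<and> x \<in> Bi i \<and> b \<le> x \<and> x \<le> b' \<longrightarrow> A i x"
      show "\<forall>x. x \<le> y + 1 \<and> x \<in> Bi i \<and> b \<le> x \<and> x \<le> b' \<longrightarrow> A i x"
      proof (intro allI impI)
        fix x assume x: "x \<le> y + 1 \<and> x \<in> Bi i \<and> b \<le> x \<and> x \<le> b'"
        show "A i x"
        proof (cases "x = b \<or> x \<le> y")
          case True
          then show ?thesis using IH x *(5) by blast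
        next
          case False
          then have xy: "x = y + 1" "b < x" using x by (auto simp: not_le antisym)
          then have "b \<le> y" by simp
          then obtain e where e: "bs (Bi i) y e" using bs_ex[OF mb_SS[OF Y] *(1)] by blast
          then have e': "e \<in> Bi i" "e \<le> y" "b \<le> e" using *(1) \<open>b \<le> y\<close> unfolding bs_def by auto
          have ex: "e < x" using e'(2) xy(1) by simp
          have sx: "sS (Bi i) e x" unfolding sS_def
          proof (intro conjI allI impI)
            fix z assume z: "z \<in> Bi i \<and> e < z"
            show "x \<le> z"
            proof (rule ccontr)
              assume "\<not> x \<le> z"
              then have "z \<le> y" using xy(1) by simp
              then have "z \<le> e" using e z unfolding bs_def by blast
              then show False using z by (auto dest: leD)
            qed
          qed (use x ex in auto)
          have eb': "e < b'" using ex x by (meson less_le_trans)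
          have "x \<le> of_nat (Suc c) * e" using ratD[OF *(4) e'(1,3) eb' *(2) sx] .
          moreover obtain q where q: "x = e * q" using S.hierB e'(1) sx unfolding shier_def by blast
          have "q \<noteq> 0" using ex q by auto
          then obtain q1 where q1: "q = q1 + 1" using succ_ex by blast
          have "q1 \<le> of_nat c"
          proof (rule ccontr)
            assume "\<not> q1 \<le> of_nat c"
            then have "e * of_nat (Suc c) < e * q"
              unfolding q1 using S.B_pos[OF e'(1)] by (intro mult_strict_left_mono) (auto simp: add.commute)
            then show False using \<open>x \<le> of_nat (Suc c) * e\<close> q by (simp add: mult.commute del: of_nat_Suc)
          qed
          \<comment> \<open>The block consists of the single step from \<open>e\<close> to
            \<open>x\<close>, so the condition on the ratios before the last one is void.\<close>
          moreover have "rat (Bi i) e e (of_nat c)" unfolding rat_def by auto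
          ultimately have "link c i e x" unfolding link_def using e'(1) sx q q1 by blast
          moreover have "A i e" using IH e' eb' by (meson less_imp_le)
          ultimately show ?thesis using link_A[OF Suc.IH e'(1)] by blast
        qed
      qed
    qed
    from this[of b'] show "A i b'" using * by blast
  qed
qed

text \<open>Below the least base an upgrade changes nothing, and least bases never decrease; the run
  simply counts down.\<close>

lemma Term_below: "(\<And>e. e \<le> x \<Longrightarrow> e \<notin> Bi j) \<Longrightarrow> Term j x"
proof -
  assume x: "\<And>e. e \<le> x \<Longrightarrow> e \<notin> Bi j"
  define Q where "Q t \<longleftrightarrow> (t \<le> x \<longrightarrow> (\<exists>y. rn j x t = y \<and> y + t = x \<and> (\<forall>e\<le>x. e \<notin> Bi (j + t))))" for t
  have "Q t" for t
  proof (rule ind_S1[of Q])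
    show "S1 (\<lambda>e. Q (e 0))" unfolding Q_def
      by (intro S1_imp S1_ex S1_and G.S1_it Tm_var Tm_const; (intro S1_D0)?;
          intro D0_le D0_eq D0_allle D0_not D0_mb[OF Y] Tm_add Tm_var Tm_const)
    show "Q 0" unfolding Q_def using x by simp
    fix t assume IH: "Q t"
    show "Q (t + 1)" unfolding Q_def
    proof
      assume t: "t + 1 \<le> x"
      then have "t \<le> x" by (simp add: less_imp_le)
      then obtain y where y: "rn j x t = y" "y + t = x" "\<forall>e\<le>x. e \<notin> Bi (j + t)" using IH unfolding Q_def by blast
      have "y \<noteq> 0" using t y(2) by auto
      then obtain y' where y': "y = y' + 1" using succ_ex by blast
      interpret S: rstep SS K Y "j + t" by (rule rs)
      have yx: "y \<le> x" unfolding y(2)[symmetric] by simp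
      have "up Y (j + t) y = y" by (rule S.u_low) (use y(3) yx in \<open>meson order_trans\<close>)
      then have "sg (j + t) y = y'" using sg_pos[OF \<open>y \<noteq> 0\<close>, of "j + t"] y' by simp
      then have 1: "rn j x (t + 1) = y'" using y(1) by (simp add: G.it_Suc)
      have 2: "y' + (t + 1) = x" using y(2) y' by (simp add: ac_simps)
      have 3: "\<forall>e\<le>x. e \<notin> Bi (j + (t + 1))"
      proof (intro allI impI notI)
        fix e assume e: "e \<le> x" "e \<in> Bi (j + (t + 1))"
        obtain z where "z \<in> Bi (j + t)" using RB_D(2)[OF S.RBi] by blast
        then obtain p where p: "smin (Bi (j + t)) p" using smin_ex[OF mb_SS[OF Y]] by blast
        then have "p \<le> e" using S.minC[of p e] e(2) unfolding smin_def by (simp add: add.assoc)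
        then show False using y(3) p e(1) unfolding smin_def by (meson order_trans)
      qed
      show "\<exists>y. rn j x (t + 1) = y \<and> y + (t + 1) = x \<and> (\<forall>e\<le>x. e \<notin> Bi (j + (t + 1)))"
        using 1 2 3 by blast
    qed
  qed
  from this[of x] obtain y where "rn j x x = y" "y + x = x" unfolding Q_def by auto
  then show ?thesis unfolding Term_def by auto
qed

text \<open>A least base is upgraded to a least base, and subtracting 1 then leads below all
  bases.\<close>

lemma A_min: "smin (Bi i) p \<Longrightarrow> A i p"
proof -
  assume p: "smin (Bi i) p"
  then have pB: "p \<in> Bi i" by (simp add: smin_def)
  have up_min: "smin (Bi (j + 1)) (up Y j b)" if "smin (Bi j) b" for j b
    using rstep.minC[OF rs, of b j] rstep.uC[OF rs, of b j] that unfolding smin_def by blast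
  have m: "\<forall>e<tr i p t. e \<notin> Bi (i + t)" for t
  proof (rule ind_S1[of "\<lambda>t. \<forall>e<tr i p t. e \<notin> Bi (i + t)"])
    have "S1 (\<lambda>e. \<exists>y. tr i p (e 0) = y \<and> (\<forall>z<y. z \<notin> Bi (i + e 0)))"
      by (intro S1_ex S1_and T.S1_it Tm_var Tm_const; intro S1_D0 D0_all D0_not D0_mb[OF Y] Tm_add Tm_var Tm_const)
    then show "S1 (\<lambda>e. \<forall>z<tr i p (e 0). z \<notin> Bi (i + e 0))" by simp
    show "\<forall>e<tr i p 0. e \<notin> Bi (i + 0)" using p unfolding smin_iff by simp
    show "\<forall>e<tr i p (t + 1). e \<notin> Bi (i + (t + 1))" if "\<forall>e<tr i p t. e \<notin> Bi (i + t)" for t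
      using up_min[of "i + t" "tr i p t"] that tr_B[OF pB] unfolding smin_iff T.it_Suc by (simp add: add.assoc)
  qed
  have "Term j b" if b: "smin (Bi j) b" for j b
  proof -
    have "b \<noteq> 0" using b rstep.B_pos[OF rs, of b j] unfolding smin_def by (simp add: pos_iff)
    then have "up Y j b = sg j b + 1" by (rule sg_pos)
    then have "sg j b < up Y j b" by simp
    then have "Term (j + 1) (sg j b)" using up_min[OF b] unfolding smin_iff by (intro Term_below) auto
    then show ?thesis by (rule Term_step)
  qed
  then show ?thesis unfolding A_def using m tr_B[OF pB] smin_iff by blast
qed

text \<open>\<open>L_all\<close> leads from the least base to some base above \<open>n\<close>; one
  exists because every base of the first hierarchy has a finite successor.\<close>

theorem terminates: "K \<le> of_nat k \<Longrightarrow> Term 0 n"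
proof -
  assume k: "K \<le> of_nat k"
  obtain x where x: "x \<in> Bi 0" using RB_D(2)[OF RB0] by blast
  then obtain p where p: "smin (Bi 0) p" using smin_ex[OF mb_SS[OF Y]] by blast
  then have pB: "p \<in> Bi 0" "\<And>b. b \<in> Bi 0 \<Longrightarrow> p \<le> b" by (auto simp: smin_def)
  have "\<exists>b\<in>Bi 0. n < b"
  proof (cases "n < p")
    case False
    then obtain b where b: "bs (Bi 0) n b" using bs_ex[OF mb_SS[OF Y] pB(1)] by (auto simp: not_less)
    then obtain s where s: "sS (Bi 0) b s" using RB_D(5)[OF RB0, of b] unfolding bs_def by blast
    then show ?thesis using bs_less_S[OF b s] unfolding sS_def by blast
  qed (use pB in blast)
  then obtain b where b: "b \<in> Bi 0" "n < b" by blast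
  have "rat (Bi 0) p b (of_nat k)"
  proof (rule ratI)
    fix e s assume e: "e \<in> Bi 0" "sS (Bi 0) e s"
    then have "s \<le> e * K" using RB_D(5)[OF RB0 e(1)] sS_unique[OF e(2)] by metis
    also have "\<dots> \<le> e * of_nat k" using k by (intro mult_left_mono) auto
    finally show "s \<le> of_nat k * e" by (simp add: mult.commute)
  qed
  then have "A 0 b" using L_D[OF L_all pB(1) b(1) pB(2)[OF b(1)] _ A_min[OF p]] by blast
  then show ?thesis using Term_mono[OF A_Term] b(2) by (meson less_imp_le)
qed

lemma sgs_rn: "sgs Y n t (rn 0 n t)"
proof (rule G.it_code[of t 0 n])
  fix a d assume a: "\<And>s. s \<le> t \<Longrightarrow> ent a d s = rn 0 n s"
    "\<And>s. s < t \<Longrightarrow> ent a d (s + 1) = sg (0 + s) (ent a d s)" "ent a d 0 = n"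
  have "(0 < ent a d s \<and> supg (Bi s) (Bi (s + 1)) (ent a d s) (ent a d (s + 1) + 1)) \<or>
     (ent a d s = 0 \<and> ent a d (s + 1) = 0)" if "s < t" for s
  proof (cases "ent a d s = 0")
    case True
    then show ?thesis using a(2)[OF that] by simp
  next
    case False
    then have "up Y s (ent a d s) = ent a d (s + 1) + 1" using sg_pos[of "ent a d s" s] a(2)[OF that] by simp
    then show ?thesis using False unfolding supg_iff[OF RB_all] rstep.supn_u[OF rs] by (simp add: pos_iff)
  qed
  then show "sgs Y n t (rn 0 n t)" unfolding sgs_def sentry_iff
    using a(1)[of t] a(3) by - (rule exI[of _ a], rule exI[of _ d], simp)
qed

end

context rca
begin

lemma RB_start:
  assumes Y: "Y \<in> SS" and D: "sdyn Y" and p: "smin (mb Y 0) p"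
    and S: "\<forall>b. b \<in> mb Y 0 \<longrightarrow> (\<exists>s. sS (mb Y 0) b s \<and> s \<le> b * p)"
  shows "RB p (mb Y 0)"
  using mb_SS[OF Y] D p S unfolding RB_def sdyn_def smin_def by blast

theorem sterm_of_nat: "sterm SS (of_nat k)"
  unfolding sterm_def
proof (intro ballI impI allI)
  fix Y n assume Y: "Y \<in> SS" and H: "sdyn Y \<and> (\<exists>p. smin (mb Y 0) p \<and> p \<le> of_nat k \<and>
     (\<forall>b. b \<in> mb Y 0 \<longrightarrow> (\<exists>s. sS (mb Y 0) b s \<and> s \<le> b * p)))"
  then obtain p where p: "smin (mb Y 0) p" "p \<le> of_nat k"
    "\<forall>b. b \<in> mb Y 0 \<longrightarrow> (\<exists>s. sS (mb Y 0) b s \<and> s \<le> b * p)" by blast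
  have "RB p (mb Y 0)" using RB_start[OF Y _ p(1,3)] H by blast
  then interpret D: dyn SS p Y using Y H by unfold_locales auto
  obtain t where t: "D.rn 0 n t = 0" using D.terminates[OF p(2)] unfolding D.Term_def by blast
  show "\<exists>i. sgs Y n i 0" using D.sgs_rn[of n t] t by metis
qed

end

section \<open>Provability for fixed \<open>k\<close>\<close>

abbreviation T0 :: "fm set" where "T0 \<equiv> RCA0 \<union> Sigma02_IND"

lemma sat_induction:
  "sat M (induction_axiom p) e E \<longleftrightarrow>
    (sat M p (case_nat (zr M) e) E \<longrightarrow> (\<forall>x. sat M p (case_nat x e) E \<longrightarrow> sat M p (case_nat (pl M x (on M)) e) E) \<longrightarrow>
     (\<forall>x. sat M p (case_nat x e) E))"
proof -
  have "(\<lambda>n. evt M (case n of 0 \<Rightarrow> Plus (NVar 0) One | Suc n \<Rightarrow> NVar (Suc n)) (case_nat x e)) = case_nat (pl M x (on M)) e" for x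
    by (rule ext) (auto split: nat.split)
  then show ?thesis unfolding induction_axiom_def by (simp add: sat_inst sat_subst) blast
qed

lemma sat_comprehension:
  "sat M (delta_comprehension_axiom p q) e E \<longleftrightarrow>
  ((\<forall>x. sat M p (case_nat x e) E \<longleftrightarrow> sat M q (case_nat x e) E) \<longrightarrow>
   (\<exists>S\<in>sets M. \<forall>x. x \<in> S \<longleftrightarrow> sat M p (case_nat x e) E))"
  unfolding delta_comprehension_axiom_def by (simp add: iff_conv_conj_imp)

lemma valid_T0:
  assumes b: "\<And>p. p \<in> basic_axioms \<Longrightarrow> valid M p"
    and i1: "\<And>p. p \<in> Sigma01 \<Longrightarrow> valid M (induction_axiom p)"
    and i2: "\<And>p. p \<in> Sigma02 \<Longrightarrow> valid M (induction_axiom p)"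
    and c: "\<And>p q. p \<in> Sigma01 \<Longrightarrow> q \<in> Pi01 \<Longrightarrow> valid M (delta_comprehension_axiom p q)"
    and p: "p \<in> T0"
  shows "valid M p"
  using p b i1 i2 c unfolding RCA0_def Sigma01_IND_def Sigma02_IND_def Delta01_CA_def by blast

lemma valid_basic:
  fixes SS :: "'a::linordered_semidom set set"
  assumes d: "\<And>x y :: 'a. x < y + 1 \<longleftrightarrow> x \<le> y" and z: "\<And>x :: 'a. 0 \<le> x" and p: "p \<in> basic_axioms"
  shows "valid (tstr SS) p"
proof -
  have 1: "x + 1 \<noteq> (0::'a)" for x using d[of 0 x] z[of x] by auto
  have 2: "\<not> x < (0::'a)" for x using z[of x] by simp
  show ?thesis using p unfolding basic_axioms_def Let_def valid_def
    by (auto simp: 1 2 d le_less add.assoc distrib_left)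
qed

lemma valid_nat: "p \<in> T0 \<Longrightarrow> valid (tstr (UNIV :: nat set set)) p"
proof (rule valid_T0)
  have i: "valid (tstr (UNIV :: nat set set)) (induction_axiom p)" for p
  proof -
    have "sat (tstr UNIV) p (case_nat x e) E"
      if "sat (tstr UNIV) p (case_nat 0 e) E" "\<forall>x. sat (tstr UNIV) p (case_nat x e) E \<longrightarrow> sat (tstr UNIV) p (case_nat (x + 1) e) E"
      for x :: nat and e E
      using that by (induction x) auto
    then show ?thesis unfolding valid_def sat_induction tstr_sel by (intro allI impI) blast
  qed
  show "valid (tstr (UNIV :: nat set set)) (induction_axiom p)"
    "valid (tstr (UNIV :: nat set set)) (induction_axiom p)" for p using i by auto
  show "valid (tstr (UNIV :: nat set set)) (delta_comprehension_axiom p q)" for p q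
    unfolding valid_def sat_comprehension
  proof (intro allI impI)
    fix e E
    show "\<exists>S\<in>sets (tstr (UNIV :: nat set set)). \<forall>x. x \<in> S \<longleftrightarrow> sat (tstr UNIV) p (case_nat x e) E"
      by (rule bexI[of _ "{x. sat (tstr UNIV) p (case_nat x e) E}"]) auto
  qed
qed (rule valid_basic, auto)

text \<open>Ensures that \<open>H0\<close> is a Henkin theory even if every instance is
  derivable.\<close>

lemma T0_consistent: "\<not> deriv T0 [] Bot"
  using soundness[of T0 "[]" Bot "tstr (UNIV :: nat set set)" "\<lambda>_. {}" "\<lambda>_. 0"] valid_nat by auto

definition GT :: "nat \<Rightarrow> fm" where
  "GT k = sentence (goodstein_termination (numeral_of k))"

text \<open>The type \<open>dn\<close> of the term model cannot depend on \<open>k\<close>; therefore one Henkin theory has to refute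
  some \<open>GT k\<close> whenever any of these is underivable.\<close>

definition H0 :: "fm set" where
  "H0 = (SOME H. henkin (closure T0) H \<and> ((\<exists>k. \<not> T0 \<turnstile> GT k) \<longrightarrow> (\<exists>k. Neg (GT k) \<in> H)))"

lemma H0: "henkin (closure T0) H0" "\<not> T0 \<turnstile> GT k \<Longrightarrow> \<exists>k. Neg (GT k) \<in> H0"
proof -
  have "\<exists>H. henkin (closure T0) H \<and> ((\<exists>k. \<not> T0 \<turnstile> GT k) \<longrightarrow> (\<exists>k. Neg (GT k) \<in> H))"
  proof (cases "\<exists>k. \<not> T0 \<turnstile> GT k")
    case True
    then obtain k where k: "\<not> T0 \<turnstile> GT k" ..
    have "\<not> deriv (closure T0) [Neg (GT k)] Bot"
    proof
      assume "deriv (closure T0) [Neg (GT k)] Bot"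
      then have "deriv (closure T0) [] (GT k)" by (rule deriv.Classical)
      then show False using k deriv_closure unfolding proves_def by blast
    qed
    from henkin_exists[OF closure_subst this] show ?thesis by auto
  next
    case False
    have "\<not> deriv (closure T0) [] Bot" using T0_consistent deriv_closure by blast
    from henkin_exists[OF closure_subst this] False show ?thesis by blast
  qed
  from someI_ex[OF this, folded H0_def]
  show "henkin (closure T0) H0" "\<not> T0 \<turnstile> GT k \<Longrightarrow> \<exists>k. Neg (GT k) \<in> H0" by blast+
qed

\<comment> \<open>The term model as an ordered semidomain\<close>
quotient_type dn = tm / "\<lambda>s t. Eq s t \<in> H0"
  by (rule henkin_equivp[OF H0(1)])

text \<open>Subtraction does not depend on the range of the set variables, so it can be defined
  before the sets of the term model.\<close>

lemma diff_of_tstr: "diff_of (tstr SS) = diff_of (tstr {})"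
  by (simp add: diff_of_def fun_eq_iff)

instantiation dn :: "{zero, one, plus, times, ord}"
begin

lift_definition zero_dn :: dn is Zero .
lift_definition one_dn :: dn is One .
lift_definition plus_dn :: "dn \<Rightarrow> dn \<Rightarrow> dn" is Plus by (rule henkin_Plus[OF H0(1)])
lift_definition times_dn :: "dn \<Rightarrow> dn \<Rightarrow> dn" is Times by (rule henkin_Times[OF H0(1)])
lift_definition less_dn :: "dn \<Rightarrow> dn \<Rightarrow> bool" is "\<lambda>s t. Less s t \<in> H0"
  using henkin_Less[OF H0(1)] henkin_EqSym[OF H0(1)] by blast
definition "less_eq_dn (x :: dn) y \<longleftrightarrow> x < y \<or> x = y"

instance ..

end

instantiation dn :: minus
begin

definition "minus_dn (x :: dn) y = diff_of (tstr {}) x y"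

instance ..

end

lift_definition mem_dn :: "dn \<Rightarrow> nat \<Rightarrow> bool" is "\<lambda>t X. Mem t X \<in> H0"
  using henkin_Mem[OF H0(1)] henkin_EqSym[OF H0(1)] by blast

definition SD :: "dn set set" where "SD = range (\<lambda>X. {a. mem_dn a X})"

lemma dn_truth:
  "sat (tstr SD) p (\<lambda>n. abs_dn (\<sigma> n)) (\<lambda>n. {a. mem_dn a (\<rho> n)}) \<longleftrightarrow> subst p \<sigma> \<rho> \<in> H0"
proof (rule henkin_truth[OF H0(1), where c = abs_dn and S = "\<lambda>X. {a. mem_dn a X}"])
  show "surj abs_dn" by (metis Quotient_abs_rep Quotient_dn surjI)
qed (simp_all add: dn.abs_eq_iff less_dn.abs_eq zero_dn.abs_eq one_dn.abs_eq plus_dn.abs_eq times_dn.abs_eq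
    mem_dn.abs_eq SD_def zero_dn_def one_dn_def)

lemma SD_valid: "p \<in> T0 \<Longrightarrow> valid (tstr SD) p"
  unfolding valid_def
proof (intro allI impI)
  fix e :: "nat \<Rightarrow> dn" and E :: "nat \<Rightarrow> dn set" assume p: "p \<in> T0" and E: "\<forall>n. E n \<in> sets (tstr SD)"
  define \<sigma> where "\<sigma> n = rep_dn (e n)" for n
  have e: "e = (\<lambda>n. abs_dn (\<sigma> n))" unfolding \<sigma>_def by (simp add: Quotient_abs_rep[OF Quotient_dn])
  have "\<forall>n. \<exists>X. E n = {a. mem_dn a X}" using E by (auto simp: SD_def)
  then obtain \<rho> where \<rho>: "\<And>n. E n = {a. mem_dn a (\<rho> n)}" by metis
  then have E': "E = (\<lambda>n. {a. mem_dn a (\<rho> n)})" by auto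
  have "subst p \<sigma> \<rho> \<in> closure T0" using p unfolding closure_def by blast
  then show "sat (tstr SD) p e E" unfolding e E' dn_truth by (rule henkin_axiom[OF H0(1)])
qed

lemma SD_ne: "SD \<noteq> {}"
  by (simp add: SD_def)

interpretation DA: arith "tstr SD"
  by unfold_locales (auto intro: SD_valid simp: RCA0_def SD_ne)

instance dn :: linordered_semidom
proof
  fix a b c :: dn
  note [simp] = minus_dn_def diff_of_tstr[of SD, symmetric]
  show "a + b + c = a + (b + c)" using DA.add_assoc[of a b c] by simp
  show "a + b = b + a" using DA.add_comm[of a b] by simp
  show "0 + a = a" using DA.zero_add[of a] by simp
  show "a * b * c = a * (b * c)" using DA.mul_assoc[of a b c] by simp
  show "a * b = b * a" using DA.mul_comm[of a b] by simp
  show "1 * a = a" using DA.one_mul[of a] by simp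
  show "(a + b) * c = a * c + b * c" using DA.distrib[of a b c] by simp
  show "a * (b + c) = a * b + a * c"
    using DA.distrib[of b c a] DA.mul_comm[of a "b + c"] DA.mul_comm[of b a] DA.mul_comm[of c a] by simp
  show "0 * a = 0" using DA.zero_mul[of a] by simp
  show "a * 0 = 0" using DA.ax(5)[of a] by simp
  show "(0::dn) \<noteq> 1" using DA.zero_lt_one DA.lt_irrefl by auto
  show "a + b - a = b" using DA.diff_add[of a b] by simp
  show "a - b - c = a - (b + c)" using DA.diff_diff[of a b c] by simp
  show "a * (b - c) = a * b - a * c" using DA.mul_diff[of a b c] by simp
  show "a \<noteq> 0 \<Longrightarrow> b \<noteq> 0 \<Longrightarrow> a * b \<noteq> 0" using DA.mul_zero[of a b] by auto
  show "a < b \<longleftrightarrow> a \<le> b \<and> \<not> b \<le> a"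
    unfolding less_eq_dn_def using DA.lt_irrefl[of a] DA.lt_trans[of a b a] by auto
  show "a \<le> a" unfolding less_eq_dn_def by simp
  show "a \<le> b \<Longrightarrow> b \<le> c \<Longrightarrow> a \<le> c" unfolding less_eq_dn_def using DA.lt_trans[of a b c] by auto
  show "a \<le> b \<Longrightarrow> b \<le> a \<Longrightarrow> a = b" unfolding less_eq_dn_def using DA.lt_irrefl[of a] DA.lt_trans[of a b a] by auto
  show "a \<le> b \<or> b \<le> a" unfolding less_eq_dn_def using DA.lt_linear[of a b] by auto
  show "a \<le> b \<Longrightarrow> c + a \<le> c + b" unfolding less_eq_dn_def using DA.add_lt[of a b c] by auto
  show "a < b \<Longrightarrow> 0 < c \<Longrightarrow> c * a < c * b" using DA.mul_lt[of a b c] by simp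
  show "(0::dn) < 1" using DA.zero_lt_one by simp
  show "a - b + b = a" if "b \<le> a"
  proof -
    from that obtain y where y: "b + y = a" using DA.le_iff[of b a] unfolding less_eq_dn_def by auto
    then have "a - b = y" using DA.diff_add[of b y] by simp
    then show ?thesis using y DA.add_comm[of y b] by simp
  qed
qed

interpretation DR: rca SD
  by unfold_locales (use SD_valid SD_ne in auto)

text \<open>\<open>H0\<close> may refute another instance than the underivable one at hand; this
  does no harm, since every standard instance holds in the term model.\<close>

theorem provable: "T0 \<turnstile> sentence (goodstein_termination (numeral_of k))"
proof (rule ccontr)
  assume "\<not> ?thesis"
  then obtain k where "Neg (GT k) \<in> H0" using H0(2) unfolding GT_def by blast
  then have "GT k \<notin> H0" using henkin_Neg[OF H0(1)] by blast
  then have "\<not> sat (tstr SD) (GT k) (\<lambda>n. abs_dn (NVar n)) (\<lambda>n. {a. mem_dn a n})"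
    using dn_truth[of "GT k" NVar "\<lambda>n. n"] by simp
  then show False unfolding GT_def hoas.sat_termination using DR.sterm_of_nat by blast
qed

section \<open>Fast growing functions and nested intervals\<close>

text \<open>Operators fitted to the runs: a ratio 2 is worth two rounds, whence
  \<open>Phi 0\<close>; a ratio \<open>c + 3\<close> can be unfolded at time \<open>x\<close> into
  \<open>x\<close> ratios \<open>c + 2\<close>, each of which contributes one application of
  \<open>Phi c\<close>.\<close>

primrec Phi :: "nat \<Rightarrow> (nat \<Rightarrow> nat) \<Rightarrow> nat \<Rightarrow> nat" where
  "Phi 0 f = f \<circ> f"
| "Phi (Suc c) f = (\<lambda>x. (Phi c ^^ x) f x)"

definition nice :: "(nat \<Rightarrow> nat) \<Rightarrow> bool" where
  "nice f \<longleftrightarrow> mono f \<and> (\<forall>x. x < f x)"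

lemma niceD: "nice f \<Longrightarrow> x < f x" "nice f \<Longrightarrow> x \<le> y \<Longrightarrow> f x \<le> f y"
  by (auto simp: nice_def monoD)

lemma niceI: "(\<And>x. x < f x) \<Longrightarrow> (\<And>x y. x \<le> y \<Longrightarrow> f x \<le> f y) \<Longrightarrow> nice f"
  by (auto simp: nice_def intro: monoI)

lemma Phi_props: "nice f \<Longrightarrow> nice (Phi c f) \<and> (\<forall>x. f x \<le> Phi c f x)"
proof (induction c arbitrary: f)
  case 0
  have "x < f (f x)" for x using niceD(1)[OF 0, of x] niceD(1)[OF 0, of "f x"] by simp
  moreover have "f (f x) \<le> f (f y)" if "x \<le> y" for x y using niceD(2)[OF 0] that by blast
  ultimately have "nice (\<lambda>x. f (f x))" by (rule niceI)
  moreover have "f x \<le> f (f x)" for x using niceD(1)[OF 0, of "f x"] by simp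
  ultimately show ?case by (simp add: comp_def)
next
  case (Suc c)
  have it: "nice ((Phi c ^^ n) f)" for n
    by (induction n) (use Suc in simp_all)
  have inc: "(Phi c ^^ n) f x \<le> (Phi c ^^ m) f x" if "n \<le> m" for n m x
    using that
  proof (induction rule: dec_induct)
    case (step m)
    have "(Phi c ^^ m) f x \<le> (Phi c ^^ Suc m) f x" using Suc.IH[OF it[of m]] by simp
    then show ?case using step by simp
  qed simp
  have "(Phi c ^^ x) f x \<le> (Phi c ^^ y) f y" if "x \<le> y" for x y
    using inc[OF that, of x] niceD(2)[OF it that, of y] by (rule order_trans)
  moreover have "f x \<le> (Phi c ^^ x) f x" for x using inc[of 0 x x] by simp
  ultimately show ?case using niceD(1)[OF it] by (auto intro!: niceI)
qed

lemma nice_Phi: "nice f \<Longrightarrow> nice (Phi c f)"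
  using Phi_props by blast

lemma Phi_ge: "nice f \<Longrightarrow> f x \<le> Phi c f x"
  using Phi_props by blast

lemma nice_iter: "nice f \<Longrightarrow> nice ((Phi c ^^ n) f)"
  by (induction n) (auto intro: nice_Phi)

lemma iter_inc: "nice f \<Longrightarrow> n \<le> m \<Longrightarrow> (Phi c ^^ n) f x \<le> (Phi c ^^ m) f x"
proof -
  assume f: "nice f" and "n \<le> m"
  from this(2) show ?thesis
  proof (induction rule: dec_induct)
    case (step m)
    have "(Phi c ^^ m) f x \<le> Phi c ((Phi c ^^ m) f) x" by (rule Phi_ge[OF nice_iter[OF f]])
    also have "\<dots> = (Phi c ^^ Suc m) f x" by (simp only: funpow.simps comp_apply)
    finally show ?case using step(3) by (rule order_trans[rotated])
  qed simp
qed

lemma Phi_twice: "nice f \<Longrightarrow> 0 < x \<Longrightarrow> f (f x) \<le> Phi c f x"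
proof (induction c)
  case (Suc c)
  have "f (f x) \<le> (Phi c ^^ 1) f x" using Suc by simp
  also have "\<dots> \<le> (Phi c ^^ x) f x" using Suc.prems by (intro iter_inc) auto
  finally show ?case by simp
qed simp

text \<open>The evaluation of \<open>Phi c h x \<le> B\<close> only uses values of \<open>h\<close> that are at most \<open>B\<close>.\<close>

lemma Phi_local:
  "nice g \<Longrightarrow> nice h \<Longrightarrow> (\<And>x. a \<le> x \<Longrightarrow> h x \<le> B \<Longrightarrow> g x \<le> h x) \<Longrightarrow> a \<le> x \<Longrightarrow> Phi c h x \<le> B \<Longrightarrow> Phi c g x \<le> Phi c h x"
proof (induction c arbitrary: g h x)
  case 0
  have hx: "h x \<le> h (h x)" using niceD(1)[OF 0(2)] by (rule less_imp_le)
  then have 1: "g x \<le> h x" using 0 by simp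
  have "g (g x) \<le> g (h x)" using niceD(2)[OF 0(1) 1] .
  also have "\<dots> \<le> h (h x)" using 0 niceD(1)[OF 0(2), of x] by simp
  finally show ?case by simp
next
  case (Suc c)
  note IH = Suc.IH and prems = Suc.prems
  have "\<forall>y. a \<le> y \<longrightarrow> (Phi c ^^ n) h y \<le> B \<longrightarrow> (Phi c ^^ n) g y \<le> (Phi c ^^ n) h y" for n
  proof (induction n)
    case 0
    then show ?case using prems(3) by simp
  next
    case (Suc n)
    have "Phi c ((Phi c ^^ n) g) y \<le> Phi c ((Phi c ^^ n) h) y"
      if "a \<le> y" "Phi c ((Phi c ^^ n) h) y \<le> B" for y
      by (rule IH[OF nice_iter[OF prems(1)] nice_iter[OF prems(2)] _ that]) (use Suc in blast)
    then show ?case by simp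
  qed
  then show ?case using prems(4,5) by simp
qed

text \<open>The functions \<open>F x\<close> need not be monotone; the maximum over all arguments up
  to \<open>y\<close> repairs this, so that the enlarged \<open>G\<close> is again nice.\<close>

definition GF :: "(nat \<Rightarrow> nat) \<Rightarrow> (nat \<Rightarrow> nat \<Rightarrow> nat) \<Rightarrow> nat set \<Rightarrow> nat \<Rightarrow> nat" where
  "GF G F Q y = Max (insert (G y) ((\<lambda>(x, y). F x y) ` (Q \<times> {..y})))"

lemma GF_ge: "finite Q \<Longrightarrow> G y \<le> GF G F Q y"
  unfolding GF_def by (intro Max_ge) auto

lemma GF_F: "finite Q \<Longrightarrow> x \<in> Q \<Longrightarrow> y' \<le> y \<Longrightarrow> F x y' \<le> GF G F Q y"
  unfolding GF_def by (intro Max_ge) auto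

lemma GF_cases: "finite Q \<Longrightarrow> GF G F Q y = G y \<or> (\<exists>x\<in>Q. \<exists>y'\<le>y. GF G F Q y = F x y')"
proof -
  assume "finite Q"
  then have "GF G F Q y \<in> insert (G y) ((\<lambda>(x, y). F x y) ` (Q \<times> {..y}))"
    unfolding GF_def by (intro Max_in) auto
  then show ?thesis by auto
qed

lemma nice_GF: "finite Q \<Longrightarrow> nice G \<Longrightarrow> nice (GF G F Q)"
proof (rule niceI)
  assume Q: "finite Q" and G: "nice G"
  show "x < GF G F Q x" for x using niceD(1)[OF G, of x] GF_ge[OF Q, of G x F] by simp
  show "GF G F Q x \<le> GF G F Q y" if xy: "x \<le> y" for x y
  proof -
    consider "GF G F Q x = G x" | w z where "w \<in> Q" "z \<le> x" "GF G F Q x = F w z"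
      using GF_cases[OF Q, of G F x] by blast
    then show ?thesis
    proof cases
      case 1
      then show ?thesis using GF_ge[OF Q, of G y F] niceD(2)[OF G xy] by simp
    next
      case 2
      then show ?thesis using GF_F[OF Q, of w z y F G] xy by simp
    qed
  qed
qed

text \<open>If the interval is not large for \<open>G\<close> enlarged by the functions \<open>F x\<close> with \<open>x \<in> Q\<close>, one of
  these functions jumps over a subinterval that is still large for \<open>G\<close>; it is then dropped.\<close>

lemma shrink:
  assumes G: "nice G"
  shows "finite Q \<Longrightarrow> card Q = n \<Longrightarrow> (Phi c ^^ Suc n) G a \<le> b \<Longrightarrow>
    \<exists>a' b' Q'. a \<le> a' \<and> b' \<le> b \<and> Q' \<subseteq> Q \<and> (\<forall>x\<in>Q - Q'. \<exists>y\<le>a'. b' \<le> F x y) \<and> Phi c (GF G F Q') a' \<le> b'"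
proof (induction n arbitrary: Q a b)
  case 0
  then have "Q = {}" by simp
  moreover have "GF G F {} = G" by (simp add: GF_def fun_eq_iff)
  ultimately show ?case using 0 by (intro exI[of _ a] exI[of _ b] exI[of _ "{}"]) simp
next
  case (Suc n)
  let ?H = "(Phi c ^^ Suc n) G"
  have H: "nice ?H" by (rule nice_iter[OF G])
  have Hb: "Phi c ?H a \<le> b" using Suc.prems(3) by simp
  show ?case
  proof (cases "Phi c (GF G F Q) a \<le> b")
    case True
    then show ?thesis by (intro exI[of _ a] exI[of _ b] exI[of _ Q]) simp
  next
    case False
    have "\<exists>z. a \<le> z \<and> ?H z \<le> b \<and> \<not> GF G F Q z \<le> ?H z"
    proof (rule ccontr)
      assume "\<not> ?thesis"
      then have "Phi c (GF G F Q) a \<le> Phi c ?H a"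
        by (intro Phi_local[OF nice_GF[OF Suc.prems(1) G] H _ _ Hb]) auto
      then show False using Hb False by simp
    qed
    then obtain z where z: "a \<le> z" "?H z \<le> b" "\<not> GF G F Q z \<le> ?H z" by blast
    have "G z \<le> ?H z" using iter_inc[OF G, of 0 "Suc n" c z] by simp
    then obtain x y where x: "x \<in> Q" "y \<le> z" "?H z \<le> F x y"
      using GF_cases[OF Suc.prems(1), of G F z] z(3) by (auto simp: not_le)
    have "finite (Q - {x})" "card (Q - {x}) = n" using Suc.prems(1,2) x(1) by auto
    note IH = Suc.IH[OF this, of z "?H z", OF order_refl]
    obtain a' b' Q' where
      *: "z \<le> a'" "b' \<le> ?H z" "Q' \<subseteq> Q - {x}" "\<forall>x\<in>Q - {x} - Q'. \<exists>y\<le>a'. b' \<le> F x y" "Phi c (GF G F Q') a' \<le> b'"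
      using IH by (elim exE conjE)
    have "\<exists>y\<le>a'. b' \<le> F w y" if "w \<in> Q - Q'" for w
    proof (cases "w = x")
      case True
      then show ?thesis using x * by (meson order_trans)
    qed (use * that in auto)
    then show ?thesis using * z(1,2) by (intro exI[of _ a'] exI[of _ b'] exI[of _ Q']) auto
  qed
qed

text \<open>The value of \<open>Phi (c + 2)\<close> at \<open>a\<close> covers two applications of
  \<open>Phi (c + 1) G\<close>. The inner one leads past \<open>G a + 1\<close>, the new left end;
  the outer one contains \<open>G a + 1\<close> iterations of \<open>Phi c\<close>, enough for
  dropping up to \<open>a\<close> functions by \<open>shrink\<close>.\<close>

lemma stage:
  assumes G: "nice G" and a: "2 \<le> a" and b: "Phi (Suc (Suc c)) G a \<le> b"
  shows "\<exists>a' b' G' Q. G a < a' \<and> b' \<le> b \<and> nice G' \<and> (\<forall>y. G y \<le> G' y) \<and> Phi c G' a' \<le> b' \<and>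
    (\<forall>x<a. x \<notin> Q \<longrightarrow> (\<exists>y\<le>a'. b' \<le> F x y)) \<and> (\<forall>x<a. x \<in> Q \<longrightarrow> (\<forall>y. F x y \<le> G' y))"
proof -
  let ?H = "Phi (Suc c) G" and ?a = "Suc (G a)"
  have H: "nice ?H" by (rule nice_Phi[OF G])
  have "?a \<le> G (G a)" using niceD(1)[OF G, of "G a"] by simp
  also have "\<dots> \<le> ?H a" using a by (intro Phi_twice[OF G]) simp
  finally have "?H ?a \<le> ?H (?H a)" by (rule niceD(2)[OF H])
  also have "\<dots> \<le> Phi (Suc c) ?H a" using a by (intro Phi_twice[OF H]) simp
  also have "\<dots> = (Phi (Suc c) ^^ 2) G a" by (simp add: numeral_2_eq_2 del: Phi.simps)
  also have "\<dots> \<le> (Phi (Suc c) ^^ a) G a" by (rule iter_inc[OF G a])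
  also have "\<dots> \<le> b" using b by (simp only: Phi.simps(2)[of "Suc c"])
  finally have Hb: "(Phi c ^^ ?a) G ?a \<le> b" by simp
  have "Suc a \<le> ?a" using niceD(1)[OF G, of a] by simp
  then have "(Phi c ^^ Suc a) G ?a \<le> b" using iter_inc[OF G, of "Suc a" ?a c ?a] Hb by simp
  from shrink[OF G _ _ this, of "{..<a}" F] obtain a' b' Q' where
    *: "?a \<le> a'" "b' \<le> b" "Q' \<subseteq> {..<a}" "\<forall>x\<in>{..<a} - Q'. \<exists>y\<le>a'. b' \<le> F x y" "Phi c (GF G F Q') a' \<le> b'"
    by auto
  have f: "finite Q'" using *(3) finite_subset by blast
  show ?thesis
    by (rule exI[of _ a'], rule exI[of _ b'], rule exI[of _ "GF G F Q'"], rule exI[of _ Q'])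
      (use * nice_GF[OF f G] GF_ge[OF f] GF_F[OF f] in auto)
qed

text \<open>The enlarged \<open>G\<close> of one stage is the input of the next, and each stage
  costs 2 in the index, whence \<open>2 * m\<close>. The family \<open>F s\<close> varies with the
  stage so that different stages can treat different formulas.\<close>

theorem cut_seq:
  "nice G0 \<Longrightarrow> 2 \<le> a0 \<Longrightarrow> Phi (Suc (2 * m)) G0 a0 \<le> b0 \<Longrightarrow>
   \<exists>a b G Q. a 0 = a0 \<and> b 0 = b0 \<and> G 0 = G0 \<and> (\<forall>s\<le>m. nice (G s) \<and> a s \<le> b s) \<and>
    (\<forall>s<m. G s (a s) < a (Suc s) \<and> b (Suc s) \<le> b s \<and> (\<forall>y. G s y \<le> G (Suc s) y) \<and>
      (\<forall>x<a s. x \<notin> Q s \<longrightarrow> (\<exists>y\<le>a (Suc s). b (Suc s) \<le> F s x y)) \<and>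
      (\<forall>x<a s. x \<in> Q s \<longrightarrow> (\<forall>y. F s x y \<le> G (Suc s) y)))"
proof (induction m arbitrary: G0 a0 b0 F)
  case 0
  have "a0 \<le> b0" using niceD(1)[OF nice_Phi[OF 0(1)], of a0 "Suc (2 * 0)"] 0(3) by simp
  then show ?case using 0
    by (intro exI[of _ "\<lambda>_. a0"] exI[of _ "\<lambda>_. b0"] exI[of _ "\<lambda>_. G0"] exI[of _ "\<lambda>_. {}"]) simp
next
  case (Suc m)
  have ab0: "a0 \<le> b0" using niceD(1)[OF nice_Phi[OF Suc(2)], of a0 "Suc (2 * Suc m)"] Suc(4) by simp
  have "Phi (Suc (Suc (Suc (2 * m)))) G0 a0 \<le> b0" using Suc.prems(3) by simp
  from stage[OF Suc.prems(1,2) this, of "F 0"] obtain a' b' G' Q' where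
    1: "G0 a0 < a'" "b' \<le> b0" "nice G'" "\<And>y. G0 y \<le> G' y" "Phi (Suc (2 * m)) G' a' \<le> b'"
      "\<And>x. x < a0 \<Longrightarrow> x \<notin> Q' \<Longrightarrow> \<exists>y\<le>a'. b' \<le> F 0 x y" "\<And>x y. x < a0 \<Longrightarrow> x \<in> Q' \<Longrightarrow> F 0 x y \<le> G' y"
    by blast
  have "2 \<le> a'" using 1(1) niceD(1)[OF Suc.prems(1), of a0] Suc.prems(2) by simp
  from Suc.IH[OF 1(3) this 1(5), of "\<lambda>s. F (Suc s)"] obtain a b G Q where
    2: "a 0 = a'" "b 0 = b'" "G 0 = G'" "\<And>s. s \<le> m \<Longrightarrow> nice (G s) \<and> a s \<le> b s"
    "\<And>s. s < m \<Longrightarrow> G s (a s) < a (Suc s) \<and> b (Suc s) \<le> b s \<and> (\<forall>y. G s y \<le> G (Suc s) y) \<and>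
      (\<forall>x<a s. x \<notin> Q s \<longrightarrow> (\<exists>y\<le>a (Suc s). b (Suc s) \<le> F (Suc s) x y)) \<and>
      (\<forall>x<a s. x \<in> Q s \<longrightarrow> (\<forall>y. F (Suc s) x y \<le> G (Suc s) y))" by metis
  show ?case
  proof (rule exI[of _ "case_nat a0 a"], rule exI[of _ "case_nat b0 b"], rule exI[of _ "case_nat G0 G"],
      rule exI[of _ "case_nat Q' Q"], intro conjI allI impI)
    fix s assume "s \<le> Suc m"
    then show "nice (case_nat G0 G s)" "case_nat a0 a s \<le> case_nat b0 b s"
      using 2(4) Suc.prems(1) ab0 by (auto split: nat.split)
  next
    fix s assume s: "s < Suc m"
    show "case_nat G0 G s (case_nat a0 a s) < case_nat a0 a (Suc s)"
      "case_nat b0 b (Suc s) \<le> case_nat b0 b s"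
      using s 1(1,2) 2(1,2,5) by (auto split: nat.split)
    show "case_nat G0 G s y \<le> case_nat G0 G (Suc s) y" for y
      using s 1(4) 2(3,5) by (auto split: nat.split)
    show "\<exists>y\<le>case_nat a0 a (Suc s). case_nat b0 b (Suc s) \<le> F s x y"
      if "x < case_nat a0 a s" "x \<notin> case_nat Q' Q s" for x
      using s that 1(6) 2(1,2,5) by (cases s) auto
    show "F s x y \<le> case_nat G0 G (Suc s) y" if "x < case_nat a0 a s" "x \<in> case_nat Q' Q s" for x y
      using s that 1(7) 2(3,5) by (cases s) auto
  qed simp_all
qed

section \<open>Upgrades between explicit hierarchies\<close>

text \<open>Closed form of the upgrade, with the target base of each leading digit prescribed by
  \<open>\<tau>\<close>. Level \<open>j\<close> serves the numbers below \<open>b j\<close>, and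
  \<open>m < b m\<close>.\<close>

primrec upj :: "(nat \<Rightarrow> nat) \<Rightarrow> (nat \<Rightarrow> nat) \<Rightarrow> (nat \<Rightarrow> nat \<Rightarrow> nat) \<Rightarrow> nat \<Rightarrow> nat \<Rightarrow> nat" where
  "upj b c \<tau> 0 m = m"
| "upj b c \<tau> (Suc j) m = c (\<tau> j (m div b j)) * (m div b j) + upj b c \<tau> j (m mod b j)"

definition upv :: "(nat \<Rightarrow> nat) \<Rightarrow> (nat \<Rightarrow> nat) \<Rightarrow> (nat \<Rightarrow> nat \<Rightarrow> nat) \<Rightarrow> nat \<Rightarrow> nat" where
  "upv b c \<tau> m = upj b c \<tau> m m"

lemma div_last: "0 < y \<Longrightarrow> (y * k + (y - 1)) div y = (k::nat)"
  by (subst div_mult_self4) auto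

text \<open>Hierarchies \<open>range b\<close> and \<open>range c\<close> with ratios \<open>q\<close> and \<open>q'\<close>; a number with leading digit
  \<open>d\<close> at the base \<open>b j\<close> has leading digit \<open>d\<close> at the base \<open>c (\<tau> j d)\<close> after the upgrade.\<close>

locale frame =
  fixes b c :: "nat \<Rightarrow> nat" and q q' :: "nat \<Rightarrow> nat" and \<tau> :: "nat \<Rightarrow> nat \<Rightarrow> nat"
  assumes b0: "2 \<le> b 0" and bc0: "b 0 \<le> c 0"
    and bS: "b (Suc j) = b j * q j" and cS: "c (Suc j) = c j * q' j"
    and q2: "2 \<le> q j" and q'2: "2 \<le> q' j" and qb: "q j \<le> b 0"
    and tau0: "\<tau> 0 1 = 0" and tauS: "\<tau> (Suc j) 1 = Suc (\<tau> j (q j - 1))"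
    and tau_mono: "1 \<le> d \<Longrightarrow> d \<le> d' \<Longrightarrow> d' < q j \<Longrightarrow> \<tau> j d \<le> \<tau> j d'"
    and tau_q': "1 \<le> d \<Longrightarrow> d < q j \<Longrightarrow> d < q' (\<tau> j d)"
    and tau_between: "1 \<le> d \<Longrightarrow> d < q j \<Longrightarrow> \<tau> j 1 \<le> t \<Longrightarrow> t < \<tau> j d \<Longrightarrow> q' t \<le> d"
    and tau_last: "q' (\<tau> j (q j - 1)) \<le> q j"
begin

abbreviation G where "G \<equiv> upj b c \<tau>"
abbreviation g where "g \<equiv> upv b c \<tau>"

lemma b_pos: "0 < b j"
proof (induction j)
  case (Suc j)
  then show ?case using q2[of j] by (simp add: bS)
qed (use b0 in simp)

lemma c_pos: "0 < c j"
proof (induction j)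
  case (Suc j)
  then show ?case using q'2[of j] by (simp add: cS)
qed (use b0 bc0 in simp)

lemma b_lt: "b j < b (Suc j)"
proof -
  have "b j * 1 < b j * q j" using b_pos q2[of j] by (intro mult_strict_left_mono) auto
  then show ?thesis by (simp add: bS)
qed

lemma c_lt: "c j < c (Suc j)"
proof -
  have "c j * 1 < c j * q' j" using c_pos q'2[of j] by (intro mult_strict_left_mono) auto
  then show ?thesis by (simp add: cS)
qed

lemma b_mono: "i \<le> j \<Longrightarrow> b i \<le> b j"
  using b_lt by (simp add: lift_Suc_mono_le less_imp_le)

lemma c_mono: "i \<le> j \<Longrightarrow> c i \<le> c j"
  using c_lt by (simp add: lift_Suc_mono_le less_imp_le)

lemma c_smono: "i < j \<Longrightarrow> c i < c j"
  using c_lt by (simp add: lift_Suc_mono_less)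

lemma less_b: "m < b m"
proof (induction m)
  case (Suc m)
  then show ?case using b_lt[of m] by simp
qed (rule b_pos)

lemma div_q: "m < b (Suc j) \<Longrightarrow> m div b j < q j"
  by (simp add: bS less_mult_imp_div_less mult.commute)


lemma tau_mono_c: "1 \<le> d \<Longrightarrow> d \<le> d' \<Longrightarrow> d' < q j \<Longrightarrow> c (\<tau> j d) \<le> c (\<tau> j d')"
  by (intro c_mono tau_mono)

lemma G_bound_step:
  assumes IH: "\<And>m. m < b j \<Longrightarrow> G j m < c (\<tau> j 1)" and m: "m < b (Suc j)" "1 \<le> m div b j"
  shows "G (Suc j) m < c (\<tau> j (m div b j)) * (m div b j + 1)"
proof -
  have "G j (m mod b j) < c (\<tau> j 1)" using IH b_pos by simp
  also have "\<dots> \<le> c (\<tau> j (m div b j))" using m div_q by (intro tau_mono_c) auto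
  finally show ?thesis by simp
qed

lemma c_digit: "1 \<le> d \<Longrightarrow> d < q j \<Longrightarrow> c (\<tau> j d) * (d + 1) \<le> c (Suc (\<tau> j d))"
  using tau_q'[of d j] by (simp add: cS del: mult_Suc_right)

lemma c_digit': "1 \<le> d \<Longrightarrow> d < q j \<Longrightarrow> c (Suc (\<tau> j d)) \<le> c (\<tau> (Suc j) 1)"
  unfolding tauS by (intro c_mono Suc_leI le_imp_less_Suc tau_mono) auto

lemma G_lt: "m < b j \<Longrightarrow> G j m < c (\<tau> j 1)"
proof (induction j arbitrary: m)
  case 0
  then show ?case using bc0 tau0 by simp
next
  case (Suc j)
  have q: "m div b j < q j" using div_q Suc.prems by simp
  show ?case
  proof (cases "m div b j = 0")
    case True
    then have "m < b j" using b_pos[of j] by (simp add: div_eq_0_iff)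
    then have "G (Suc j) m < c (\<tau> j 1)" using Suc.IH[of m] by simp
    also have "\<dots> \<le> c (\<tau> (Suc j) 1)" unfolding tauS using q2[of j]
      by (intro c_mono le_SucI tau_mono) auto
    finally show ?thesis .
  next
    case False
    then have d: "1 \<le> m div b j" by simp
    from G_bound_step[OF Suc.IH Suc.prems d] c_digit[OF d q] c_digit'[OF d q] show ?thesis by linarith
  qed
qed

lemmas G_bound = G_bound_step[OF G_lt]

lemma G_stable: "m < b j \<Longrightarrow> j \<le> j' \<Longrightarrow> G j' m = G j m"
proof (rotate_tac, induction rule: dec_induct)
  case (step n)
  have "m < b n" using step b_mono[of j n] by simp
  then show ?case using step by simp
qed simp

lemma g_G: "m < b j \<Longrightarrow> g m = G j m"
  unfolding upv_def using G_stable[of m j m] G_stable[OF less_b, of m j] by (cases "j \<le> m") auto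

lemma g_small: "m < b 0 \<Longrightarrow> g m = m"
  using g_G[of m 0] by simp

lemma g_decomp: "m < b (Suc j) \<Longrightarrow> g m = c (\<tau> j (m div b j)) * (m div b j) + g (m mod b j)"
  using g_G[of m "Suc j"] g_G[of "m mod b j" j] b_pos[of j] by simp

lemma g_lt: "m < b j \<Longrightarrow> g m < c (\<tau> j 1)"
  using g_G G_lt by simp

lemma g_bound: "m < b (Suc j) \<Longrightarrow> 1 \<le> m div b j \<Longrightarrow> g m < c (\<tau> j (m div b j)) * (m div b j + 1)"
  using g_G[of m "Suc j"] G_bound by simp

lemma g_0 [simp]: "g 0 = 0"
  using g_small[of 0] b0 by simp

lemma g_smono_aux: "m < m' \<Longrightarrow> m' < b j \<Longrightarrow> g m < g m'"
proof (induction j arbitrary: m m')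
  case 0
  then show ?case using g_small by simp
next
  case (Suc j)
  let ?d = "m div b j" and ?d' = "m' div b j"
  have m: "m < b (Suc j)" using Suc.prems by simp
  note q' = div_q[OF Suc.prems(2)]
  show ?case
  proof (cases "?d = ?d'")
    case True
    then have "m mod b j < m' mod b j" using Suc.prems(1)
      by (metis add_less_cancel_left mult_div_mod_eq)
    then have "g (m mod b j) < g (m' mod b j)" using b_pos by (intro Suc.IH) auto
    then show ?thesis using g_decomp[OF m] g_decomp[OF Suc.prems(2)] True by simp
  next
    case False
    then have dd: "?d < ?d'" using Suc.prems(1) div_le_mono[of m m' "b j"] by simp
    have "g m < c (\<tau> j ?d') * ?d'"
    proof (cases "?d = 0")
      case True
      then have "m < b j" using b_pos[of j] by (simp add: div_eq_0_iff)
      then have "g m < c (\<tau> j 1)" by (rule g_lt)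
      also have "\<dots> \<le> c (\<tau> j ?d') * 1" using dd q' by (simp add: tau_mono_c)
      also have "\<dots> \<le> c (\<tau> j ?d') * ?d'" using dd by (intro mult_left_mono) auto
      finally show ?thesis .
    next
      case F: False
      then have "g m < c (\<tau> j ?d) * (?d + 1)" by (intro g_bound m) auto
      also have "\<dots> \<le> c (\<tau> j ?d') * ?d'" using F dd q' by (intro mult_mono tau_mono_c) auto
      finally show ?thesis .
    qed
    then show ?thesis using g_decomp[OF Suc.prems(2)] by simp
  qed
qed

lemma g_smono: "m < m' \<Longrightarrow> g m < g m'"
  by (rule g_smono_aux[OF _ less_b])

lemma g_mono: "m \<le> m' \<Longrightarrow> g m \<le> g m'"
  using g_smono[of m m'] by (cases "m = m'") auto

lemma g_b: "g (b j) = c (\<tau> j 1)"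
  using g_decomp[OF b_lt[of j]] b_pos[of j] by simp

lemma slessS_range: "x < c (Suc t) \<Longrightarrow> slessS x (range c) (c t)"
proof -
  assume x: "x < c (Suc t)"
  have "c (Suc t) \<le> c u" if "c t < c u" for u
    using that c_mono[of u t] c_mono[of "Suc t" u] by (cases "u \<le> t") auto
  then show ?thesis using x unfolding slessS_def sS_def by fastforce
qed

lemma slessS_rangeD: "slessS x (range c) (c t) \<Longrightarrow> x < c (Suc t)"
proof -
  have "c (Suc t) \<le> c u" if "c t < c u" for u
    using that c_mono[of u t] c_mono[of "Suc t" u] by (cases "u \<le> t") auto
  then have "sS (range c) (c t) (c (Suc t))" unfolding sS_def using c_lt[of t] by auto
  moreover assume "slessS x (range c) (c t)"
  ultimately show ?thesis unfolding slessS_def by blast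
qed

lemma bs_range: assumes "bs (range b) m x" obtains j where "x = b j" "b j \<le> m" "m < b (Suc j)"
proof -
  from assms obtain j where j: "x = b j" "b j \<le> m" unfolding bs_def by auto
  have "m < b (Suc j)"
  proof (rule ccontr)
    assume "\<not> ?thesis"
    then have "b (Suc j) \<le> b j" using assms j unfolding bs_def by auto
    then show False using b_lt[of j] by simp
  qed
  then show ?thesis using that j by blast
qed

lemma c_last: "c (\<tau> j (q j - 1)) \<le> g (b (Suc j) - 1)"
proof -
  have q: "b (Suc j) - 1 = b j * (q j - 1) + (b j - 1)"
    using b_pos[of j] q2[of j] by (simp add: bS diff_mult_distrib2)
  have "(b (Suc j) - 1) div b j = q j - 1" unfolding q by (rule div_last[OF b_pos])
  then have "g (b (Suc j) - 1) \<ge> c (\<tau> j (q j - 1)) * (q j - 1)"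
    using g_decomp[of "b (Suc j) - 1" j] b_pos[of "Suc j"] by simp
  moreover have "c (\<tau> j (q j - 1)) * 1 \<le> c (\<tau> j (q j - 1)) * (q j - 1)"
    using q2[of j] by (intro mult_left_mono) auto
  ultimately show ?thesis by linarith
qed

text \<open>A smaller \<open>c t\<close> is rejected. If the remainder is positive,
  \<open>m - 1\<close> has the same leading digit and its upgrade already reaches
  \<open>c (Suc t)\<close>. Otherwise the ratio at \<open>t\<close> exceeds the digit, so
  \<open>t < \<tau> j 1\<close> by \<open>tau_between\<close>, and again the upgrade of
  \<open>m - 1\<close> is too large.\<close>

lemma least_adm_g:
  assumes m: "b j \<le> m" "m < b (Suc j)"
  shows "least_adm (range c) (g (m - 1)) (g (m div b j)) (g (m mod b j)) (c (\<tau> j (m div b j)))"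
proof -
  let ?f = "m div b j" and ?r = "m mod b j"
  have f: "1 \<le> ?f" "?f < q j" using m div_q b_pos[of j] by (auto simp: Suc_le_eq div_greater_zero_iff)
  have gf: "g ?f = ?f" using f qb[of j] by (intro g_small) auto
  have m0: "0 < m" using m b_pos[of j] by simp
  note gm = g_decomp[OF m(2)]
  have "g (m - 1) < g m" using m0 by (intro g_smono) auto
  moreover have "g m < c (Suc (\<tau> j ?f))"
    using g_bound[OF m(2) f(1)] c_digit[OF f] by simp
  ultimately have adm: "adm (range c) (g (m - 1)) ?f (g ?r) (c (\<tau> j ?f))"
    unfolding adm_def using gm by (auto intro: slessS_range)
  have "\<not> adm (range c) (g (m - 1)) ?f (g ?r) (c t)" if t: "c t < c (\<tau> j ?f)" for t
  proof
    assume "adm (range c) (g (m - 1)) ?f (g ?r) (c t)"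
    then have a: "g (m - 1) < c t * ?f + g ?r" "c t * ?f + g ?r < c (Suc t)"
      unfolding adm_def by (auto dest: slessS_rangeD)
    have tt: "t < \<tau> j ?f" using t c_mono[of "\<tau> j ?f" t] by (cases "t < \<tau> j ?f") auto
    show False
    proof (cases "?r = 0")
      case False
      then have "m - 1 = b j * ?f + (?r - 1)" using mult_div_mod_eq[of "b j" m] by linarith
      moreover have "?r - 1 < b j" using False mod_less_divisor[OF b_pos[of j], of m] by linarith
      ultimately have "(m - 1) div b j = ?f" using b_pos[of j] by simp
      then have "c (\<tau> j ?f) * ?f \<le> g (m - 1)" using g_decomp[of "m - 1" j] m by simp
      moreover have "c (Suc t) \<le> c (\<tau> j ?f) * 1" using tt by (simp add: c_mono)
      moreover have "c (\<tau> j ?f) * 1 \<le> c (\<tau> j ?f) * ?f" using f by (intro mult_left_mono) auto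
      ultimately show False using a by linarith
    next
      case True
      then have mf: "m = b j * ?f" using mult_div_mod_eq[of "b j" m] by simp
      have "c t * ?f < c t * q' t" using a(2) True by (simp add: cS)
      then have fq: "?f < q' t" by simp
      have ts: "t < \<tau> j 1" using tau_between[OF f, of t] tt fq by (meson leD leI)
      have "c t \<le> g (m - 1) \<or> c (Suc t) \<le> g (m - 1)"
      proof (cases "?f = 1")
        \<comment> \<open>The predecessor of \<open>b j\<close> has the digit \<open>q i - 1\<close>
          at the previous base, whose target immediately precedes \<open>c (\<tau> j 1)\<close> by
          \<open>tauS\<close>.\<close>
        case True
        then have mb: "m = b j" using mf by simp
        show ?thesis
        proof (cases j)
          case 0
          then show ?thesis using ts tau0 by simp
        next
          case (Suc i)
          have "c t \<le> c (\<tau> i (q i - 1))" using ts unfolding Suc tauS by (intro c_mono) simp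
          also have "\<dots> \<le> g (m - 1)" using c_last[of i] mb Suc by simp
          finally show ?thesis by simp
        qed
      next
        case False
        then have "b j * 2 \<le> m" using mf f by (metis One_nat_def Suc_1 Suc_leI le_neq_implies_less mult_le_mono2)
        then have "b j \<le> m - 1" using b_pos[of j] by linarith
        then have "c (\<tau> j 1) \<le> g (m - 1)" using g_mono[of "b j" "m - 1"] g_b[of j] by simp
        moreover have "c (Suc t) \<le> c (\<tau> j 1)" using ts by (intro c_mono) simp
        ultimately show ?thesis by simp
      qed
      then show False
      proof
        assume "c t \<le> g (m - 1)"
        then have "?f \<noteq> 1" using a(1) True by auto
        then have "b j * 2 \<le> m" using mf f by (metis One_nat_def Suc_1 Suc_leI le_neq_implies_less mult_le_mono2)
        then have "b j \<le> m - 1" using b_pos[of j] by linarith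
        then have "c (\<tau> j 1) \<le> g (m - 1)" using g_mono[of "b j" "m - 1"] g_b[of j] by simp
        moreover have "c (Suc t) \<le> c (\<tau> j 1)" using ts by (intro c_mono) simp
        ultimately show False using a by linarith
      qed (use a in linarith)
    qed
  qed
  then show ?thesis unfolding least_adm_def gf using adm by auto
qed

lemma stepg_g: "stepg (range b) (range c) g m"
  unfolding stepg_def
proof (intro conjI impI allI)
  assume "\<forall>x\<le>m. x \<notin> range b"
  then have "\<not> b 0 \<le> m" by blast
  then show "g m = m" by (intro g_small) simp
next
  fix x f r m'
  assume A: "bs (range b) m x \<and> m = x * f + r \<and> r < x \<and> m' + 1 = m"
  then obtain j where j: "x = b j" "b j \<le> m" "m < b (Suc j)" by (blast elim: bs_range)
  have fr: "f = m div b j" "r = m mod b j" "m' = m - 1" using A j by auto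
  show "\<exists>d. least_adm (range c) (g m') (g f) (g r) d \<and> g m = d * g f + g r"
  proof (intro exI conjI)
    show "least_adm (range c) (g m') (g f) (g r) (c (\<tau> j f))" using least_adm_g[OF j(2,3)] fr by simp
    have "f < b 0" using div_q[OF j(3)] qb[of j] fr by simp
    then show "g m = c (\<tau> j f) * g f + g r" using g_decomp[OF j(3)] fr g_small by simp
  qed
qed

text \<open>With \<open>?T = \<tau> j (q j - 1)\<close>, the value \<open>?x\<close> has base
  \<open>c ?T\<close> and is at least \<open>c ?T * (q j - 1)\<close>, whereas the next base is at
  most \<open>c ?T * q j\<close> by \<open>tau_last\<close>. No multiple of \<open>c ?T\<close> fits
  in between.\<close>

lemma good_gap:
  assumes "sbase (range c) (g (b (Suc j) - 1)) x"
  shows "\<not> (\<exists>y. (\<exists>z. y = x * z) \<and> g (b (Suc j) - 1) < y \<and> slessS y (range c) (g (b (Suc j) - 1)))"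
proof -
  let ?x = "g (b (Suc j) - 1)" and ?T = "\<tau> j (q j - 1)"
  have q: "b (Suc j) - 1 = b j * (q j - 1) + (b j - 1)"
    using b_pos[of j] q2[of j] by (simp add: bS diff_mult_distrib2)
  have d: "(b (Suc j) - 1) div b j = q j - 1" unfolding q by (rule div_last[OF b_pos])
  have lt: "b (Suc j) - 1 < b (Suc j)" using b_pos[of "Suc j"] by simp
  have qj: "1 \<le> q j - 1" "q j - 1 < q j" using q2[of j] by auto
  have lo: "c ?T * (q j - 1) \<le> ?x" using g_decomp[OF lt] d by simp
  have hi: "?x < c (Suc ?T)" using g_bound[OF lt, unfolded d, OF qj(1)] c_digit[OF qj] by linarith
  have up: "c ?T \<le> ?x" by (rule c_last)
  have min: "smin (range c) (c 0)" unfolding smin_def by (auto simp: c_mono)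
  obtain p where p: "smin (range c) p" "(p \<le> ?x \<and> x \<in> range c \<and> x \<le> ?x \<and> (\<forall>z. z \<in> range c \<and> z \<le> ?x \<longrightarrow> z \<le> x)) \<or> ?x < p \<and> x = p"
    using assms unfolding sbase_def by blast
  have "p \<le> c ?T" using p(1) unfolding smin_def by blast
  then have x: "x \<in> range c" "x \<le> ?x" "\<And>z. z \<in> range c \<Longrightarrow> z \<le> ?x \<Longrightarrow> z \<le> x" using p(2) up by auto
  then obtain u where u: "x = c u" by blast
  have "\<not> Suc ?T \<le> u" using hi x(2) u c_mono[of "Suc ?T" u] by linarith
  moreover have "\<not> u < ?T" using x(3)[OF _ up] u c_smono[of u ?T] by auto
  ultimately have "u = ?T" by linarith
  then have xT: "x = c ?T" using u by simp
  show ?thesis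
  proof
    assume "\<exists>y. (\<exists>z. y = x * z) \<and> ?x < y \<and> slessS y (range c) ?x"
    then obtain z where z: "?x < c ?T * z" "slessS (c ?T * z) (range c) ?x" using xT by blast
    have "c (Suc ?T) \<le> c v" if "?x < c v" for v
    proof -
      have "\<not> v \<le> ?T" using that up c_mono[of v ?T] by auto
      then show ?thesis by (intro c_mono) simp
    qed
    then have "sS (range c) ?x (c (Suc ?T))" unfolding sS_def using hi by auto
    then have "c ?T * z < c ?T * q' ?T" using z(2) unfolding slessS_def cS by blast
    then have "z < q' ?T" by simp
    then have "z \<le> q j - 1" using tau_last[of j] by linarith
    then have "c ?T * z \<le> c ?T * (q j - 1)" by (rule mult_left_mono) simp
    then show False using z(1) lo by linarith
  qed
qed

text \<open>If each digit moves to a base larger by a factor of at most \<open>W\<close>, so does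
  the whole number. The bound will keep upgrades inside the cut.\<close>

lemma g_le:
  assumes W: "1 \<le> W" and cW: "\<And>j d. 1 \<le> d \<Longrightarrow> d < q j \<Longrightarrow> c (\<tau> j d) \<le> b j * W"
  shows "g m \<le> m * W"
proof -
  have "g m \<le> m * W" if "m < b j" for j using that
  proof (induction j arbitrary: m)
    case 0
    then show ?case using W g_small by simp
  next
    case (Suc j)
    let ?d = "m div b j"
    have "c (\<tau> j ?d) * ?d \<le> b j * W * ?d"
      using cW[of ?d j] div_q[OF Suc.prems] by (cases "?d = 0") auto
    moreover have "g (m mod b j) \<le> m mod b j * W" using b_pos by (intro Suc.IH) simp
    moreover have "m * W = b j * W * ?d + m mod b j * W"
      by (metis add_mult_distrib mult.assoc mult.commute mult_div_mod_eq)
    ultimately show ?case using g_decomp[OF Suc.prems] by linarith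
  qed
  then show ?thesis using less_b by blast
qed

lemma b_dvd: "J \<le> j \<Longrightarrow> b J dvd b j"
  by (induction rule: dec_induct) (auto simp: bS)

text \<open>Digits are upgraded separately; peeling off leading digits above \<open>b J\<close>
  never touches the part \<open>l\<close>.\<close>

lemma g_add: "l < b J \<Longrightarrow> g (b J * x + l) = g (b J * x) + g l"
proof -
  assume l: "l < b J"
  have "g (b J * x + l) = g (b J * x) + g l" if "J \<le> j" "b J * x + l < b j" for j using that
  proof (induction j arbitrary: x rule: dec_induct)
    case base
    then have "x = 0" using b_pos[of J] by (cases x) auto
    then show ?case by simp
  next
    case (step j)
    obtain y where y: "b j = b J * y" using b_dvd[OF step(1)] by blast
    have y0: "0 < y" using y b_pos[of j] by (cases y) auto
    have lt: "b J * (x mod y) + l < b j"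
    proof -
      have "b J * (x mod y) + l < b J * (x mod y + 1)" using l by simp
      also have "\<dots> \<le> b J * y" using y0 by (intro mult_left_mono) (auto simp: Suc_le_eq)
      finally show ?thesis using y by simp
    qed
    have e1: "b J * x + l = b j * (x div y) + (b J * (x mod y) + l)"
    proof -
      have "b J * x = b J * (y * (x div y) + x mod y)" by simp
      also have "\<dots> = b j * (x div y) + b J * (x mod y)" unfolding y by (simp only: distrib_left mult.assoc)
      finally show ?thesis by simp
    qed
    have d: "(b J * x + l) div b j = x div y" "(b J * x + l) mod b j = b J * (x mod y) + l"
      unfolding e1 using lt by auto
    have d0: "(b J * x) div b j = x div y" "(b J * x) mod b j = b J * (x mod y)"
      unfolding y using b_pos[of J] by auto
    show ?case using g_decomp[OF step(4)] g_decomp[of "b J * x" j] step(3)[OF lt] step(4) d d0 by simp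
  qed
  from this[of "max J (b J * x + l)"] show ?thesis
    using less_b[of "b J * x + l"] b_mono[of "b J * x + l" "max J (b J * x + l)"] by simp
qed

text \<open>From \<open>J\<close> on the ratios are merely shifted by \<open>mm\<close>, so all
  bases above \<open>b J\<close> are scaled by the same factor.\<close>

lemma g_shift:
  assumes tau: "\<And>j d. J \<le> j \<Longrightarrow> 1 \<le> d \<Longrightarrow> d < q j \<Longrightarrow> \<tau> j d = j + mm"
    and qq: "\<And>j. J \<le> j \<Longrightarrow> q' (j + mm) = q j"
  shows "g (b J * x) = c (J + mm) * x"
proof -
  have "g (b J * x) = c (J + mm) * x" if "J \<le> j" "b J * x < b j" for j using that
  proof (induction j arbitrary: x rule: dec_induct)
    case base
    then have "x = 0" using b_pos[of J] by (cases x) auto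
    then show ?case by simp
  next
    case (step j)
    have *: "\<exists>y. b j = b J * y \<and> c (j + mm) = c (J + mm) * y" using step(1)
    proof (induction rule: dec_induct)
      case base
      then show ?case by (intro exI[of _ 1]) simp
    next
      case (step j)
      then obtain y where "b j = b J * y" "c (j + mm) = c (J + mm) * y" by blast
      then show ?case using qq[OF step(1)] by (intro exI[of _ "y * q j"]) (simp add: bS cS)
    qed
    then obtain y where y: "b j = b J * y" "c (j + mm) = c (J + mm) * y" by blast
    have y0: "0 < y" using y b_pos[of j] by (cases y) auto
    have d0: "(b J * x) div b j = x div y" "(b J * x) mod b j = b J * (x mod y)"
      unfolding y using b_pos[of J] by auto
    have "g (b J * (x mod y)) = c (J + mm) * (x mod y)"
      using b_pos[of J] y0 by (intro step(3)) (simp add: y)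
    moreover have "c (\<tau> j (x div y)) * (x div y) = c (J + mm) * y * (x div y)"
      using tau[OF step(1), of "x div y"] div_q[OF step(4)] y d0 by (cases "x div y = 0") auto
    ultimately have "g (b J * x) = c (J + mm) * y * (x div y) + c (J + mm) * (x mod y)"
      using g_decomp[OF step(4)] unfolding d0 by linarith
    also have "\<dots> = c (J + mm) * (y * (x div y) + x mod y)" by (simp only: distrib_left mult.assoc)
    finally show ?case by simp
  qed
  from this[of "max J (b J * x)"] show ?thesis
    using less_b[of "b J * x"] b_mono[of "b J * x" "max J (b J * x)"] by simp
qed

end

section \<open>Long Goodstein runs\<close>

definition bb :: "nat \<Rightarrow> (nat \<Rightarrow> nat) \<Rightarrow> nat \<Rightarrow> nat" where
  "bb p q j = p * (\<Prod>l<j. q l)"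

text \<open>A ratio \<open>q J = c + 1\<close> is replaced by \<open>M\<close> ratios \<open>c\<close> followed by \<open>c + 1\<close>.\<close>

definition ins :: "(nat \<Rightarrow> nat) \<Rightarrow> nat \<Rightarrow> nat \<Rightarrow> nat \<Rightarrow> nat" where
  "ins q J M j = (if j < J then q j else if j < J + M then q J - 1 else q (j - M))"

text \<open>The base that the upgrade rule selects: at position \<open>J\<close> digits below
  \<open>q J - 1\<close> fit the first inserted ratio and stay; the digit \<open>q J - 1\<close>
  requires the ratio \<open>q J\<close> and passes all \<open>M\<close> insertions; positions above
  shift by \<open>M\<close>.\<close>

definition tau :: "(nat \<Rightarrow> nat) \<Rightarrow> nat \<Rightarrow> nat \<Rightarrow> nat \<Rightarrow> nat \<Rightarrow> nat" where
  "tau q J M j d = (if j < J \<or> j = J \<and> d + 1 < q J then j else j + M)"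

definition gup :: "nat \<Rightarrow> (nat \<Rightarrow> nat) \<Rightarrow> nat \<Rightarrow> nat \<Rightarrow> nat \<Rightarrow> nat \<Rightarrow> nat" where
  "gup p q p' J M = upv (bb p q) (bb p' (ins q J M)) (tau q J M)"

definition conf :: "nat \<Rightarrow> nat \<Rightarrow> (nat \<Rightarrow> nat) \<Rightarrow> bool" where
  "conf k p q \<longleftrightarrow> 2 \<le> k \<and> k \<le> p \<and> (\<forall>j. 2 \<le> q j \<and> q j \<le> k)"

type_synonym pos = "nat \<times> (nat \<Rightarrow> nat) \<times> nat"

text \<open>A move raises the least base and unfolds one ratio. The bounds \<open>h i + 1\<close>
  and \<open>i\<close> limit the growth in terms of the time, which later keeps the upgrades inside
  the cut.\<close>

fun pstep :: "(nat \<Rightarrow> nat) \<Rightarrow> nat \<Rightarrow> pos \<Rightarrow> pos \<Rightarrow> bool" where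
  "pstep h i (p, q, n) (p', q', n') \<longleftrightarrow> (\<exists>J M. 0 < n \<and> p \<le> p' \<and> p' \<le> max p (h i + 1) \<and> M \<le> i \<and>
     (M = 0 \<or> 3 \<le> q J) \<and> q' = ins q J M \<and> n' + 1 = gup p q p' J M n)"

inductive play :: "(nat \<Rightarrow> nat) \<Rightarrow> nat \<Rightarrow> pos \<Rightarrow> nat \<Rightarrow> pos \<Rightarrow> bool" for h i s where
  play_0: "play h i s i s"
| play_Suc: "play h i s j t \<Longrightarrow> pstep h j t t' \<Longrightarrow> play h i s (Suc j) t'"

lemma bb_0 [simp]: "bb p q 0 = p"
  by (simp add: bb_def)

lemma bb_Suc: "bb p q (Suc j) = bb p q j * q j"
  by (simp add: bb_def)

lemma ins_0 [simp]: "ins q J 0 = q"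
  by (auto simp: ins_def fun_eq_iff)

lemma conf_ins: "conf k p q \<Longrightarrow> p \<le> p' \<Longrightarrow> M = 0 \<or> 3 \<le> q J \<Longrightarrow> conf k p' (ins q J M)"
  unfolding conf_def ins_def using le_trans diff_le_self by fastforce

text \<open>Inserted ratios are \<open>q J - 1\<close> and must be at least 2; hence
  \<open>3 \<le> q J\<close> unless nothing is inserted.\<close>

lemma frame_move:
  assumes c: "conf k p q" and p: "p \<le> p'" and M: "M = 0 \<or> 3 \<le> q J"
  shows "frame (bb p q) (bb p' (ins q J M)) q (ins q J M) (tau q J M)"
proof
  note c' = conf_ins[OF c p M]
  have q: "2 \<le> q j" "q j \<le> k" for j using c by (auto simp: conf_def)
  have t: "tau q J M j 1 = (if j \<le> J then j else j + M)" for j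
    using M q(1)[of J] by (auto simp: tau_def)
  show "2 \<le> bb p q 0" "bb p q 0 \<le> bb p' (ins q J M) 0" using c p by (auto simp: conf_def)
  show "bb p q (Suc j) = bb p q j * q j" for j by (rule bb_Suc)
  show "bb p' (ins q J M) (Suc j) = bb p' (ins q J M) j * ins q J M j" for j by (rule bb_Suc)
  show "2 \<le> q j" for j by (rule q)
  show "2 \<le> ins q J M j" for j using c' by (auto simp: conf_def)
  show "q j \<le> bb p q 0" for j using c by (auto simp: conf_def intro: order_trans)
  show "tau q J M 0 1 = 0" unfolding t by simp
  show "tau q J M (Suc j) 1 = Suc (tau q J M j (q j - 1))" for j
    unfolding t using q(1)[of j] by (auto simp: tau_def)
  show "tau q J M j d \<le> tau q J M j d'" if "1 \<le> d" "d \<le> d'" "d' < q j" for j d d'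
    using that by (auto simp: tau_def)
  show "d < ins q J M (tau q J M j d)" if "1 \<le> d" "d < q j" for j d
    using that M by (auto simp: tau_def ins_def)
  show "ins q J M t \<le> d" if "1 \<le> d" "d < q j" "tau q J M j 1 \<le> t" "t < tau q J M j d" for j d t
    using that unfolding t by (auto simp: tau_def ins_def split: if_splits)
  show "ins q J M (tau q J M j (q j - 1)) \<le> q j" for j
    using q(1)[of j] by (auto simp: tau_def ins_def)
qed

lemma play_trans: "play h j t i' t' \<Longrightarrow> play h i s j t \<Longrightarrow> play h i s i' t'"
  by (induction rule: play.induct) (auto intro: play.intros)

lemma play_le: "play h i s j t \<Longrightarrow> i \<le> j"
  by (induction rule: play.induct) auto

lemma play1: "pstep h i s t \<Longrightarrow> play h i s (Suc i) t"
  by (rule play_Suc[OF play_0])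

lemma upj_idle: "upj b b (\<lambda>j d. j) j m = m"
  by (induction j arbitrary: m) auto

lemma gup_idle: "gup p q p 0 0 n = n"
proof -
  have "tau q 0 0 = (\<lambda>j d. j)" by (auto simp: tau_def fun_eq_iff)
  then show ?thesis by (simp add: gup_def upv_def upj_idle)
qed

lemma pstep_idle: "pstep h i (p, q, Suc n) (p, q, n)"
  by (auto simp: gup_idle intro!: exI[of _ 0])

lemma play_idle1: "play h i s j (p, q, n + 1) \<Longrightarrow> play h i s (Suc j) (p, q, n)"
  using play_Suc[OF _ pstep_idle, of h i s j p q n] by simp

lemma play_idle: "play h i (p, q, n + m) (i + m) (p, q, n)"
proof (induction m arbitrary: n)
  case (Suc m)
  from play_Suc[OF Suc.IH[of "Suc n"] pstep_idle] show ?case by simp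
qed (simp add: play_0)

lemma gup_raise: "conf k p q \<Longrightarrow> p \<le> p' \<Longrightarrow> gup p q p' 0 0 (p * x) = p' * x"
proof -
  assume c: "conf k p q" and p: "p \<le> p'"
  interpret frame "bb p q" "bb p' (ins q 0 0)" q "ins q 0 0" "tau q 0 0"
    by (rule frame_move[OF c p]) simp
  show ?thesis using g_shift[of 0 0 x] by (simp add: gup_def tau_def)
qed

text \<open>Raising the least base to \<open>p'\<close> turns \<open>p (u + 1)\<close> into
  \<open>p' u + (p' - 1)\<close>. Idling down to \<open>p' u + 1\<close> takes \<open>p' - 2\<close>
  steps, which passes time \<open>h i\<close>.\<close>

lemma play_raise:
  assumes c: "conf k p q"
  shows "\<exists>i'. h i \<le> i' \<and> play h i (p, q, p * (u + 1)) i' (max p (h i + 1), q, max p (h i + 1) * u + 1)"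
proof -
  let ?p = "max p (h i + 1)"
  have p2: "2 \<le> p" using c by (auto simp: conf_def)
  then have e: "?p * u + (?p - 1) + 1 = ?p * (u + 1)" "?p * u + (?p - 1) = ?p * u + 1 + (?p - 2)" by auto
  have "pstep h i (p, q, p * (u + 1)) (?p, q, ?p * u + (?p - 1))"
    using p2 e(1) gup_raise[OF c, of ?p "u + 1"] by (auto intro!: exI[of _ 0])
  from play_trans[OF play_idle play1[OF this[unfolded e(2)]]]
  have "play h i (p, q, p * (u + 1)) (Suc i + (?p - 2)) (?p, q, ?p * u + 1)" .
  moreover have "h i \<le> Suc i + (?p - 2)" using p2 by auto
  ultimately show ?thesis by blast
qed

text \<open>The digit \<open>cc\<close> is the largest one possible at \<open>J\<close>, so it moves
  past the insertions together with the part above it. The summand 1 is what the step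
  subtracts.\<close>

lemma pstep_expand:
  assumes c: "conf k p q" and J: "q J = cc + 1" "2 \<le> cc" and M: "M \<le> i"
  shows "pstep h i (p, q, bb p q J * (q J * u + cc) + 1)
    (p, ins q J M, bb p (ins q J M) (J + M) * (q J * u + cc))"
proof -
  have M3: "M = 0 \<or> 3 \<le> q J" using J by simp
  interpret frame "bb p q" "bb p (ins q J M)" q "ins q J M" "tau q J M"
    by (rule frame_move[OF c order_refl M3])
  have b1: "1 < bb p q j" for j using b_mono[of 0 j] b0 by simp
  have e: "bb p q J * (q J * u + cc) + 1 = bb p q (Suc J) * u + (bb p q J * cc + 1)"
    by (simp add: bb_Suc algebra_simps)
  have l: "bb p q J * cc + 1 < bb p q (Suc J)"
    using b1[of J] J by (simp add: bb_Suc)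
  have 1: "g (bb p q (Suc J) * u) = bb p (ins q J M) (Suc J + M) * u"
    by (rule g_shift) (auto simp: tau_def ins_def)
  have d: "(bb p q J * cc + 1) div bb p q J = cc" "(bb p q J * cc + 1) mod bb p q J = 1"
    unfolding div_mult_self4[OF gr_implies_not0[OF b1]] mod_mult_self4 using b1[of J] by (simp_all only: div_less mod_less add_0_right)
  have t: "tau q J M J cc = J + M" using J by (simp add: tau_def)
  have g1: "g 1 = 1" using b0 by (intro g_small) simp
  have 2: "g (bb p q J * cc + 1) = bb p (ins q J M) (J + M) * cc + 1"
    using g_decomp[OF l] unfolding d t g1 .
  have "bb p (ins q J M) (Suc J + M) = bb p (ins q J M) (J + M) * q J"
    using bb_Suc[of p "ins q J M" "J + M"] by (simp add: ins_def)
  then have "g (bb p q J * (q J * u + cc) + 1) = bb p (ins q J M) (J + M) * (q J * u + cc) + 1"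
    unfolding e g_add[OF l] 1 2 by (simp add: algebra_simps)
  then show ?thesis unfolding pstep.simps using M M3
    by - (rule exI[of _ J], rule exI[of _ M], simp add: gup_def)
qed

section \<open>Words of ratios and the play lengths they guarantee\<close>

definition pre :: "(nat \<Rightarrow> nat) \<Rightarrow> nat list \<Rightarrow> bool" where
  "pre q w \<longleftrightarrow> (\<forall>l<length w. q l = w ! l)"

lemma pre_snoc: "pre q (w @ [a]) \<longleftrightarrow> pre q w \<and> q (length w) = a"
  unfolding pre_def by (auto simp: nth_append less_Suc_eq)

text \<open>A play of length at least \<open>f i\<close> that consumes one unit of the base following the ratios \<open>w\<close>
  and ends with ratios from \<open>K\<close> in place of \<open>w\<close>, the remaining ratios being unchanged.\<close>

definition gstep :: "nat \<Rightarrow> (nat \<Rightarrow> nat) \<Rightarrow> (nat \<Rightarrow> nat) \<Rightarrow> nat list set \<Rightarrow> nat list \<Rightarrow> bool" where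
  "gstep k h f K w \<longleftrightarrow> (\<forall>i p q u. conf k p q \<longrightarrow> pre q w \<longrightarrow> (\<exists>i' p' q' w'. w' \<in> K \<and> f i \<le> i' \<and>
     play h i (p, q, bb p q (length w) * (u + 1)) i' (p', q', bb p' q' (length w') * u + 1) \<and>
     conf k p' q' \<and> pre q' w' \<and> (\<forall>j. q' (length w' + j) = q (length w + j))))"

text \<open>Unfolding alters the word of ratios, so the guarantee is given for a set of words closed
  under such plays; it can then be invoked any number of times, as with a coinductive
  invariant.\<close>

definition goodw :: "nat \<Rightarrow> (nat \<Rightarrow> nat) \<Rightarrow> (nat \<Rightarrow> nat) \<Rightarrow> nat list \<Rightarrow> bool" where
  "goodw k h f v \<longleftrightarrow> (\<exists>K. v \<in> K \<and> (\<forall>w\<in>K. gstep k h f K w))"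

lemma goodwE:
  assumes "goodw k h f w" "conf k p q" "pre q w"
  obtains i' p' q' w' where "goodw k h f w'" "f i \<le> i'" "i \<le> i'"
    "play h i (p, q, bb p q (length w) * (u + 1)) i' (p', q', bb p' q' (length w') * u + 1)"
    "conf k p' q'" "pre q' w'" "\<And>j. q' (length w' + j) = q (length w + j)"
proof -
  from assms(1) obtain K where K: "w \<in> K" "\<And>w. w \<in> K \<Longrightarrow> gstep k h f K w" unfolding goodw_def by blast
  from K(2)[OF K(1), unfolded gstep_def, rule_format, OF assms(2,3), of i u]
  obtain i' p' q' w' where 1: "w' \<in> K" "f i \<le> i'"
    "play h i (p, q, bb p q (length w) * (u + 1)) i' (p', q', bb p' q' (length w') * u + 1)"
    "conf k p' q'" "pre q' w'" "\<forall>j. q' (length w' + j) = q (length w + j)" by blast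
  have "goodw k h f w'" unfolding goodw_def using K(2) 1(1) by blast
  then show ?thesis using that 1 play_le[OF 1(3)] by blast
qed

lemma goodwI: "P v \<Longrightarrow> (\<And>w. P w \<Longrightarrow> gstep k h f {w. P w} w) \<Longrightarrow> goodw k h f v"
  unfolding goodw_def by (intro exI[of _ "{w. P w}"]) simp

lemma goodw_le: "goodw k h f v \<Longrightarrow> (\<And>i. f' i \<le> f i) \<Longrightarrow> goodw k h f' v"
proof (rule goodwI[of "goodw k h f"])
  fix w assume g: "goodw k h f w" and le: "\<And>i. f' i \<le> f i"
  show "gstep k h f' {w. goodw k h f w} w"
    unfolding gstep_def mem_Collect_eq
  proof (intro allI impI)
    fix i p q u assume c: "conf k p q" "pre q w"
    show "\<exists>i' p' q' w'. goodw k h f w' \<and> f' i \<le> i' \<and>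
      play h i (p, q, bb p q (length w) * (u + 1)) i' (p', q', bb p' q' (length w') * u + 1) \<and>
      conf k p' q' \<and> pre q' w' \<and> (\<forall>j. q' (length w' + j) = q (length w + j))"
      by (rule goodwE[OF g c, of i u]) (use le[of i] in \<open>meson order_trans\<close>)
  qed
qed

text \<open>Each round leaves a summand 1, which pays for the idle step before the next
  round.\<close>

lemma consume:
  assumes "goodw k h f w" "conf k p q" "pre q w"
  obtains i' p' q' w' where "goodw k h f w'" "f i \<le> i'"
    "play h i (p, q, bb p q (length w) * (x + d + 1)) i' (p', q', bb p' q' (length w') * x + 1)"
    "conf k p' q'" "pre q' w'" "\<And>j. q' (length w' + j) = q (length w + j)"
  using assms
proof (induction d arbitrary: i p q w thesis)
  case 0
  show ?case
  proof (rule goodwE[OF 0(2-4), of i x])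
    fix i' p' q' w' assume "goodw k h f w'" "f i \<le> i'"
      "play h i (p, q, bb p q (length w) * (x + 1)) i' (p', q', bb p' q' (length w') * x + 1)"
      "conf k p' q'" "pre q' w'" "\<And>j. q' (length w' + j) = q (length w + j)"
    then show thesis by (intro 0(1)[of w' i' p' q']) simp_all
  qed
next
  case (Suc d)
  obtain i1 p1 q1 w1 where 1: "goodw k h f w1" "f i \<le> i1"
    "play h i (p, q, bb p q (length w) * (x + d + 1 + 1)) i1 (p1, q1, bb p1 q1 (length w1) * (x + d + 1) + 1)"
    "conf k p1 q1" "pre q1 w1" "\<And>j. q1 (length w1 + j) = q (length w + j)"
    by (rule goodwE[OF Suc(3-5), of i "x + d + 1"]) (rule that)
  note st = play_idle1[OF 1(3)]
  show ?case
  proof (rule Suc.IH[OF _ 1(1,4,5), of "Suc i1"])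
    fix i' p' q' w' assume 2: "goodw k h f w'" "f (Suc i1) \<le> i'"
      "play h (Suc i1) (p1, q1, bb p1 q1 (length w1) * (x + d + 1)) i' (p', q', bb p' q' (length w') * x + 1)"
      "conf k p' q'" "pre q' w'" "\<And>j. q' (length w' + j) = q1 (length w1 + j)"
    show thesis
    proof (rule Suc.prems(1)[OF 2(1) _ _ 2(4,5)])
      show "f i \<le> i'" using 1(2) play_le[OF 2(3)] by simp
      show "play h i (p, q, bb p q (length w) * (x + Suc d + 1)) i' (p', q', bb p' q' (length w') * x + 1)"
        using play_trans[OF 2(3)] st by simp
      show "q' (length w' + j) = q (length w + j)" for j using 2(6) 1(6) by simp
    qed
  qed
qed

lemma goodw_Nil: "2 \<le> k \<Longrightarrow> goodw k h h []"
proof (rule goodwI[of "\<lambda>w. w = []"])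
  fix w :: "nat list" assume w: "w = []"
  show "gstep k h h {w. w = []} w"
    unfolding gstep_def mem_Collect_eq
  proof (intro allI impI)
    fix i p q u assume c: "conf k p q"
    obtain i' where i': "h i \<le> i'"
      "play h i (p, q, p * (u + 1)) i' (max p (h i + 1), q, max p (h i + 1) * u + 1)"
      using play_raise[OF c] by blast
    show "\<exists>i' p' q' w'. w' = [] \<and> h i \<le> i' \<and>
      play h i (p, q, bb p q (length w) * (u + 1)) i' (p', q', bb p' q' (length w') * u + 1) \<and>
      conf k p' q' \<and> pre q' w' \<and> (\<forall>j. q' (length w' + j) = q (length w + j))"
      by (rule exI[of _ i'], rule exI[of _ "max p (h i + 1)"], rule exI[of _ q], rule exI[of _ "[]"])
        (use i' w c in \<open>auto simp: conf_def pre_def\<close>)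
  qed
qed simp

text \<open>A ratio 2 gives two rounds with \<open>w\<close>, hence \<open>f\<close> twice. For a
  ratio \<open>c + 3\<close>, one round frees the digit \<open>c + 2\<close>; unfolding inserts
  \<open>i\<close> ratios \<open>c + 2\<close>, and by the induction hypothesis the longer word
  guarantees \<open>(Phi c ^^ i) f\<close>. The ratio \<open>c + 3\<close> itself survives behind
  the altered word, so the invariant is restored.\<close>

lemma goodw_Phi:
  "goodw k h f v \<Longrightarrow> nice f \<Longrightarrow> c + 2 \<le> k \<Longrightarrow> goodw k h (Phi c f) (v @ [c + 2])"
proof (induction c arbitrary: f v)
  case 0
  show ?case
  proof (rule goodwI[of "\<lambda>w'. \<exists>w. w' = w @ [2] \<and> goodw k h f w"])
    show "\<exists>w. v @ [0 + 2] = w @ [2] \<and> goodw k h f w" using 0 by simp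
    fix w' assume "\<exists>w. w' = w @ [2] \<and> goodw k h f w"
    then obtain w where w: "w' = w @ [2]" "goodw k h f w" by blast
    show "gstep k h (Phi 0 f) {w'. \<exists>w. w' = w @ [2] \<and> goodw k h f w} w'"
      unfolding gstep_def mem_Collect_eq
    proof (intro allI impI)
      fix i p q u assume c: "conf k p q" and "pre q w'"
      then have p: "pre q w" "q (length w) = 2" unfolding w pre_snoc by auto
      obtain i1 p1 q1 w1 where 1: "goodw k h f w1" "f i \<le> i1"
        "play h i (p, q, bb p q (length w) * (2 * u + 1 + 1)) i1 (p1, q1, bb p1 q1 (length w1) * (2 * u + 1) + 1)"
        "conf k p1 q1" "pre q1 w1" "\<And>j. q1 (length w1 + j) = q (length w + j)"
        by (rule goodwE[OF w(2) c p(1), of i "2 * u + 1"]) (rule that)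
      note st = play_idle1[OF 1(3)]
      obtain i2 p2 q2 w2 where 2: "goodw k h f w2" "f (Suc i1) \<le> i2"
        "play h (Suc i1) (p1, q1, bb p1 q1 (length w1) * (2 * u + 1)) i2 (p2, q2, bb p2 q2 (length w2) * (2 * u) + 1)"
        "conf k p2 q2" "pre q2 w2" "\<And>j. q2 (length w2 + j) = q1 (length w1 + j)"
        by (rule goodwE[OF 1(1,4,5), of "Suc i1" "2 * u"]) (rule that)
      have q2: "q2 (length w2 + j) = q (length w + j)" for j using 1(6) 2(6) by simp
      have q20: "q2 (length w2) = 2" using q2[of 0] p(2) by simp
      have "play h i (p, q, bb p q (length w') * (u + 1)) i2 (p2, q2, bb p2 q2 (length (w2 @ [2])) * u + 1)"
        using play_trans[OF 2(3) st] p(2) q20 by (simp add: w bb_Suc algebra_simps)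
      moreover have "Phi 0 f i \<le> i2"
        using niceD(2)[OF 0(2), of "f i" "Suc i1"] 1(2) 2(2) by simp
      moreover have "q2 (length (w2 @ [2]) + j) = q (length w' + j)" for j
        using q2[of "Suc j"] by (simp add: w)
      moreover have "pre q2 (w2 @ [2])" using 2(5) q20 by (simp add: pre_snoc)
      ultimately show "\<exists>i' p' q' w''. (\<exists>w. w'' = w @ [2] \<and> goodw k h f w) \<and> Phi 0 f i \<le> i' \<and>
        play h i (p, q, bb p q (length w') * (u + 1)) i' (p', q', bb p' q' (length w'') * u + 1) \<and>
        conf k p' q' \<and> pre q' w'' \<and> (\<forall>j. q' (length w'' + j) = q (length w' + j))"
        using 2(1,4) by - (rule exI[of _ i2], rule exI[of _ p2], rule exI[of _ q2], rule exI[of _ "w2 @ [2]"], simp)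
    qed
  qed
next
  case (Suc c)
  note IH = Suc.IH
  have rep: "goodw k h ((Phi c ^^ m) f) (w @ replicate m (c + 2))" if g: "goodw k h f w" for m w
  proof (induction m)
    case (Suc m)
    have "goodw k h (Phi c ((Phi c ^^ m) f)) ((w @ replicate m (c + 2)) @ [c + 2])"
      by (rule IH[OF Suc nice_iter[OF \<open>nice f\<close>]]) (use \<open>Suc c + 2 \<le> k\<close> in simp)
    then show ?case by (simp add: replicate_append_same)
  qed (use g in simp)
  let ?a = "c + 3"
  show ?case
  proof (rule goodwI[of "\<lambda>w'. \<exists>w. w' = w @ [?a] \<and> goodw k h f w"])
    show "\<exists>w. v @ [Suc c + 2] = w @ [?a] \<and> goodw k h f w" using Suc.prems by simp
    fix w' assume "\<exists>w. w' = w @ [?a] \<and> goodw k h f w"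
    then obtain w where w: "w' = w @ [?a]" "goodw k h f w" by blast
    show "gstep k h (Phi (Suc c) f) {w'. \<exists>w. w' = w @ [?a] \<and> goodw k h f w} w'"
      unfolding gstep_def mem_Collect_eq
    proof (intro allI impI)
      fix i p q u assume cf: "conf k p q" and "pre q w'"
      then have p: "pre q w" "q (length w) = ?a" unfolding w pre_snoc by auto
      obtain i1 p1 q1 w1 where 1: "goodw k h f w1" "f i \<le> i1" "i \<le> i1"
        "play h i (p, q, bb p q (length w) * (?a * u + (c + 2) + 1)) i1 (p1, q1, bb p1 q1 (length w1) * (?a * u + (c + 2)) + 1)"
        "conf k p1 q1" "pre q1 w1" "\<And>j. q1 (length w1 + j) = q (length w + j)"
        by (rule goodwE[OF w(2) cf p(1), of i "?a * u + (c + 2)"]) (rule that)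
      have q1: "q1 (length w1) = ?a" using 1(7)[of 0] p(2) by simp
      \<comment> \<open>\<open>i\<close> insertions are allowed at time \<open>i1\<close> since
        \<open>i \<le> i1\<close>.\<close>
      let ?q = "ins q1 (length w1) i" and ?w = "w1 @ replicate i (c + 2)"
      have st: "play h i (p, q, bb p q (length w) * (?a * u + (c + 2) + 1)) (Suc i1) (p1, ?q, bb p1 ?q (length ?w) * (?a * u + (c + 1) + 1))"
        using play_Suc[OF 1(4)] pstep_expand[OF 1(5), of "length w1" "c + 2" i i1 h u] q1 1(3) by simp
      have cf2: "conf k p1 ?q" using q1 by (intro conf_ins[OF 1(5)]) auto
      have pre2: "pre ?q ?w"
        using 1(6) q1 by (auto simp: pre_def nth_append ins_def)
      have tl2: "?q (length ?w + j) = q (length w + j)" for j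
        using 1(7)[of j] by (simp add: ins_def)
      obtain i3 p3 q3 w3 where 3: "goodw k h ((Phi c ^^ i) f) w3" "(Phi c ^^ i) f (Suc i1) \<le> i3"
        "play h (Suc i1) (p1, ?q, bb p1 ?q (length ?w) * (?a * u + (c + 1) + 1)) i3 (p3, q3, bb p3 q3 (length w3) * (?a * u) + 1)"
        "conf k p3 q3" "pre q3 w3" "\<And>j. q3 (length w3 + j) = ?q (length ?w + j)"
        by (rule consume[OF rep[OF 1(1), of i] cf2 pre2, of "Suc i1" "?a * u" "c + 1"]) (rule that)
      have g3: "goodw k h f w3"
        by (rule goodw_le[OF 3(1)]) (use iter_inc[OF \<open>nice f\<close>, of 0 i c] in simp)
      have q3: "q3 (length w3 + j) = q (length w + j)" for j using 3(6) tl2 by simp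
      have q30: "q3 (length w3) = ?a" using q3[of 0] p(2) by simp
      have "play h i (p, q, bb p q (length w') * (u + 1)) i3 (p3, q3, bb p3 q3 (length (w3 @ [?a])) * u + 1)"
        using play_trans[OF 3(3) st] p(2) q30 by (simp add: w bb_Suc algebra_simps)
      moreover have "Phi (Suc c) f i \<le> i3"
        using niceD(2)[OF nice_iter[OF \<open>nice f\<close>, of i c], of i "Suc i1"] 1(3) 3(2) by simp
      moreover have "q3 (length (w3 @ [?a]) + j) = q (length w' + j)" for j
        using q3[of "Suc j"] by (simp add: w)
      moreover have "pre q3 (w3 @ [?a])" using 3(5) q30 by (simp add: pre_snoc)
      ultimately show "\<exists>i' p' q' w''. (\<exists>w. w'' = w @ [?a] \<and> goodw k h f w) \<and> Phi (Suc c) f i \<le> i' \<and>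
        play h i (p, q, bb p q (length w') * (u + 1)) i' (p', q', bb p' q' (length w'') * u + 1) \<and>
        conf k p' q' \<and> pre q' w'' \<and> (\<forall>j. q' (length w'' + j) = q (length w' + j))"
        using g3 3(4) by - (rule exI[of _ i3], rule exI[of _ p3], rule exI[of _ q3], rule exI[of _ "w3 @ [?a]"], simp)
    qed
  qed
qed

lemma play_seq: "play h i s i' s' \<Longrightarrow>
  \<exists>S. S i = s \<and> S i' = s' \<and> (\<forall>j. i \<le> j \<longrightarrow> j < i' \<longrightarrow> pstep h j (S j) (S (Suc j)))"
proof (induction rule: play.induct)
  case play_0
  then show ?case by (intro exI[of _ "\<lambda>_. s"]) auto
next
  case (play_Suc j t t')
  then obtain S where S: "S i = s" "S j = t" "\<forall>l. i \<le> l \<longrightarrow> l < j \<longrightarrow> pstep h l (S l) (S (Suc l))" by blast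
  have "i \<le> j" by (rule play_le[OF play_Suc(1)])
  then show ?case using S play_Suc(2) by (intro exI[of _ "S(Suc j := t')"]) (auto simp: less_Suc_eq)
qed

text \<open>The ratio 2 contributes \<open>Phi 0\<close>, the next ratio \<open>k = c + 2\<close>
  contributes \<open>Phi c\<close>. The summand \<open>k - 1\<close> of the starting value is idled
  away, so that the play proper begins at time \<open>k - 1\<close>. After time \<open>T\<close> the
  hierarchies are frozen.\<close>

theorem long_run:
  fixes c :: nat
  assumes h: "nice h"
  defines "k \<equiv> c + 2"
  shows "\<exists>P Q J M r T. P 0 = k \<and> (\<forall>i. conf k (P i) (Q i) \<and> P i \<le> P (Suc i) \<and> P (Suc i) \<le> max (P i) (h i + 1) \<and>
     M i \<le> i \<and> (M i = 0 \<or> 3 \<le> Q i (J i)) \<and> Q (Suc i) = ins (Q i) (J i) (M i)) \<and>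
     r 0 = k * 2 * k + (k - 1) \<and> (\<forall>i\<le>T. 0 < r i) \<and>
     (\<forall>i<T. r (Suc i) + 1 = gup (P i) (Q i) (P (Suc i)) (J i) (M i) (r i)) \<and>
     Phi c (Phi 0 h) (k - 1) \<le> T"
proof -
  let ?q = "\<lambda>j. if j = 0 then 2 else k"
  have k: "2 \<le> k" by (simp add: k_def)
  have "goodw k h (Phi 0 h) ([] @ [0 + 2])" by (rule goodw_Phi[OF goodw_Nil[OF k] h]) (use k in simp)
  from goodw_Phi[OF this nice_Phi[OF h], of c]
  have g: "goodw k h (Phi c (Phi 0 h)) [2, k]" by (simp add: k_def numeral_2_eq_2)
  have cf: "conf k k ?q" using k by (auto simp: conf_def)
  have pr: "pre ?q [2, k]" by (auto simp: pre_def nth_Cons split: nat.split)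
  have "\<exists>T p' q' (w'::nat list). Phi c (Phi 0 h) (k - 1) \<le> T \<and>
    play h (k - 1) (k, ?q, bb k ?q (length [2, k]) * (0 + 1)) T (p', q', bb p' q' (length w') * 0 + 1)"
    by (rule goodwE[OF g cf pr, of "k - 1" 0]) (intro exI conjI)
  then obtain T p' q' and w' :: "nat list" where T: "Phi c (Phi 0 h) (k - 1) \<le> T"
    "play h (k - 1) (k, ?q, bb k ?q (length [2, k]) * (0 + 1)) T (p', q', bb p' q' (length w') * 0 + 1)"
    by (elim exE conjE)
  have "bb k ?q (length [2, k]) = k * 2 * k" by (simp add: bb_Suc)
  with T(2) have "play h (k - 1) (k, ?q, k * 2 * k) T (p', q', 1)" by simp
  from play_trans[OF this] have "play h 0 (k, ?q, k * 2 * k + (k - 1)) T (p', q', 1)"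
    using play_idle[of h 0 k ?q "k * 2 * k" "k - 1"] by simp
  from play_seq[OF this] obtain S where
    S: "S 0 = (k, ?q, k * 2 * k + (k - 1))" "S T = (p', q', 1)" "\<And>j. j < T \<Longrightarrow> pstep h j (S j) (S (Suc j))" by auto
  define P where "P i = fst (S (min i T))" for i
  define Q where "Q i = fst (snd (S (min i T)))" for i
  define r where "r i = snd (snd (S (min i T)))" for i
  have "\<exists>J M. P i \<le> P (Suc i) \<and> P (Suc i) \<le> max (P i) (h i + 1) \<and>
     M \<le> i \<and> (M = 0 \<or> 3 \<le> Q i J) \<and> Q (Suc i) = ins (Q i) J M \<and>
     (i < T \<longrightarrow> 0 < r i \<and> r (Suc i) + 1 = gup (P i) (Q i) (P (Suc i)) J M (r i))" for i
  proof (cases "i < T")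
    case True
    have "S i = (P i, Q i, r i)" "S (Suc i) = (P (Suc i), Q (Suc i), r (Suc i))"
      using True by (simp_all add: P_def Q_def r_def)
    then show ?thesis using S(3)[OF True] by (simp only: pstep.simps) blast
  next
    case False
    then have "P (Suc i) = P i" "Q (Suc i) = Q i" by (simp_all add: P_def Q_def)
    then show ?thesis using False by (intro exI[of _ 0]) simp
  qed
  then obtain J M where JM: "\<And>i. P i \<le> P (Suc i) \<and> P (Suc i) \<le> max (P i) (h i + 1) \<and>
     M i \<le> i \<and> (M i = 0 \<or> 3 \<le> Q i (J i)) \<and> Q (Suc i) = ins (Q i) (J i) (M i) \<and>
     (i < T \<longrightarrow> 0 < r i \<and> r (Suc i) + 1 = gup (P i) (Q i) (P (Suc i)) (J i) (M i) (r i))" by metis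
  have "conf k (P i) (Q i)" for i
  proof (induction i)
    case 0
    then show ?case using cf S(1) by (simp add: P_def Q_def)
  next
    case (Suc i)
    then show ?case using conf_ins[OF Suc] JM[of i] by simp
  qed
  moreover have "P 0 = k" "r 0 = k * 2 * k + (k - 1)" "r T = 1" using S by (simp_all add: P_def r_def)
  ultimately show ?thesis
    using JM T(1)
    by - (rule exI[of _ P], rule exI[of _ Q], rule exI[of _ J], rule exI[of _ M], rule exI[of _ r],
        rule exI[of _ T], auto simp: le_less)
qed

section \<open>The hierarchies of the independence proof\<close>

interpretation NR: rca "UNIV :: nat set set"
  by unfold_locales (use valid_nat in auto)

section \<open>Pairs and codes of sequences in the natural numbers\<close>

lemma pair_inj:
  assumes "(x + i) * (x + i) + x = (y + j) * (y + j) + (y :: nat)"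
  shows "x = y \<and> i = j"
proof -
  have *: "(a + k) * (a + k) + a < (b + l) * (b + l) + b" if "a + k < b + l" for a b k l :: nat
  proof -
    have "Suc (a + k) * Suc (a + k) \<le> (b + l) * (b + l)" using that by (intro mult_le_mono) auto
    then show ?thesis by simp
  qed
  have "x + i = y + j" using *[of x i y j] *[of y j x i] assms by (metis linorder_neqE_nat nat_less_le)
  then show ?thesis using assms by simp
qed

definition pr :: "nat \<Rightarrow> nat \<Rightarrow> nat" where "pr x i = (x + i) * (x + i) + x"
definition pr1 :: "nat \<Rightarrow> nat" where "pr1 z = (THE x. \<exists>i. z = pr x i)"
definition pr2 :: "nat \<Rightarrow> nat" where "pr2 z = (THE i. \<exists>x. z = pr x i)"

lemma pr1 [simp]: "pr1 (pr x i) = x"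
  unfolding pr1_def by (rule the_equality) (auto simp: pr_def dest: pair_inj)

lemma pr2 [simp]: "pr2 (pr x i) = i"
  unfolding pr2_def by (rule the_equality) (auto simp: pr_def dest: pair_inj)

definition en :: "nat \<Rightarrow> nat \<Rightarrow> nat \<Rightarrow> nat" where
  "en a d i = a mod (1 + (i + 1) * d)"

lemma sentry_en: "sentry a d i v \<longleftrightarrow> v = en a d i"
proof
  assume "v = en a d i"
  moreover have "a = a div (1 + (i + 1) * d) * (1 + (i + 1) * d) + en a d i" by (simp only: en_def div_mult_mod_eq)
  moreover have "en a d i < 1 + (i + 1) * d" unfolding en_def by (intro mod_less_divisor) simp
  ultimately show "sentry a d i v" unfolding sentry_def by blast
next
  assume "sentry a d i v"
  then obtain q where q: "v < 1 + (i + 1) * d" "a = q * (1 + (i + 1) * d) + v" unfolding sentry_def by blast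
  show "v = en a d i" unfolding en_def q(2) mod_mult_self3 using q(1) by simp
qed

text \<open>With all sets of numbers available, every graph is \<Delta>0 in a set parameter, and the
  internal coding lemma applies to arbitrary functions.\<close>

lemma beta_nat:
  fixes f :: "nat \<Rightarrow> nat"
  shows "\<exists>a d. \<forall>i\<le>n. en a d i = f i"
proof -
  have ent: "NR.ent a d i = en a d i" for a d i
    using NR.sentry_iff[of a d i "NR.ent a d i"] by (simp add: sentry_en)
  let ?S = "{pr i v |i v. v = f i}"
  have iff: "pr i v \<in> ?S \<longleftrightarrow> v = f i" for i v by (auto simp: pr_def dest: pair_inj)
  have "NR.S1 (\<lambda>e. (e 0 + e (Suc 0)) * (e 0 + e (Suc 0)) + e 0 \<in> ?S)"
    by (intro NR.S1_D0 NR.D0_mem NR.Tm_add NR.Tm_mult NR.Tm_var) simp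
  then have S: "NR.S1 (\<lambda>e. pr (e 0) (e (Suc 0)) \<in> ?S)" unfolding pr_def .
  have "\<exists>a d. \<forall>i\<le>n. pr i (en a d i) \<in> ?S"
    unfolding ent[symmetric] by (rule NR.beta[OF S]) (auto simp: iff)
  then show ?thesis unfolding iff .
qed

text \<open>There are finitely many sequences of length \<open>y + 1\<close> with entries up to
  \<open>y\<close>, so a single bound serves for codes of all of them.\<close>

definition Kbeta :: "nat \<Rightarrow> nat" where
  "Kbeta y = (LEAST K. \<forall>f :: nat \<Rightarrow> nat. (\<forall>i\<le>y. f i \<le> y) \<longrightarrow> (\<exists>a\<le>K. \<exists>d\<le>K. \<forall>i\<le>y. en a d i = f i))"

lemma Kbeta: "(\<And>i. i \<le> y \<Longrightarrow> f i \<le> y) \<Longrightarrow> \<exists>a\<le>Kbeta y. \<exists>d\<le>Kbeta y. \<forall>i\<le>y. en a d i = f i"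
proof -
  assume f: "\<And>i. i \<le> y \<Longrightarrow> f i \<le> y"
  let ?F = "{f. \<forall>i. (i \<in> {..y} \<longrightarrow> f i \<in> {..y}) \<and> (i \<notin> {..y} \<longrightarrow> f i = (0::nat))}"
  have fin: "finite ?F" by (rule finite_set_of_finite_funs) auto
  obtain A D where AD: "\<And>f :: nat \<Rightarrow> nat. \<forall>i\<le>y. en (A f) (D f) i = f i" using beta_nat[of y] by metis
  let ?K = "Max (A ` ?F) + Max (D ` ?F)"
  have "\<exists>a\<le>?K. \<exists>d\<le>?K. \<forall>i\<le>y. en a d i = f i" if "\<forall>i\<le>y. f i \<le> y" for f :: "nat \<Rightarrow> nat"
  proof -
    let ?f = "\<lambda>i. if i \<le> y then f i else 0"
    have "?f \<in> ?F" using that by auto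
    then have "A ?f \<le> Max (A ` ?F)" "D ?f \<le> Max (D ` ?F)" using fin by (auto intro: Max_ge)
    then have "A ?f \<le> ?K" "D ?f \<le> ?K" by linarith+
    moreover have "\<forall>i\<le>y. en (A ?f) (D ?f) i = f i" using AD[of ?f] by simp
    ultimately show ?thesis by blast
  qed
  then have "\<forall>f :: nat \<Rightarrow> nat. (\<forall>i\<le>y. f i \<le> y) \<longrightarrow> (\<exists>a\<le>?K. \<exists>d\<le>?K. \<forall>i\<le>y. en a d i = f i)" by blast
  from LeastI[of "\<lambda>K. \<forall>f :: nat \<Rightarrow> nat. (\<forall>i\<le>y. f i \<le> y) \<longrightarrow> (\<exists>a\<le>K. \<exists>d\<le>K. \<forall>i\<le>y. en a d i = f i)", OF this]
  show ?thesis using f unfolding Kbeta_def by blast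
qed

text \<open>A common bound for codes of sequences, for values of upgrades (cf. \<open>g_le\<close>) and for pairs; a cut
  closed under \<open>hf\<close> is therefore closed under upgrades and contains codes of their graphs.\<close>

definition hf :: "nat \<Rightarrow> nat" where
  "hf y = (\<Sum>x\<le>y. Kbeta x + x * (x + x + 1) * x ^ x + (x + x) * (x + x) + 3 * x + 3)"

lemma hf_ge: "Kbeta y + y * (y + y + 1) * y ^ y + (y + y) * (y + y) + 3 * y + 3 \<le> hf y"
  unfolding hf_def by (rule member_le_sum) auto

lemma nice_hf: "nice hf"
proof (rule niceI)
  show "x < hf x" for x using hf_ge[of x] by linarith
  show "hf x \<le> hf y" if "x \<le> y" for x y unfolding hf_def using that by (intro sum_mono2) auto
qed

lemma hf_mono: "x \<le> y \<Longrightarrow> hf x \<le> hf y"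
  by (rule niceD(2)[OF nice_hf])

lemma hf_add: "x \<le> z \<Longrightarrow> y \<le> z \<Longrightarrow> x + y + 1 \<le> hf z"
  using hf_ge[of z] by linarith

lemma hf_mult: "x \<le> z \<Longrightarrow> y \<le> z \<Longrightarrow> x * y \<le> hf z"
proof -
  assume "x \<le> z" "y \<le> z"
  then have "x * y \<le> (z + z) * (z + z)" by (intro mult_le_mono) auto
  then show ?thesis using hf_ge[of z] by linarith
qed

lemma hf_pr: "x \<le> z \<Longrightarrow> y \<le> z \<Longrightarrow> pr x y \<le> hf z"
proof -
  assume "x \<le> z" "y \<le> z"
  then have "(x + y) * (x + y) \<le> (z + z) * (z + z)" "x \<le> z" by (auto intro!: mult_le_mono)
  then show ?thesis using hf_ge[of z] unfolding pr_def by linarith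
qed

text \<open>The witness \<open>c\<close> is bounded by \<open>g m\<close>, which makes the clause a
  bounded statement and thus transferable to the ultraproduct; the bound holds because leading
  digits are positive.\<close>

definition stepgb :: "'a::linordered_semidom set \<Rightarrow> 'a set \<Rightarrow> ('a \<Rightarrow> 'a) \<Rightarrow> 'a \<Rightarrow> bool" where
  "stepgb B C g m \<longleftrightarrow> ((\<forall>x\<le>m. x \<notin> B) \<longrightarrow> g m = m) \<and>
     (\<forall>b\<le>m. \<forall>f\<le>m. \<forall>r\<le>m. \<forall>m'\<le>m. bs B m b \<and> m = b * f + r \<and> r < b \<and> m' + 1 = m \<longrightarrow>
       (\<exists>c\<le>g m. least_adm C (g m') (g f) (g r) c \<and> g m = c * g f + g r))"

text \<open>What is to be transferred from a factor of the ultraproduct, stated pointwise or with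
  bounded quantifiers. The factor \<open>(k + hf i + 1) * k ^ i\<close> stems from a raised least
  base and at most \<open>i\<close> inserted ratios.\<close>

definition world :: "nat \<Rightarrow> nat set \<Rightarrow> (nat \<Rightarrow> nat) \<Rightarrow> (nat \<Rightarrow> nat \<Rightarrow> nat) \<Rightarrow> (nat \<Rightarrow> nat) \<Rightarrow> nat \<Rightarrow> bool" where
  "world k X P g r T \<longleftrightarrow>
    (\<forall>i. smin (mb X i) (P i) \<and> P i \<le> P (i + 1) \<and> P i \<le> k + hf i + 1 \<and>
      (\<forall>b\<in>mb X i. 2 \<le> b \<and> k \<le> b \<and> (\<exists>s\<le>b * k. sS (mb X i) b s \<and> (\<exists>z\<le>s. s = b * z))) \<and>
      (\<forall>m. stepgb (mb X i) (mb X (i + 1)) (g i) m \<and> g i m \<le> m * ((k + hf i + 1) * k ^ i)) \<and>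
      (\<forall>b c z. b + 1 \<in> mb X i \<and> P i < b + 1 \<longrightarrow> P (i + 1) \<le> g i b \<and>
        (bs (mb X (i + 1)) (g i b) c \<and> g i b < c * z \<longrightarrow> \<not> slessS (c * z) (mb X (i + 1)) (g i b)))) \<and>
    P 0 = k \<and> r 0 = k * 2 * k + (k - 1) \<and> (\<forall>i\<le>T. 0 < r i) \<and> (\<forall>i<T. r (i + 1) + 1 = g i (r i))"

lemma stepgb_of_stepg:
  fixes g :: "nat \<Rightarrow> nat"
  assumes s: "stepg B C g m" and mono: "\<And>x y. x < y \<Longrightarrow> g x < g y"
  shows "stepgb B C g m"
proof -
  have ge: "x \<le> g x" for x
  proof (induction x)
    case (Suc x)
    then show ?case using mono[of x "Suc x"] by simp
  qed simp
  have "\<exists>c\<le>g m. least_adm C (g m') (g f) (g r) c \<and> g m = c * g f + g r"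
    if a: "b \<le> m" "f \<le> m" "r \<le> m" "m' \<le> m" "bs B m b \<and> m = b * f + r \<and> r < b \<and> m' + 1 = m" for b f r m'
  proof -
    obtain c where c: "least_adm C (g m') (g f) (g r) c" "g m = c * g f + g r"
      using stepgD[OF s, of b f r m'] a by blast
    have "f \<noteq> 0"
    proof
      assume "f = 0"
      then have "m < b" using a by simp
      then show False using a(1) by simp
    qed
    then have "1 \<le> g f" using ge[of f] by simp
    then have "c * 1 \<le> c * g f" by (intro mult_left_mono) auto
    then have "c \<le> g m" using c(2) by linarith
    then show ?thesis using c by blast
  qed
  moreover have "(\<forall>x\<le>m. x \<notin> B) \<longrightarrow> g m = m" using s unfolding stepg_def by (rule conjunct1)
  ultimately show ?thesis unfolding stepgb_def by blast
qed

text \<open>Up to \<open>M\<close> inserted ratios, each at most \<open>k\<close>, contribute at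
  most \<open>k ^ M\<close>; the change of the least base contributes at most
  \<open>p'\<close>.\<close>

lemma bb_ins_le:
  assumes q: "\<And>j. q j \<le> k" and k: "1 \<le> k" and M: "M = 0 \<or> 3 \<le> q J" and p: "1 \<le> p"
  shows "bb p' (ins q J M) (tau q J M j d) \<le> bb p q j * (p' * k ^ M)"
proof -
  have k1: "1 \<le> k ^ M" using k by simp
  have low: "(\<Prod>l<j. ins q J M l) = (\<Prod>l<j. q l)" if "j \<le> J" for j
    using that by (intro prod.cong) (auto simp: ins_def)
  have mid: "(\<Prod>l<J + m. ins q J M l) \<le> (\<Prod>l<J. q l) * k ^ m" if "m \<le> M" for m using that
  proof (induction m)
    case (Suc m)
    have "ins q J M (J + m) \<le> k" using Suc.prems q[of J] by (simp add: ins_def)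
    then have "(\<Prod>l<J + m. ins q J M l) * ins q J M (J + m) \<le> (\<Prod>l<J. q l) * k ^ m * k"
      using Suc by (intro mult_le_mono) auto
    then show ?case by (simp add: ac_simps)
  qed (simp add: low)
  have high: "(\<Prod>l<j + M. ins q J M l) \<le> (\<Prod>l<j. q l) * k ^ M" if "J \<le> j" for j using that
  proof (induction rule: dec_induct)
    case (step j)
    have "ins q J M (j + M) = q j" using step(1) by (simp add: ins_def)
    then show ?case using step(3) by (simp add: ac_simps)
  qed (use mid[of M] in simp)
  have "(\<Prod>l<tau q J M j d. ins q J M l) \<le> (\<Prod>l<j. q l) * k ^ M"
  proof (cases "j \<le> J \<and> tau q J M j d = j")
    case True
    then have "(\<Prod>l<tau q J M j d. ins q J M l) = (\<Prod>l<j. q l) * 1" using low[of j] by simp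
    also have "\<dots> \<le> (\<Prod>l<j. q l) * k ^ M" using k1 by (intro mult_left_mono) auto
    finally show ?thesis .
  next
    case False
    then have "tau q J M j d = j + M \<and> J \<le> j" by (auto simp: tau_def split: if_splits)
    then show ?thesis using high by simp
  qed
  then have "p' * (\<Prod>l<tau q J M j d. ins q J M l) \<le> p * (p' * ((\<Prod>l<j. q l) * k ^ M))"
    using p by (simp add: mult_le_mono trans_le_add1 le_trans[OF _ mult_le_mono1[OF p]])
  then show ?thesis by (simp add: bb_def ac_simps)
qed

theorem world_exists:
  fixes c :: nat
  defines "k \<equiv> c + 2"
  shows "\<exists>X P g r T. world k X P g r T \<and> Phi c (Phi 0 hf) (k - 1) \<le> T"
proof -
  obtain P Q J M r T where run: "P 0 = k"
    and st': "\<forall>i. conf k (P i) (Q i) \<and> P i \<le> P (Suc i) \<and> P (Suc i) \<le> max (P i) (hf i + 1) \<and>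
     M i \<le> i \<and> (M i = 0 \<or> 3 \<le> Q i (J i)) \<and> Q (Suc i) = ins (Q i) (J i) (M i)"
    and r: "r 0 = k * 2 * k + (k - 1)" "\<forall>i\<le>T. 0 < r i"
     "\<forall>i<T. r (Suc i) + 1 = gup (P i) (Q i) (P (Suc i)) (J i) (M i) (r i)"
     "Phi c (Phi 0 hf) (k - 1) \<le> T"
    using long_run[OF nice_hf, of c] unfolding k_def[symmetric] by (elim exE conjE) (rule that)
  note st = spec[OF st']
  define g where "g i = gup (P i) (Q i) (P (Suc i)) (J i) (M i)" for i
  define X where "X = {pr x i |x i. x \<in> range (bb (P i) (Q i))}"
  have mb: "mb X i = range (bb (P i) (Q i))" for i
    unfolding mb_def X_def by (auto simp: pr_def dest!: pair_inj)
  have P: "P i \<le> k + hf i + 1 \<and> P (Suc i) \<le> k + hf i + 1" for i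
  proof (induction i)
    case (Suc i)
    then show ?case using st[of "Suc i"] hf_mono[of i "Suc i"] by auto
  qed (use run st[of 0] in auto)
  have "smin (mb X i) (P i) \<and> P i \<le> P (i + 1) \<and> P i \<le> k + hf i + 1 \<and>
      (\<forall>b\<in>mb X i. 2 \<le> b \<and> k \<le> b \<and> (\<exists>s\<le>b * k. sS (mb X i) b s \<and> (\<exists>z\<le>s. s = b * z))) \<and>
      (\<forall>m. stepgb (mb X i) (mb X (i + 1)) (g i) m \<and> g i m \<le> m * ((k + hf i + 1) * k ^ i)) \<and>
      (\<forall>b c z. b + 1 \<in> mb X i \<and> P i < b + 1 \<longrightarrow> P (i + 1) \<le> g i b \<and>
        (bs (mb X (i + 1)) (g i b) c \<and> g i b < c * z \<longrightarrow> \<not> slessS (c * z) (mb X (i + 1)) (g i b)))" for i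
  proof -
    let ?b = "bb (P i) (Q i)" and ?c = "bb (P (Suc i)) (Q (Suc i))"
    have cf: "conf k (P i) (Q i)" and QS: "Q (Suc i) = ins (Q i) (J i) (M i)" and M: "M i \<le> i" "M i = 0 \<or> 3 \<le> Q i (J i)"
      and PS: "P i \<le> P (Suc i)" using st[of i] by auto
    have q: "Q i j \<le> k" "2 \<le> k" "k \<le> P i" for j using cf by (auto simp: conf_def)
    interpret F: frame ?b ?c "Q i" "Q (Suc i)" "tau (Q i) (J i) (M i)"
      unfolding QS by (rule frame_move[OF cf PS M(2)])
    have gi: "g i = F.g" by (simp add: g_def gup_def QS)
    have min: "smin (range ?b) (P i)" unfolding smin_def using F.b_mono[of 0] by (auto intro: range_eqI[of _ _ 0])
    have minc: "smin (range ?c) (P (Suc i))" unfolding smin_def using F.c_mono[of 0] by (auto intro: range_eqI[of _ _ 0])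
    have bk: "k \<le> ?b j" for j using F.b_mono[of 0 j] q by simp
    have sS: "sS (range ?b) (?b j) (?b (Suc j))" for j
    proof -
      have "?b (Suc j) \<le> ?b u" if "?b j < ?b u" for u
        using that F.b_mono[of u j] F.b_mono[of "Suc j" u] by (cases "u \<le> j") auto
      then show ?thesis unfolding sS_def using F.b_lt[of j] by auto
    qed
    have 1: "\<exists>s\<le>?b j * k. sS (range ?b) (?b j) s \<and> (\<exists>z\<le>s. s = ?b j * z)" for j
    proof -
      have "?b (Suc j) \<le> ?b j * k" unfolding bb_Suc by (intro mult_left_mono q) simp
      moreover have "Q i j \<le> ?b (Suc j)" unfolding bb_Suc using F.b_pos[of j] by simp
      ultimately show ?thesis using sS[of j] bb_Suc[of "P i" "Q i" j] by blast
    qed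
    have 2: "stepgb (range ?b) (range ?c) (g i) m" for m
      unfolding gi by (rule stepgb_of_stepg[OF F.stepg_g F.g_smono])
    have 3: "g i m \<le> m * ((k + hf i + 1) * k ^ i)" for m
      unfolding gi
    proof (rule F.g_le)
      have "1 * 1 \<le> (k + hf i + 1) * k ^ i" using q by (intro mult_le_mono) auto
      then show "1 \<le> (k + hf i + 1) * k ^ i" by linarith
      fix j d
      have "?c (tau (Q i) (J i) (M i) j d) \<le> ?b j * (P (Suc i) * k ^ M i)"
        unfolding QS using q by (intro bb_ins_le M) (auto intro: order_trans[rotated])
      also have "\<dots> \<le> ?b j * ((k + hf i + 1) * k ^ i)"
        using P[of i] M q by (intro mult_le_mono power_increasing) auto
      finally show "?c (tau (Q i) (J i) (M i) j d) \<le> ?b j * ((k + hf i + 1) * k ^ i)" .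
    qed
    have 4: "P (Suc i) \<le> g i b \<and> (bs (range ?c) (g i b) c \<and> g i b < c * z \<longrightarrow> \<not> slessS (c * z) (range ?c) (g i b))"
      if b: "b + 1 \<in> range ?b" "P i < b + 1" for b c z
    proof -
      obtain j where j: "b + 1 = ?b j" using b(1) by blast
      have "j \<noteq> 0" using j b(2) by (cases j) auto
      then obtain j' where "j = Suc j'" using not0_implies_Suc by blast
      then have j': "b = ?b (Suc j') - 1" using j by (metis add_diff_cancel_right')
      have up: "P (Suc i) \<le> g i b"
        unfolding gi j' using F.c_last[of j'] F.c_mono[of 0] by (auto intro: order_trans)
      have "\<not> slessS (c * z) (range ?c) (g i b)" if c: "bs (range ?c) (g i b) c" "g i b < c * z"
      proof
        assume s: "slessS (c * z) (range ?c) (g i b)"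
        have "sbase (range ?c) (g i b) c"
          using NR.sbase_iff[OF minc up] c(1) by blast
        from F.good_gap[OF this[unfolded gi j']] show False using s c(2) unfolding gi j' by blast
      qed
      then show ?thesis using up by blast
    qed
    show ?thesis unfolding mb Suc_eq_plus1[symmetric] using min P[of i] PS bk q(2) 1 2 3 4
      by (intro conjI allI impI ballI) (auto intro: order_trans)
  qed
  then have "world k X P g r T"
    unfolding world_def using run r by (simp add: g_def)
  then show ?thesis using r(4) by blast
qed

section \<open>Cuts in an ultraproduct\<close>

text \<open>A minimal proper filter below \<open>sequentially\<close>, from Zorn's lemma:
  intersected with \<open>P\<close> it either stays the same or becomes improper, in which case it
  contains the complement of \<open>P\<close>.\<close>

lemma ultrafilter_exists:
  "\<exists>U. U \<le> sequentially \<and> U \<noteq> bot \<and> (\<forall>P. eventually P U \<or> eventually (\<lambda>n. \<not> P n) U)"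
proof -
  let ?A = "{F :: nat filter. F \<le> sequentially \<and> F \<noteq> bot}"
  let ?P = "\<lambda>F G :: nat filter. G \<le> F"
  have "\<exists>m\<in>?A. \<forall>a\<in>?A. ?P m a \<longrightarrow> a = m"
  proof (rule predicate_Zorn)
    show "partial_order_on ?A (relation_of ?P ?A)"
      by (rule partial_order_on_relation_ofI) auto
    fix C assume C: "C \<in> Chains (relation_of ?P ?A)"
    have CA: "C \<subseteq> ?A" and ch: "\<And>F G. F \<in> C \<Longrightarrow> G \<in> C \<Longrightarrow> F \<le> G \<or> G \<le> F"
      using C unfolding Chains_def relation_of_def by auto
    show "\<exists>u\<in>?A. \<forall>a\<in>C. u \<le> a"
    proof (cases "C = {}")
      case True
      then show ?thesis by (intro bexI[of _ sequentially]) auto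
    next
      case False
      have "\<exists>x\<in>C. x \<le> inf F G" if "F \<in> C" "G \<in> C" for F G
        using ch[OF that] that by (metis inf.absorb1 inf.absorb2 order_refl)
      from eventually_Inf_base[OF False this] have "Inf C \<noteq> bot"
        using CA unfolding trivial_limit_def by blast
      moreover have "Inf C \<le> sequentially" using False CA by (auto intro: Inf_lower2)
      ultimately show ?thesis by (intro bexI[of _ "Inf C"]) (auto intro: Inf_lower)
    qed
  qed
  then obtain U where U: "U \<le> sequentially" "U \<noteq> bot"
    and max: "\<And>F. F \<le> sequentially \<Longrightarrow> F \<noteq> bot \<Longrightarrow> F \<le> U \<Longrightarrow> F = U" by auto
  have "eventually P U \<or> eventually (\<lambda>n. \<not> P n) U" for P
  proof (cases "inf U (principal {n. P n}) = bot")
    case True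
    then have "eventually (\<lambda>n. False) (inf U (principal {n. P n}))" by simp
    then show ?thesis by (simp add: eventually_inf_principal)
  next
    case False
    then have "inf U (principal {n. P n}) = U" using U(1) by (intro max) (auto intro: le_infI1)
    moreover have "eventually P (inf U (principal {n. P n}))" by (simp add: eventually_inf_principal)
    ultimately show ?thesis by simp
  qed
  then show ?thesis using U by blast
qed

definition UF :: "nat filter" where
  "UF = (SOME U. U \<le> sequentially \<and> U \<noteq> bot \<and> (\<forall>P. eventually P U \<or> eventually (\<lambda>n. \<not> P n) U))"

abbreviation alm :: "(nat \<Rightarrow> bool) \<Rightarrow> bool" where "alm P \<equiv> eventually P UF"

lemma UF: "UF \<le> sequentially" "UF \<noteq> bot" "alm P \<or> alm (\<lambda>n. \<not> P n)"
  using someI_ex[OF ultrafilter_exists, folded UF_def] by blast+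

lemma alm_not: "alm (\<lambda>n. \<not> P n) \<longleftrightarrow> \<not> alm P"
proof -
  have False if "alm P" "alm (\<lambda>n. \<not> P n)"
  proof -
    have "alm (\<lambda>n. False)" using that by eventually_elim blast
    then show False using UF(2) by (simp add: eventually_False)
  qed
  then show ?thesis using UF(3) by blast
qed

lemma alm_const [simp]: "alm (\<lambda>n. P) \<longleftrightarrow> P"
  by (simp add: UF(2))

lemma alm_imp: "alm (\<lambda>n. P n \<longrightarrow> Q n) \<longleftrightarrow> (alm P \<longrightarrow> alm Q)"
proof
  show "alm (\<lambda>n. P n \<longrightarrow> Q n)" if "alm P \<longrightarrow> alm Q"
  proof (cases "alm P")
    case True
    then have "alm Q" using that by blast
    then show ?thesis by eventually_elim blast
  next
    case False
    then have "alm (\<lambda>n. \<not> P n)" by (simp add: alm_not)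
    then show ?thesis by eventually_elim blast
  qed
qed (metis eventually_mp)

lemma alm_disj: "alm (\<lambda>n. P n \<or> Q n) \<longleftrightarrow> alm P \<or> alm Q"
  using alm_imp[of "\<lambda>n. \<not> P n" Q] by (simp add: alm_not disj_imp)

lemma alm_ge: "alm (\<lambda>n. m \<le> n)"
  using UF(1) eventually_ge_at_top[of m] unfolding le_filter_def by blast

text \<open>The \<open>n\<close>-th factor of the ultraproduct carries a hierarchy for \<open>k = 2 n + 3\<close> and a Goodstein run of
  length at least \<open>wb n\<close>. This suffices for \<open>n\<close> stages, as each stage decreases the index of \<open>Phi\<close> by 2.\<close>

definition kk :: "nat \<Rightarrow> nat" where "kk n = 2 * n + 3"

definition wdata :: "nat \<Rightarrow> nat set \<times> (nat \<Rightarrow> nat) \<times> (nat \<Rightarrow> nat \<Rightarrow> nat) \<times> (nat \<Rightarrow> nat) \<times> nat" where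
  "wdata n = (SOME (X, P, g, r, T). world (kk n) X P g r T \<and> Phi (2 * n + 1) (Phi 0 hf) (kk n - 1) \<le> T)"

definition wX :: "nat \<Rightarrow> nat set" where "wX n = fst (wdata n)"
definition wP :: "nat \<Rightarrow> nat \<Rightarrow> nat" where "wP n = fst (snd (wdata n))"
definition wg :: "nat \<Rightarrow> nat \<Rightarrow> nat \<Rightarrow> nat" where "wg n = fst (snd (snd (wdata n)))"
definition wr :: "nat \<Rightarrow> nat \<Rightarrow> nat" where "wr n = fst (snd (snd (snd (wdata n))))"
definition wT :: "nat \<Rightarrow> nat" where "wT n = snd (snd (snd (snd (wdata n))))"
definition wb :: "nat \<Rightarrow> nat" where "wb n = Phi (2 * n + 1) (Phi 0 hf) (kk n - 1)"

lemma wdata: "world (kk n) (wX n) (wP n) (wg n) (wr n) (wT n)" "wb n \<le> wT n"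
proof -
  have e: "2 * n + 1 + 2 = kk n" by (simp add: kk_def)
  have "\<exists>w. case w of (X, P, g, r, T) \<Rightarrow> world (kk n) X P g r T \<and> Phi (2 * n + 1) (Phi 0 hf) (kk n - 1) \<le> T"
    using world_exists[of "2 * n + 1", unfolded e] by (simp only: split_paired_Ex prod.case)
  from someI_ex[OF this, folded wdata_def]
  show "world (kk n) (wX n) (wP n) (wg n) (wr n) (wT n)" "wb n \<le> wT n"
    by (simp_all only: wX_def wP_def wg_def wr_def wT_def wb_def split_beta)
qed

text \<open>Sets of the model are given by codes with numerical parameters: the ground set, and sets
  arising from it by \<open>\<Delta>\<^sup>0\<^sub>1\<close> comprehension, where the least witness for either of the two
  \<open>\<Sigma>\<^sup>0\<^sub>1\<close> formulas decides.\<close>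

datatype code = CX | CNew fm fm "code list"

instance code :: countable
  by countable_datatype

primrec de :: "nat \<Rightarrow> nat \<Rightarrow> nat" where
  "de v 0 = pr1 v"
| "de v (Suc i) = de (pr2 v) i"

primrec enc :: "nat \<Rightarrow> (nat \<Rightarrow> nat) \<Rightarrow> nat" where
  "enc 0 f = 0"
| "enc (Suc N) f = pr (f 0) (enc N (\<lambda>i. f (Suc i)))"

declare de.simps [simp del]

lemma de_pr [simp]: "de (pr x y) 0 = x" "de (pr x y) (Suc i) = de y i"
  by (simp_all add: de.simps)

lemma de_enc: "i < N \<Longrightarrow> de (enc N f) i = f i"
proof (induction N arbitrary: f i)
  case (Suc N)
  then show ?case by (cases i) auto
qed simp

text \<open>The even entries of a parameter are the values of number variables, the odd ones are the
  parameters of set variables.\<close>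

definition sgl :: "(nat \<Rightarrow> nat set) list \<Rightarrow> nat set \<Rightarrow> nat \<Rightarrow> nat \<Rightarrow> nat set" where
  "sgl Ss X v j = (if j < length Ss then (Ss ! j) (de v (2 * j + 1)) else X)"

primrec evc :: "nat set \<Rightarrow> code \<Rightarrow> nat \<Rightarrow> nat set" where
  "evc X CX = (\<lambda>v. X)"
| "evc X (CNew p q cs) = (\<lambda>v. {x. \<exists>y.
     sat (tstr UNIV) p (case_nat y (case_nat x (\<lambda>i. de v (2 * i)))) (sgl (map (evc X) cs) X v) \<and>
     (\<forall>y'<y. \<not> sat (tstr UNIV) p (case_nat y' (case_nat x (\<lambda>i. de v (2 * i)))) (sgl (map (evc X) cs) X v) \<and>
       sat (tstr UNIV) q (case_nat y' (case_nat x (\<lambda>i. de v (2 * i)))) (sgl (map (evc X) cs) X v))})"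

text \<open>The least counterexample to \<open>\<forall>z. p(z, y)\<close>, or \<open>b\<close> if there is none.\<close>

definition cx :: "nat set \<Rightarrow> fm \<times> code list \<Rightarrow> nat \<Rightarrow> nat \<Rightarrow> nat \<Rightarrow> nat" where
  "cx X pc b x y = (let S = (\<lambda>z. sat (tstr UNIV) (fst pc) (case_nat z (case_nat y (\<lambda>i. de x (2 * i))))
       (sgl (map (evc X) (snd pc)) X x)) in if \<forall>z. S z then b else LEAST z. \<not> S z)"

text \<open>The second component of \<open>s\<close> is ignored, so every request recurs at
  arbitrarily late stages, when its parameters lie below the left end point.\<close>

definition req :: "nat \<Rightarrow> fm \<times> code list" where "req s = from_nat (pr1 s)"

text \<open>\<open>cut_seq\<close> with \<open>n\<close> stages in the \<open>n\<close>-th factor.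
  Stage \<open>s\<close> treats the least counterexamples for the \<open>s\<close>-th request; the
  default \<open>wb n\<close> for a missing counterexample is the right end of the initial
  interval.\<close>

definition cdata :: "nat \<Rightarrow> (nat \<Rightarrow> nat) \<times> (nat \<Rightarrow> nat) \<times> (nat \<Rightarrow> nat \<Rightarrow> nat) \<times> (nat \<Rightarrow> nat set)" where
  "cdata n = (SOME (a, b, G, Q). a 0 = kk n - 1 \<and> b 0 = wb n \<and> G 0 = Phi 0 hf \<and>
     (\<forall>s\<le>n. nice (G s) \<and> a s \<le> b s) \<and>
     (\<forall>s<n. G s (a s) < a (Suc s) \<and> b (Suc s) \<le> b s \<and> (\<forall>y. G s y \<le> G (Suc s) y) \<and>
      (\<forall>x<a s. x \<notin> Q s \<longrightarrow> (\<exists>y\<le>a (Suc s). b (Suc s) \<le> cx (wX n) (req s) (wb n) x y)) \<and>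
      (\<forall>x<a s. x \<in> Q s \<longrightarrow> (\<forall>y. cx (wX n) (req s) (wb n) x y \<le> G (Suc s) y))))"

definition ca :: "nat \<Rightarrow> nat \<Rightarrow> nat" where "ca n = fst (cdata n)"
definition cb :: "nat \<Rightarrow> nat \<Rightarrow> nat" where "cb n = fst (snd (cdata n))"
definition cG :: "nat \<Rightarrow> nat \<Rightarrow> nat \<Rightarrow> nat" where "cG n = fst (snd (snd (cdata n)))"
definition cQ :: "nat \<Rightarrow> nat \<Rightarrow> nat set" where "cQ n = snd (snd (snd (cdata n)))"

lemma cdata:
  "ca n 0 = kk n - 1" "cb n 0 = wb n" "cG n 0 = Phi 0 hf"
  "s \<le> n \<Longrightarrow> nice (cG n s)" "s \<le> n \<Longrightarrow> ca n s \<le> cb n s"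
  "s < n \<Longrightarrow> cG n s (ca n s) < ca n (Suc s)" "s < n \<Longrightarrow> cb n (Suc s) \<le> cb n s"
  "s < n \<Longrightarrow> cG n s y \<le> cG n (Suc s) y"
  "s < n \<Longrightarrow> x < ca n s \<Longrightarrow> x \<notin> cQ n s \<Longrightarrow> \<exists>y\<le>ca n (Suc s). cb n (Suc s) \<le> cx (wX n) (req s) (wb n) x y"
  "s < n \<Longrightarrow> x < ca n s \<Longrightarrow> x \<in> cQ n s \<Longrightarrow> cx (wX n) (req s) (wb n) x y \<le> cG n (Suc s) y"
proof -
  have "2 \<le> kk n - 1" by (simp add: kk_def)
  moreover have "Phi (Suc (2 * n)) (Phi 0 hf) (kk n - 1) \<le> wb n" by (simp add: wb_def)
  ultimately have "\<exists>c. case c of (a, b, G, Q) \<Rightarrow> a 0 = kk n - 1 \<and> b 0 = wb n \<and> G 0 = Phi 0 hf \<and>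
     (\<forall>s\<le>n. nice (G s) \<and> a s \<le> b s) \<and>
     (\<forall>s<n. G s (a s) < a (Suc s) \<and> b (Suc s) \<le> b s \<and> (\<forall>y. G s y \<le> G (Suc s) y) \<and>
      (\<forall>x<a s. x \<notin> Q s \<longrightarrow> (\<exists>y\<le>a (Suc s). b (Suc s) \<le> cx (wX n) (req s) (wb n) x y)) \<and>
      (\<forall>x<a s. x \<in> Q s \<longrightarrow> (\<forall>y. cx (wX n) (req s) (wb n) x y \<le> G (Suc s) y)))"
    using cut_seq[OF nice_Phi[OF nice_hf], of "kk n - 1" n 0 "wb n" "\<lambda>s. cx (wX n) (req s) (wb n)"]
    by (simp only: split_paired_Ex prod.case)
  note 1 = someI_ex[OF this, folded cdata_def, unfolded split_beta]
  have *: "ca n 0 = kk n - 1 \<and> cb n 0 = wb n \<and> cG n 0 = Phi 0 hf \<and>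
     (\<forall>s\<le>n. nice (cG n s) \<and> ca n s \<le> cb n s) \<and>
     (\<forall>s<n. cG n s (ca n s) < ca n (Suc s) \<and> cb n (Suc s) \<le> cb n s \<and> (\<forall>y. cG n s y \<le> cG n (Suc s) y) \<and>
      (\<forall>x<ca n s. x \<notin> cQ n s \<longrightarrow> (\<exists>y\<le>ca n (Suc s). cb n (Suc s) \<le> cx (wX n) (req s) (wb n) x y)) \<and>
      (\<forall>x<ca n s. x \<in> cQ n s \<longrightarrow> (\<forall>y. cx (wX n) (req s) (wb n) x y \<le> cG n (Suc s) y)))"
    unfolding ca_def cb_def cG_def cQ_def by (rule 1)
  show "ca n 0 = kk n - 1" "cb n 0 = wb n" "cG n 0 = Phi 0 hf" using * by blast+
  show "s \<le> n \<Longrightarrow> nice (cG n s)" "s \<le> n \<Longrightarrow> ca n s \<le> cb n s" using * by blast+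
  show "s < n \<Longrightarrow> cG n s (ca n s) < ca n (Suc s)" "s < n \<Longrightarrow> cb n (Suc s) \<le> cb n s"
    "s < n \<Longrightarrow> cG n s y \<le> cG n (Suc s) y"
    "s < n \<Longrightarrow> x < ca n s \<Longrightarrow> x \<notin> cQ n s \<Longrightarrow> \<exists>y\<le>ca n (Suc s). cb n (Suc s) \<le> cx (wX n) (req s) (wb n) x y"
    "s < n \<Longrightarrow> x < ca n s \<Longrightarrow> x \<in> cQ n s \<Longrightarrow> cx (wX n) (req s) (wb n) x y \<le> cG n (Suc s) y"
    using * by simp_all
qed

lemma cb_mono: "s \<le> t \<Longrightarrow> t \<le> n \<Longrightarrow> cb n t \<le> cb n s"
proof (induction rule: dec_induct)
  case (step t)
  then show ?case using cdata(7)[of t n] by simp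
qed simp

lemma cG_mono: "s \<le> t \<Longrightarrow> t \<le> n \<Longrightarrow> cG n s y \<le> cG n t y"
proof (induction rule: dec_induct)
  case (step t)
  then show ?case using cdata(8)[of t n y] by simp
qed simp

lemma ca_less: "s < n \<Longrightarrow> ca n s < ca n (Suc s)"
  using cdata(6)[of s n] niceD(1)[OF cdata(4)[of s n], of "ca n s"] by simp

lemma ca_mono: "s \<le> t \<Longrightarrow> t \<le> n \<Longrightarrow> ca n s \<le> ca n t"
proof (induction rule: dec_induct)
  case (step t)
  then show ?case using ca_less[of t n] by simp
qed simp

text \<open>\<open>cG n 0\<close> is \<open>hf\<close> applied twice and the \<open>cG n s\<close>
  only grow, so each stage moves the left end point beyond its image under \<open>hf\<close>. This
  closes the cut under \<open>hf\<close>.\<close>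

lemma ca_hf: "s < n \<Longrightarrow> hf (ca n s) \<le> ca n (Suc s)"
  using cdata(6)[of s n] cG_mono[of 0 s n "ca n s"] cdata(3)[of n] niceD(1)[OF nice_hf, of "hf (ca n s)"] by simp

lemma ca_cb: "s \<le> n \<Longrightarrow> t \<le> n \<Longrightarrow> ca n s \<le> cb n t"
  using ca_mono[of s t n] cb_mono[of t s n] cdata(5)[of s n] cdata(5)[of t n] by (cases "s \<le> t") auto

text \<open>The cut below the right and above the left end points of the nested intervals
  \<open>[ca n s, cb n s]\<close>.\<close>

definition DD :: "(nat \<Rightarrow> nat) set" where
  "DD = {f. \<exists>s. alm (\<lambda>n. f n \<le> ca n s)}"

lemma DD_ge: "f \<in> DD \<Longrightarrow> \<exists>s\<ge>t. alm (\<lambda>n. f n \<le> ca n s)"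
proof -
  assume "f \<in> DD"
  then obtain s where s: "alm (\<lambda>n. f n \<le> ca n s)" unfolding DD_def by blast
  have "alm (\<lambda>n. f n \<le> ca n (max s t))"
    using s alm_ge[of "max s t"]
  proof eventually_elim
    case (elim n)
    then show ?case using ca_mono[of s "max s t" n] by simp
  qed
  then show ?thesis by (intro exI[of _ "max s t"]) simp
qed

lemma DD_le: "g \<in> DD \<Longrightarrow> alm (\<lambda>n. f n \<le> g n) \<Longrightarrow> f \<in> DD"
proof -
  assume "g \<in> DD" and le: "alm (\<lambda>n. f n \<le> g n)"
  then obtain s where "alm (\<lambda>n. g n \<le> ca n s)" unfolding DD_def by blast
  with le have "alm (\<lambda>n. f n \<le> ca n s)" by eventually_elim simp
  then show ?thesis unfolding DD_def by blast
qed

lemma DD_le': "g \<in> DD \<Longrightarrow> (\<And>n. f n \<le> g n) \<Longrightarrow> f \<in> DD"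
  by (rule DD_le) auto

lemma DD_max: "f \<in> DD \<Longrightarrow> g \<in> DD \<Longrightarrow> (\<lambda>n. max (f n) (g n)) \<in> DD"
proof -
  assume fg: "f \<in> DD" "g \<in> DD"
  obtain s where s: "alm (\<lambda>n. f n \<le> ca n s)" using DD_ge[OF fg(1), of 0] by blast
  obtain t where t: "s \<le> t" "alm (\<lambda>n. g n \<le> ca n t)" using DD_ge[OF fg(2), of s] by blast
  have "alm (\<lambda>n. max (f n) (g n) \<le> ca n t)"
    using s t(2) alm_ge[of t]
  proof eventually_elim
    case (elim n)
    then show ?case using ca_mono[OF t(1), of n] by simp
  qed
  then show ?thesis unfolding DD_def by blast
qed

lemma DD_hf: "f \<in> DD \<Longrightarrow> (\<lambda>n. hf (f n)) \<in> DD"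
proof -
  assume "f \<in> DD"
  then obtain s where s: "alm (\<lambda>n. f n \<le> ca n s)" unfolding DD_def by blast
  have "alm (\<lambda>n. hf (f n) \<le> ca n (Suc s))"
    using s alm_ge[of "Suc s"]
  proof eventually_elim
    case (elim n)
    then show ?case using ca_hf[of s n] hf_mono[of "f n" "ca n s"] by simp
  qed
  then show ?thesis unfolding DD_def by blast
qed

lemma DD_kk: "kk \<in> DD"
proof (rule DD_le'[OF DD_hf])
  show "(\<lambda>n. ca n 0) \<in> DD" unfolding DD_def by (intro CollectI exI[of _ 0]) simp
  show "kk n \<le> hf (ca n 0)" for n
    using niceD(1)[OF nice_hf, of "ca n 0"] by (simp add: cdata(1))
qed

lemma DD_id: "(\<lambda>n. n) \<in> DD"
  by (rule DD_le'[OF DD_kk]) (simp add: kk_def)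

lemma DD_const: "(\<lambda>n. c) \<in> DD"
  using DD_le[OF DD_id alm_ge[of c]] .

lemma DD_add: "f \<in> DD \<Longrightarrow> g \<in> DD \<Longrightarrow> (\<lambda>n. f n + g n) \<in> DD"
proof (rule DD_le'[OF DD_hf[OF DD_max[of f g]]])
  show "f n + g n \<le> hf (max (f n) (g n))" for n
    using hf_add[of "f n" "max (f n) (g n)" "g n"] by simp
qed

lemma DD_mult: "f \<in> DD \<Longrightarrow> g \<in> DD \<Longrightarrow> (\<lambda>n. f n * g n) \<in> DD"
  by (rule DD_le'[OF DD_hf[OF DD_max[of f g]]]) (auto intro: hf_mult)

lemma DD_pr: "f \<in> DD \<Longrightarrow> g \<in> DD \<Longrightarrow> (\<lambda>n. pr (f n) (g n)) \<in> DD"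
  by (rule DD_le'[OF DD_hf[OF DD_max[of f g]]]) (auto intro: hf_pr)

lemma DD_enc: "(\<And>i. f i \<in> DD) \<Longrightarrow> (\<lambda>n. enc N (\<lambda>i. f i n)) \<in> DD"
proof (induction N arbitrary: f)
  case (Suc N)
  then show ?case by (simp add: DD_pr)
qed (simp add: DD_const)

text \<open>A counterexample can be chosen in each factor separately, and a function below
  \<open>b\<close> stays in the cut.\<close>

lemma alm_all:
  assumes b: "b \<in> DD"
  shows "(\<forall>f\<in>DD. alm (\<lambda>n. f n < b n \<longrightarrow> \<phi> n (f n))) \<longleftrightarrow> alm (\<lambda>n. \<forall>x<b n. \<phi> n x)"
proof
  assume L: "\<forall>f\<in>DD. alm (\<lambda>n. f n < b n \<longrightarrow> \<phi> n (f n))"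
  define f where "f n = (if \<exists>x<b n. \<not> \<phi> n x then SOME x. x < b n \<and> \<not> \<phi> n x else 0)" for n
  have f: "f n < b n \<and> \<not> \<phi> n (f n)" if "\<not> (\<forall>x<b n. \<phi> n x)" for n
    using someI_ex[of "\<lambda>x. x < b n \<and> \<not> \<phi> n x"] that unfolding f_def by auto
  have "f \<in> DD"
  proof (rule DD_le'[OF b])
    show "f n \<le> b n" for n using f[of n] by (cases "\<forall>x<b n. \<phi> n x") (auto simp: f_def)
  qed
  then have "alm (\<lambda>n. f n < b n \<longrightarrow> \<phi> n (f n))" using L by blast
  then show "alm (\<lambda>n. \<forall>x<b n. \<phi> n x)" by eventually_elim (use f in blast)
next
  assume R: "alm (\<lambda>n. \<forall>x<b n. \<phi> n x)"
  show "\<forall>f\<in>DD. alm (\<lambda>n. f n < b n \<longrightarrow> \<phi> n (f n))"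
    using R by (auto elim: eventually_mono)
qed

\<comment> \<open>The cut as an ordered semidomain\<close>
quotient_type cut = "nat \<Rightarrow> nat" / partial: "\<lambda>f g. f \<in> DD \<and> g \<in> DD \<and> alm (\<lambda>n. f n = g n)"
proof (rule part_equivpI)
  show "\<exists>f. f \<in> DD \<and> f \<in> DD \<and> alm (\<lambda>n. f n = f n)" using DD_id by auto
  show "symp (\<lambda>f g. f \<in> DD \<and> g \<in> DD \<and> alm (\<lambda>n. f n = g n))"
    by (rule sympI) (auto elim: eventually_mono)
  show "transp (\<lambda>f g. f \<in> DD \<and> g \<in> DD \<and> alm (\<lambda>n. f n = g n))"
    by (rule transpI) (auto elim: eventually_elim2)
qed

abbreviation cls :: "(nat \<Rightarrow> nat) \<Rightarrow> cut" where "cls \<equiv> abs_cut"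

lemma cls_eq: "f \<in> DD \<Longrightarrow> g \<in> DD \<Longrightarrow> cls f = cls g \<longleftrightarrow> alm (\<lambda>n. f n = g n)"
  using Quotient3_rel[OF Quotient3_cut, of f g] by simp

lemma rep_DD: "rep_cut x \<in> DD"
  using Quotient3_rep_reflp[OF Quotient3_cut, of x] by simp

lemma cls_rep [simp]: "cls (rep_cut x) = x"
  by (rule Quotient3_abs_rep[OF Quotient3_cut])

lemma rep_cls: "f \<in> DD \<Longrightarrow> alm (\<lambda>n. rep_cut (cls f) n = f n)"
  using cls_eq[OF rep_DD, of f "cls f"] by simp

lemma cut_cases: obtains f where "f \<in> DD" "x = cls f"
  using rep_DD[of x] cls_rep[of x] by metis

lemma cut_all: "(\<forall>x. P x) \<longleftrightarrow> (\<forall>f\<in>DD. P (cls f))"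
  by (metis cut_cases)

lemma cut_ex: "(\<exists>x. P x) \<longleftrightarrow> (\<exists>f\<in>DD. P (cls f))"
  by (metis cut_cases)

instantiation cut :: "{zero, one, plus, times, minus, ord}"
begin

definition "0 = cls (\<lambda>n. 0)"
definition "1 = cls (\<lambda>n. 1)"
definition "x + y = cls (\<lambda>n. rep_cut x n + rep_cut y n)"
definition "x * y = cls (\<lambda>n. rep_cut x n * rep_cut y n)"
definition "x - y = cls (\<lambda>n. rep_cut x n - rep_cut y n)"
definition "x < y \<longleftrightarrow> alm (\<lambda>n. rep_cut x n < rep_cut y n)"
definition "x \<le> y \<longleftrightarrow> alm (\<lambda>n. rep_cut x n \<le> rep_cut y n)"

instance ..

end

lemma DD_minus: "f \<in> DD \<Longrightarrow> (\<lambda>n. f n - g n) \<in> DD"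
  by (rule DD_le'[of f]) auto

lemma cls_cong: "alm (\<lambda>n. f n = g n) \<Longrightarrow> g \<in> DD \<Longrightarrow> cls f = cls g"
proof -
  assume fg: "alm (\<lambda>n. f n = g n)" and g: "g \<in> DD"
  have "alm (\<lambda>n. f n \<le> g n)" using fg by eventually_elim simp
  then have "f \<in> DD" by (rule DD_le[OF g])
  then show ?thesis using fg g by (simp add: cls_eq)
qed

lemma cls_plus: "f \<in> DD \<Longrightarrow> g \<in> DD \<Longrightarrow> cls f + cls g = cls (\<lambda>n. f n + g n)"
proof -
  assume fg: "f \<in> DD" "g \<in> DD"
  have "alm (\<lambda>n. rep_cut (cls f) n + rep_cut (cls g) n = f n + g n)"
    using rep_cls[OF fg(1)] rep_cls[OF fg(2)] by eventually_elim simp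
  then show ?thesis unfolding plus_cut_def by (rule cls_cong[OF _ DD_add[OF fg]])
qed

lemma cls_times: "f \<in> DD \<Longrightarrow> g \<in> DD \<Longrightarrow> cls f * cls g = cls (\<lambda>n. f n * g n)"
proof -
  assume fg: "f \<in> DD" "g \<in> DD"
  have "alm (\<lambda>n. rep_cut (cls f) n * rep_cut (cls g) n = f n * g n)"
    using rep_cls[OF fg(1)] rep_cls[OF fg(2)] by eventually_elim simp
  then show ?thesis unfolding times_cut_def by (rule cls_cong[OF _ DD_mult[OF fg]])
qed

lemma cls_minus: "f \<in> DD \<Longrightarrow> g \<in> DD \<Longrightarrow> cls f - cls g = cls (\<lambda>n. f n - g n)"
proof -
  assume fg: "f \<in> DD" "g \<in> DD"
  have "alm (\<lambda>n. rep_cut (cls f) n - rep_cut (cls g) n = f n - g n)"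
    using rep_cls[OF fg(1)] rep_cls[OF fg(2)] by eventually_elim simp
  then show ?thesis unfolding minus_cut_def by (rule cls_cong[OF _ DD_minus[OF fg(1)]])
qed

lemma cls_less: "f \<in> DD \<Longrightarrow> g \<in> DD \<Longrightarrow> cls f < cls g \<longleftrightarrow> alm (\<lambda>n. f n < g n)"
proof -
  assume fg: "f \<in> DD" "g \<in> DD"
  have "alm (\<lambda>n. (rep_cut (cls f) n < rep_cut (cls g) n) = (f n < g n))"
    using rep_cls[OF fg(1)] rep_cls[OF fg(2)] by eventually_elim simp
  then show ?thesis unfolding less_cut_def by (rule eventually_subst)
qed

lemma cls_less_eq: "f \<in> DD \<Longrightarrow> g \<in> DD \<Longrightarrow> cls f \<le> cls g \<longleftrightarrow> alm (\<lambda>n. f n \<le> g n)"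
proof -
  assume fg: "f \<in> DD" "g \<in> DD"
  have "alm (\<lambda>n. (rep_cut (cls f) n \<le> rep_cut (cls g) n) = (f n \<le> g n))"
    using rep_cls[OF fg(1)] rep_cls[OF fg(2)] by eventually_elim simp
  then show ?thesis unfolding less_eq_cut_def by (rule eventually_subst)
qed

lemmas cls_ops = zero_cut_def one_cut_def cls_plus cls_times cls_minus cls_less cls_less_eq cls_eq
  DD_const DD_add DD_mult DD_minus

instance cut :: linordered_semidom
proof
  fix a b c :: cut
  obtain f where f: "f \<in> DD" "a = cls f" by (rule cut_cases)
  obtain g where g: "g \<in> DD" "b = cls g" by (rule cut_cases)
  obtain h where h: "h \<in> DD" "c = cls h" by (rule cut_cases)
  note [simp] = cls_ops f g h
  show "a + b + c = a + (b + c)" by (simp add: add.assoc)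
  show "a + b = b + a" by (simp add: add.commute)
  show "0 + a = a" by simp
  show "a * b * c = a * (b * c)" by (simp add: mult.assoc)
  show "a * b = b * a" by (simp add: mult.commute)
  show "1 * a = a" by simp
  show "(a + b) * c = a * c + b * c" by (simp add: algebra_simps)
  show "a * (b + c) = a * b + a * c" by (simp add: algebra_simps)
  show "0 * a = 0" by simp
  show "a * 0 = 0" by simp
  show "(0::cut) \<noteq> 1" by simp
  show "a + b - a = b" by simp
  show "a - b - c = a - (b + c)" by simp
  show "a * (b - c) = a * b - a * c" by (simp add: diff_mult_distrib2)
  show "a \<noteq> 0 \<Longrightarrow> b \<noteq> 0 \<Longrightarrow> a * b \<noteq> 0" by (simp add: alm_disj)
  show "a < b \<longleftrightarrow> a \<le> b \<and> \<not> b \<le> a"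
  proof -
    have "a < b \<longleftrightarrow> \<not> b \<le> a"
      unfolding f(2) g(2) cls_less[OF f(1) g(1)] cls_less_eq[OF g(1) f(1)] alm_not[symmetric] not_le ..
    moreover have "a < b \<Longrightarrow> a \<le> b"
      unfolding f(2) g(2) cls_less[OF f(1) g(1)] cls_less_eq[OF f(1) g(1)] by (elim eventually_mono) simp
    ultimately show ?thesis by blast
  qed
  show "a \<le> a" by simp
  show "a \<le> b \<Longrightarrow> b \<le> c \<Longrightarrow> a \<le> c" by simp (erule (1) eventually_elim2, simp)
  show "a \<le> b \<Longrightarrow> b \<le> a \<Longrightarrow> a = b" by simp (erule (1) eventually_elim2, simp)
  show "a \<le> b \<or> b \<le> a"
    unfolding f(2) g(2) cls_less_eq[OF f(1) g(1)] cls_less_eq[OF g(1) f(1)] alm_disj[symmetric]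
    by (simp add: linear)
  show "a \<le> b \<Longrightarrow> c + a \<le> c + b" by simp
  show "a < b \<Longrightarrow> 0 < c \<Longrightarrow> c * a < c * b" by simp (erule (1) eventually_elim2, simp)
  show "(0::cut) < 1" by simp
  show "a - b + b = a" if "b \<le> a" using that by simp (elim eventually_mono, simp)
qed

lemma cut_less_add1: "x < y + 1 \<longleftrightarrow> x \<le> (y :: cut)"
proof -
  obtain f where f: "f \<in> DD" "x = cls f" by (rule cut_cases)
  obtain g where g: "g \<in> DD" "y = cls g" by (rule cut_cases)
  show ?thesis
    unfolding f(2) g(2) one_cut_def cls_plus[OF g(1) DD_const] cls_less[OF f(1) DD_add[OF g(1) DD_const]]
      cls_less_eq[OF f(1) g(1)] by (simp add: less_Suc_eq_le)
qed

lemma cut_zero_le: "0 \<le> (x :: cut)"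
proof -
  obtain f where f: "f \<in> DD" "x = cls f" by (rule cut_cases)
  show ?thesis by (simp add: cls_ops f)
qed

lemma DD_ev: "(\<And>i. e i \<in> DD) \<Longrightarrow> (\<lambda>n. ev t (\<lambda>i. e i n)) \<in> DD"
  by (induction t) (auto intro: DD_const DD_add DD_mult)

lemma ev_cls: "(\<And>i. e i \<in> DD) \<Longrightarrow> ev t (\<lambda>i. cls (e i)) = cls (\<lambda>n. ev t (\<lambda>i. e i n))"
  by (induction t) (auto simp: cls_plus cls_times zero_cut_def one_cut_def DD_ev)

section \<open>Internal sets and truth in the cut\<close>

definition setI :: "code \<Rightarrow> (nat \<Rightarrow> nat) \<Rightarrow> cut set" where
  "setI C v = {cls f |f. f \<in> DD \<and> alm (\<lambda>n. f n \<in> evc (wX n) C (v n))}"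

definition SI :: "cut set set" where "SI = {setI C v |C v. v \<in> DD}"

lemma cls_setI: "f \<in> DD \<Longrightarrow> cls f \<in> setI C v \<longleftrightarrow> alm (\<lambda>n. f n \<in> evc (wX n) C (v n))"
proof
  assume f: "f \<in> DD" and "cls f \<in> setI C v"
  then obtain g where g: "g \<in> DD" "cls f = cls g" "alm (\<lambda>n. g n \<in> evc (wX n) C (v n))" unfolding setI_def by blast
  have "alm (\<lambda>n. f n = g n)" using cls_eq[OF f g(1)] g(2) by simp
  with g(3) show "alm (\<lambda>n. f n \<in> evc (wX n) C (v n))" by eventually_elim simp
qed (auto simp: setI_def)

lemma case_nat_cls: "case_nat (cls f) (\<lambda>i. cls (e i)) = (\<lambda>i. cls (case_nat f e i))"
  by (rule ext) (simp split: nat.split)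

lemma case_nat_at: "(\<lambda>i. case_nat f e i n) = case_nat (f n) (\<lambda>i. e i n)"
  by (rule ext) (simp split: nat.split)

lemma case_nat_DD: "f \<in> DD \<Longrightarrow> (\<And>i. e i \<in> DD) \<Longrightarrow> case_nat f e i \<in> DD"
  by (simp split: nat.split)

text \<open>The theorem of Los for bounded formulas: the cut is an initial segment, so bounded
  quantifiers are handled by \<open>alm_all\<close>, whereas an unbounded one may have its witnesses
  outside the cut.\<close>

theorem los: "p \<in> Delta00 \<Longrightarrow> (\<And>i. e i \<in> DD) \<Longrightarrow>
  sat (tstr SI) p (\<lambda>i. cls (e i)) (\<lambda>j. setI (C j) (V j)) \<longleftrightarrow>
  alm (\<lambda>n. sat (tstr UNIV) p (\<lambda>i. e i n) (\<lambda>j. evc (wX n) (C j) (V j n)))"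
proof (induction p arbitrary: e rule: Delta00.induct)
  case (8 p t)
  note D = DD_ev[OF 8(3), of t]
  have "sat (tstr SI) (All (Imp (Less (NVar 0) (shift_tm t)) p)) (\<lambda>i. cls (e i)) (\<lambda>j. setI (C j) (V j)) \<longleftrightarrow>
    (\<forall>f\<in>DD. alm (\<lambda>n. f n < ev t (\<lambda>i. e i n) \<longrightarrow>
      sat (tstr UNIV) p (case_nat (f n) (\<lambda>i. e i n)) (\<lambda>j. evc (wX n) (C j) (V j n))))"
    using 8(3) by (simp add: cut_all ev_cls D cls_less case_nat_cls 8(2)[OF case_nat_DD] case_nat_at alm_imp)
  also have "\<dots> \<longleftrightarrow> alm (\<lambda>n. sat (tstr UNIV) (All (Imp (Less (NVar 0) (shift_tm t)) p)) (\<lambda>i. e i n)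
      (\<lambda>j. evc (wX n) (C j) (V j n)))"
    using alm_all[OF D] by simp
  finally show ?case .
next
  case (9 p t)
  note D = DD_ev[OF 9(3), of t]
  have "sat (tstr SI) (Ex (And (Less (NVar 0) (shift_tm t)) p)) (\<lambda>i. cls (e i)) (\<lambda>j. setI (C j) (V j)) \<longleftrightarrow>
    (\<exists>f\<in>DD. alm (\<lambda>n. f n < ev t (\<lambda>i. e i n)) \<and>
      alm (\<lambda>n. sat (tstr UNIV) p (case_nat (f n) (\<lambda>i. e i n)) (\<lambda>j. evc (wX n) (C j) (V j n))))"
    using 9(3) by (simp add: cut_ex ev_cls D cls_less case_nat_cls 9(2)[OF case_nat_DD] case_nat_at)
  also have "\<dots> \<longleftrightarrow> \<not> (\<forall>f\<in>DD. alm (\<lambda>n. f n < ev t (\<lambda>i. e i n) \<longrightarrow>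
      \<not> sat (tstr UNIV) p (case_nat (f n) (\<lambda>i. e i n)) (\<lambda>j. evc (wX n) (C j) (V j n))))"
    unfolding alm_imp alm_not by blast
  also have "\<dots> \<longleftrightarrow> \<not> alm (\<lambda>n. \<forall>x<ev t (\<lambda>i. e i n).
      \<not> sat (tstr UNIV) p (case_nat x (\<lambda>i. e i n)) (\<lambda>j. evc (wX n) (C j) (V j n)))"
    using alm_all[OF D, where \<phi> = "\<lambda>n x. \<not> sat (tstr UNIV) p (case_nat x (\<lambda>i. e i n)) (\<lambda>j. evc (wX n) (C j) (V j n))"]
    by (rule arg_cong)
  also have "\<dots> \<longleftrightarrow> alm (\<lambda>n. \<not> (\<forall>x<ev t (\<lambda>i. e i n).
      \<not> sat (tstr UNIV) p (case_nat x (\<lambda>i. e i n)) (\<lambda>j. evc (wX n) (C j) (V j n))))"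
    by (rule alm_not[symmetric])
  also have "\<dots> \<longleftrightarrow> alm (\<lambda>n. sat (tstr UNIV) (Ex (And (Less (NVar 0) (shift_tm t)) p)) (\<lambda>i. e i n)
      (\<lambda>j. evc (wX n) (C j) (V j n)))" by simp
  finally show ?case .
qed (simp_all add: ev_cls DD_ev cls_eq cls_less cls_setI alm_imp alm_disj eventually_conj_iff)

lemma sat_cong:
  assumes e: "\<And>i. i < nbound p \<Longrightarrow> e i = e' i" and E: "\<And>j. j < Suc (sbound p) \<Longrightarrow> E j = E' j"
  shows "sat M p e E \<longleftrightarrow> sat M p e' E'"
proof -
  let ?\<sigma> = "\<lambda>i. if i < nbound p then NVar i else Zero" and ?\<rho> = "\<lambda>j. if j < sbound p then j else 0"
  have s: "p = subst p ?\<sigma> ?\<rho>"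
    using subst_cong[of p NVar ?\<sigma> "\<lambda>n. n" ?\<rho>] by simp
  have "(\<lambda>n. evt M (?\<sigma> n) e) = (\<lambda>n. evt M (?\<sigma> n) e')" "(\<lambda>n. E (?\<rho> n)) = (\<lambda>n. E' (?\<rho> n))"
    using e E by (auto simp: fun_eq_iff)
  then show ?thesis by (subst (1 2) s) (simp only: sat_subst)
qed

text \<open>Packs all parameters into a single number, so that a stage of the construction meets an
  instance of a formula as one argument \<open>x\<close> below the left end point.\<close>

definition par :: "nat \<Rightarrow> (nat \<Rightarrow> nat \<Rightarrow> nat) \<Rightarrow> (nat \<Rightarrow> nat \<Rightarrow> nat) \<Rightarrow> nat \<Rightarrow> nat" where
  "par N e V n = enc (2 * N) (\<lambda>i. if even i then e (i div 2) n else V (i div 2) n)"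

lemma DD_par: "(\<And>i. e i \<in> DD) \<Longrightarrow> (\<And>i. V i \<in> DD) \<Longrightarrow> par N e V \<in> DD"
proof -
  assume "\<And>i. e i \<in> DD" "\<And>i. V i \<in> DD"
  then have "(\<lambda>n. if even i then e (i div 2) n else V (i div 2) n) \<in> DD" for i by (cases "even i") simp_all
  from DD_enc[OF this] show ?thesis unfolding par_def .
qed

lemma sat_par:
  assumes N: "nbound p \<le> N + 2" "sbound p < N"
  shows "sat (tstr UNIV) p (case_nat x (case_nat y (\<lambda>i. de (par N e V n) (2 * i))))
      (sgl (map (evc X) (map C [0..<N])) X (par N e V n)) \<longleftrightarrow>
    sat (tstr UNIV) p (case_nat x (case_nat y (\<lambda>i. e i n))) (\<lambda>j. evc X (C j) (V j n))"
proof (rule sat_cong)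
  fix i assume "i < nbound p"
  then have "i < N + 2" using N by simp
  then show "(case i of 0 \<Rightarrow> x | Suc k \<Rightarrow> case_nat y (\<lambda>i. de (par N e V n) (2 * i)) k) =
     (case i of 0 \<Rightarrow> x | Suc k \<Rightarrow> case_nat y (\<lambda>i. e i n) k)"
    by (auto split: nat.split simp: par_def de_enc)
next
  fix j assume "j < Suc (sbound p)"
  then have "j < N" using N by simp
  then show "sgl (map (evc X) (map C [0..<N])) X (par N e V n) j = evc X (C j) (V j n)"
    by (simp add: sgl_def par_def de_enc)
qed

lemma SI_env:
  assumes "\<forall>j. E j \<in> SI"
  obtains C V where "\<And>j. V j \<in> DD" "E = (\<lambda>j. setI (C j) (V j))"
proof -
  have "\<forall>j. \<exists>C v. v \<in> DD \<and> E j = setI C v" using assms unfolding SI_def by blast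
  then obtain C V where "\<And>j. V j \<in> DD \<and> E j = setI (C j) (V j)" by metis
  then show ?thesis using that by blast
qed

lemma not_ballD: "\<not> (\<forall>y\<in>A. P y) \<Longrightarrow> \<exists>y\<in>A. \<not> P y"
  by blast

text \<open>In each factor the least \<open>y\<close> that satisfies \<open>p0\<close> or refutes
  \<open>q0\<close> decides membership. Equivalence of \<open>p\<close> and \<open>q\<close> in the
  model places such a \<open>y\<close>, and hence the least one, inside the cut, where bounded truth
  transfers.\<close>

lemma valid_comprehension_SI:
  assumes "p \<in> Sigma01" "q \<in> Pi01"
  shows "valid (tstr SI) (delta_comprehension_axiom p q)"
  unfolding valid_def sat_comprehension tstr_sel
proof (intro allI impI)
  fix e E
  assume "\<forall>n. E n \<in> SI"
    and iff: "\<forall>x. sat (tstr SI) p (case_nat x e) E \<longleftrightarrow> sat (tstr SI) q (case_nat x e) E"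
  obtain C V where V: "\<And>j. V j \<in> DD" "E = (\<lambda>j. setI (C j) (V j))" using SI_env[OF \<open>\<forall>n. E n \<in> SI\<close>] by blast
  obtain p0 q0 where p0: "p = Ex p0" "p0 \<in> Delta00" and q0: "q = All q0" "q0 \<in> Delta00"
    using assms unfolding Sigma01_def Pi01_def by blast
  define e' where "e' i = rep_cut (e i)" for i
  have e': "e' i \<in> DD" "e = (\<lambda>i. cls (e' i))" for i by (simp_all add: e'_def rep_DD)
  define N where "N = nbound p0 + nbound q0 + sbound p0 + sbound q0 + 1"
  have v: "par N e' V \<in> DD" by (rule DD_par[OF e'(1) V(1)])
  let ?S = "\<lambda>p n y x. sat (tstr UNIV) p (case_nat y (case_nat x (\<lambda>i. e' i n))) (\<lambda>j. evc (wX n) (C j) (V j n))"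
  let ?Z = "setI (CNew p0 q0 (map C [0..<N])) (par N e' V)"
  have ev: "x \<in> evc (wX n) (CNew p0 q0 (map C [0..<N])) (par N e' V n) \<longleftrightarrow>
    (\<exists>y. ?S p0 n y x \<and> (\<forall>y'<y. \<not> ?S p0 n y' x \<and> ?S q0 n y' x))" for x n
  proof -
    have "nbound p0 \<le> N + 2" "sbound p0 < N" "nbound q0 \<le> N + 2" "sbound q0 < N" by (simp_all add: N_def)
    then show ?thesis unfolding evc.simps mem_Collect_eq by (simp only: sat_par)
  qed
  have L: "sat (tstr SI) p (case_nat (cls y) (case_nat (cls x) e)) E \<longleftrightarrow> alm (\<lambda>n. ?S p n (y n) (x n))"
    if "p \<in> Delta00" "x \<in> DD" "y \<in> DD" for p x y
  proof -
    have D: "case_nat y (case_nat x e') i \<in> DD" for i by (intro case_nat_DD that e'(1))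
    show ?thesis
      using los[OF that(1), of "case_nat y (case_nat x e')" C V, OF D]
      unfolding e'(2) V(2) case_nat_cls case_nat_at .
  qed
  have "cls x \<in> ?Z \<longleftrightarrow> sat (tstr SI) p (case_nat (cls x) e) E" if x: "x \<in> DD" for x
  proof -
    have P: "sat (tstr SI) p (case_nat (cls x) e) E \<longleftrightarrow> (\<exists>y\<in>DD. alm (\<lambda>n. ?S p0 n (y n) (x n)))"
      unfolding p0(1) using L[OF p0(2) x] by (simp add: cut_ex)
    have Q: "sat (tstr SI) q (case_nat (cls x) e) E \<longleftrightarrow> (\<forall>y\<in>DD. alm (\<lambda>n. ?S q0 n (y n) (x n)))"
      unfolding q0(1) using L[OF q0(2) x] by (simp add: cut_all)
    note iff' = spec[OF iff, of "cls x"]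
    have Z: "cls x \<in> ?Z \<longleftrightarrow> alm (\<lambda>n. \<exists>y. ?S p0 n y (x n) \<and> (\<forall>y'<y. \<not> ?S p0 n y' (x n) \<and> ?S q0 n y' (x n)))"
      unfolding cls_setI[OF x] ev ..
    obtain y where y: "y \<in> DD" "alm (\<lambda>n. ?S p0 n (y n) (x n) \<or> \<not> ?S q0 n (y n) (x n))"
    proof (cases "\<exists>y\<in>DD. alm (\<lambda>n. ?S p0 n (y n) (x n))")
      case True
      then obtain y where y: "y \<in> DD" "alm (\<lambda>n. ?S p0 n (y n) (x n))" by (rule bexE)
      show ?thesis by (rule that[OF y(1)]) (unfold alm_disj, rule disjI1, rule y(2))
    next
      case False
      then have "\<not> (\<forall>y\<in>DD. alm (\<lambda>n. ?S q0 n (y n) (x n)))"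
        unfolding Q[symmetric] iff'[symmetric] P .
      from not_ballD[OF this] obtain y where y: "y \<in> DD" "\<not> alm (\<lambda>n. ?S q0 n (y n) (x n))" by (rule bexE)
      show ?thesis by (rule that[OF y(1)]) (unfold alm_disj alm_not, rule disjI2, rule y(2))
    qed
    define l where "l n = (LEAST y. ?S p0 n y (x n) \<or> \<not> ?S q0 n y (x n))" for n
    have l: "?S p0 n (l n) (x n) \<or> \<not> ?S q0 n (l n) (x n)" "l n \<le> y n"
      if "?S p0 n (y n) (x n) \<or> \<not> ?S q0 n (y n) (x n)" for n
      unfolding l_def
      by (rule LeastI[where P = "\<lambda>u. ?S p0 n u (x n) \<or> \<not> ?S q0 n u (x n)", OF that],
          rule Least_le[where P = "\<lambda>u. ?S p0 n u (x n) \<or> \<not> ?S q0 n u (x n)", OF that])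
    have ll: "\<not> ?S p0 n y' (x n) \<and> ?S q0 n y' (x n)" if "y' < l n" for y' n
      using not_less_Least[OF that[unfolded l_def]] by blast
    have "alm (\<lambda>n. l n \<le> y n)" using y(2) by eventually_elim (rule l(2))
    then have lD: "l \<in> DD" by (rule DD_le[OF y(1)])
    have la: "alm (\<lambda>n. ?S p0 n (l n) (x n) \<or> \<not> ?S q0 n (l n) (x n))" using y(2) by eventually_elim (rule l(1))
    show ?thesis
    proof
      assume "cls x \<in> ?Z"
      then have "alm (\<lambda>n. ?S p0 n (l n) (x n))" using la unfolding Z
      proof eventually_elim
        case (elim n)
        from elim(1) obtain u where u: "?S p0 n u (x n)" "\<And>y'. y' < u \<Longrightarrow> \<not> ?S p0 n y' (x n) \<and> ?S q0 n y' (x n)" by blast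
        have "l n \<le> u" unfolding l_def by (rule Least_le) (use u in blast)
        then have "u = l n" using u(2)[of "l n"] elim(2) by (cases "l n < u") auto
        then show ?case using u(1) by blast
      qed
      then show "sat (tstr SI) p (case_nat (cls x) e) E" unfolding P using lD by blast
    next
      assume s: "sat (tstr SI) p (case_nat (cls x) e) E"
      from bspec[OF iffD1[OF Q iffD1[OF iff' s]] lD]
      have "alm (\<lambda>n. ?S q0 n (l n) (x n))" .
      then have "alm (\<lambda>n. ?S p0 n (l n) (x n))" using la by eventually_elim blast
      then show "cls x \<in> ?Z" unfolding Z
      proof eventually_elim
        case (elim n)
        then show ?case by (intro exI[of _ "l n"] conjI allI impI) (use ll in blast)+
      qed
    qed
  qed
  then have "\<forall>x. x \<in> ?Z \<longleftrightarrow> sat (tstr SI) p (case_nat x e) E" unfolding cut_all by blast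
  moreover have "?Z \<in> SI" unfolding SI_def using v by blast
  ultimately show "\<exists>S\<in>SI. \<forall>x. x \<in> S \<longleftrightarrow> sat (tstr SI) p (case_nat x e) E" by blast
qed

lemma req_ex: "\<exists>s\<ge>t. req s = pc"
proof -
  have "req (pr (to_nat pc) t) = pc" by (simp add: req_def)
  moreover have "t \<le> pr (to_nat pc) t"
    unfolding pr_def using le_square[of "to_nat pc + t"] by linarith
  ultimately show ?thesis by blast
qed

text \<open>Up to any bound in the cut, a \<open>\<Sigma>\<^sup>0\<^sub>2\<close> formula holds in the model if and only if its
  argument was dropped at a suitable stage, which is an internal property.\<close>

lemma sigma2_induction:
  assumes th: "th \<in> Delta00" and E: "\<forall>n. E n \<in> SI"
    and z: "sat (tstr SI) (Ex (All th)) (case_nat 0 e) E"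
    and st: "\<And>x. sat (tstr SI) (Ex (All th)) (case_nat x e) E \<Longrightarrow> sat (tstr SI) (Ex (All th)) (case_nat (x + 1) e) E"
  shows "sat (tstr SI) (Ex (All th)) (case_nat x e) E"
proof -
  obtain C V where V: "\<And>j. V j \<in> DD" "E = (\<lambda>j. setI (C j) (V j))" using SI_env[OF E] by blast
  define e' where "e' i = rep_cut (e i)" for i
  have e': "e' i \<in> DD" "e = (\<lambda>i. cls (e' i))" for i by (simp_all add: e'_def rep_DD)
  obtain m where m: "m \<in> DD" "x = cls m" by (rule cut_cases)
  define N where "N = nbound th + sbound th + 1"
  define vv where "vv n l = par N (case_nat (\<lambda>_. l) e') V n" for n l :: nat
  let ?S = "\<lambda>n z y l. sat (tstr UNIV) th (case_nat z (case_nat y (case_nat l (\<lambda>i. e' i n)))) (\<lambda>j. evc (wX n) (C j) (V j n))"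
  have vvD: "(\<lambda>n. vv n (l n)) \<in> DD" if l: "l \<in> DD" for l
  proof -
    have "(\<lambda>n. vv n (l n)) = par N (case_nat l e') V"
      unfolding vv_def par_def by (rule ext) (auto intro!: arg_cong[where f = "enc _"] split: nat.split)
    then show ?thesis using DD_par[OF case_nat_DD[OF l e'(1)] V(1)] by simp
  qed
  \<comment> \<open>The largest code among the arguments up to \<open>m\<close> belongs to the cut,
    so a late stage has all of these codes below its left end point.\<close>
  have "\<forall>n. \<exists>l\<le>m n. \<forall>l'\<le>m n. vv n l' \<le> vv n l"
  proof
    fix n
    have "Max (vv n ` {..m n}) \<in> vv n ` {..m n}" by (intro Max_in) auto
    then obtain l where l: "Max (vv n ` {..m n}) = vv n l" "l \<in> {..m n}" by (rule imageE)
    have "vv n l' \<le> vv n l" if "l' \<le> m n" for l' using that unfolding l(1)[symmetric] by (intro Max_ge) auto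
    then show "\<exists>l\<le>m n. \<forall>l'\<le>m n. vv n l' \<le> vv n l" using l(2) by blast
  qed
  then obtain lm where lm: "\<And>n. lm n \<le> m n" "\<And>n l'. l' \<le> m n \<Longrightarrow> vv n l' \<le> vv n (lm n)" by metis
  have "lm \<in> DD" by (rule DD_le'[OF m(1) lm(1)])
  then have "(\<lambda>n. vv n (lm n) + 1) \<in> DD" by (intro DD_add vvD DD_const)
  then obtain t where t: "alm (\<lambda>n. vv n (lm n) + 1 \<le> ca n t)" unfolding DD_def by blast
  obtain s where s: "t \<le> s" "req s = (th, map C [0..<N])" using req_ex by blast
  have vs: "alm (\<lambda>n. s + 2 \<le> n \<and> (\<forall>l\<le>m n. vv n l < ca n s))"
    using t alm_ge[of "s + 2"]
  proof eventually_elim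
    case (elim n)
    have "vv n l < ca n s" if "l \<le> m n" for l
      using lm(2)[OF that] elim ca_mono[OF s(1), of n] by simp
    then show ?case using elim by blast
  qed
  have cx: "cx (wX n) (req s) b (vv n l) y = (if \<forall>z. ?S n z y l then b else LEAST z. \<not> ?S n z y l)" for n b l y
  proof -
    have "sat (tstr UNIV) th (case_nat z (case_nat y (\<lambda>i. de (vv n l) (2 * i))))
      (sgl (map (evc (wX n)) (map C [0..<N])) (wX n) (vv n l)) \<longleftrightarrow> ?S n z y l" for z
      unfolding vv_def by (subst sat_par) (auto simp: N_def case_nat_at)
    then show ?thesis unfolding cx_def s(2) Let_def by simp
  qed
  have L: "sat (tstr SI) (Ex (All th)) (case_nat (cls l) e) E \<longleftrightarrow> (\<exists>y\<in>DD. \<forall>z\<in>DD. alm (\<lambda>n. ?S n (z n) (y n) (l n)))"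
    if l: "l \<in> DD" for l
  proof -
    have "sat (tstr SI) th (case_nat (cls z) (case_nat (cls y) (case_nat (cls l) e))) E \<longleftrightarrow> alm (\<lambda>n. ?S n (z n) (y n) (l n))"
      if "y \<in> DD" "z \<in> DD" for y z
    proof -
      have D: "case_nat z (case_nat y (case_nat l e')) i \<in> DD" for i by (intro case_nat_DD that l e'(1))
      show ?thesis
        using los[OF th, of "case_nat z (case_nat y (case_nat l e'))" C V, OF D]
        unfolding e'(2) V(2) case_nat_cls case_nat_at .
    qed
    then show ?thesis by (simp add: cut_ex cut_all)
  qed
  have key: "sat (tstr SI) (Ex (All th)) (case_nat (cls l) e) E \<longleftrightarrow> alm (\<lambda>n. vv n (l n) \<notin> cQ n s)"
    if l: "l \<in> DD" "alm (\<lambda>n. l n \<le> m n)" for l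
  proof
    assume out: "alm (\<lambda>n. vv n (l n) \<notin> cQ n s)"
    \<comment> \<open>A point where the dropped function jumps beyond \<open>cb n (Suc s)\<close>;
      it is at most \<open>ca n (Suc s)\<close>, also by the default 0, and so lies in the
      cut.\<close>
    define y where "y n = (if \<exists>y\<le>ca n (Suc s). cb n (Suc s) \<le> cx (wX n) (req s) (wb n) (vv n (l n)) y
      then SOME y. y \<le> ca n (Suc s) \<and> cb n (Suc s) \<le> cx (wX n) (req s) (wb n) (vv n (l n)) y else 0)" for n
    have y: "y n \<le> ca n (Suc s)" "\<exists>y\<le>ca n (Suc s). cb n (Suc s) \<le> cx (wX n) (req s) (wb n) (vv n (l n)) y \<Longrightarrow>
      cb n (Suc s) \<le> cx (wX n) (req s) (wb n) (vv n (l n)) (y n)" for n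
      using someI_ex[of "\<lambda>y. y \<le> ca n (Suc s) \<and> cb n (Suc s) \<le> cx (wX n) (req s) (wb n) (vv n (l n)) y"]
      unfolding y_def by auto
    have yD: "y \<in> DD" unfolding DD_def by (intro CollectI exI[of _ "Suc s"]) (simp add: y)
    have "alm (\<lambda>n. ?S n (z n) (y n) (l n))" if zD: "z \<in> DD" for z
    proof -
      obtain u where u: "Suc s \<le> u" "alm (\<lambda>n. z n \<le> ca n u)" using DD_ge[OF zD] by blast
      show ?thesis using out l(2) vs u(2) alm_ge[of "Suc u"]
      proof eventually_elim
        case (elim n)
        have "vv n (l n) < ca n s" "s < n" using elim by auto
        from y(2)[OF cdata(9)[OF this(2,1) elim(1)]]
        have "cb n (Suc s) \<le> cx (wX n) (req s) (wb n) (vv n (l n)) (y n)" .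
        \<comment> \<open>Elements of the cut lie below all right end points, hence below the least
          counterexample.\<close>
        moreover have "z n < cb n (Suc s)"
          using elim ca_less[of u n] ca_cb[of "Suc u" n "Suc s"] u(1) by simp
        ultimately have lt: "z n < cx (wX n) (req s) (wb n) (vv n (l n)) (y n)" by simp
        show ?case
        proof (cases "\<forall>z. ?S n z (y n) (l n)")
          case False
          then have "z n < (LEAST z. \<not> ?S n z (y n) (l n))" using lt unfolding cx by (simp only: if_False)
          from not_less_Least[OF this] show ?thesis by blast
        qed blast
      qed
    qed
    then show "sat (tstr SI) (Ex (All th)) (case_nat (cls l) e) E" unfolding L[OF l(1)] using yD by blast
  next
    assume "sat (tstr SI) (Ex (All th)) (case_nat (cls l) e) E"
    then obtain y where y: "y \<in> DD" "\<And>z. z \<in> DD \<Longrightarrow> alm (\<lambda>n. ?S n (z n) (y n) (l n))" unfolding L[OF l(1)] by blast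
    show "alm (\<lambda>n. vv n (l n) \<notin> cQ n s)"
    proof (rule ccontr)
      assume "\<not> ?thesis"
      then have inn: "alm (\<lambda>n. vv n (l n) \<in> cQ n s)" by (simp add: alm_not)
      obtain u where u: "Suc s \<le> u" "alm (\<lambda>n. y n \<le> ca n u)" using DD_ge[OF y(1)] by blast
      \<comment> \<open>For a retained argument the least counterexample is bounded by
        \<open>cG\<close>, so it stays in the cut; being below \<open>wb n\<close>, it is a genuine
        counterexample and not the default.\<close>
      define z where "z n = cx (wX n) (req s) (wb n) (vv n (l n)) (y n)" for n
      have z1: "alm (\<lambda>n. z n \<le> ca n (Suc u) \<and> \<not> ?S n (z n) (y n) (l n))"
        using inn l(2) vs u(2) alm_ge[of "Suc (Suc u)"]
      proof eventually_elim
        case (elim n)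
        have v: "vv n (l n) < ca n s" "s < n" using elim by auto
        have "z n \<le> cG n (Suc s) (y n)" unfolding z_def using cdata(10)[OF v(2,1) elim(1)] .
        also have "\<dots> \<le> cG n (Suc s) (ca n u)" using elim niceD(2)[OF cdata(4)[of "Suc s" n]] by simp
        also have "\<dots> \<le> cG n u (ca n u)" using elim u(1) by (intro cG_mono) auto
        also have "\<dots> < ca n (Suc u)" using elim by (intro cdata(6)) simp
        finally have zu: "z n < ca n (Suc u)" .
        have "ca n (Suc u) \<le> wb n" using ca_cb[of "Suc u" n 0] elim cdata(2)[of n] by simp
        then have "z n \<noteq> wb n" using zu by simp
        then have nall: "\<not> (\<forall>z. ?S n z (y n) (l n))" unfolding z_def cx by (rule contrapos_nn) (rule if_P)
        then obtain z' where z': "\<not> ?S n z' (y n) (l n)" by blast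
        have "z n = (LEAST z. \<not> ?S n z (y n) (l n))" unfolding z_def cx by (rule if_not_P[OF nall])
        then have "\<not> ?S n (z n) (y n) (l n)" using LeastI[where P = "\<lambda>z. \<not> ?S n z (y n) (l n)", OF z'] by simp
        then show ?case using zu by simp
      qed
      then have "alm (\<lambda>n. z n \<le> ca n (Suc u))" by eventually_elim blast
      then have "z \<in> DD" unfolding DD_def by blast
      from y(2)[OF this] z1 have "alm (\<lambda>n. False)" by eventually_elim blast
      then show False by simp
    qed
  qed
  show ?thesis
  proof (rule ccontr)
    assume "\<not> ?thesis"
    moreover have "alm (\<lambda>n. m n \<le> m n)" by simp
    ultimately have "\<not> alm (\<lambda>n. vv n (m n) \<notin> cQ n s)" unfolding m(2) key[OF m(1) \<open>alm (\<lambda>n. m n \<le> m n)\<close>] by simp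
    then have inn: "alm (\<lambda>n. vv n (m n) \<in> cQ n s)" by (simp add: alm_not)
    \<comment> \<open>Failure of the formula is membership in the internal set
      \<open>cQ n s\<close>, so its first occurrence exists factor by factor. The predecessor then
      contradicts the induction step.\<close>
    define l where "l n = (LEAST l. vv n l \<in> cQ n s)" for n
    have l: "vv n (l n) \<in> cQ n s" "l n \<le> m n" if "vv n (m n) \<in> cQ n s" for n
      unfolding l_def by (rule LeastI[where P = "\<lambda>l. vv n l \<in> cQ n s", OF that], rule Least_le[where P = "\<lambda>l. vv n l \<in> cQ n s", OF that])
    have lm: "alm (\<lambda>n. l n \<le> m n)" using inn by eventually_elim (rule l(2))
    have lD: "l \<in> DD" by (rule DD_le[OF m(1) lm])
    have "alm (\<lambda>n. vv n (l n) \<in> cQ n s)" using inn by eventually_elim (rule l(1))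
    then have nl: "\<not> sat (tstr SI) (Ex (All th)) (case_nat (cls l) e) E"
      unfolding key[OF lD lm] by (simp add: alm_not)
    have "\<not> alm (\<lambda>n. l n = 0)"
    proof
      assume "alm (\<lambda>n. l n = 0)"
      then have e: "cls l = 0" unfolding zero_cut_def by (rule cls_cong[OF _ DD_const])
      show False using nl z unfolding e by (rule notE)
    qed
    then have l0: "alm (\<lambda>n. l n \<noteq> 0)" unfolding alm_not .
    define l' where "l' n = l n - 1" for n
    have l'D: "l' \<in> DD" unfolding l'_def by (rule DD_minus[OF lD])
    have l'm: "alm (\<lambda>n. l' n \<le> m n)" using lm by eventually_elim (simp add: l'_def)
    have "alm (\<lambda>n. vv n (l' n) \<notin> cQ n s)" using l0
    proof eventually_elim
      case (elim n)
      then have "l' n < l n" by (simp add: l'_def)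
      then show ?case unfolding l_def by (rule not_less_Least)
    qed
    then have "sat (tstr SI) (Ex (All th)) (case_nat (cls l') e) E" unfolding key[OF l'D l'm] .
    note st = st[OF this]
    have e: "cls l' + 1 = cls l"
      unfolding one_cut_def cls_plus[OF l'D DD_const]
    proof (rule cls_cong[OF _ lD])
      show "alm (\<lambda>n. l' n + 1 = l n)" using l0 by eventually_elim (simp add: l'_def)
    qed
    show False using nl st unfolding e by (rule notE)
  qed
qed

theorem SI_valid: "p \<in> T0 \<Longrightarrow> valid (tstr SI) p"
proof (rule valid_T0)
  show "p \<in> basic_axioms \<Longrightarrow> valid (tstr SI) p" for p
    by (rule valid_basic[OF cut_less_add1 cut_zero_le])
  show "valid (tstr SI) (induction_axiom p)" if "p \<in> Sigma02" for p
  proof -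
    obtain th where th: "th \<in> Delta00" "p = Ex (All th)" using \<open>p \<in> Sigma02\<close> unfolding Sigma02_def Pi01_def by blast
    show ?thesis unfolding valid_def sat_induction tstr_sel th(2)
    proof (intro allI impI)
      fix e E x
      assume E: "\<forall>n. E n \<in> SI" and z: "sat (tstr SI) (Ex (All th)) (case_nat 0 e) E"
        and st: "\<forall>x. sat (tstr SI) (Ex (All th)) (case_nat x e) E \<longrightarrow> sat (tstr SI) (Ex (All th)) (case_nat (x + 1) e) E"
      show "sat (tstr SI) (Ex (All th)) (case_nat x e) E"
        by (rule sigma2_induction[OF th(1) E z]) (use st in blast)
    qed
  qed
  show "valid (tstr SI) (induction_axiom p)" if "p \<in> Sigma01" for p
  proof -
    obtain p0 where p0: "p0 \<in> Delta00" "p = Ex p0" using \<open>p \<in> Sigma01\<close> unfolding Sigma01_def by blast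
    \<comment> \<open>A \<Sigma>1 formula is treated as a \<Sigma>2 formula whose universal
      quantifier is a dummy.\<close>
    have eq: "sat (tstr SI) (Ex p0) e E \<longleftrightarrow> sat (tstr SI) (Ex (All (shift p0))) e E" for e E
      by (simp only: sat.simps sat_shift simp_thms)
    have th: "shift p0 \<in> Delta00" unfolding shift_def by (rule Delta00_subst[OF p0(1)])
    show ?thesis unfolding valid_def sat_induction tstr_sel p0(2)
    proof (intro allI impI)
      fix e E x
      assume E: "\<forall>n. E n \<in> SI" and z: "sat (tstr SI) (Ex p0) (case_nat 0 e) E"
        and st: "\<forall>x. sat (tstr SI) (Ex p0) (case_nat x e) E \<longrightarrow> sat (tstr SI) (Ex p0) (case_nat (x + 1) e) E"
      show "sat (tstr SI) (Ex p0) (case_nat x e) E"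
        unfolding eq by (rule sigma2_induction[OF th E z[unfolded eq]]) (use st eq in blast)
    qed
  qed
qed (auto intro: valid_comprehension_SI)

lemma SI_ne: "SI \<noteq> {}"
  unfolding SI_def using DD_id by blast

interpretation CR: rca SI
  by unfold_locales (use SI_valid SI_ne in auto)

section \<open>The independence proof\<close>

definition tt :: "cut \<Rightarrow> (nat \<Rightarrow> nat) \<Rightarrow> bool" where "tt x f \<longleftrightarrow> f \<in> DD \<and> x = cls f"
definition tr :: "bool \<Rightarrow> (nat \<Rightarrow> bool) \<Rightarrow> bool" where "tr \<Phi> \<phi> \<longleftrightarrow> (\<Phi> \<longleftrightarrow> alm \<phi>)"
text \<open>Together with \<open>tt\<close> for elements and \<open>tr\<close> for truth values this
  gives transfer by introduction rules along the structure of a bounded predicate, without object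
  formulas.\<close>

definition intl :: "cut set \<Rightarrow> (nat \<Rightarrow> nat set) \<Rightarrow> bool" where
  "intl B Bf \<longleftrightarrow> (\<forall>x f. tt x f \<longrightarrow> tr (x \<in> B) (\<lambda>n. f n \<in> Bf n))"

lemma tt_add: "tt x f \<Longrightarrow> tt y g \<Longrightarrow> tt (x + y) (\<lambda>n. f n + g n)"
  by (auto simp: tt_def cls_plus DD_add)

lemma tt_mult: "tt x f \<Longrightarrow> tt y g \<Longrightarrow> tt (x * y) (\<lambda>n. f n * g n)"
  by (auto simp: tt_def cls_times DD_mult)

lemma tt_one: "tt 1 (\<lambda>n. 1)"
  by (simp add: tt_def one_cut_def DD_const)

lemma tt_zero: "tt 0 (\<lambda>n. 0)"
  by (simp add: tt_def zero_cut_def DD_const)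

lemma tt_cls: "f \<in> DD \<Longrightarrow> tt (cls f) f"
  by (simp add: tt_def)

lemma tt_ex: "\<exists>f. tt x f"
  unfolding tt_def by (meson cut_cases)

lemma tr_less: "tt x f \<Longrightarrow> tt y g \<Longrightarrow> tr (x < y) (\<lambda>n. f n < g n)"
  by (auto simp: tt_def tr_def cls_less)

lemma tr_le: "tt x f \<Longrightarrow> tt y g \<Longrightarrow> tr (x \<le> y) (\<lambda>n. f n \<le> g n)"
  by (auto simp: tt_def tr_def cls_less_eq)

lemma tr_eq: "tt x f \<Longrightarrow> tt y g \<Longrightarrow> tr (x = y) (\<lambda>n. f n = g n)"
  by (auto simp: tt_def tr_def cls_eq)

lemma tr_conj: "tr \<Phi> \<phi> \<Longrightarrow> tr \<Psi> \<psi> \<Longrightarrow> tr (\<Phi> \<and> \<Psi>) (\<lambda>n. \<phi> n \<and> \<psi> n)"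
  unfolding tr_def eventually_conj_iff by simp

lemma tr_imp: "tr \<Phi> \<phi> \<Longrightarrow> tr \<Psi> \<psi> \<Longrightarrow> tr (\<Phi> \<longrightarrow> \<Psi>) (\<lambda>n. \<phi> n \<longrightarrow> \<psi> n)"
  unfolding tr_def alm_imp by simp

lemma tr_not: "tr \<Phi> \<phi> \<Longrightarrow> tr (\<not> \<Phi>) (\<lambda>n. \<not> \<phi> n)"
  unfolding tr_def alm_not by simp

lemma tr_all:
  assumes b: "tt b bf" and \<Phi>: "\<And>x f. tt x f \<Longrightarrow> tr (\<Phi> x) (\<lambda>n. \<phi> n (f n))"
  shows "tr (\<forall>x<b. \<Phi> x) (\<lambda>n. \<forall>x<bf n. \<phi> n x)"
proof -
  have bD: "bf \<in> DD" using b by (simp add: tt_def)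
  have "(\<forall>x<b. \<Phi> x) \<longleftrightarrow> (\<forall>f\<in>DD. cls f < b \<longrightarrow> \<Phi> (cls f))" by (rule cut_all)
  also have "\<dots> \<longleftrightarrow> (\<forall>f\<in>DD. alm (\<lambda>n. f n < bf n \<longrightarrow> \<phi> n (f n)))"
  proof (rule ball_cong[OF HOL.refl])
    fix f assume f: "f \<in> DD"
    show "(cls f < b \<longrightarrow> \<Phi> (cls f)) \<longleftrightarrow> alm (\<lambda>n. f n < bf n \<longrightarrow> \<phi> n (f n))"
      using tr_imp[OF tr_less[OF tt_cls[OF f] b] \<Phi>[OF tt_cls[OF f]]] unfolding tr_def .
  qed
  also have "\<dots> \<longleftrightarrow> alm (\<lambda>n. \<forall>x<bf n. \<phi> n x)" by (rule alm_all[OF bD])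
  finally show ?thesis unfolding tr_def .
qed

lemma tr_allle:
  assumes b: "tt b bf" and \<Phi>: "\<And>x f. tt x f \<Longrightarrow> tr (\<Phi> x) (\<lambda>n. \<phi> n (f n))"
  shows "tr (\<forall>x\<le>b. \<Phi> x) (\<lambda>n. \<forall>x\<le>bf n. \<phi> n x)"
  using tr_all[OF tt_add[OF b tt_one], where \<Phi> = \<Phi> and \<phi> = \<phi>, OF \<Phi>] unfolding cut_less_add1 by (simp add: less_Suc_eq_le)

lemma tr_exle:
  assumes b: "tt b bf" and \<Phi>: "\<And>x f. tt x f \<Longrightarrow> tr (\<Phi> x) (\<lambda>n. \<phi> n (f n))"
  shows "tr (\<exists>x\<le>b. \<Phi> x) (\<lambda>n. \<exists>x\<le>bf n. \<phi> n x)"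
  using tr_not[OF tr_allle[OF b, where \<Phi> = "\<lambda>x. \<not> \<Phi> x" and \<phi> = "\<lambda>n x. \<not> \<phi> n x", OF tr_not[OF \<Phi>]]] by simp

lemma tr_mem: "intl B Bf \<Longrightarrow> tt x f \<Longrightarrow> tr (x \<in> B) (\<lambda>n. f n \<in> Bf n)"
  by (simp add: intl_def)

lemma tr_bs: "intl B Bf \<Longrightarrow> tt m mf \<Longrightarrow> tt b bf \<Longrightarrow> tr (bs B m b) (\<lambda>n. bs (Bf n) (mf n) (bf n))"
  unfolding bs_def by (intro tr_conj tr_mem tr_le tr_allle tr_imp)

lemma tr_sS: "intl B Bf \<Longrightarrow> tt m mf \<Longrightarrow> tt b bf \<Longrightarrow> tr (sS B m b) (\<lambda>n. sS (Bf n) (mf n) (bf n))"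
  unfolding CR.sS_iff NR.sS_iff by (intro tr_conj tr_mem tr_less tr_all tr_imp tr_not)

lemma tr_slessS: "intl B Bf \<Longrightarrow> tt m mf \<Longrightarrow> tt b bf \<Longrightarrow> tr (slessS m B b) (\<lambda>n. slessS (mf n) (Bf n) (bf n))"
  unfolding CR.slessS_iff NR.slessS_iff by (intro tr_allle tr_not tr_sS)

lemma tr_smin: "intl B Bf \<Longrightarrow> tt b bf \<Longrightarrow> tr (smin B b) (\<lambda>n. smin (Bf n) (bf n))"
  unfolding CR.smin_iff NR.smin_iff by (intro tr_conj tr_mem tr_all tr_not)

lemma tr_adm: "intl C Cf \<Longrightarrow> tt u uf \<Longrightarrow> tt y yf \<Longrightarrow> tt z zf \<Longrightarrow> tt c cf \<Longrightarrow>
  tr (adm C u y z c) (\<lambda>n. adm (Cf n) (uf n) (yf n) (zf n) (cf n))"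
  unfolding adm_def by (intro tr_conj tr_less tr_slessS tt_add tt_mult)

lemma tr_least_adm: "intl C Cf \<Longrightarrow> tt u uf \<Longrightarrow> tt y yf \<Longrightarrow> tt z zf \<Longrightarrow> tt c cf \<Longrightarrow>
  tr (least_adm C u y z c) (\<lambda>n. least_adm (Cf n) (uf n) (yf n) (zf n) (cf n))"
  unfolding least_adm_def by (intro tr_conj tr_mem tr_adm tr_all tr_imp tr_not)

lemma tr_stepgb:
  assumes B: "intl B Bf" and C: "intl C Cf" and m: "tt m mf"
    and g: "\<And>x f. tt x f \<Longrightarrow> tt (g x) (\<lambda>n. gf n (f n))"
  shows "tr (stepgb B C g m) (\<lambda>n. stepgb (Bf n) (Cf n) (gf n) (mf n))"
  unfolding stepgb_def
  by (intro tr_conj tr_imp tr_allle tr_exle tr_not tr_mem[OF B] tr_bs[OF B] tr_least_adm[OF C] tr_eq tr_less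
      tt_add tt_mult tt_one g m)

lemma stepg_of_stepgb: "stepgb B C g m \<Longrightarrow> stepg B C g m"
  unfolding stepgb_def stepg_def by blast

lemma stepgb_ext:
  assumes eq: "\<And>x. x \<le> m \<Longrightarrow> g x = h x" and g: "stepgb B C g m"
  shows "stepgb B C h m"
  unfolding stepgb_def
proof (intro conjI impI allI)
  assume "\<forall>x\<le>m. x \<notin> B"
  then show "h m = m" using g eq[of m] unfolding stepgb_def by simp
next
  fix b f r m' assume a: "b \<le> m" "f \<le> m" "r \<le> m" "m' \<le> m" "bs B m b \<and> m = b * f + r \<and> r < b \<and> m' + 1 = m"
  have "\<exists>c\<le>g m. least_adm C (g m') (g f) (g r) c \<and> g m = c * g f + g r"
    using conjunct2[OF g[unfolded stepgb_def], rule_format, OF a] .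
  then show "\<exists>c\<le>h m. least_adm C (h m') (h f) (h r) c \<and> h m = c * h f + h r"
    unfolding eq[OF order_refl] eq[OF a(2)] eq[OF a(3)] eq[OF a(4)] .
qed

lemma en_le: "en a d i \<le> a"
  by (simp add: en_def)

text \<open>Quotient and remainder of each factor are at most \<open>af\<close>, so both lie in the
  cut and witness the division there.\<close>

lemma tt_ent:
  assumes a: "tt a af" and d: "tt d df" and x: "tt x f"
  shows "tt (CR.ent a d x) (\<lambda>n. en (af n) (df n) (f n))"
proof -
  have D: "(\<lambda>n. en (af n) (df n) (f n)) \<in> DD" "(\<lambda>n. af n div (1 + (f n + 1) * df n)) \<in> DD"
    using a by (auto simp: tt_def intro: DD_le'[of af] en_le div_le_dividend)
  note t = tt_cls[OF D(1)] tt_cls[OF D(2)]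
  let ?v = "cls (\<lambda>n. en (af n) (df n) (f n))" and ?q = "cls (\<lambda>n. af n div (1 + (f n + 1) * df n))"
  have "tr (?v < 1 + (x + 1) * d) (\<lambda>n. en (af n) (df n) (f n) < 1 + (f n + 1) * df n)"
    by (intro tr_less tt_add tt_mult tt_one t x d)
  moreover have "alm (\<lambda>n. en (af n) (df n) (f n) < 1 + (f n + 1) * df n)"
    unfolding en_def by (intro always_eventually allI mod_less_divisor) simp
  ultimately have 1: "?v < 1 + (x + 1) * d" unfolding tr_def by blast
  have "tr (a = ?q * (1 + (x + 1) * d) + ?v)
    (\<lambda>n. af n = (af n div (1 + (f n + 1) * df n)) * (1 + (f n + 1) * df n) + en (af n) (df n) (f n))"
    by (intro tr_eq tt_add tt_mult tt_one t x d a)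
  then have 2: "a = ?q * (1 + (x + 1) * d) + ?v" unfolding tr_def en_def div_mult_mod_eq by simp
  from 1 2 have "sentry a d x ?v" unfolding sentry_def by blast
  then show ?thesis using t(1) unfolding CR.sentry_iff by simp
qed

section \<open>The dynamical hierarchy inside the cut\<close>

definition XI :: "cut set" where "XI = setI CX (\<lambda>n. 0)"

lemma XI_SI: "XI \<in> SI"
  unfolding XI_def SI_def using DD_const by blast

lemma intl_mb: "tt i f \<Longrightarrow> intl (mb XI i) (\<lambda>n. mb (wX n) (f n))"
  unfolding intl_def
proof (intro allI impI)
  fix x xf assume i: "tt i f" and x: "tt x xf"
  have t: "tt ((x + i) * (x + i) + x) (\<lambda>n. (xf n + f n) * (xf n + f n) + xf n)"
    by (intro tt_add tt_mult i x)
  then have "(x + i) * (x + i) + x \<in> XI \<longleftrightarrow> alm (\<lambda>n. (xf n + f n) * (xf n + f n) + xf n \<in> wX n)"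
    unfolding tt_def XI_def using cls_setI[of _ CX "\<lambda>n. 0"] by simp
  then show "tr (x \<in> mb XI i) (\<lambda>n. xf n \<in> mb (wX n) (f n))" unfolding tr_def mb_def by simp
qed

lemma wfacts:
  "smin (mb (wX n) i) (wP n i)" "wP n i \<le> wP n (i + 1)" "wP n i \<le> kk n + hf i + 1"
  "b \<in> mb (wX n) i \<Longrightarrow> 2 \<le> b \<and> kk n \<le> b \<and> (\<exists>s\<le>b * kk n. sS (mb (wX n) i) b s \<and> (\<exists>z\<le>s. s = b * z))"
  "stepgb (mb (wX n) i) (mb (wX n) (i + 1)) (wg n i) m"
  "wg n i m \<le> m * ((kk n + hf i + 1) * kk n ^ i)"
  "b + 1 \<in> mb (wX n) i \<Longrightarrow> wP n i < b + 1 \<Longrightarrow> wP n (i + 1) \<le> wg n i b"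
  "b + 1 \<in> mb (wX n) i \<Longrightarrow> wP n i < b + 1 \<Longrightarrow> bs (mb (wX n) (i + 1)) (wg n i b) c \<Longrightarrow> wg n i b < c * z \<Longrightarrow>
    slessS (c * z) (mb (wX n) (i + 1)) (wg n i b) \<Longrightarrow> False"
  "wP n 0 = kk n" "wr n 0 = kk n * 2 * kk n + (kk n - 1)" "i \<le> wT n \<Longrightarrow> 0 < wr n i"
  "i < wT n \<Longrightarrow> wr n (i + 1) + 1 = wg n i (wr n i)"
  using wdata(1)[of n] unfolding world_def by (simp_all only:)

lemma DD_P: "i \<in> DD \<Longrightarrow> (\<lambda>n. wP n (i n)) \<in> DD"
proof (rule DD_le')
  assume i: "i \<in> DD"
  show "(\<lambda>n. kk n + hf (i n) + 1) \<in> DD" by (intro DD_add DD_kk DD_hf i DD_const)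
qed (rule wfacts)

text \<open>Bounds the upgrades of all arguments up to \<open>m\<close>, see \<open>wg_yb\<close>;
  the summand \<open>x * (x + x + 1) * x ^ x\<close> of \<open>hf\<close> was included for this
  purpose.\<close>

definition yb :: "(nat \<Rightarrow> nat) \<Rightarrow> (nat \<Rightarrow> nat) \<Rightarrow> nat \<Rightarrow> nat" where
  "yb i m n = hf (max (m n) (kk n + hf (i n) + 1))"

lemma DD_yb: "i \<in> DD \<Longrightarrow> m \<in> DD \<Longrightarrow> yb i m \<in> DD"
  unfolding yb_def by (intro DD_hf DD_max DD_add DD_kk DD_const)

lemma wg_yb: "x \<le> m n \<Longrightarrow> wg n (i n) x \<le> yb i m n"
proof -
  assume x: "x \<le> m n"
  let ?y = "max (m n) (kk n + hf (i n) + 1)"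
  have iy: "i n \<le> ?y" using niceD(1)[OF nice_hf, of "i n"] by simp
  have "kk n ^ i n \<le> ?y ^ i n" by (intro power_mono) auto
  also have "\<dots> \<le> ?y ^ ?y" using iy by (intro power_increasing) auto
  finally have p: "kk n ^ i n \<le> ?y ^ ?y" .
  have "wg n (i n) x \<le> x * ((kk n + hf (i n) + 1) * kk n ^ i n)" by (rule wfacts)
  also have "\<dots> \<le> ?y * ((?y + ?y + 1) * ?y ^ ?y)" using x by (intro mult_le_mono p) auto
  also have "\<dots> \<le> yb i m n" unfolding yb_def using hf_ge[of ?y] by (simp only: mult.assoc)
  finally show ?thesis .
qed

lemma DD_wg: "i \<in> DD \<Longrightarrow> m \<in> DD \<Longrightarrow> (\<lambda>n. wg n (i n) (m n)) \<in> DD"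
  by (rule DD_le'[OF DD_yb[of i m]]) (auto intro: wg_yb)

text \<open>Codes are bounded by \<open>Kbeta\<close>, which is a summand of \<open>hf\<close>, so
  the upgrade function up to \<open>m\<close> has a code in the cut.\<close>

lemma supn_codes:
  assumes i: "i \<in> DD" and m: "m \<in> DD"
  obtains a d where "a \<in> DD" "d \<in> DD" "\<And>n x. x \<le> m n \<Longrightarrow> en (a n) (d n) x = wg n (i n) x"
proof -
  have "\<exists>a\<le>Kbeta (yb i m n). \<exists>d\<le>Kbeta (yb i m n). \<forall>x\<le>m n. en a d x = wg n (i n) x" for n
  proof -
    \<comment> \<open>Beyond \<open>m n\<close> the sequence is set to 0, so that all its entries up
      to \<open>?y\<close> are at most \<open>?y\<close>, as \<open>Kbeta\<close> requires.\<close>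
    let ?y = "yb i m n" and ?f = "\<lambda>x. if x \<le> m n then wg n (i n) x else 0"
    have my: "m n \<le> ?y"
      unfolding yb_def using niceD(1)[OF nice_hf, of "max (m n) (kk n + hf (i n) + 1)"] by simp
    have "?f x \<le> ?y" for x using wg_yb[of x m n i] by simp
    from Kbeta[of ?y ?f, OF this] obtain a d where
      ad: "a \<le> Kbeta ?y" "d \<le> Kbeta ?y" "\<forall>x\<le>?y. en a d x = ?f x" by blast
    have "\<forall>x\<le>m n. en a d x = wg n (i n) x" using ad(3) my by simp
    then show ?thesis using ad(1,2) by blast
  qed
  then obtain a d where ad: "\<And>n. a n \<le> Kbeta (yb i m n)" "\<And>n. d n \<le> Kbeta (yb i m n)"
    "\<And>n x. x \<le> m n \<Longrightarrow> en (a n) (d n) x = wg n (i n) x" by metis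
  have K: "Kbeta (yb i m n) \<le> hf (yb i m n)" for n using hf_ge[of "yb i m n"] by linarith
  note D = DD_hf[OF DD_yb[OF i m]]
  show ?thesis
    by (rule that[of a d, OF DD_le'[OF D] DD_le'[OF D] ad(3)]) (auto intro: order_trans[OF ad(1) K] order_trans[OF ad(2) K])
qed

lemma RB_XI:
  assumes i: "i \<in> DD" shows "CR.RB (cls kk) (mb XI (cls i))"
proof -
  let ?B = "mb XI (cls i)"
  note B = intl_mb[OF tt_cls[OF i]] and k = tt_cls[OF DD_kk]
  have ne: "cls (\<lambda>n. wP n (i n)) \<in> ?B"
  proof -
    have "alm (\<lambda>n. wP n (i n) \<in> mb (wX n) (i n))"
      using wfacts(1) unfolding smin_def by (intro always_eventually) blast
    then show ?thesis using tr_mem[OF B tt_cls[OF DD_P[OF i]]] unfolding tr_def by blast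
  qed
  have mem: "2 \<le> b \<and> cls kk \<le> b \<and> (\<exists>s\<le>b * cls kk. sS ?B b s \<and> (\<exists>z\<le>s. s = b * z))" if b: "b \<in> ?B" for b
  proof -
    obtain bf where bf: "tt b bf" using tt_ex by blast
    have "tr (b \<in> ?B \<longrightarrow> 1 + 1 \<le> b \<and> cls kk \<le> b \<and> (\<exists>s\<le>b * cls kk. sS ?B b s \<and> (\<exists>z\<le>s. s = b * z)))
      (\<lambda>n. bf n \<in> mb (wX n) (i n) \<longrightarrow> 1 + 1 \<le> bf n \<and> kk n \<le> bf n \<and>
        (\<exists>s\<le>bf n * kk n. sS (mb (wX n) (i n)) (bf n) s \<and> (\<exists>z\<le>s. s = bf n * z)))"
      by (intro tr_imp tr_conj tr_mem[OF B] tr_le tr_exle tr_sS[OF B] tr_eq tt_mult tt_add tt_one k bf)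
    moreover have "alm (\<lambda>n. bf n \<in> mb (wX n) (i n) \<longrightarrow> 1 + 1 \<le> bf n \<and> kk n \<le> bf n \<and>
        (\<exists>s\<le>bf n * kk n. sS (mb (wX n) (i n)) (bf n) s \<and> (\<exists>z\<le>s. s = bf n * z)))"
      using wfacts(4) unfolding one_add_one by (intro always_eventually allI impI)
    ultimately show ?thesis using b unfolding tr_def one_add_one by blast
  qed
  have S: "?B \<in> SI" by (rule CR.mb_SS[OF XI_SI])
  have "shier ?B"
    unfolding shier_def
  proof (intro conjI allI impI)
    show "\<exists>x. x \<in> ?B" using ne by blast
    show "x \<noteq> 0" "x \<noteq> 1" if "x \<in> ?B" for x
      using conjunct1[OF mem[OF that]] CR.two_le[of x] by auto
    show "\<exists>q. s = b * q" if "b \<in> ?B" "sS ?B b s" for b s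
      using mem[OF that(1)] CR.sS_unique[OF that(2)] by blast
  qed
  moreover have "\<exists>s. sS ?B b s \<and> s \<le> b * cls kk" if "b \<in> ?B" for b using mem[OF that] by blast
  moreover have "cls kk \<le> b" if "b \<in> ?B" for b using mem[OF that] by blast
  ultimately show ?thesis unfolding CR.RB_def using S by blast
qed

text \<open>The codes of the factors satisfy the upgrade clause in the model by transfer. Uniqueness
  of the values then identifies the upgrade of the model with that of the factors.\<close>

lemma supn_cls:
  assumes i: "i \<in> DD" and m: "m \<in> DD"
  shows "CR.supn (mb XI (cls i)) (mb XI (cls i + 1)) (cls m) v \<longleftrightarrow> v = cls (\<lambda>n. wg n (i n) (m n))"
proof -
  obtain a d where ad: "a \<in> DD" "d \<in> DD" "\<And>n x. x \<le> m n \<Longrightarrow> en (a n) (d n) x = wg n (i n) x"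
    using supn_codes[OF i m] by blast
  note B = intl_mb[OF tt_cls[OF i]] and C = intl_mb[OF tt_add[OF tt_cls[OF i] tt_one]]
  note e = tt_ent[OF tt_cls[OF ad(1)] tt_cls[OF ad(2)]]
  have st: "stepg (mb XI (cls i)) (mb XI (cls i + 1)) (CR.ent (cls a) (cls d)) x" if x: "x \<le> cls m" for x
  proof -
    obtain f where f: "tt x f" using tt_ex by blast
    have "alm (\<lambda>n. f n \<le> m n)" using x tr_le[OF f tt_cls[OF m]] unfolding tr_def by blast
    then have "alm (\<lambda>n. stepgb (mb (wX n) (i n)) (mb (wX n) (i n + 1)) (en (a n) (d n)) (f n))"
    proof eventually_elim
      case (elim n)
      show ?case by (rule stepgb_ext[OF _ wfacts(5)]) (use ad(3) elim in simp)
    qed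
    then have "stepgb (mb XI (cls i)) (mb XI (cls i + 1)) (CR.ent (cls a) (cls d)) x"
      using tr_stepgb[OF B C f, where g = "CR.ent (cls a) (cls d)" and gf = "\<lambda>n. en (a n) (d n)", OF e] unfolding tr_def by blast
    then show ?thesis by (rule stepg_of_stepgb)
  qed
  have val: "CR.ent (cls a) (cls d) (cls m) = cls (\<lambda>n. wg n (i n) (m n))"
    using e[OF tt_cls[OF m]] ad(3) unfolding tt_def by simp
  show ?thesis
  proof
    assume "CR.supn (mb XI (cls i)) (mb XI (cls i + 1)) (cls m) v"
    from CR.supn_ent[OF RB_XI[OF i] this st] show "v = cls (\<lambda>n. wg n (i n) (m n))" unfolding val .
  next
    assume v: "v = cls (\<lambda>n. wg n (i n) (m n))"
    show "CR.supn (mb XI (cls i)) (mb XI (cls i + 1)) (cls m) v"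
      unfolding CR.supn_def by (rule exI[of _ "cls a"], rule exI[of _ "cls d"]) (use st val v in blast)
  qed
qed

lemma smin_XI: "i \<in> DD \<Longrightarrow> smin (mb XI (cls i)) (cls (\<lambda>n. wP n (i n)))"
  using tr_smin[OF intl_mb[OF tt_cls] tt_cls[OF DD_P], of i i] wfacts(1) unfolding tr_def by simp

text \<open>A violation of the third condition consists of finitely many elements of the cut subject
  to bounded conditions; it would transfer to almost all factors and contradict
  \<open>wfacts(8)\<close>.\<close>

lemma good_XI:
  assumes i: "i \<in> DD"
  shows "sgood (mb XI (cls i)) (mb XI (cls i + 1))"
proof -
  let ?B = "mb XI (cls i)" and ?C = "mb XI (cls i + 1)"
  have i1: "(\<lambda>n. i n + 1) \<in> DD" by (intro DD_add i DD_const)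
  have ci: "cls i + 1 = cls (\<lambda>n. i n + 1)" unfolding one_cut_def by (rule cls_plus[OF i DD_const])
  note B = intl_mb[OF tt_cls[OF i]] and C = intl_mb[OF tt_add[OF tt_cls[OF i] tt_one]]
  note mB = smin_XI[OF i] and mC = smin_XI[OF i1, folded ci]
  have "False" if b: "b \<in> ?B" "smin ?B p" "p < b" and x: "m + 1 = b" "CR.supn ?B ?C m x" "sbase ?C x c"
    and y: "y = c * q" "x < y" "slessS y ?C x" for b p m x c y q
  proof -
    obtain mf where mf: "tt m mf" using tt_ex by blast
    then have mD: "mf \<in> DD" "m = cls mf" by (simp_all add: tt_def)
    have xx: "x = cls (\<lambda>n. wg n (i n) (mf n))" using x(2) supn_cls[OF i mD(1)] unfolding mD(2) by blast
    have xt: "tt x (\<lambda>n. wg n (i n) (mf n))" unfolding xx by (rule tt_cls[OF DD_wg[OF i mD(1)]])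
    have "p = cls (\<lambda>n. wP n (i n))" by (rule CR.smin_unique[OF b(2) mB])
    then have pt: "tt p (\<lambda>n. wP n (i n))" using tt_cls[OF DD_P[OF i]] by simp
    have "tr (m + 1 \<in> ?B \<and> p < m + 1) (\<lambda>n. mf n + 1 \<in> mb (wX n) (i n) \<and> wP n (i n) < mf n + 1)"
      by (intro tr_conj tr_mem[OF B] tr_less tt_add tt_one mf pt)
    then have a1: "alm (\<lambda>n. mf n + 1 \<in> mb (wX n) (i n) \<and> wP n (i n) < mf n + 1)"
      using b(1,3) x(1) unfolding tr_def by blast
    have "alm (\<lambda>n. wP n (i n + 1) \<le> wg n (i n) (mf n))"
      using a1 by eventually_elim (use wfacts(7) in blast)
    then have le: "cls (\<lambda>n. wP n (i n + 1)) \<le> x"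
      using tr_le[OF tt_cls[OF DD_P[OF i1]] xt] unfolding tr_def by blast
    have bs: "bs ?C x c" using CR.sbase_iff[OF mC le] x(3) by blast
    obtain cf qf where c: "tt c cf" "tt q qf" using tt_ex by metis
    have "tr (bs ?C x c \<and> x < c * q \<and> slessS (c * q) ?C x)
      (\<lambda>n. bs (mb (wX n) (i n + 1)) (wg n (i n) (mf n)) (cf n) \<and> wg n (i n) (mf n) < cf n * qf n \<and>
        slessS (cf n * qf n) (mb (wX n) (i n + 1)) (wg n (i n) (mf n)))"
      by (intro tr_conj tr_bs[OF C] tr_less tr_slessS[OF C] tt_mult c xt)
    then have "alm (\<lambda>n. bs (mb (wX n) (i n + 1)) (wg n (i n) (mf n)) (cf n) \<and> wg n (i n) (mf n) < cf n * qf n \<and>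
        slessS (cf n * qf n) (mb (wX n) (i n + 1)) (wg n (i n) (mf n)))"
      using bs y unfolding tr_def by blast
    with a1 have "alm (\<lambda>n. False)" by eventually_elim (use wfacts(8) in blast)
    then show False by simp
  qed
  then have 3: "\<forall>b. b \<in> ?B \<and> (\<exists>p. smin ?B p \<and> p < b) \<longrightarrow>
       (\<forall>n x c. n + 1 = b \<and> CR.supn ?B ?C n x \<and> sbase ?C x c \<longrightarrow>
         \<not> (\<exists>y. (\<exists>q. y = c * q) \<and> x < y \<and> slessS y ?C x))" by blast
  have "alm (\<lambda>n. wP n (i n) \<le> wP n (i n + 1))" using wfacts(2) by (intro always_eventually allI)
  then have "cls (\<lambda>n. wP n (i n)) \<le> cls (\<lambda>n. wP n (i n + 1))"
    using tr_le[OF tt_cls[OF DD_P[OF i]] tt_cls[OF DD_P[OF i1]]] unfolding tr_def by blast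
  then have 1: "\<exists>p q. smin ?B p \<and> smin ?C q \<and> p \<le> q" using mB mC by blast
  have 2: "\<forall>n. \<exists>v. CR.supn ?B ?C n v"
    unfolding cut_all by (intro ballI exI, rule iffD2[OF supn_cls[OF i] HOL.refl])
  show ?thesis unfolding sgood_def CR.supg_iff[OF RB_XI[OF i]] using 1 2 3 by (intro conjI)
qed

lemma dyn_XI: "sdyn XI"
  unfolding sdyn_def cut_all
  by (intro ballI conjI good_XI) (use RB_XI in \<open>auto simp: CR.RB_def\<close>)

text \<open>Up to time \<open>wT n\<close>, which lies above the cut, the real runs do not terminate. A code in the
  model of a terminating run would have to deviate from the real run for the first time.\<close>

lemma not_sterm: "\<not> sterm SI (cls kk)"
proof
  assume st: "sterm SI (cls kk)"
  define N where "N n = kk n * 2 * kk n + (kk n - 1)" for n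
  have ND: "N \<in> DD" unfolding N_def by (intro DD_add DD_mult DD_minus DD_kk DD_const)
  have z: "(0::cut) = cls (\<lambda>n. 0)" by (rule zero_cut_def)
  have m0: "smin (mb XI 0) (cls kk)" using smin_XI[OF DD_const[of 0]] unfolding z wfacts(9) .
  have "\<forall>b. b \<in> mb XI 0 \<longrightarrow> (\<exists>s. sS (mb XI 0) b s \<and> s \<le> b * cls kk)"
    using RB_XI[OF DD_const[of 0]] unfolding z CR.RB_def by blast
  then have "\<exists>p. smin (mb XI 0) p \<and> p \<le> cls kk \<and> (\<forall>b. b \<in> mb XI 0 \<longrightarrow> (\<exists>s. sS (mb XI 0) b s \<and> s \<le> b * p))"
    using m0 by blast
  then have "\<forall>n. \<exists>i. sgs XI n i 0" using st[unfolded sterm_def] XI_SI dyn_XI by blast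
  then obtain i where "sgs XI (cls N) i 0" by blast
  then obtain a d where s0: "sentry a d 0 (cls N)"
    and step: "\<forall>j. j < i \<longrightarrow> (\<exists>u w. sentry a d j u \<and> sentry a d (j + 1) w \<and>
       ((0 < u \<and> supg (mb XI j) (mb XI (j + 1)) u (w + 1)) \<or> (u = 0 \<and> w = 0)))"
    and si: "sentry a d i 0" unfolding sgs_def by (elim exE conjE)
  obtain af df f where t: "tt a af" "tt d df" "tt i f" using tt_ex by metis
  note e = tt_ent[OF t(1,2)]
  have "alm (\<lambda>n. N n = en (af n) (df n) 0)"
    using tr_eq[OF tt_cls[OF ND] e[OF tt_zero]] s0 unfolding CR.sentry_iff tr_def by blast
  then have e0: "alm (\<lambda>n. en (af n) (df n) 0 = wr n 0)" by eventually_elim (simp add: N_def wfacts(10))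
  have ei: "alm (\<lambda>n. 0 = en (af n) (df n) (f n))"
    using tr_eq[OF tt_zero e[OF t(3)]] si unfolding CR.sentry_iff tr_def by blast
  have fD: "f \<in> DD" "i = cls f" using t(3) by (simp_all add: tt_def)
  obtain s where s: "alm (\<lambda>n. f n \<le> ca n s)" using fD unfolding DD_def by blast
  \<comment> \<open>Left end points lie below \<open>wb n\<close>, and \<open>wb n\<close> is at
    most the length of the run in the factor.\<close>
  have fT: "alm (\<lambda>n. f n \<le> wT n)" using s alm_ge[of s]
  proof eventually_elim
    case (elim n)
    then show ?case using ca_cb[of s n 0] cdata(2)[of n] wdata(2)[of n] by simp
  qed
  have "\<not> alm (\<lambda>n. \<forall>j\<le>f n. en (af n) (df n) j = wr n j)"
  proof
    assume "alm (\<lambda>n. \<forall>j\<le>f n. en (af n) (df n) j = wr n j)"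
    with ei fT have "alm (\<lambda>n. False)"
    proof eventually_elim
      case (elim n)
      then have "wr n (f n) = 0" by simp
      then show ?case using wfacts(11)[OF elim(2)] by simp
    qed
    then show False by simp
  qed
  then have ex: "alm (\<lambda>n. \<exists>j\<le>f n. en (af n) (df n) j \<noteq> wr n j)"
    unfolding alm_not[symmetric] by eventually_elim blast
  define j where "j n = (LEAST j. en (af n) (df n) j \<noteq> wr n j)" for n
  have j: "j n \<le> f n" "en (af n) (df n) (j n) \<noteq> wr n (j n)" if "\<exists>j\<le>f n. en (af n) (df n) j \<noteq> wr n j" for n
  proof -
    from that obtain u where u: "u \<le> f n" "en (af n) (df n) u \<noteq> wr n u" by blast
    show "en (af n) (df n) (j n) \<noteq> wr n (j n)"
      unfolding j_def by (rule LeastI[where P = "\<lambda>j. en (af n) (df n) j \<noteq> wr n j", OF u(2)])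
    have "j n \<le> u" unfolding j_def by (rule Least_le[where P = "\<lambda>j. en (af n) (df n) j \<noteq> wr n j", OF u(2)])
    then show "j n \<le> f n" using u(1) by simp
  qed
  have jl: "en (af n) (df n) u = wr n u" if "u < j n" for u n
    using not_less_Least[of u "\<lambda>j. en (af n) (df n) j \<noteq> wr n j"] that unfolding j_def by blast
  \<comment> \<open>The index just before the first deviation: there the code agrees with the real
    run, and the model performs the same upgrade as the factor, so the next entries agree as
    well.\<close>
  define l where "l n = j n - 1" for n
  have lf: "alm (\<lambda>n. l n + 1 = j n \<and> l n < f n)" using ex e0
  proof eventually_elim
    case (elim n)
    have "j n \<noteq> 0" using j(2)[OF elim(1)] elim(2) by metis
    then show ?case using j(1)[OF elim(1)] by (simp add: l_def)
  qed
  have "alm (\<lambda>n. l n \<le> f n)" using lf by eventually_elim simp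
  then have lD: "l \<in> DD" by (rule DD_le[OF fD(1)])
  have "alm (\<lambda>n. l n < f n)" using lf by eventually_elim simp
  then have "cls l < i" unfolding fD(2) cls_less[OF lD fD(1)] .
  from step[rule_format, OF this] obtain u w where uw: "u = CR.ent a d (cls l)" "w = CR.ent a d (cls l + 1)"
    "(0 < u \<and> supg (mb XI (cls l)) (mb XI (cls l + 1)) u (w + 1)) \<or> (u = 0 \<and> w = 0)"
    unfolding CR.sentry_iff by (elim exE conjE)
  have ut: "tt u (\<lambda>n. en (af n) (df n) (l n))" and wt: "tt w (\<lambda>n. en (af n) (df n) (l n + 1))"
    unfolding uw(1,2) by (intro e tt_add tt_one tt_cls lD)+
  have el: "alm (\<lambda>n. en (af n) (df n) (l n) = wr n (l n) \<and> l n < wT n)" using lf fT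
  proof eventually_elim
    case (elim n)
    then show ?case using jl[of "l n" n] by simp
  qed
  have ej: "alm (\<lambda>n. en (af n) (df n) (l n + 1) \<noteq> wr n (l n + 1))" using lf ex
  proof eventually_elim
    case (elim n)
    then show ?case using j(2)[OF elim(2)] by simp
  qed
  from uw(3) show False
  proof
    assume "u = 0 \<and> w = 0"
    then have "alm (\<lambda>n. en (af n) (df n) (l n) = 0)" using tr_eq[OF ut tt_zero] unfolding tr_def by blast
    with el have "alm (\<lambda>n. False)"
    proof eventually_elim
      case (elim n)
      then show ?case using wfacts(11)[of "l n" n] by simp
    qed
    then show False by simp
  next
    assume "0 < u \<and> supg (mb XI (cls l)) (mb XI (cls l + 1)) u (w + 1)"
    then have s: "CR.supn (mb XI (cls l)) (mb XI (cls l + 1)) u (w + 1)"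
      unfolding CR.supg_iff[OF RB_XI[OF lD]] by blast
    have uD: "(\<lambda>n. en (af n) (df n) (l n)) \<in> DD" "u = cls (\<lambda>n. en (af n) (df n) (l n))" using ut by (simp_all add: tt_def)
    have "w + 1 = cls (\<lambda>n. wg n (l n) (en (af n) (df n) (l n)))"
      using s unfolding uD(2) supn_cls[OF lD uD(1)] .
    then have "alm (\<lambda>n. en (af n) (df n) (l n + 1) + 1 = wg n (l n) (en (af n) (df n) (l n)))"
      using tr_eq[OF tt_add[OF wt tt_one] tt_cls[OF DD_wg[OF lD uD(1)]]] unfolding tr_def by blast
    with el ej have "alm (\<lambda>n. False)"
    proof eventually_elim
      case (elim n)
      then show ?case using wfacts(12)[of "l n" n] by simp
    qed
    then show False by simp
  qed
qed

theorem theorem8p6: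
  shows "(\<forall>k\<ge>2. RCA0 \<union> Sigma02_IND \<turnstile> sentence (goodstein_termination (numeral_of k))) \<and>
    \<not> (RCA0 \<union> Sigma02_IND \<turnstile> sentence (\<^bold>\<forall>k. numeral_of 2 \<^bold>\<le> k \<^bold>\<longrightarrow> goodstein_termination k))"
proof (intro conjI allI impI notI)
  show "T0 \<turnstile> sentence (goodstein_termination (numeral_of k))" for k by (rule provable)
next
  assume "T0 \<turnstile> sentence (\<^bold>\<forall>k. numeral_of 2 \<^bold>\<le> k \<^bold>\<longrightarrow> goodstein_termination k)"
  then have "deriv T0 [] (sentence (\<^bold>\<forall>k. numeral_of 2 \<^bold>\<le> k \<^bold>\<longrightarrow> goodstein_termination k))"
    unfolding proves_def .
  from soundness[OF this SI_valid, of "\<lambda>_. XI" "\<lambda>_. 0"]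
  have "sat (tstr SI) (sentence (\<^bold>\<forall>k. numeral_of 2 \<^bold>\<le> k \<^bold>\<longrightarrow> goodstein_termination k)) (\<lambda>_. 0) (\<lambda>_. XI)"
    using XI_SI by simp
  then have "\<forall>k\<ge>2. sterm SI k" unfolding hoas.sat_all_termination .
  moreover have "(2::cut) \<le> cls kk"
  proof -
    have "tr (1 + 1 \<le> cls kk) (\<lambda>n. 1 + 1 \<le> kk n)" by (intro tr_le tt_add tt_one tt_cls DD_kk)
    then show ?thesis unfolding tr_def one_add_one by (simp add: kk_def)
  qed
  ultimately show False using not_sterm by blast
qed

end
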